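(* For every real number $p$ with $1\le p<2$ and every integer $j\ge 1$ there exists a weakly conformal, Hamiltonian stationary, Lagrangian map $\Phi\in C^{\sqrt{j^2+j}}(D^2,\mathbb{C}^2)$ satisfying the following properties: (1) $\Phi$ has infinitely many, isolated Schoen-Wolfson singularities; (2) $\Phi$ is continuous up to the boundary (i.e. extends continuously to $\overline{D^2}$) and its trace on $\partial D^2$ is smooth; (3) the Lagrangian angle of $\Phi$ lies in $W^{1,p}(D^2)\cap W^{1,(2,\infty)}_{\mathrm{loc}}(D^2)$. Moreover, $\Phi$ is a smooth branched immersion away from its Schoen-Wolfson singularities.
   Context: $D^2\subset\mathbb{R}^2\cong\mathbb{C}$ is the open unit disc centered at the origin, with coordinates $(x,y)$. $\mathbb{S}^1\subset\mathbb{C}$ is the unit circle. $\nabla^\perp:=(-\partial_y,\partial_x)^T$. Differential equations such as $\operatorname{div}(\cdot)=0$ are understood in the sense of distributions on $D^2$. Function spaces. For non-integer $a>0$, $C^a(D^2)$ denotes the Hölder space $C^{\lfloor a\rfloor,\,a-\lfloor a\rfloor}(D^2)$ (functions whose derivatives up to order $\lfloor a\rfloor$ are bounded and continuous on $D^2$, those of order $\lfloor a\rfloor$ being Hölder continuous on $D^2$ with exponent $a-\lfloor a\rfloor$). $W^{1,(2,\infty)}_{\mathrm{loc}}(D^2)$ is the space of functions $g\in W^{1,1}_{\mathrm{loc}}(D^2)$ with $\nabla g\in L^{2,\infty}_{\mathrm{loc}}(D^2)$ (weak $L^2$). The trace is the restriction of the continuous extension to $\partial D^2$; smooth means $C^\infty$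 as a map on the circle $\partial D^2$. A set of points of $D^2$ is called isolated if it has no accumulation point in $D^2$ (accumulation at $\partial D^2$ is allowed). Lagrangian and conformal. Write $z_k=x_k+iy_k$, $k=1,2$, for the coordinates on $\mathbb{C}^2$ and $\omega=dx_1\wedge dy_1+dx_2\wedge dy_2$. A map $\Phi\in W^{1,1}(D^2,\mathbb{C}^2)$ is Lagrangian if $\Phi^*\omega=0$ a.e., and weakly conformal if $\langle\partial_x\Phi,\partial_y\Phi\rangle=0$ and $|\partial_x\Phi|^2=|\partial_y\Phi|^2$ a.e. (real inner product). If $\Phi\in W^{1,2}(D^2,\mathbb{C}^2)$ is Lagrangian and weakly conformal, there is a measurable map $g:D^2\to\mathbb{S}^1$ with $$\Phi^*(dz_1\wedge dz_2)=e^{2\lambda}\,\overline{g}\,dx\wedge dy\quad\text{a.e.},\qquad e^{2\lambda}=|\partial_x\Phi|^2=|\partial_y\Phi|^2 ,$$ and $\overline g$ is called the Lagrangian angle of $\Phi$ (it is determined a.e. where $\nabla\Phi\ne0$). A Lagrangian, weakly conformal map $\Phi$ with Lagrangian angle $\overline g$ is Hamiltonian stationary if $\operatorname{div}(i\overline g\nabla g)=0$ in $D^2$. Branched immersion. Let $\Phi$ be a $C^1$ weakly conformal Lagrangian map such that $\nabla\Phi$ vanishes only at isolated points. A point $q$ is a branch point of $\Phi$ if $\nabla\Phi(q)=0$ and the Lagrangian angle of $\Phi$ is continuous at $q$. $\Phi$ is a branched immersion on an open set if it is an immersion there away from isolated points which are branch points of $\Phi$. Schoen-Wolfson singularities. Let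 $\Phi\in W^{1,2}(D^2,\mathbb{C}^2)$ be weakly conformal, Lagrangian and Hamiltonian stationary with Lagrangian angle $\overline g$, where $g\in W^{1,(2,\infty)}_{\mathrm{loc}}(D^2,\mathbb{S}^1)$, and suppose $g$ has a singularity of degree $1$ at $q\in D^2$, i.e. $\operatorname{div}(i\overline g\nabla^\perp g)=2\pi\delta_q$ near $q$. Let $G$ be a real-valued function near $q$ with $-i\overline g\nabla g=\nabla^\perp G$. Then near $q$ the map $\Phi$ has the form $$\Phi=U\cdot\sum_{m\ge1}a_m\begin{pmatrix}\sqrt{m+1}\,e^{\sqrt{m(m+1)}\,G}\,g^{m}\\ i\sqrt{m}\,e^{\sqrt{m(m+1)}\,G}\,g^{-m-1}\end{pmatrix}+\Phi_0,$$ with $U$ a unitary matrix, $\Phi_0\in\mathbb{C}^2$ constant and $\sum_m|a_m|^2<\infty$. One says that $\Phi$ has a Schoen-Wolfson singularity (of type $\Sigma_{m,m+1}$, for some $m\geq 1$) at $q$ if $a_m\neq0$ and $a_k=0$ for all $k<m$. *)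

theory Defs
  imports "HOL-Analysis.Analysis"
begin

text \<open>The plane is the type \<^typ>\<open>complex\<close>, whose Euclidean basis is \<open>{1, \<i>}\<close>, so that
  \<open>\<partial>\<^sub>x\<close> and \<open>\<partial>\<^sub>y\<close> are the derivatives in the directions \<open>1\<close> and \<open>\<i>\<close>. The target
  \<open>\<complex>\<^sup>2\<close> is \<^typ>\<open>complex^2\<close>; its inner product \<open>\<bullet>\<close> is the real one.\<close>

abbreviation disc :: "complex set" where
  "disc \<equiv> ball 0 1"

text \<open>No accumulation point in the open disc; accumulation at the boundary is allowed.\<close>

definition isolated_in_disc :: "complex set \<Rightarrow> bool" where
  "isolated_in_disc A \<longleftrightarrow> A \<subseteq> disc \<and> (\<forall>z\<in>disc. \<not> z islimpt A)"


section \<open>Classical differentiability and Hoelder spaces\<close>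

definition partial_deriv :: "'a \<Rightarrow> ('a::euclidean_space \<Rightarrow> 'b::real_normed_vector) \<Rightarrow> 'a \<Rightarrow> 'b" where
  "partial_deriv v f = (\<lambda>z. frechet_derivative f (at z) v)"

primrec iter_partial :: "'a list \<Rightarrow> ('a::euclidean_space \<Rightarrow> 'b::real_normed_vector) \<Rightarrow> 'a \<Rightarrow> 'b" where
  "iter_partial [] f = f"
| "iter_partial (v # vs) f = partial_deriv v (iter_partial vs f)"

text \<open>The following notions are meant for open sets \<open>S\<close>.\<close>

definition Ck_on :: "nat \<Rightarrow> 'a set \<Rightarrow> ('a::euclidean_space \<Rightarrow> 'b::real_normed_vector) \<Rightarrow> bool" where
  "Ck_on k S f \<longleftrightarrow> (\<forall>vs\<in>lists Basis.
     (length vs < k \<longrightarrow> iter_partial vs f differentiable_on S) \<and>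
     (length vs \<le> k \<longrightarrow> continuous_on S (iter_partial vs f)))"

definition smooth_on :: "'a set \<Rightarrow> ('a::euclidean_space \<Rightarrow> 'b::real_normed_vector) \<Rightarrow> bool" where
  "smooth_on S f \<longleftrightarrow> (\<forall>k. Ck_on k S f)"

definition holder_continuous_on :: "real \<Rightarrow> 'a set \<Rightarrow> ('a::metric_space \<Rightarrow> 'b::metric_space) \<Rightarrow> bool" where
  "holder_continuous_on \<alpha> S f \<longleftrightarrow>
     (\<exists>C. \<forall>x\<in>S. \<forall>y\<in>S. dist (f x) (f y) \<le> C * dist x y powr \<alpha>)"

text \<open>\<open>C\<^sup>a(S)\<close> for non-integer \<open>a > 0\<close>.\<close>

definition holder_space :: "real \<Rightarrow> 'a set \<Rightarrow> ('a::euclidean_space \<Rightarrow> 'b::real_normed_vector) set" where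
  "holder_space a S = {f. Ck_on (nat \<lfloor>a\<rfloor>) S f \<and>
     (\<forall>vs\<in>lists Basis.
        (length vs \<le> nat \<lfloor>a\<rfloor> \<longrightarrow> bounded (iter_partial vs f ` S)) \<and>
        (length vs = nat \<lfloor>a\<rfloor> \<longrightarrow> holder_continuous_on (a - of_int \<lfloor>a\<rfloor>) S (iter_partial vs f)))}"


section \<open>Distributions and Sobolev spaces\<close>

definition test_function :: "'a set \<Rightarrow> ('a::euclidean_space \<Rightarrow> real) \<Rightarrow> bool" where
  "test_function S \<phi> \<longleftrightarrow> smooth_on UNIV \<phi> \<and>
     compact (closure {z. \<phi> z \<noteq> 0}) \<and> closure {z. \<phi> z \<noteq> 0} \<subseteq> S"

definition locally_integrable_on :: "'a set \<Rightarrow> ('a::euclidean_space \<Rightarrow> 'b::euclidean_space) \<Rightarrow> bool" where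
  "locally_integrable_on S f \<longleftrightarrow> (\<forall>K. compact K \<and> K \<subseteq> S \<longrightarrow> f absolutely_integrable_on K)"

definition weak_partial ::
  "'a set \<Rightarrow> 'a \<Rightarrow> ('a::euclidean_space \<Rightarrow> 'b::euclidean_space) \<Rightarrow> ('a \<Rightarrow> 'b) \<Rightarrow> bool" where
  "weak_partial S v f f' \<longleftrightarrow> locally_integrable_on S f \<and> locally_integrable_on S f' \<and>
     (\<forall>\<phi>. test_function S \<phi> \<longrightarrow>
        (LINT z:S|lebesgue. partial_deriv v \<phi> z *\<^sub>R f z) = - (LINT z:S|lebesgue. \<phi> z *\<^sub>R f' z))"

text \<open>\<open>f \<in> W\<^sup>1\<^sup>,\<^sup>1\<^sub>l\<^sub>o\<^sub>c(S)\<close> with weak gradient \<open>(fx, fy)\<close>.\<close>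

definition weak_gradient ::
  "complex set \<Rightarrow> (complex \<Rightarrow> 'b::euclidean_space) \<Rightarrow> (complex \<Rightarrow> 'b) \<Rightarrow> (complex \<Rightarrow> 'b) \<Rightarrow> bool" where
  "weak_gradient S f fx fy \<longleftrightarrow> weak_partial S 1 f fx \<and> weak_partial S \<i> f fy"

definition Lp_space :: "real \<Rightarrow> 'a set \<Rightarrow> ('a::euclidean_space \<Rightarrow> 'b::euclidean_space) set" where
  "Lp_space p S = {f \<in> borel_measurable (lebesgue_on S).
     integrable (lebesgue_on S) (\<lambda>z. norm (f z) powr p)}"

definition sobolev_gradient ::
  "real \<Rightarrow> complex set \<Rightarrow> (complex \<Rightarrow> 'b::euclidean_space) \<Rightarrow> (complex \<Rightarrow> 'b) \<Rightarrow> (complex \<Rightarrow> 'b) \<Rightarrow> bool" where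
  "sobolev_gradient p S f fx fy \<longleftrightarrow> weak_gradient S f fx fy \<and>
     f \<in> Lp_space p S \<and> fx \<in> Lp_space p S \<and> fy \<in> Lp_space p S"

definition W1p_space :: "real \<Rightarrow> complex set \<Rightarrow> (complex \<Rightarrow> 'b::euclidean_space) set" where
  "W1p_space p S = {f. \<exists>fx fy. sobolev_gradient p S f fx fy}"

text \<open>\<open>L\<^sup>2\<^sup>,\<^sup>\<infinity>\<^sub>l\<^sub>o\<^sub>c(S)\<close>: on each compact \<open>K \<subseteq> S\<close>, the quantity
  \<open>t\<^sup>2 |{z \<in> K. |f z| > t}|\<close> is bounded in \<open>t > 0\<close>.\<close>

definition weak_L2_loc :: "'a set \<Rightarrow> ('a::euclidean_space \<Rightarrow> 'b::euclidean_space) set" where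
  "weak_L2_loc S = {f \<in> borel_measurable (lebesgue_on S).
     \<forall>K. compact K \<and> K \<subseteq> S \<longrightarrow>
       (\<exists>C. \<forall>t>0. t\<^sup>2 * measure lebesgue {z\<in>K. norm (f z) > t} \<le> C)}"

definition W1_weak_L2_loc :: "complex set \<Rightarrow> (complex \<Rightarrow> 'b::euclidean_space) set" where
  "W1_weak_L2_loc S = {f. \<exists>fx fy. weak_gradient S f fx fy \<and>
     fx \<in> weak_L2_loc S \<and> fy \<in> weak_L2_loc S}"

text \<open>The divergence of the vector field \<open>(X, Y)\<close> as a distribution on \<open>S\<close>, evaluated at
  the test function \<open>\<phi>\<close>.\<close>

definition distr_div ::
  "complex set \<Rightarrow> (complex \<Rightarrow> complex) \<Rightarrow> (complex \<Rightarrow> complex) \<Rightarrow> (complex \<Rightarrow> real) \<Rightarrow> complex" where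
  "distr_div S X Y \<phi> =
     - (LINT z:S|lebesgue. partial_deriv 1 \<phi> z *\<^sub>R X z + partial_deriv \<i> \<phi> z *\<^sub>R Y z)"


section \<open>Lagrangian, conformal and Hamiltonian stationary maps\<close>

text \<open>\<open>\<omega> = dx\<^sub>1 \<and> dy\<^sub>1 + dx\<^sub>2 \<and> dy\<^sub>2\<close> and \<open>dz\<^sub>1 \<and> dz\<^sub>2\<close>; the pullback by \<open>\<Phi>\<close> of a 2-form is its
  value on \<open>(\<partial>\<^sub>x\<Phi>, \<partial>\<^sub>y\<Phi>)\<close> times \<open>dx \<and> dy\<close>.\<close>

definition omega :: "complex^2 \<Rightarrow> complex^2 \<Rightarrow> real" where
  "omega u v = (\<Sum>k\<in>UNIV. Re (u $ k) * Im (v $ k) - Im (u $ k) * Re (v $ k))"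

definition dz1_dz2 :: "complex^2 \<Rightarrow> complex^2 \<Rightarrow> complex" where
  "dz1_dz2 u v = u $ 1 * v $ 2 - u $ 2 * v $ 1"

definition lagrangian :: "(complex \<Rightarrow> complex^2) \<Rightarrow> bool" where
  "lagrangian \<Phi> \<longleftrightarrow> (\<exists>\<Phi>x \<Phi>y. sobolev_gradient 1 disc \<Phi> \<Phi>x \<Phi>y \<and>
     (AE z in lebesgue_on disc. omega (\<Phi>x z) (\<Phi>y z) = 0))"

definition weakly_conformal :: "(complex \<Rightarrow> complex^2) \<Rightarrow> bool" where
  "weakly_conformal \<Phi> \<longleftrightarrow> (\<exists>\<Phi>x \<Phi>y. sobolev_gradient 1 disc \<Phi> \<Phi>x \<Phi>y \<and>
     (AE z in lebesgue_on disc. \<Phi>x z \<bullet> \<Phi>y z = 0 \<and> (norm (\<Phi>x z))\<^sup>2 = (norm (\<Phi>y z))\<^sup>2))"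

text \<open>\<open>h\<close> is (a representative of) the Lagrangian angle of \<open>\<Phi>\<close>. Where \<open>\<nabla>\<Phi> \<noteq> 0\<close> it is
  determined almost everywhere.\<close>

definition lagrangian_angle :: "(complex \<Rightarrow> complex^2) \<Rightarrow> (complex \<Rightarrow> complex) \<Rightarrow> bool" where
  "lagrangian_angle \<Phi> h \<longleftrightarrow> lagrangian \<Phi> \<and> weakly_conformal \<Phi> \<and>
     h \<in> borel_measurable (lebesgue_on disc) \<and> (\<forall>z\<in>disc. cmod (h z) = 1) \<and>
     (\<exists>\<Phi>x \<Phi>y. sobolev_gradient 2 disc \<Phi> \<Phi>x \<Phi>y \<and>
        (AE z in lebesgue_on disc.
           dz1_dz2 (\<Phi>x z) (\<Phi>y z) = complex_of_real ((norm (\<Phi>x z))\<^sup>2) * h z))"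

text \<open>Here and below \<open>g\<close> is the complex conjugate of the Lagrangian angle. The condition
  is \<open>div(i g\<^sup>* \<nabla>g) = 0\<close> on the disc, with \<open>g\<^sup>*\<close> the conjugate of \<open>g\<close>.\<close>

definition hamiltonian_stationary :: "(complex \<Rightarrow> complex^2) \<Rightarrow> (complex \<Rightarrow> complex) \<Rightarrow> bool" where
  "hamiltonian_stationary \<Phi> g \<longleftrightarrow> lagrangian_angle \<Phi> (\<lambda>z. cnj (g z)) \<and>
     (\<exists>gx gy. weak_gradient disc g gx gy \<and>
        (\<forall>\<phi>. test_function disc \<phi> \<longrightarrow>
           distr_div disc (\<lambda>z. \<i> * cnj (g z) * gx z) (\<lambda>z. \<i> * cnj (g z) * gy z) \<phi> = 0))"


section \<open>Branched immersions\<close>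

text \<open>As the Lagrangian angle is only defined almost everywhere, its continuity at a point
  means that of some representative.\<close>

definition branch_point :: "(complex \<Rightarrow> complex^2) \<Rightarrow> complex \<Rightarrow> bool" where
  "branch_point \<Phi> q \<longleftrightarrow> q \<in> disc \<and> (\<Phi> has_derivative (\<lambda>_. 0)) (at q) \<and>
     (\<exists>h. lagrangian_angle \<Phi> h \<and> isCont h q)"

definition immersed_at :: "(complex \<Rightarrow> complex^2) \<Rightarrow> complex \<Rightarrow> bool" where
  "immersed_at \<Phi> q \<longleftrightarrow> \<Phi> differentiable (at q) \<and> inj (frechet_derivative \<Phi> (at q))"

definition branched_immersion_on :: "complex set \<Rightarrow> (complex \<Rightarrow> complex^2) \<Rightarrow> bool" where
  "branched_immersion_on \<Omega> \<Phi> \<longleftrightarrow> open \<Omega> \<and> \<Omega> \<subseteq> disc \<and>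
     Ck_on 1 disc \<Phi> \<and> weakly_conformal \<Phi> \<and> lagrangian \<Phi> \<and>
     isolated_in_disc {z\<in>disc. (\<Phi> has_derivative (\<lambda>_. 0)) (at z)} \<and>
     (\<exists>B. isolated_in_disc B \<and> (\<forall>q\<in>B. branch_point \<Phi> q) \<and> (\<forall>q\<in>\<Omega> - B. immersed_at \<Phi> q))"


section \<open>Schoen-Wolfson singularities\<close>

text \<open>\<open>div(i g\<^sup>* \<nabla>\<^sup>\<bottom>g) = 2\<pi>\<delta>\<^sub>q\<close> near \<open>q\<close>, where \<open>\<nabla>\<^sup>\<bottom>g = (-\<partial>\<^sub>yg, \<partial>\<^sub>xg)\<close>.\<close>

definition degree_one_singularity :: "(complex \<Rightarrow> complex) \<Rightarrow> complex \<Rightarrow> bool" where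
  "degree_one_singularity g q \<longleftrightarrow> (\<exists>r>0. ball q r \<subseteq> disc \<and>
     (\<exists>gx gy. weak_gradient (ball q r) g gx gy \<and>
        (\<forall>\<phi>. test_function (ball q r) \<phi> \<longrightarrow>
           distr_div (ball q r) (\<lambda>z. \<i> * cnj (g z) * (- gy z)) (\<lambda>z. \<i> * cnj (g z) * gx z) \<phi>
             = complex_of_real (2 * pi * \<phi> q))))"

text \<open>\<open>-i g\<^sup>* \<nabla>g = \<nabla>\<^sup>\<bottom>G\<close> on \<open>S\<close>. Near a singularity \<open>q\<close> of degree one, such a \<open>G\<close> differs
  from \<open>log |z - q|\<close> by a harmonic function, so it lies in \<open>W\<^sup>1\<^sup>,\<^sup>1\<close> around \<open>q\<close>.\<close>

definition perp_potential :: "complex set \<Rightarrow> (complex \<Rightarrow> complex) \<Rightarrow> (complex \<Rightarrow> real) \<Rightarrow> bool" where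
  "perp_potential S g G \<longleftrightarrow>
     (\<exists>gx gy Gx Gy. weak_gradient S g gx gy \<and> weak_gradient S G Gx Gy \<and>
        (AE z in lebesgue_on S.
           - \<i> * cnj (g z) * gx z = complex_of_real (- Gy z) \<and>
           - \<i> * cnj (g z) * gy z = complex_of_real (Gx z)))"

definition unitary :: "complex^2^2 \<Rightarrow> bool" where
  "unitary U \<longleftrightarrow> U ** (\<chi> k l. cnj (U $ l $ k)) = mat 1"

definition sw_mode :: "nat \<Rightarrow> real \<Rightarrow> complex \<Rightarrow> complex^2" where
  "sw_mode m G g = vector
     [complex_of_real (sqrt (m + 1) * exp (sqrt (m * (m + 1)) * G)) * g powi (int m),
      \<i> * complex_of_real (sqrt m * exp (sqrt (m * (m + 1)) * G)) * g powi (- int m - 1)]"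

text \<open>Type \<open>\<Sigma>\<^sub>m\<^sub>,\<^sub>m\<^sub>+\<^sub>1\<close>. The coefficients are indexed from 1; the value \<open>a 0\<close> is not used.\<close>

definition schoen_wolfson_type ::
  "nat \<Rightarrow> (complex \<Rightarrow> complex^2) \<Rightarrow> (complex \<Rightarrow> complex) \<Rightarrow> complex \<Rightarrow> bool" where
  "schoen_wolfson_type m \<Phi> g q \<longleftrightarrow>
     q \<in> disc \<and> hamiltonian_stationary \<Phi> g \<and> g \<in> W1_weak_L2_loc disc \<and>
     degree_one_singularity g q \<and>
     (\<exists>r>0. ball q r \<subseteq> disc \<and>
       (\<exists>G U \<Phi>\<^sub>0 a. perp_potential (ball q r) g G \<and> unitary U \<and>
          summable (\<lambda>n. (cmod (a (Suc n)))\<^sup>2) \<and>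
          (AE z in lebesgue_on (ball q r).
             \<exists>s. (\<lambda>n. a (Suc n) *s sw_mode (Suc n) (G z) (g z)) sums s \<and> \<Phi> z = U *v s + \<Phi>\<^sub>0) \<and>
          a m \<noteq> 0 \<and> (\<forall>k. 1 \<le> k \<and> k < m \<longrightarrow> a k = 0)))"

definition schoen_wolfson_singularities ::
  "(complex \<Rightarrow> complex^2) \<Rightarrow> (complex \<Rightarrow> complex) \<Rightarrow> complex set" where
  "schoen_wolfson_singularities \<Phi> g = {q. \<exists>m\<ge>1. schoen_wolfson_type m \<Phi> g q}"

text \<open>A map on the unit circle is smooth iff its composition with the covering
  \<open>t \<mapsto> e\<^sup>i\<^sup>t\<close>, a local diffeomorphism, is smooth on the line.\<close>

definition continuous_extension_with_smooth_trace :: "(complex \<Rightarrow> complex^2) \<Rightarrow> bool" where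
  "continuous_extension_with_smooth_trace \<Phi> \<longleftrightarrow>
     (\<exists>F. continuous_on (cball 0 1) F \<and> (\<forall>z\<in>disc. F z = \<Phi> z) \<and>
        smooth_on UNIV (\<lambda>t::real. F (cis t)))"

end

theory Submission
  imports Defs "HOL-Complex_Analysis.Complex_Analysis"
begin

text \<open>If \<open>f\<close> is holomorphic, then \<open>G = ln \<bar>f\<bar>\<close> and \<open>g = f / \<bar>f\<bar>\<close> satisfy \<open>- i g\<^sup>* \<nabla>g = \<nabla>\<^sup>\<bottom>G\<close>, and a
  single Schoen-Wolfson mode of type \<open>\<Sigma>\<^sub>m\<^sub>,\<^sub>m\<^sub>+\<^sub>1\<close> formed with these \<open>g\<close> and \<open>G\<close> is weakly conformal, Lagrangian
  and Hamiltonian stationary on the whole disc, with singularities exactly at the (simple) zeros of \<open>f\<close>.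
  We take \<open>f = (exp (i \<zeta>) - 1) exp (- \<zeta>\<^sup>2)\<close> with \<open>\<zeta> = Ln (1 - z)\<close>. The first factor is periodic in \<open>\<zeta>\<close> and
  vanishes at \<open>z = 1 - exp (- 2 \<pi> n)\<close>; the second one has no zeros and
  modulus \<open>\<approx> exp (- (ln \<bar>1 - z\<bar>)\<^sup>2)\<close>, so it beats every power of \<open>\<bar>1 - z\<bar>\<close> and makes the map smooth up to the boundary.
  The components of the map are \<open>\<bar>f\<bar>\<^sup>\<alpha>\<close> times powers of \<open>g\<close>, with \<open>\<alpha>\<^sup>2 = j (j + 1)\<close>; this class
  loses one unit of \<open>\<alpha>\<close> per derivative, whence the Hoelder regularity. Finally \<open>\<bar>\<nabla>g\<bar> = \<bar>f'/f\<bar>\<close> is bounded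
  by \<open>C (1 + n)\<close> over the distance to the nearest zero \<open>1 - exp (- 2 \<pi> n)\<close>; as the zeros accumulate geometrically,
  this is in \<open>L\<^sup>p\<close> for every \<open>p < 2\<close>.\<close>

section \<open>Iterated partial derivatives and smoothness\<close>

text \<open>exp (i zeta) = 1 forces zeta to be a real multiple of 2 pi, so the zeros lie on the
  radius towards 1 and none on the circle; near 1 on the circle Im zeta tends to pi/2 or -pi/2,
  which keeps |exp (i zeta)| away from 1. The Gaussian works because Im zeta is bounded, so Re
  (zeta^2) equals |zeta|^2 up to a constant. The components are f^((\<alpha>+n)/2) times cnj
  f^((\<alpha>-n)/2) for n = j and n = -j-1. With the weights sqrt (j+1) and sqrt j, whose product
  is \<alpha>, their Wirtinger coefficients agree up to order and a unit, so that the conformal and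
  Lagrangian conditions are pointwise identities that do not see the zeros. The obstacle is g,
  discontinuous at infinitely many points. Its weak gradient, that of ln |f| and the stationarity
  equation come from replacing |f|^2 by |f|^2 + \<epsilon> and letting \<epsilon> tend to 0, the
  derivatives being dominated by a multiple of |f'/f|. The degree is the Dirac mass at a simple pole
  of f'/f. As degree one quantifies existentially over weak gradients, excluding other singularities
  takes their uniqueness against test functions.\<close>

lemma frechet_derivative_cong_open:
  assumes "open S" "z \<in> S" "\<And>x. x \<in> S \<Longrightarrow> f x = g x"
  shows "frechet_derivative f (at z) = frechet_derivative g (at z)"
proof -
  have "(f has_derivative D) (at z) \<longleftrightarrow> (g has_derivative D) (at z)" for D
    using has_derivative_transform_within_open[OF _ assms(1,2)] assms(3) by metis
  then show ?thesis
    by (simp add: frechet_derivative_def)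
qed

lemma iter_partial_cong:
  assumes "open S" "\<And>x. x \<in> S \<Longrightarrow> f x = g x" "z \<in> S"
  shows "iter_partial vs f z = iter_partial vs g z"
  using assms(3)
proof (induction vs arbitrary: z)
  case (Cons v vs)
  then show ?case
    using frechet_derivative_cong_open[OF assms(1) Cons.prems, of "iter_partial vs f" "iter_partial vs g"]
    by (simp add: partial_deriv_def)
qed (use assms in auto)

lemma iter_partial_append:
  "iter_partial (vs @ ws) f = iter_partial vs (iter_partial ws f)"
  by (induction vs) auto

lemma differentiable_on_cong_open:
  assumes "open S" "\<And>x. x \<in> S \<Longrightarrow> f x = g x"
  shows "f differentiable_on S \<longleftrightarrow> g differentiable_on S"
proof -
  have "f differentiable_on S" if "g differentiable_on S" "\<And>x. x \<in> S \<Longrightarrow> f x = g x"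
    for f g :: "'a \<Rightarrow> 'b"
    unfolding differentiable_on_def
  proof
    fix x assume x: "x \<in> S"
    show "f differentiable (at x within S)"
      by (rule differentiable_transform_within[of g _ _ 1]) (use that x in \<open>auto simp: differentiable_on_def\<close>)
  qed
  then show ?thesis using assms(2) by metis
qed

lemma Ck_on_cong:
  assumes "open S" "\<And>x. x \<in> S \<Longrightarrow> f x = g x"
  shows "Ck_on k S f \<longleftrightarrow> Ck_on k S g"
  unfolding Ck_on_def
proof (intro ball_cong refl conj_cong imp_cong)
  fix vs :: "'a list"
  have eq: "iter_partial vs f z = iter_partial vs g z" if "z \<in> S" for z
    using iter_partial_cong[OF assms that] .
  show "iter_partial vs f differentiable_on S \<longleftrightarrow> iter_partial vs g differentiable_on S"
    by (rule differentiable_on_cong_open[OF assms(1) eq])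
  show "continuous_on S (iter_partial vs f) \<longleftrightarrow> continuous_on S (iter_partial vs g)"
    by (rule continuous_on_cong[OF refl eq])
qed

lemma smooth_on_cong:
  assumes "open S" "\<And>x. x \<in> S \<Longrightarrow> f x = g x"
  shows "smooth_on S f \<longleftrightarrow> smooth_on S g"
  using Ck_on_cong[OF assms] by (simp add: smooth_on_def)

text \<open>Differentiability of an iterated partial derivative already contains its
  continuity.\<close>

lemma smooth_on_iff:
  "smooth_on S f \<longleftrightarrow>
    (\<forall>vs\<in>lists Basis. iter_partial vs f differentiable_on S)"
proof
  assume "smooth_on S f"
  then show "\<forall>vs\<in>lists Basis. iter_partial vs f differentiable_on S"
    unfolding smooth_on_def Ck_on_def by blast
qed (auto simp: smooth_on_def Ck_on_def intro: differentiable_imp_continuous_on)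

lemma smooth_on_Un:
  assumes "open S" "open T" "smooth_on S f" "smooth_on T f"
  shows "smooth_on (S \<union> T) f"
  using assms by (auto simp: smooth_on_iff differentiable_on_eq_differentiable_at open_Un)

lemma smooth_on_subset:
  assumes "smooth_on S f" "T \<subseteq> S"
  shows "smooth_on T f"
  using assms unfolding smooth_on_iff
  using differentiable_on_subset by blast

lemma smooth_on_partial_deriv:
  assumes "smooth_on S f" "v \<in> Basis"
  shows "smooth_on S (partial_deriv v f)"
proof -
  \<comment> \<open>The last entry of the list is the derivative taken first.\<close>
  have "iter_partial vs (partial_deriv v f) = iter_partial (vs @ [v]) f" for vs
    by (simp add: iter_partial_append)
  then show ?thesis
    using assms unfolding smooth_on_iff by (simp add: lists_eq_set)
qed

lemma smooth_on_imp_continuous_on: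
  assumes "smooth_on S f"
  shows "continuous_on S f"
  using assms[unfolded smooth_on_def Ck_on_def, rule_format, of "[]" 0] by simp

lemma smooth_on_imp_differentiable:
  assumes "smooth_on S f" "open S" "z \<in> S"
  shows "f differentiable (at z)"
  using assms[unfolded smooth_on_iff] 
  by (auto simp: differentiable_on_eq_differentiable_at dest!: bspec[of _ _ "[]"])

text \<open>A predicate graded by the number of derivatives that may still be taken.\<close>

lemma iter_partial_graded:
  fixes P :: "nat \<Rightarrow> ('a::euclidean_space \<Rightarrow> 'b::real_normed_vector) \<Rightarrow> bool"
  assumes S: "open S"
    and step: "\<And>k u v. P (Suc k) u \<Longrightarrow> v \<in> Basis \<Longrightarrow>
      \<exists>u'. P k u' \<and> (\<forall>z\<in>S. \<exists>D. (u has_derivative D) (at z) \<and> D v = u' z)"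
    and vs: "vs \<in> lists Basis" and u: "P (k + length vs) u"
  shows "\<exists>u'. P k u' \<and> (\<forall>z\<in>S. iter_partial vs u z = u' z)"
  using vs u
proof (induction vs arbitrary: k)
  case Nil
  then show ?case by auto
next
  case (Cons v vs)
  from Cons.IH[of "Suc k"] Cons.prems obtain w
    where w: "P (Suc k) w" "\<And>z. z \<in> S \<Longrightarrow> iter_partial vs u z = w z" by auto
  have "v \<in> Basis" by (rule Cons(1))
  from step[OF w(1) this] obtain w' where
    w': "P k w'" "\<And>z. z \<in> S \<Longrightarrow> \<exists>D. (w has_derivative D) (at z) \<and> D v = w' z" by blast
  have "iter_partial (v # vs) u z = w' z" if z: "z \<in> S" for z
  proof -
    from w'(2)[OF z] obtain D where D: "(w has_derivative D) (at z)" "D v = w' z" by auto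
    have "frechet_derivative (iter_partial vs u) (at z) = frechet_derivative w (at z)"
      by (rule frechet_derivative_cong_open[OF S z w(2)])
    also have "\<dots> = D" using D(1) by (metis frechet_derivative_at)
    finally show ?thesis using D(2) by (simp add: partial_deriv_def)
  qed
  then show ?case using w'(1) by auto
qed

text \<open>Only one differentiation step and the continuity of members of the class have to be
  checked; iterated derivatives are never computed. The grading is what the Hoelder regularity
  needs, where each derivative costs one unit of the exponent.\<close>

lemma Ck_on_graded:
  fixes P :: "nat \<Rightarrow> ('a::euclidean_space \<Rightarrow> 'b::real_normed_vector) \<Rightarrow> bool"
  assumes S: "open S"
    and step: "\<And>k u v. P (Suc k) u \<Longrightarrow> v \<in> Basis \<Longrightarrow>
      \<exists>u'. P k u' \<and> (\<forall>z\<in>S. \<exists>D. (u has_derivative D) (at z) \<and> D v = u' z)"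
    and cont: "\<And>k u. P k u \<Longrightarrow> continuous_on S u"
    and u: "P n u"
  shows "Ck_on n S u"
  unfolding Ck_on_def
proof (intro ballI conjI impI)
  fix vs :: "'a list" assume vs: "vs \<in> lists Basis"
  {
    assume "length vs < n"
    then obtain k where n: "n = Suc k + length vs"
      by (metis Suc_diff_Suc le_add_diff_inverse2 less_imp_le_nat add_Suc diff_add_inverse2 add.commute less_iff_Suc_add)
    from iter_partial_graded[where P=P, OF S step vs u[unfolded n]] obtain w
      where w: "P (Suc k) w" "\<And>z. z \<in> S \<Longrightarrow> iter_partial vs u z = w z" by auto
    obtain v :: 'a where "v \<in> Basis" using nonempty_Basis by blast
    from step[OF w(1) this] have "w differentiable_on S"
      unfolding differentiable_on_eq_differentiable_at[OF S] by (auto simp: differentiable_def)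
    then show "iter_partial vs u differentiable_on S"
      using differentiable_on_cong_open[OF S, of "iter_partial vs u" w] w(2) by auto
  }
  {
    assume "length vs \<le> n"
    then obtain k where n: "n = k + length vs"
      by (metis le_add_diff_inverse2)
    from iter_partial_graded[where P=P, OF S step vs u[unfolded n]] obtain w
      where w: "P k w" "\<And>z. z \<in> S \<Longrightarrow> iter_partial vs u z = w z" by auto
    then show "continuous_on S (iter_partial vs u)"
      using cont[OF w(1)] continuous_on_cong[OF refl, of S "iter_partial vs u" w] by auto
  }
qed

text \<open>The case of a constant grading: to prove smoothness it suffices to exhibit a family of
  formulas that contains the function and is closed under partial derivatives.\<close>

lemma smooth_on_class:
  fixes P :: "('a::euclidean_space \<Rightarrow> 'b::real_normed_vector) \<Rightarrow> bool"
  assumes S: "open S"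
    and step: "\<And>u v. P u \<Longrightarrow> v \<in> Basis \<Longrightarrow>
      \<exists>u'. P u' \<and> (\<forall>z\<in>S. \<exists>D. (u has_derivative D) (at z) \<and> D v = u' z)"
    and u: "P u"
  shows "smooth_on S u"
  unfolding smooth_on_def
proof
  fix k
  show "Ck_on k S u"
  proof (rule Ck_on_graded[OF S, of "\<lambda>_. P"])
    fix u assume u: "P u"
    obtain v :: 'a where "v \<in> Basis" using nonempty_Basis by blast
    from step[OF u this] have "u differentiable_on S"
      unfolding differentiable_on_eq_differentiable_at[OF S] by (auto simp: differentiable_def)
    then show "continuous_on S u" by (rule differentiable_imp_continuous_on)
  qed (use step u in auto)
qed

text \<open>The terms that the iterated product rule produces. Binomial coefficients are not
  tracked: a repeated term is simply added again.\<close>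

inductive leibniz_sum for f g :: "'a::euclidean_space \<Rightarrow> 'b::real_normed_algebra" where
  "vs \<in> lists Basis \<Longrightarrow> ws \<in> lists Basis \<Longrightarrow>
    leibniz_sum f g (\<lambda>z. iter_partial vs f z * iter_partial ws g z)"
| "leibniz_sum f g u \<Longrightarrow> leibniz_sum f g v \<Longrightarrow> leibniz_sum f g (\<lambda>z. u z + v z)"

lemma has_derivative_frechet:
  "f differentiable (at z) \<Longrightarrow> (f has_derivative frechet_derivative f (at z)) (at z)"
  using frechet_derivative_works by blast

lemma smooth_on_mult:
  fixes f g :: "'a::euclidean_space \<Rightarrow> 'b::real_normed_algebra"
  assumes S: "open S" and f: "smooth_on S f" and g: "smooth_on S g"
  shows "smooth_on S (\<lambda>z. f z * g z)"
proof (rule smooth_on_class[OF S, of "leibniz_sum f g"])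
  show "leibniz_sum f g (\<lambda>z. f z * g z)"
    using leibniz_sum.intros(1)[of "[]" "[]" f g] by simp
  fix u and v :: 'a assume "leibniz_sum f g u" and v: "v \<in> Basis"
  then show "\<exists>u'. leibniz_sum f g u' \<and> (\<forall>z\<in>S. \<exists>D. (u has_derivative D) (at z) \<and> D v = u' z)"
  proof (induction rule: leibniz_sum.induct)
    case (1 vs ws)
    let ?u = "\<lambda>z. iter_partial vs f z * iter_partial (v # ws) g z + iter_partial (v # vs) f z * iter_partial ws g z"
    have "\<exists>D. ((\<lambda>z. iter_partial vs f z * iter_partial ws g z) has_derivative D) (at z) \<and> D v = ?u z"
      if z: "z \<in> S" for z
    proof -
      have "iter_partial vs f differentiable at z" "iter_partial ws g differentiable at z"
        using f g 1 z S by (auto simp: smooth_on_iff differentiable_on_eq_differentiable_at)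
      from has_derivative_mult[OF this[THEN has_derivative_frechet]] show ?thesis
        by (intro exI conjI) (assumption, simp add: partial_deriv_def)
    qed
    moreover have "leibniz_sum f g ?u"
      using 1 v by (intro leibniz_sum.intros) auto
    ultimately show ?case by blast
  next
    case (2 u1 u2)
    from 2 obtain w1 w2 where w: "leibniz_sum f g w1" "leibniz_sum f g w2"
      "\<And>z. z \<in> S \<Longrightarrow> \<exists>D. (u1 has_derivative D) (at z) \<and> D v = w1 z"
      "\<And>z. z \<in> S \<Longrightarrow> \<exists>D. (u2 has_derivative D) (at z) \<and> D v = w2 z" by blast
    have "\<exists>D. ((\<lambda>z. u1 z + u2 z) has_derivative D) (at z) \<and> D v = w1 z + w2 z" if z: "z \<in> S" for z
    proof -
      obtain D1 D2 where "(u1 has_derivative D1) (at z)" "D1 v = w1 z"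
        "(u2 has_derivative D2) (at z)" "D2 v = w2 z" using w(3,4)[OF z] by blast
      then show ?thesis by (intro exI[of _ "\<lambda>h. D1 h + D2 h"]) (auto intro: has_derivative_add)
    qed
    then show ?case using leibniz_sum.intros(2)[OF w(1,2)] by blast
  qed
qed

section \<open>Wirtinger derivatives\<close>

text \<open>The numbers \<open>a\<close> and \<open>b\<close> are the derivatives with respect to z
  and to its conjugate. The partial derivatives in the directions 1 and i are a + b and i (a - b),
  and b = 0 means complex differentiability.\<close>

definition has_wirtinger ::
  "(complex \<Rightarrow> complex) \<Rightarrow> complex \<Rightarrow> complex \<Rightarrow> complex \<Rightarrow> bool" where
  "has_wirtinger f a b z \<longleftrightarrow> (f has_derivative (\<lambda>h. a * h + b * cnj h)) (at z)"

lemma has_wirtinger_const: "has_wirtinger (\<lambda>_. c) 0 0 z"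
  by (simp add: has_wirtinger_def)

lemma has_wirtinger_holomorphic:
  "(f has_field_derivative d) (at z) \<Longrightarrow> has_wirtinger f d 0 z"
  by (simp add: has_wirtinger_def has_field_derivative_def)

lemma has_wirtinger_add:
  "has_wirtinger f a b z \<Longrightarrow> has_wirtinger g c d z \<Longrightarrow> has_wirtinger (\<lambda>z. f z + g z) (a + c) (b + d) z"
  unfolding has_wirtinger_def by (drule (1) has_derivative_add) (simp add: algebra_simps)

lemma has_wirtinger_mult:
  assumes "has_wirtinger f a b z" "has_wirtinger g c d z"
  shows "has_wirtinger (\<lambda>z. f z * g z) (a * g z + f z * c) (b * g z + f z * d) z"
  using has_derivative_mult[OF assms[unfolded has_wirtinger_def]]
  by (simp add: has_wirtinger_def algebra_simps)

lemma has_wirtinger_cnj: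
  assumes "has_wirtinger f a b z"
  shows "has_wirtinger (\<lambda>z. cnj (f z)) (cnj b) (cnj a) z"
  using bounded_linear.has_derivative[OF bounded_linear_cnj assms[unfolded has_wirtinger_def]]
  by (simp add: has_wirtinger_def algebra_simps)

lemma has_wirtinger_compose:
  assumes g: "has_wirtinger g c d (f z)" and f: "has_wirtinger f a b z"
  shows "has_wirtinger (\<lambda>z. g (f z)) (c * a + d * cnj b) (c * b + d * cnj a) z"
  using has_derivative_compose[OF f[unfolded has_wirtinger_def] g[unfolded has_wirtinger_def]]
  by (simp add: has_wirtinger_def algebra_simps)

text \<open>Polynomials in the generators and their conjugates. Conjugates are needed because the
  second Wirtinger derivative of a function of |f| contains the conjugate of f'.\<close>

inductive_set star_alg :: "(complex \<Rightarrow> complex) set \<Rightarrow> (complex \<Rightarrow> complex) set" for X where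
  star_alg_const: "(\<lambda>_. c) \<in> star_alg X"
| star_alg_gen: "u \<in> X \<Longrightarrow> u \<in> star_alg X"
| star_alg_cnj: "u \<in> star_alg X \<Longrightarrow> (\<lambda>z. cnj (u z)) \<in> star_alg X"
| star_alg_add: "u \<in> star_alg X \<Longrightarrow> v \<in> star_alg X \<Longrightarrow> (\<lambda>z. u z + v z) \<in> star_alg X"
| star_alg_mult: "u \<in> star_alg X \<Longrightarrow> v \<in> star_alg X \<Longrightarrow> (\<lambda>z. u z * v z) \<in> star_alg X"

text \<open>The sum, product and conjugation rules carry closure under both Wirtinger derivatives
  from the generators to the whole algebra.\<close>

lemma star_alg_has_wirtinger:
  assumes gen: "\<And>u. u \<in> X \<Longrightarrow> \<exists>a\<in>star_alg X. \<exists>b\<in>star_alg X. \<forall>z\<in>S. has_wirtinger u (a z) (b z) z"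
    and u: "u \<in> star_alg X"
  shows "\<exists>a\<in>star_alg X. \<exists>b\<in>star_alg X. \<forall>z\<in>S. has_wirtinger u (a z) (b z) z"
  using u
proof (induction rule: star_alg.induct)
  case (star_alg_const c)
  show ?case
    by (intro bexI[of _ "\<lambda>_. 0"]) (auto intro: has_wirtinger_const star_alg.star_alg_const)
next
  case (star_alg_gen u)
  then show ?case by (rule gen)
next
  case (star_alg_cnj u)
  then obtain a b where "a \<in> star_alg X" "b \<in> star_alg X"
    "\<forall>z\<in>S. has_wirtinger u (a z) (b z) z" by blast
  then show ?case
    by (intro bexI[of _ "\<lambda>z. cnj (b z)"] bexI[of _ "\<lambda>z. cnj (a z)"])
      (auto intro: has_wirtinger_cnj star_alg.star_alg_cnj)
next
  case (star_alg_add u v)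
  then obtain a b c d where "a \<in> star_alg X" "b \<in> star_alg X" "c \<in> star_alg X" "d \<in> star_alg X"
    "\<forall>z\<in>S. has_wirtinger u (a z) (b z) z" "\<forall>z\<in>S. has_wirtinger v (c z) (d z) z" by blast
  then show ?case
    by (intro bexI[of _ "\<lambda>z. a z + c z"] bexI[of _ "\<lambda>z. b z + d z"])
      (auto intro: has_wirtinger_add star_alg.star_alg_add)
next
  case (star_alg_mult u v)
  then obtain a b c d where "a \<in> star_alg X" "b \<in> star_alg X" "c \<in> star_alg X" "d \<in> star_alg X"
    "\<forall>z\<in>S. has_wirtinger u (a z) (b z) z" "\<forall>z\<in>S. has_wirtinger v (c z) (d z) z" by blast
  then show ?case using star_alg_mult.hyps
    by (intro bexI[of _ "\<lambda>z. a z * v z + u z * c z"] bexI[of _ "\<lambda>z. b z * v z + u z * d z"])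
      (auto intro: has_wirtinger_mult star_alg.star_alg_add star_alg.star_alg_mult)
qed

text \<open>Since the weight \<open>b\<close> is at least 1, exponents may be added in sums as well
  as in products. The weight 1 gives boundedness on the disc, the weight 2 / |1 - z| gives the
  growth on the circle near 1.\<close>

lemma star_alg_growth:
  assumes b: "\<And>z. z \<in> S \<Longrightarrow> b z \<ge> (1::real)"
    and gen: "\<And>u. u \<in> X \<Longrightarrow> \<exists>C N. \<forall>z\<in>S. cmod (u z) \<le> C * b z ^ N"
    and u: "u \<in> star_alg X"
  shows "\<exists>C N. \<forall>z\<in>S. cmod (u z) \<le> C * b z ^ N"
  using u
proof (induction rule: star_alg.induct)
  case (star_alg_const c)
  show ?case by (intro exI[of _ "cmod c"] exI[of _ 0]) auto
next
  case (star_alg_add u v)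
  then obtain C D M N where "\<forall>z\<in>S. cmod (u z) \<le> C * b z ^ M" "\<forall>z\<in>S. cmod (v z) \<le> D * b z ^ N" by blast
  note uv = bspec[OF this(1)] bspec[OF this(2)]
  have "cmod (u z + v z) \<le> (\<bar>C\<bar> + \<bar>D\<bar>) * b z ^ (M + N)" if z: "z \<in> S" for z
  proof -
    have "cmod (u z) \<le> \<bar>C\<bar> * b z ^ M"
      by (rule order_trans[OF uv(1)[OF z]]) (use b[OF z] in \<open>auto intro: mult_right_mono\<close>)
    also have "\<dots> \<le> \<bar>C\<bar> * b z ^ (M + N)"
      using b[OF z] by (intro mult_left_mono power_increasing) auto
    finally have 1: "cmod (u z) \<le> \<bar>C\<bar> * b z ^ (M + N)" .
    have "cmod (v z) \<le> \<bar>D\<bar> * b z ^ N"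
      by (rule order_trans[OF uv(2)[OF z]]) (use b[OF z] in \<open>auto intro: mult_right_mono\<close>)
    also have "\<dots> \<le> \<bar>D\<bar> * b z ^ (M + N)"
      using b[OF z] by (intro mult_left_mono power_increasing) auto
    finally show ?thesis using 1 norm_triangle_ineq[of "u z" "v z"] by (simp add: algebra_simps)
  qed
  then show ?case by blast
next
  case (star_alg_mult u v)
  then obtain C D M N where "\<forall>z\<in>S. cmod (u z) \<le> C * b z ^ M" "\<forall>z\<in>S. cmod (v z) \<le> D * b z ^ N" by blast
  note uv = bspec[OF this(1)] bspec[OF this(2)]
  have "cmod (u z * v z) \<le> (C * D) * b z ^ (M + N)" if z: "z \<in> S" for z
    using mult_mono'[OF uv[OF z]] by (simp add: norm_mult power_add algebra_simps)
  then show ?case by blast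
qed (use gen in auto)

section \<open>Integration by parts\<close>

lemma lborel_integral_translation:
  fixes F :: "'a::euclidean_space \<Rightarrow> 'b::{banach, second_countable_topology}"
  assumes "F \<in> borel_measurable borel"
  shows "(LINT z|lborel. F (c + z)) = (LINT z|lborel. F z)"
proof -
  have "distr lborel borel ((+) c) = lborel"
    using lborel_affine[of 1 c] by (simp add: density_1)
  then have "(LINT z|lborel. F z) = (LINT z|distr lborel borel ((+) c). F z)" by simp
  also have "\<dots> = (LINT z|lborel. F (c + z))"
    using assms by (subst integral_distr) auto
  finally show ?thesis by simp
qed

text \<open>By translation invariance the difference quotients of \<open>F\<close> integrate to zero.\<close>

lemma integral_derivative_eq_0:
  fixes F :: "'a::euclidean_space \<Rightarrow> 'b::euclidean_space"
  assumes lip: "\<And>x y. norm (F x - F y) \<le> C * norm (x - y)"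
    and supp: "\<And>x. norm x > R \<Longrightarrow> F x = 0"
    and meas: "F' \<in> borel_measurable lebesgue"
    and deriv: "AE z in lebesgue. \<exists>D. (F has_derivative D) (at z) \<and> D v = F' z"
  shows "(LINT z|lebesgue. F' z) = 0"
proof -
  define h :: "nat \<Rightarrow> real" where "h n = inverse (Suc n)" for n
  have h: "h n > 0" "h n \<le> 1" "h \<longlonglongrightarrow> 0" for n
    using LIMSEQ_inverse_real_of_nat by (auto simp: h_def[abs_def] divide_simps)
  define q where "q n z = (1 / h n) *\<^sub>R (F (h n *\<^sub>R v + z) - F z)" for n z

  have contF: "continuous_on UNIV F"
    unfolding continuous_on_iff
  proof (intro ballI allI impI)
    fix x :: 'a and e :: real assume e: "e > 0"
    have "dist (F y) (F x) < e" if y: "dist y x < e / (\<bar>C\<bar> + 1)" for y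
    proof -
      have "norm (F y - F x) \<le> (\<bar>C\<bar> + 1) * norm (y - x)"
        by (rule order_trans[OF lip]) (intro mult_right_mono, auto)
      also have "\<dots> < e" using y by (simp add: dist_norm pos_less_divide_eq add_nonneg_pos mult.commute)
      finally show ?thesis by (simp add: dist_norm)
    qed
    then show "\<exists>d>0. \<forall>y\<in>UNIV. dist y x < d \<longrightarrow> dist (F y) (F x) < e"
      using e by (intro exI[of _ "e / (\<bar>C\<bar> + 1)"]) (auto simp: add_nonneg_pos)
  qed
  then have Fm[measurable]: "F \<in> borel_measurable borel"
    by (rule borel_measurable_continuous_onI)
  have Fc: "continuous_on UNIV (\<lambda>z. F (c + z))" for c
    by (rule continuous_on_compose2[OF contF]) (auto intro: continuous_intros)
  have intF: "integrable lborel (\<lambda>z. F (c + z))" for c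
  proof -
    have "integrable lborel (\<lambda>z. indicator (cball 0 (norm c + \<bar>R\<bar>)) z *\<^sub>R F (c + z))"
      by (intro borel_integrable_compact continuous_on_subset[OF Fc]) auto
    moreover have "indicator (cball 0 (norm c + \<bar>R\<bar>)) z *\<^sub>R F (c + z) = F (c + z)" for z
    proof (cases "z \<in> cball 0 (norm c + \<bar>R\<bar>)")
      case False
      then have "norm (c + z) > R" using norm_diff_ineq[of z c] by (auto simp: add.commute)
      then show ?thesis using supp by simp
    qed auto
    ultimately show ?thesis by simp
  qed
  have qm: "q n \<in> borel_measurable borel" for n
    unfolding q_def by measurable
  have int0: "(LINT z|lebesgue. q n z) = 0" for n
  proof -
    have "(LINT z|lebesgue. q n z) = (LINT z|lborel. q n z)"
      by (rule integral_completion) (use qm in simp)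
    also have "\<dots> = (1 / h n) *\<^sub>R ((LINT z|lborel. F (h n *\<^sub>R v + z)) - (LINT z|lborel. F z))"
      using intF[of "h n *\<^sub>R v"] intF[of 0]
      by (simp add: q_def[abs_def])
    also have "\<dots> = 0"
      using lborel_integral_translation[OF Fm] by simp
    finally show ?thesis .
  qed
  \<comment> \<open>If |z| > |R| + |v|, then z and z + h v both have norm greater than R because h
    \<le> 1, and the quotient vanishes; elsewhere the Lipschitz bound gives C |v|.\<close>
  define w where "w z = indicator (cball 0 (\<bar>R\<bar> + norm v)) z *\<^sub>R (C * norm v)" for z :: 'a
  have "integrable lborel w"
    unfolding w_def by (rule borel_integrable_compact) auto
  then have intw: "integrable lebesgue w"
    using integrable_completion[where f=w and M=lborel] borel_measurable_integrable by blast
  have bd: "norm (q n z) \<le> w z" for n z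
  proof (cases "norm z \<le> \<bar>R\<bar> + norm v")
    case True
    have "norm (F (h n *\<^sub>R v + z) - F z) \<le> C * (h n * norm v)"
      using lip[of "h n *\<^sub>R v + z" z] h(1)[of n] by simp
    then have "norm (F (h n *\<^sub>R v + z) - F z) / h n \<le> C * norm v"
      using h(1)[of n] by (simp add: field_simps)
    then show ?thesis
      using True h(1)[of n] by (simp add: q_def w_def del: scaleR_diff_right)
  next
    case False
    have "norm (h n *\<^sub>R v) \<le> norm v" using h(1,2)[of n] by (simp add: mult_left_le_one_le)
    with False have "norm (h n *\<^sub>R v + z) > R" "norm z > R"
      using norm_diff_ineq[of z "h n *\<^sub>R v"] norm_ge_zero[of v] abs_ge_self[of R]
      by (simp_all only: add.commute[of z] not_le; linarith)+
    then show ?thesis using False supp by (simp add: q_def w_def)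
  qed
  have lim: "AE z in lebesgue. (\<lambda>n. q n z) \<longlonglongrightarrow> F' z"
    using deriv
  proof eventually_elim
    case (elim z)
    then obtain D where D: "(F has_derivative D) (at z)" "D v = F' z" by blast
    have "((\<lambda>t. (1 / t) *\<^sub>R (F (t *\<^sub>R v + z) - F z)) \<longlongrightarrow> D v) (at 0)"
    proof -
      have "((\<lambda>t::real. t *\<^sub>R v + z) has_derivative (\<lambda>t. t *\<^sub>R v)) (at 0)"
        by (auto intro!: derivative_eq_intros)
      from has_derivative_compose[OF this, of F D]
      have "((\<lambda>t::real. F (t *\<^sub>R v + z)) has_derivative (\<lambda>t. D (t *\<^sub>R v))) (at 0)"
        using D(1) by simp
      moreover have "D (t *\<^sub>R v) = t *\<^sub>R D v" for t
        using has_derivative_bounded_linear[OF D(1)] by (rule linear_simps(5))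
      ultimately have quot: "((\<lambda>t. norm (F (t *\<^sub>R v + z) - F z - t *\<^sub>R D v) / norm t) \<longlongrightarrow> 0) (at 0)"
        by (simp add: has_derivative_at)
      have eq: "norm (F (t *\<^sub>R v + z) - F z - t *\<^sub>R D v) / norm t
          = norm ((1 / t) *\<^sub>R (F (t *\<^sub>R v + z) - F z) - D v)" if "t \<noteq> 0" for t
      proof -
        have "(1 / t) *\<^sub>R (F (t *\<^sub>R v + z) - F z) - D v
            = (1 / t) *\<^sub>R (F (t *\<^sub>R v + z) - F z - t *\<^sub>R D v)"
          using that by (simp add: scaleR_diff_right)
        then show ?thesis by simp
      qed
      have "\<forall>\<^sub>F t in at 0. norm (F (t *\<^sub>R v + z) - F z - t *\<^sub>R D v) / norm t
          = norm ((1 / t) *\<^sub>R (F (t *\<^sub>R v + z) - F z) - D v)"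
        by (rule eventually_mono[OF eventually_neq_at_within]) (rule eq)
      from Lim_transform_eventually[OF quot this]
      have "((\<lambda>t. (1 / t) *\<^sub>R (F (t *\<^sub>R v + z) - F z) - D v) \<longlongrightarrow> 0) (at 0)"
        by (rule tendsto_norm_zero_cancel)
      then show ?thesis
        by (rule LIM_zero_cancel)
    qed
    moreover have "filterlim h (at 0) sequentially"
      using h by (auto simp: filterlim_at h_def)
    ultimately have "(\<lambda>n. (1 / h n) *\<^sub>R (F (h n *\<^sub>R v + z) - F z)) \<longlonglongrightarrow> D v"
      by (rule filterlim_compose)
    then show ?case by (simp add: q_def D)
  qed
  have "(\<lambda>n. LINT z|lebesgue. q n z) \<longlonglongrightarrow> (LINT z|lebesgue. F' z)"
  proof (rule integral_dominated_convergence[OF meas _ intw lim])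
    show "q n \<in> borel_measurable lebesgue" for n
      by (intro measurable_completion) (use qm in simp)
    show "AE z in lebesgue. norm (q n z) \<le> w z" for n
      using bd by simp
  qed
  then show ?thesis
    using int0 by (simp add: LIMSEQ_const_iff)
qed

text \<open>The derivative is bounded on K by compactness and vanishes off K, so the mean value
  inequality applies on the whole space, which is convex.\<close>

lemma C1_compact_support_lipschitz:
  fixes F :: "'a::euclidean_space \<Rightarrow> 'b::real_normed_vector"
  assumes D: "\<And>z. (F has_derivative D z) (at z)"
    and cont: "\<And>b. b \<in> Basis \<Longrightarrow> continuous_on UNIV (\<lambda>z. D z b)"
    and K: "compact K" and supp: "\<And>z. z \<notin> K \<Longrightarrow> F z = 0"
  obtains C where "\<And>x y. norm (F x - F y) \<le> C * norm (x - y)"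
proof -
  have "\<exists>B. \<forall>z\<in>K. norm (D z b) \<le> B" if "b \<in> Basis" for b
    using compact_imp_bounded[OF compact_continuous_image[OF continuous_on_subset[OF cont[OF that]] K]]
    by (auto simp: bounded_iff)
  then obtain B where B: "\<And>b z. b \<in> Basis \<Longrightarrow> z \<in> K \<Longrightarrow> norm (D z b) \<le> B b" by metis
  define C where "C = (\<Sum>b\<in>Basis. \<bar>B b\<bar>)"
  have bound: "norm (D z h) \<le> C * norm h" for z h
  proof (cases "z \<in> K")
    case True
    interpret bounded_linear "D z" using D by (rule has_derivative_bounded_linear)
    have "D z h = (\<Sum>b\<in>Basis. (h \<bullet> b) *\<^sub>R D z b)"
      by (subst euclidean_representation[of h, symmetric]) (simp only: sum scaleR)
    also have "norm \<dots> \<le> (\<Sum>b\<in>Basis. norm h * \<bar>B b\<bar>)"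
    proof (intro sum_norm_le)
      fix b :: 'a assume b: "b \<in> Basis"
      have "norm ((h \<bullet> b) *\<^sub>R D z b) = \<bar>h \<bullet> b\<bar> * norm (D z b)" by simp
      also have "\<dots> \<le> norm h * \<bar>B b\<bar>"
        using B[OF b True] Basis_le_norm[OF b] by (intro mult_mono) auto
      finally show "norm ((h \<bullet> b) *\<^sub>R D z b) \<le> norm h * \<bar>B b\<bar>" .
    qed
    finally show ?thesis by (simp add: C_def sum_distrib_left mult.commute)
  next
    case False
    have "(F has_derivative (\<lambda>_. 0)) (at z)"
      by (rule has_derivative_transform_within_open[of "\<lambda>_. 0" _ z UNIV "- K"])
        (use False supp K compact_imp_closed in auto)
    then have "D z = (\<lambda>_. 0)" using D has_derivative_unique by blast
    then show ?thesis by (simp add: C_def sum_nonneg)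
  qed
  have "norm (F x - F y) \<le> C * norm (x - y)" for x y
    by (rule differentiable_bound[of UNIV F D])
      (use D bound in \<open>auto intro!: onorm_le has_derivative_at_withinI\<close>)
  then show ?thesis by (rule that)
qed

lemma test_functionE:
  fixes \<phi> :: "'a::euclidean_space \<Rightarrow> real"
  assumes "test_function S \<phi>"
  obtains K where "compact K" "K \<subseteq> S" "\<And>z. z \<notin> K \<Longrightarrow> \<phi> z = 0"
    "\<And>z v. z \<notin> K \<Longrightarrow> partial_deriv v \<phi> z = 0"
    "\<And>z. (\<phi> has_derivative frechet_derivative \<phi> (at z)) (at z)"
    "continuous_on UNIV \<phi>"
    "\<And>v. v \<in> Basis \<Longrightarrow> continuous_on UNIV (partial_deriv v \<phi>)"
proof -
  define K where "K = closure {z. \<phi> z \<noteq> 0}"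
  have sm: "smooth_on UNIV \<phi>" and K: "compact K" "K \<subseteq> S"
    using assms by (auto simp: test_function_def K_def)
  have z: "\<phi> z = 0" if "z \<notin> K" for z
    using that closure_subset[of "{z. \<phi> z \<noteq> 0}"] by (auto simp: K_def)
  have "partial_deriv v \<phi> z = 0" if "z \<notin> K" for z v
  proof -
    have "(\<phi> has_derivative (\<lambda>_. 0)) (at z)"
      by (rule has_derivative_transform_within_open[of "\<lambda>_. 0" _ z UNIV "- K"])
        (use that z K compact_imp_closed in auto)
    then show ?thesis by (simp add: partial_deriv_def frechet_derivative_at[symmetric])
  qed
  with z K sm show ?thesis
    by (intro that[of K])
      (auto intro: smooth_on_imp_continuous_on smooth_on_partial_deriv has_derivative_frechet
         smooth_on_imp_differentiable)
qed

lemma test_integrable: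
  fixes f :: "'a::euclidean_space \<Rightarrow> 'b::euclidean_space" and \<psi> :: "'a \<Rightarrow> real"
  assumes f: "locally_integrable_on S f" and K: "compact K" "K \<subseteq> S"
    and \<psi>: "continuous_on UNIV \<psi>" "\<And>z. z \<notin> K \<Longrightarrow> \<psi> z = 0"
  shows "set_integrable lebesgue S (\<lambda>z. \<psi> z *\<^sub>R f z)"
proof -
  have int: "integrable lebesgue (\<lambda>z. indicator K z *\<^sub>R f z)"
    using f K by (auto simp: locally_integrable_on_def set_integrable_def)
  have eq: "indicator S z *\<^sub>R \<psi> z *\<^sub>R f z = \<psi> z *\<^sub>R indicator K z *\<^sub>R f z" for z
    using K \<psi>(2)[of z] by (auto simp: indicator_def)
  obtain B where B: "\<And>z. z \<in> K \<Longrightarrow> norm (\<psi> z) \<le> B"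
    using compact_imp_bounded[OF compact_continuous_image[OF continuous_on_subset[OF \<psi>(1)] K(1)]]
    by (auto simp: bounded_iff)
  have B0: "norm (\<psi> z) \<le> \<bar>B\<bar>" for z
    using B[of z] \<psi>(2)[of z] by (cases "z \<in> K") auto
  have "\<psi> \<in> borel_measurable borel"
    using \<psi>(1) by (rule borel_measurable_continuous_onI)
  then have m: "\<psi> \<in> borel_measurable lebesgue"
    by (intro measurable_completion) simp
  show ?thesis
    unfolding set_integrable_def eq
  proof (rule Bochner_Integration.integrable_bound)
    show "integrable lebesgue (\<lambda>z. \<bar>B\<bar> * norm (indicator K z *\<^sub>R f z))"
      by (intro integrable_mult_right integrable_norm int)
    show "AE z in lebesgue. norm (\<psi> z *\<^sub>R indicator K z *\<^sub>R f z) \<le> norm (\<bar>B\<bar> * norm (indicator K z *\<^sub>R f z))"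
      using B0 by (intro AE_I2) (simp only: norm_scaleR norm_mult, auto intro!: mult_right_mono)
  qed (use m borel_measurable_integrable[OF int] in measurable)
qed

lemma test_integral_tendsto:
  fixes f :: "'a::euclidean_space \<Rightarrow> 'b::euclidean_space" and \<psi> :: "'a \<Rightarrow> real"
  assumes S: "open S" and K: "compact K" "K \<subseteq> S"
    and \<psi>: "continuous_on UNIV \<psi>" "\<And>z. z \<notin> K \<Longrightarrow> \<psi> z = 0"
    and u: "\<And>n. locally_integrable_on S (u n)" and f: "locally_integrable_on S f"
    and lim: "AE z in lebesgue. z \<in> S \<longrightarrow> (\<lambda>n. u n z) \<longlonglongrightarrow> f z"
    and bound: "\<And>n. AE z in lebesgue. z \<in> S \<longrightarrow> norm (u n z) \<le> U z"
    and U: "locally_integrable_on S (U :: 'a \<Rightarrow> real)"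
  shows "(\<lambda>n. LINT z:S|lebesgue. \<psi> z *\<^sub>R u n z) \<longlonglongrightarrow> (LINT z:S|lebesgue. \<psi> z *\<^sub>R f z)"
  unfolding set_lebesgue_integral_def
proof (rule integral_dominated_convergence)
  show "integrable lebesgue (\<lambda>z. norm (indicator S z *\<^sub>R \<psi> z *\<^sub>R U z))"
    using test_integrable[OF U K \<psi>] by (auto simp: set_integrable_def)
  show "(\<lambda>z. indicator S z *\<^sub>R \<psi> z *\<^sub>R f z) \<in> borel_measurable lebesgue"
    "(\<lambda>z. indicator S z *\<^sub>R \<psi> z *\<^sub>R u n z) \<in> borel_measurable lebesgue" for n
    using test_integrable[OF f K \<psi>] test_integrable[OF u K \<psi>] unfolding set_integrable_def
    by (blast intro: borel_measurable_integrable)+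
  show "AE z in lebesgue. (\<lambda>n. indicator S z *\<^sub>R \<psi> z *\<^sub>R u n z) \<longlonglongrightarrow> indicator S z *\<^sub>R \<psi> z *\<^sub>R f z"
    using lim by eventually_elim (auto simp: indicator_def intro!: tendsto_intros)
  show "AE z in lebesgue. norm (indicator S z *\<^sub>R \<psi> z *\<^sub>R u n z) \<le> norm (indicator S z *\<^sub>R \<psi> z *\<^sub>R U z)" for n
    using bound[of n]
    by eventually_elim (auto simp: indicator_def abs_mult intro!: mult_left_mono)
qed

text \<open>The product of u with the test function is Lipschitz with compact support, so the
  integral of its derivative vanishes, and the product rule splits it. Differentiability of u almost
  everywhere is enough, which admits functions glued along a null set.\<close>

lemma weak_partial_lipschitz:
  fixes u :: "'a::euclidean_space \<Rightarrow> 'b::euclidean_space"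
  assumes S: "open S" and \<phi>: "test_function S \<phi>" and v: "v \<in> Basis"
    and lip: "\<And>x y. norm (\<phi> x *\<^sub>R u x - \<phi> y *\<^sub>R u y) \<le> C * norm (x - y)"
    and u: "locally_integrable_on S u" and u': "locally_integrable_on S u'"
    and d: "AE z in lebesgue. z \<in> S \<longrightarrow> (\<exists>D. (u has_derivative D) (at z) \<and> D v = u' z)"
  shows "(LINT z:S|lebesgue. partial_deriv v \<phi> z *\<^sub>R u z) = - (LINT z:S|lebesgue. \<phi> z *\<^sub>R u' z)"
proof -
  from \<phi> obtain K where K: "compact K" "K \<subseteq> S" "\<And>z. z \<notin> K \<Longrightarrow> \<phi> z = 0"
    "\<And>z v. z \<notin> K \<Longrightarrow> partial_deriv v \<phi> z = 0"
    "\<And>z. (\<phi> has_derivative frechet_derivative \<phi> (at z)) (at z)"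
    "continuous_on UNIV \<phi>" "continuous_on UNIV (partial_deriv v \<phi>)"
    using v by (elim test_functionE) metis
  let ?F' = "\<lambda>z. indicator S z *\<^sub>R partial_deriv v \<phi> z *\<^sub>R u z + indicator S z *\<^sub>R \<phi> z *\<^sub>R u' z"
  have int: "set_integrable lebesgue S (\<lambda>z. partial_deriv v \<phi> z *\<^sub>R u z)"
    "set_integrable lebesgue S (\<lambda>z. \<phi> z *\<^sub>R u' z)"
    using test_integrable[OF u K(1,2) K(7) K(4)] test_integrable[OF u' K(1,2) K(6) K(3)] by auto
  obtain R where R: "\<And>x. x \<in> K \<Longrightarrow> norm x \<le> R"
    using compact_imp_bounded[OF K(1)] by (auto simp: bounded_iff)
  have "(LINT z|lebesgue. ?F' z) = 0"
  proof (rule integral_derivative_eq_0[OF lip])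
    show "\<phi> x *\<^sub>R u x = 0" if "norm x > R" for x
      using K(3)[of x] R[of x] that by force
    show "?F' \<in> borel_measurable lebesgue"
      using int unfolding set_integrable_def
      by (intro borel_measurable_integrable Bochner_Integration.integrable_add)
    show "AE z in lebesgue. \<exists>D. ((\<lambda>z. \<phi> z *\<^sub>R u z) has_derivative D) (at z) \<and> D v = ?F' z"
      using d
    proof eventually_elim
      case (elim z)
      show ?case
      proof (cases "z \<in> K")
        case True
        then obtain D where D: "(u has_derivative D) (at z)" "D v = u' z" using elim K by auto
        show ?thesis
          by (rule exI, rule conjI, rule has_derivative_scaleR[OF K(5)[of z] D(1)])
            (use D(2) True K(2) in \<open>auto simp: partial_deriv_def\<close>)
      next
        case False
        have "((\<lambda>z. \<phi> z *\<^sub>R u z) has_derivative (\<lambda>_. 0)) (at z)"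
          by (rule has_derivative_transform_within_open[of "\<lambda>_. 0" _ z UNIV "- K"])
            (use False K(3) K(1) compact_imp_closed in auto)
        then show ?thesis using False K(3,4) by (intro exI[of _ "\<lambda>_. 0"]) auto
      qed
    qed
  qed
  then show ?thesis
    using int unfolding set_integrable_def set_lebesgue_integral_def
    by (simp add: add_eq_0_iff2)
qed

lemma continuous_on_imp_locally_integrable:
  fixes f :: "'a::euclidean_space \<Rightarrow> 'b::euclidean_space"
  assumes "continuous_on S f"
  shows "locally_integrable_on S f"
  unfolding locally_integrable_on_def
proof safe
  fix K assume K: "compact K" "K \<subseteq> S"
  have "integrable lborel (\<lambda>z. indicator K z *\<^sub>R f z)"
    by (rule borel_integrable_compact[OF K(1) continuous_on_subset[OF assms K(2)]])
  then show "set_integrable lebesgue K f"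
    unfolding set_integrable_def using integrable_completion borel_measurable_integrable by blast
qed

text \<open>The product of u with a test function, extended by zero, is C^1 with compact support on
  the whole space and therefore Lipschitz.\<close>

lemma weak_partial_C1:
  fixes u :: "'a::euclidean_space \<Rightarrow> 'b::euclidean_space"
  assumes S: "open S" and D: "\<And>z. z \<in> S \<Longrightarrow> (u has_derivative D z) (at z)"
    and cont: "\<And>b. b \<in> Basis \<Longrightarrow> continuous_on S (\<lambda>z. D z b)"
    and v: "v \<in> Basis"
  shows "weak_partial S v u (\<lambda>z. D z v)"
proof -
  have contu: "continuous_on S u"
    using D by (meson continuous_at_imp_continuous_on has_derivative_continuous)
  have "(LINT z:S|lebesgue. partial_deriv v \<phi> z *\<^sub>R u z) = - (LINT z:S|lebesgue. \<phi> z *\<^sub>R D z v)"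
    if \<phi>: "test_function S \<phi>" for \<phi>
  proof -
    from \<phi> obtain K where K: "compact K" "K \<subseteq> S" "\<And>z. z \<notin> K \<Longrightarrow> \<phi> z = 0"
      "\<And>z v. z \<notin> K \<Longrightarrow> partial_deriv v \<phi> z = 0"
      "\<And>z. (\<phi> has_derivative frechet_derivative \<phi> (at z)) (at z)"
      "continuous_on UNIV \<phi>" "\<And>v. v \<in> Basis \<Longrightarrow> continuous_on UNIV (partial_deriv v \<phi>)"
      by (elim test_functionE) metis
    \<comment> \<open>The derivative of the product, extended by zero off S. It is continuous
      because it is so on each of the open sets S and - K, which cover the space.\<close>
    define E where "E z h = (if z \<in> S then \<phi> z *\<^sub>R D z h + frechet_derivative \<phi> (at z) h *\<^sub>R u z else 0)" for z h
    have E: "((\<lambda>z. \<phi> z *\<^sub>R u z) has_derivative E z) (at z)" for z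
    proof (cases "z \<in> S")
      case True
      then show ?thesis
        using has_derivative_scaleR[OF K(5)[of z] D[OF True]] by (simp add: E_def[abs_def])
    next
      case False
      have "((\<lambda>z. \<phi> z *\<^sub>R u z) has_derivative (\<lambda>_. 0)) (at z)"
        by (rule has_derivative_transform_within_open[of "\<lambda>_. 0" _ z UNIV "- K"])
          (use False K(1-3) compact_imp_closed in auto)
      then show ?thesis using False by (simp add: E_def[abs_def])
    qed
    have "continuous_on UNIV (\<lambda>z. E z b)" if b: "b \<in> Basis" for b
    proof -
      have "continuous_on S (\<lambda>z. E z b)"
      proof (rule continuous_on_eq)
        show "continuous_on S (\<lambda>z. \<phi> z *\<^sub>R D z b + partial_deriv b \<phi> z *\<^sub>R u z)"
          using K(6) K(7)[OF b] contu cont[OF b]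
          by (intro continuous_intros) (auto intro: continuous_on_subset)
      qed (auto simp: E_def partial_deriv_def)
      moreover have "continuous_on (- K) (\<lambda>z. E z b)"
      proof (rule continuous_on_eq)
        show "continuous_on (- K) (\<lambda>_. 0 :: 'b)" by simp
      qed (use K(3,4) in \<open>auto simp: E_def partial_deriv_def\<close>)
      ultimately have "continuous_on (S \<union> - K) (\<lambda>z. E z b)"
        using S K(1) compact_imp_closed by (intro continuous_on_open_Un) auto
      moreover have "S \<union> - K = UNIV" using K by auto
      ultimately show ?thesis by simp
    qed
    from C1_compact_support_lipschitz[OF E this K(1)] K(3)
    obtain C where "\<And>x y. norm (\<phi> x *\<^sub>R u x - \<phi> y *\<^sub>R u y) \<le> C * norm (x - y)" by auto
    then show ?thesis
      using D by (intro weak_partial_lipschitz[OF S \<phi> v] AE_I2)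
        (auto intro!: continuous_on_imp_locally_integrable contu cont v)
  qed
  then show ?thesis
    by (auto simp: weak_partial_def intro!: continuous_on_imp_locally_integrable contu cont v)
qed

lemma locally_integrable_on_bound:
  fixes f :: "'a::euclidean_space \<Rightarrow> 'b::euclidean_space" and U :: "'a \<Rightarrow> 'c::euclidean_space"
  assumes S: "open S" and f: "f \<in> borel_measurable (lebesgue_on S)" and U: "locally_integrable_on S U"
    and bound: "AE z in lebesgue. z \<in> S \<longrightarrow> norm (f z) \<le> norm (U z)"
  shows "locally_integrable_on S f"
  unfolding locally_integrable_on_def set_integrable_def
proof safe
  fix K assume K: "compact K" "K \<subseteq> S"
  have m: "(\<lambda>z. indicator S z *\<^sub>R f z) \<in> borel_measurable lebesgue"
    using f S by (subst (asm) borel_measurable_restrict_space_iff) auto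
  have [measurable]: "K \<in> sets lebesgue"
    using K(1) by (simp add: borel_compact)
  have eq: "indicator K z *\<^sub>R f z = indicator K z *\<^sub>R indicator S z *\<^sub>R f z" for z
    using K by (auto simp: indicator_def)
  have mK: "(\<lambda>z. indicator K z *\<^sub>R f z) \<in> borel_measurable lebesgue"
    unfolding eq using m by measurable
  show "integrable lebesgue (\<lambda>z. indicator K z *\<^sub>R f z)"
  proof (rule Bochner_Integration.integrable_bound[OF _ mK])
    show "integrable lebesgue (\<lambda>z. indicator K z *\<^sub>R U z)"
      using U K by (auto simp: locally_integrable_on_def set_integrable_def)
    show "AE z in lebesgue. norm (indicator K z *\<^sub>R f z) \<le> norm (indicator K z *\<^sub>R U z)"
      using bound by eventually_elim (use K in \<open>auto simp: indicator_def\<close>)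
  qed
qed

lemma locally_integrable_on_subset:
  "locally_integrable_on S f \<Longrightarrow> T \<subseteq> S \<Longrightarrow> locally_integrable_on T f"
  by (auto simp: locally_integrable_on_def)

text \<open>Both sides of the integration by parts formula pass to the limit by dominated
  convergence. This carries weak gradients across the zeros of \<open>sw_fun\<close>, where the
  approximations are C^1 but the limits are singular.\<close>

lemma weak_partial_limit:
  fixes f :: "'a::euclidean_space \<Rightarrow> 'b::euclidean_space"
  assumes S: "open S" and v: "v \<in> Basis"
    and w: "\<And>n. weak_partial S v (u n) (u' n)"
    and f: "f \<in> borel_measurable (lebesgue_on S)" "f' \<in> borel_measurable (lebesgue_on S)"
    and lim: "AE z in lebesgue. z \<in> S \<longrightarrow> (\<lambda>n. u n z) \<longlonglongrightarrow> f z"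
      "AE z in lebesgue. z \<in> S \<longrightarrow> (\<lambda>n. u' n z) \<longlonglongrightarrow> f' z"
    and bound: "\<And>n. AE z in lebesgue. z \<in> S \<longrightarrow> norm (u n z) \<le> U z"
      "\<And>n. AE z in lebesgue. z \<in> S \<longrightarrow> norm (u' n z) \<le> U' z"
    and U: "locally_integrable_on S (U :: 'a \<Rightarrow> real)" "locally_integrable_on S (U' :: 'a \<Rightarrow> real)"
  shows "weak_partial S v f f'"
proof -
  \<comment> \<open>The limits inherit the bounds of the sequences, which makes them locally
    integrable.\<close>
  have lb: "AE z in lebesgue. z \<in> S \<longrightarrow> norm (g z) \<le> norm (V z)"
    if "AE z in lebesgue. z \<in> S \<longrightarrow> (\<lambda>n. w n z) \<longlonglongrightarrow> g z"
      "\<And>n. AE z in lebesgue. z \<in> S \<longrightarrow> norm (w n z) \<le> V z"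
    for g :: "'a \<Rightarrow> 'b" and w and V :: "'a \<Rightarrow> real"
  proof -
    have "AE z in lebesgue. \<forall>n. z \<in> S \<longrightarrow> norm (w n z) \<le> V z"
      unfolding AE_all_countable using that(2) by blast
    with that(1) show ?thesis
    proof eventually_elim
      case (elim z)
      have "norm (g z) \<le> V z" if "z \<in> S"
      proof (rule LIMSEQ_le_const2)
        show "(\<lambda>n. norm (w n z)) \<longlonglongrightarrow> norm (g z)"
          using elim that by (auto intro: tendsto_norm)
      qed (use elim that in auto)
      then show ?case by fastforce
    qed
  qed
  have lf: "locally_integrable_on S f" "locally_integrable_on S f'"
    using locally_integrable_on_bound[OF S f(1) U(1) lb[OF lim(1) bound(1)]]
      locally_integrable_on_bound[OF S f(2) U(2) lb[OF lim(2) bound(2)]] by auto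
  have lu: "locally_integrable_on S (u n)" "locally_integrable_on S (u' n)" for n
    using w by (auto simp: weak_partial_def)
  have "(LINT z:S|lebesgue. partial_deriv v \<phi> z *\<^sub>R f z) = - (LINT z:S|lebesgue. \<phi> z *\<^sub>R f' z)"
    if \<phi>: "test_function S \<phi>" for \<phi>
  proof -
    from \<phi> obtain K where K: "compact K" "K \<subseteq> S" "\<And>z. z \<notin> K \<Longrightarrow> \<phi> z = 0"
      "\<And>z v. z \<notin> K \<Longrightarrow> partial_deriv v \<phi> z = 0"
      "continuous_on UNIV \<phi>" "\<And>v. v \<in> Basis \<Longrightarrow> continuous_on UNIV (partial_deriv v \<phi>)"
      by (elim test_functionE) metis
    have lim_f: "(\<lambda>n. LINT z:S|lebesgue. partial_deriv v \<phi> z *\<^sub>R u n z)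
        \<longlonglongrightarrow> (LINT z:S|lebesgue. partial_deriv v \<phi> z *\<^sub>R f z)"
      by (rule test_integral_tendsto[OF S K(1,2) K(6)[OF v] K(4) lu(1) lf(1) lim(1) bound(1) U(1)])
    have "(\<lambda>n. LINT z:S|lebesgue. \<phi> z *\<^sub>R u' n z)
        \<longlonglongrightarrow> (LINT z:S|lebesgue. \<phi> z *\<^sub>R f' z)"
      by (rule test_integral_tendsto[OF S K(1,2) K(5) K(3) lu(2) lf(2) lim(2) bound(2) U(2)])
    moreover have "(LINT z:S|lebesgue. partial_deriv v \<phi> z *\<^sub>R u n z)
        = - (LINT z:S|lebesgue. \<phi> z *\<^sub>R u' n z)" for n
      using w \<phi> by (auto simp: weak_partial_def)
    ultimately have "(\<lambda>n. LINT z:S|lebesgue. partial_deriv v \<phi> z *\<^sub>R u n z)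
        \<longlonglongrightarrow> - (LINT z:S|lebesgue. \<phi> z *\<^sub>R f' z)"
      by (simp only: tendsto_minus)
    with lim_f show ?thesis by (rule LIMSEQ_unique)
  qed
  then show ?thesis using lf by (simp add: weak_partial_def)
qed

lemma test_function_subset: "test_function T \<phi> \<Longrightarrow> T \<subseteq> S \<Longrightarrow> test_function S \<phi>"
  by (auto simp: test_function_def)

lemma test_set_integral_subset:
  assumes "\<And>z. z \<notin> T \<Longrightarrow> h z = 0" "T \<subseteq> S"
  shows "(LINT z:S|M. h z) = (LINT z:T|M. h z)"
  unfolding set_lebesgue_integral_def
  by (rule Bochner_Integration.integral_cong) (use assms in \<open>auto simp: indicator_def\<close>)

lemma weak_partial_subset:
  assumes w: "weak_partial S v f f'" and T: "T \<subseteq> S"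
  shows "weak_partial T v f f'"
  unfolding weak_partial_def
proof (intro conjI allI impI)
  show "locally_integrable_on T f" "locally_integrable_on T f'"
    using w T by (auto simp: weak_partial_def intro: locally_integrable_on_subset)
  fix \<phi> assume \<phi>: "test_function T \<phi>"
  from \<phi> obtain K where K: "K \<subseteq> T" "\<And>z. z \<notin> K \<Longrightarrow> \<phi> z = 0"
      "\<And>z v. z \<notin> K \<Longrightarrow> partial_deriv v \<phi> z = 0"
    by (elim test_functionE) metis
  have "(LINT z:S|lebesgue. partial_deriv v \<phi> z *\<^sub>R f z) = (LINT z:T|lebesgue. partial_deriv v \<phi> z *\<^sub>R f z)"
    "(LINT z:S|lebesgue. \<phi> z *\<^sub>R f' z) = (LINT z:T|lebesgue. \<phi> z *\<^sub>R f' z)"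
    using K T by (intro test_set_integral_subset; auto)+
  then show "(LINT z:T|lebesgue. partial_deriv v \<phi> z *\<^sub>R f z) = - (LINT z:T|lebesgue. \<phi> z *\<^sub>R f' z)"
    using w test_function_subset[OF \<phi> T] by (simp add: weak_partial_def)
qed

lemma weak_gradient_subset:
  "weak_gradient S f fx fy \<Longrightarrow> T \<subseteq> S \<Longrightarrow> weak_gradient T f fx fy"
  by (auto simp: weak_gradient_def intro: weak_partial_subset)

lemma locally_integrable_on_linear:
  fixes f :: "'a::euclidean_space \<Rightarrow> 'b::euclidean_space" and L :: "'b \<Rightarrow> 'c::euclidean_space"
  assumes "bounded_linear L" "locally_integrable_on S f"
  shows "locally_integrable_on S (\<lambda>z. L (f z))"
  unfolding locally_integrable_on_def set_integrable_def
proof (intro allI impI)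
  fix K assume "compact K \<and> K \<subseteq> S"
  then have "integrable lebesgue (\<lambda>z. indicator K z *\<^sub>R f z)"
    using assms(2) by (auto simp: locally_integrable_on_def set_integrable_def)
  from integrable_bounded_linear[OF assms(1) this]
  show "integrable lebesgue (\<lambda>z. indicator K z *\<^sub>R L (f z))"
    by (simp add: linear_simps(5)[OF assms(1)])
qed

lemma weak_partial_linear:
  fixes f :: "'a::euclidean_space \<Rightarrow> 'b::euclidean_space" and L :: "'b \<Rightarrow> 'c::euclidean_space"
  assumes L: "bounded_linear L" and w: "weak_partial S v f f'" and v: "v \<in> Basis"
  shows "weak_partial S v (\<lambda>z. L (f z)) (\<lambda>z. L (f' z))"
  unfolding weak_partial_def
proof (intro conjI allI impI)
  show "locally_integrable_on S (\<lambda>z. L (f z))" "locally_integrable_on S (\<lambda>z. L (f' z))"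
    using w by (auto simp: weak_partial_def intro: locally_integrable_on_linear[OF L])
  fix \<phi> assume \<phi>: "test_function S \<phi>"
  from \<phi> obtain K where K: "compact K" "K \<subseteq> S" "\<And>z. z \<notin> K \<Longrightarrow> \<phi> z = 0"
    "\<And>z v. z \<notin> K \<Longrightarrow> partial_deriv v \<phi> z = 0"
    "continuous_on UNIV \<phi>" "\<And>v. v \<in> Basis \<Longrightarrow> continuous_on UNIV (partial_deriv v \<phi>)"
    by (elim test_functionE) metis
  have eq: "(LINT z:S|lebesgue. \<psi> z *\<^sub>R L (h z)) = L (LINT z:S|lebesgue. \<psi> z *\<^sub>R h z)"
    if "set_integrable lebesgue S (\<lambda>z. \<psi> z *\<^sub>R h z)" for \<psi> :: "'a \<Rightarrow> real" and h :: "'a \<Rightarrow> 'b"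
    using integral_bounded_linear[OF L that[unfolded set_integrable_def]]
    by (simp add: set_lebesgue_integral_def linear_simps(5)[OF L])
  have lf: "locally_integrable_on S f" "locally_integrable_on S f'"
    and ibp: "(LINT z:S|lebesgue. partial_deriv v \<phi> z *\<^sub>R f z) = - (LINT z:S|lebesgue. \<phi> z *\<^sub>R f' z)"
    using w \<phi> by (auto simp: weak_partial_def)
  show "(LINT z:S|lebesgue. partial_deriv v \<phi> z *\<^sub>R L (f z)) = - (LINT z:S|lebesgue. \<phi> z *\<^sub>R L (f' z))"
  proof -
    have "set_integrable lebesgue S (\<lambda>z. partial_deriv v \<phi> z *\<^sub>R f z)"
      by (rule test_integrable[OF lf(1) K(1,2) K(6)[OF v] K(4)])
    moreover have "set_integrable lebesgue S (\<lambda>z. \<phi> z *\<^sub>R f' z)"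
      by (rule test_integrable[OF lf(2) K(1,2) K(5) K(3)])
    ultimately show ?thesis
      by (simp only: eq ibp linear_simps(4)[OF L])
  qed
qed

lemma weak_gradient_linear:
  assumes "bounded_linear L" "weak_gradient S f fx fy"
  shows "weak_gradient S (\<lambda>z. L (f z)) (\<lambda>z. L (fx z)) (\<lambda>z. L (fy z))"
  using weak_partial_linear[OF assms(1), of S 1 f fx] weak_partial_linear[OF assms(1), of S \<i> f fy] assms(2)
  by (simp add: weak_gradient_def Basis_complex_def)

lemma weak_gradient_wirtinger:
  assumes S: "open S" and w: "\<And>z. z \<in> S \<Longrightarrow> has_wirtinger u (a z) (b z) z"
    and c: "continuous_on S a" "continuous_on S b"
  shows "weak_gradient S u (\<lambda>z. a z + b z) (\<lambda>z. \<i> * (a z - b z))"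
proof -
  have "weak_partial S v u (\<lambda>z. a z * v + b z * cnj v)" if "v \<in> Basis" for v
    using S w[unfolded has_wirtinger_def] c that
    by (intro weak_partial_C1[where D="\<lambda>z h. a z * h + b z * cnj h"]) (auto intro!: continuous_intros)
  from this[of 1] this[of \<i>]
  have "weak_partial S 1 u (\<lambda>z. a z * 1 + b z * cnj 1)" "weak_partial S \<i> u (\<lambda>z. a z * \<i> + b z * cnj \<i>)"
    by (auto simp: Basis_complex_def)
  moreover have "(\<lambda>z. a z * 1 + b z * cnj 1) = (\<lambda>z. a z + b z)"
    "(\<lambda>z. a z * \<i> + b z * cnj \<i>) = (\<lambda>z. \<i> * (a z - b z))"
    by (simp_all add: fun_eq_iff algebra_simps)
  ultimately show ?thesis
    by (simp only: weak_gradient_def)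
qed

section \<open>Kernels bounding functions in Lebesgue spaces\<close>

text \<open>Dyadic decomposition: on the annulus between the radii r / 2^(k+1) and r / 2^k the
  kernel is at most its value at the inner radius, and the area is at most pi (r / 2^k)^2. The
  products form a geometric series of ratio 2^(p-2), which is less than 1 exactly because p < 2. The
  constant does not depend on the centre.\<close>

lemma nn_integral_norm_powr_cball:
  fixes p :: real
  assumes p: "0 < p" "p < 2"
  obtains C where "C \<ge> 0"
    "\<And>(a::complex) r. r \<ge> 0 \<Longrightarrow>
      (\<integral>\<^sup>+z\<in>cball a r. ennreal (norm (z - a) powr - p) \<partial>lborel) \<le> ennreal (C * r powr (2 - p))"
proof -
  define C where "C = pi * 2 powr p * (1 / (1 - 2 powr (p - 2)))"
  have lt1: "2 powr (p - 2) < (1::real)" using p by (simp add: powr_less_one)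
  have C0: "C \<ge> 0" using lt1 by (simp add: C_def)
  have "(\<integral>\<^sup>+z\<in>cball a r. ennreal (norm (z - a) powr - p) \<partial>lborel) \<le> ennreal (C * r powr (2 - p))"
    if r: "r \<ge> 0" for a :: complex and r
  proof (cases "r = 0")
    case True
    have "ennreal (cmod (z - a) powr - p) * indicator (cball a 0) z = 0" for z
      by (auto simp: indicator_def)
    with True show ?thesis by simp
  next
    case False
    with r have r: "r > 0" by simp
    define T where "T k = (r / 2 ^ (k + 1)) powr - p" for k :: nat
    have le: "ennreal (norm (z - a) powr - p) * indicator (cball a r) z
        \<le> (\<Sum>k. ennreal (T k) * indicator (cball a (r / 2 ^ k)) z)" for z
    proof (cases "z \<in> cball a r \<and> z \<noteq> a")
      case True
      define d where "d = norm (z - a)"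
      have d: "0 < d" "d \<le> r" using True by (auto simp: d_def dist_norm norm_minus_commute)
      have ex: "\<exists>k. r / 2 ^ (k + 1) < d"
      proof -
        obtain k where "(1/2::real) ^ k < d / r" using real_arch_pow_inv[of "d / r" "1/2"] d r by auto
        then have "r / 2 ^ k < d" using r by (simp add: field_simps power_divide)
        moreover have "r / 2 ^ (k + 1) \<le> r / 2 ^ k" using r by (simp add: field_simps)
        ultimately show ?thesis by (intro exI[of _ k]) linarith
      qed
      \<comment> \<open>The index of the annulus that contains z: minimality of k gives the outer
        bound d \<le> r / 2^k, and for k = 0 this is d \<le> r.\<close>
      define k where "k = (LEAST k. r / 2 ^ (k + 1) < d)"
      have k: "r / 2 ^ (k + 1) < d" unfolding k_def by (rule LeastI_ex[OF ex])
      have "d \<le> r / 2 ^ k"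
      proof (cases k)
        case (Suc m)
        then have "\<not> r / 2 ^ (m + 1) < d" using not_less_Least[of m] by (metis k_def lessI)
        then show ?thesis using Suc by simp
      qed (use d in simp)
      then have zk: "z \<in> cball a (r / 2 ^ k)" by (simp add: d_def dist_norm norm_minus_commute)
      have "d powr - p \<le> T k"
        unfolding T_def using k p r by (intro powr_mono2') auto
      then have "ennreal (norm (z - a) powr - p) * indicator (cball a r) z
          \<le> ennreal (T k) * indicator (cball a (r / 2 ^ k)) z"
        using True zk by (simp add: d_def ennreal_leI)
      also have "\<dots> \<le> (\<Sum>k. ennreal (T k) * indicator (cball a (r / 2 ^ k)) z)"
      proof -
        define F where "F k = ennreal (T k) * indicator (cball a (r / 2 ^ k)) z" for k
        have "F k \<le> suminf F" using sum_le_suminf[of F "{k}"] by simp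
        then show ?thesis by (simp add: F_def[abs_def])
      qed
      finally show ?thesis .
    qed (auto simp: indicator_def)
    have geo: "(\<lambda>k. (2 powr (p - 2)) ^ k) sums (1 / (1 - 2 powr (p - 2)))"
      by (rule geometric_sums) (use lt1 in auto)
    have T_eq: "T k * (pi * (r / 2 ^ k)\<^sup>2) = (pi * 2 powr p * r powr (2 - p)) * (2 powr (p - 2)) ^ k" for k
    proof -
      have "T k = r powr - p * 2 powr p * (2 powr p) ^ k"
        using r by (simp add: T_def powr_divide powr_minus powr_mult powr_power
              powr_realpow[symmetric] powr_powr powr_add field_simps)
      moreover have "(r / 2 ^ k)\<^sup>2 = r\<^sup>2 * (2 powr - 2) ^ k"
        by (simp add: power_divide powr_minus power2_eq_square field_simps flip: power_mult_distrib)
      moreover have "r powr (2 - p) = r\<^sup>2 * r powr - p"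
        using r powr_add[of r 2 "- p"] by (simp add: powr_numeral)
      moreover have "(2::real) powr (p - 2) = 2 powr p * 2 powr - 2"
        using powr_add[of 2 p "- 2"] by simp
      ultimately show ?thesis by (simp add: power_mult_distrib algebra_simps)
    qed
    have "(\<integral>\<^sup>+z\<in>cball a r. ennreal (norm (z - a) powr - p) \<partial>lborel)
        \<le> (\<integral>\<^sup>+z. (\<Sum>k. ennreal (T k) * indicator (cball a (r / 2 ^ k)) z) \<partial>lborel)"
      by (intro nn_integral_mono le)
    also have "\<dots> = (\<Sum>k. \<integral>\<^sup>+z. ennreal (T k) * indicator (cball a (r / 2 ^ k)) z \<partial>lborel)"
      by (intro nn_integral_suminf borel_measurable_times_ennreal borel_measurable_indicator) auto
    also have "\<dots> = (\<Sum>k. ennreal (T k * (pi * (r / 2 ^ k)\<^sup>2)))"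
    proof (intro suminf_cong)
      fix k
      have "emeasure lborel (cball a (r / 2 ^ k)) = ennreal (pi * (r / 2 ^ k)\<^sup>2)"
        using r by (subst emeasure_cball) (auto simp: unit_ball_vol_2)
      then show "(\<integral>\<^sup>+z. ennreal (T k) * indicator (cball a (r / 2 ^ k)) z \<partial>lborel)
          = ennreal (T k * (pi * (r / 2 ^ k)\<^sup>2))"
        by (simp add: nn_integral_cmult_indicator T_def ennreal_mult'')
    qed
    also have "\<dots> = ennreal (C * r powr (2 - p))"
    proof -
      have "(\<lambda>k. T k * (pi * (r / 2 ^ k)\<^sup>2)) sums (C * r powr (2 - p))"
        unfolding T_eq using sums_mult[OF geo, of "pi * 2 powr p * r powr (2 - p)"]
        by (simp add: C_def mult_ac)
      then show ?thesis
        by (intro suminf_ennreal_eq) (auto simp: T_def)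
    qed
    finally show ?thesis .
  qed
  with C0 show ?thesis by (rule that)
qed

lemma countable_null_sets_lebesgue: "countable Z \<Longrightarrow> Z \<in> null_sets (lebesgue :: 'a::euclidean_space measure)"
  using countable_imp_null_set_lborel null_sets_completionI by blast

lemma AE_not_in_countable:
  assumes "countable (Z :: 'a::euclidean_space set)"
  shows "AE z in lebesgue. z \<notin> Z"
  using countable_null_sets_lebesgue[OF assms] by (rule AE_not_in)

text \<open>Off a null set, |h|^p is at most the sum over n of (c n)^p |z - a n|^(-p) restricted to
  the n-th disc. Integrating term by term, each disc contributes a multiple of (c n)^p (r
  n)^(2-p).\<close>

lemma Lp_space_kernel_bound:
  fixes h :: "complex \<Rightarrow> 'b::euclidean_space"
  assumes S: "S \<in> sets lebesgue" and h: "h \<in> borel_measurable (lebesgue_on S)"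
    and p: "0 < p" "p < 2" and Z: "countable Z"
    and bound: "\<And>z. z \<in> S - Z \<Longrightarrow> \<exists>n::nat. norm (z - a n) \<le> r n \<and> norm (h z) \<le> c n / norm (z - a n)"
    and r: "\<And>n. r n \<ge> 0" and c: "\<And>n. c n \<ge> 0"
    and sm: "summable (\<lambda>n. c n powr p * r n powr (2 - p))"
  shows "h \<in> Lp_space p S"
proof -
  from nn_integral_norm_powr_cball[OF p] obtain C where C: "C \<ge> 0"
    "\<And>(a::complex) r. r \<ge> 0 \<Longrightarrow>
      (\<integral>\<^sup>+z\<in>cball a r. ennreal (norm (z - a) powr - p) \<partial>lborel) \<le> ennreal (C * r powr (2 - p))" by blast
  define F where "F n z = ennreal (c n powr p) * (ennreal (norm (z - a n) powr - p) * indicator (cball (a n) (r n)) z)"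
    for n z
  have Fm': "(\<lambda>z. ennreal (norm (z - a n) powr - p) * indicator (cball (a n) (r n)) z) \<in> borel_measurable borel" for n
    by (intro borel_measurable_times_ennreal borel_measurable_indicator) auto
  have Fm: "F n \<in> borel_measurable borel" for n
    unfolding F_def by (intro borel_measurable_times_ennreal Fm') auto
  have le: "ennreal (norm (h z) powr p) * indicator S z \<le> (\<Sum>n. F n z)" if "z \<notin> Z" for z
  proof (cases "z \<in> S")
    case True
    with that bound obtain n where n: "norm (z - a n) \<le> r n" "norm (h z) \<le> c n / norm (z - a n)" by auto
    have "norm (h z) powr p \<le> (c n / norm (z - a n)) powr p"
      using n p by (intro powr_mono2) auto
    also have "\<dots> = c n powr p * norm (z - a n) powr - p"
      using c[of n] by (simp add: powr_divide powr_minus) (simp add: divide_inverse)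
    finally have "ennreal (norm (h z) powr p) \<le> ennreal (c n powr p) * ennreal (norm (z - a n) powr - p)"
      by (simp add: ennreal_mult'[symmetric] ennreal_leI)
    then have "ennreal (norm (h z) powr p) * indicator S z \<le> F n z"
      using n(1) True by (simp add: F_def dist_norm norm_minus_commute)
    also have "\<dots> \<le> (\<Sum>n. F n z)"
      using sum_le_suminf[of "\<lambda>n. F n z" "{n}"] by simp
    finally show ?thesis .
  qed auto
  have "(\<integral>\<^sup>+z. ennreal (norm (norm (h z) powr p)) \<partial>lebesgue_on S)
      = (\<integral>\<^sup>+z. ennreal (norm (h z) powr p) * indicator S z \<partial>lebesgue)"
    using S by (subst nn_integral_restrict_space) auto
  also have "\<dots> \<le> (\<integral>\<^sup>+z. (\<Sum>n. F n z) \<partial>lebesgue)"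
    by (intro nn_integral_mono_AE eventually_mono[OF AE_not_in_countable[OF Z]] le)
  also have "\<dots> = (\<integral>\<^sup>+z. (\<Sum>n. F n z) \<partial>lborel)"
    by (rule nn_integral_completion)
  also have "\<dots> = (\<Sum>n. \<integral>\<^sup>+z. F n z \<partial>lborel)"
    using Fm by (intro nn_integral_suminf) simp
  also have "\<dots> \<le> (\<Sum>n. ennreal (C * (c n powr p * r n powr (2 - p))))"
  proof (intro suminf_le)
    fix n
    have "(\<integral>\<^sup>+z. F n z \<partial>lborel)
      = ennreal (c n powr p) * (\<integral>\<^sup>+z\<in>cball (a n) (r n). ennreal (norm (z - a n) powr - p) \<partial>lborel)"
      unfolding F_def using Fm' by (intro nn_integral_cmult) simp
    also have "\<dots> \<le> ennreal (c n powr p) * ennreal (C * r n powr (2 - p))"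
      by (intro mult_left_mono C(2) r) auto
    also have "\<dots> = ennreal (C * (c n powr p * r n powr (2 - p)))"
      using C(1) by (simp add: ennreal_mult'[symmetric] mult_ac)
    finally show "(\<integral>\<^sup>+z. F n z \<partial>lborel) \<le> ennreal (C * (c n powr p * r n powr (2 - p)))" .
  qed auto
  also have "\<dots> < \<infinity>"
  proof -
    have "(\<Sum>n. ennreal (C * (c n powr p * r n powr (2 - p)))) = ennreal (\<Sum>n. C * (c n powr p * r n powr (2 - p)))"
      using C(1) by (intro suminf_ennreal2 summable_mult sm) auto
    then show ?thesis by simp
  qed
  finally have "integrable (lebesgue_on S) (\<lambda>z. norm (h z) powr p)"
    using h by (intro integrableI_bounded) measurable
  then show ?thesis using h by (simp add: Lp_space_def)
qed

text \<open>The borderline exponent 2: the set where |h| > t lies, up to a null set, in finitely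
  many discs of radius |c| / t, each of area pi c^2 / t^2.\<close>

lemma weak_L2_loc_kernel_bound:
  fixes h :: "complex \<Rightarrow> 'b::euclidean_space"
  assumes S: "S \<in> sets lebesgue" and h: "h \<in> borel_measurable (lebesgue_on S)" and Z: "countable Z"
    and bound: "\<And>K. compact K \<Longrightarrow> K \<subseteq> S \<Longrightarrow>
      \<exists>A c. finite A \<and> (\<forall>z\<in>K - Z. \<exists>a\<in>A. norm (h z) \<le> c / norm (z - a))"
  shows "h \<in> weak_L2_loc S"
proof -
  have "\<exists>C. \<forall>t>0. t\<^sup>2 * measure lebesgue {z\<in>K. norm (h z) > t} \<le> C" if K: "compact K" "K \<subseteq> S" for K
  proof -
    from bound[OF K] obtain A c where A: "finite A"
      "\<And>z. z \<in> K - Z \<Longrightarrow> \<exists>a\<in>A. norm (h z) \<le> c / norm (z - a)" by blast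
    have "t\<^sup>2 * measure lebesgue {z\<in>K. norm (h z) > t} \<le> card A * (pi * c\<^sup>2)" if t: "t > 0" for t
    proof -
      define B where "B = (\<Union>a\<in>A. cball a (\<bar>c\<bar> / t))"
      have Bl: "B \<in> lmeasurable" using A(1) unfolding B_def by (intro fmeasurable.finite_UN) auto
      have sub: "{z\<in>K. norm (h z) > t} \<subseteq> B \<union> Z"
      proof
        fix z assume z: "z \<in> {z\<in>K. norm (h z) > t}"
        show "z \<in> B \<union> Z"
        proof (cases "z \<in> Z")
          case False
          with z A(2) obtain a where a: "a \<in> A" "norm (h z) \<le> c / norm (z - a)" by auto
          with z have *: "t < c / norm (z - a)" by auto
          then have "norm (z - a) > 0" using t by (cases "z = a") auto
          then have "norm (z - a) \<le> \<bar>c\<bar> / t" using * t by (simp add: field_simps)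
          then show ?thesis using a by (auto simp: B_def dist_norm norm_minus_commute)
        qed simp
      qed
      have [measurable]: "K \<in> sets lebesgue" using K(1) by (simp add: borel_compact)
      have "{z\<in>K. norm (h z) > t} = K \<inter> {z\<in>space (lebesgue_on S). norm (h z) > t}"
        using K by (auto simp: space_restrict_space)
      moreover have "{z\<in>space (lebesgue_on S). norm (h z) > t} \<in> sets (lebesgue_on S)"
        using h by measurable
      then have "{z\<in>space (lebesgue_on S). norm (h z) > t} \<in> sets lebesgue"
        using S by (auto simp: sets_restrict_space_iff)
      ultimately have m: "{z\<in>K. norm (h z) > t} \<in> sets lebesgue" by auto
      have Zl: "Z \<in> lmeasurable" "measure lebesgue Z = 0"
        using countable_null_sets_lebesgue[OF Z] by (auto simp: fmeasurable_def null_sets_def measure_def)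
      have "measure lebesgue {z\<in>K. norm (h z) > t} \<le> measure lebesgue (B \<union> Z)"
        by (rule measure_mono_fmeasurable[OF sub m]) (use Bl Zl in auto)
      also have "\<dots> \<le> measure lebesgue B + measure lebesgue Z"
        using Bl Zl by (intro measure_Un_le) auto
      also have "\<dots> \<le> (\<Sum>a\<in>A. measure lebesgue (cball a (\<bar>c\<bar> / t)))"
        unfolding Zl B_def using A(1) measure_UNION_le[of A "\<lambda>a. cball a (\<bar>c\<bar> / t)" lebesgue] by simp
      also have "\<dots> = card A * (pi * (\<bar>c\<bar> / t)\<^sup>2)"
        using t by (simp add: content_cball unit_ball_vol_2)
      finally show ?thesis using t by (simp add: field_simps power_divide)
    qed
    then show ?thesis by blast
  qed
  then show ?thesis using h by (auto simp: weak_L2_loc_def)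
qed

section \<open>Powers of the modulus times powers of the sign\<close>

text \<open>The power |w|^s (w / |w|)^n, with separate exponents for modulus and phase. With G = ln
  |w| and g = w / |w| it is exp (s G) g^n, the building block of a Schoen-Wolfson mode. As 0 powr s
  = 0 for every s, its value at 0 is 0 even for s = 0.\<close>

definition epw :: "real \<Rightarrow> int \<Rightarrow> complex \<Rightarrow> complex" where
  "epw s n w = complex_of_real (cmod w powr s) * sgn w powi n"

lemma norm_sgn_powi: "w \<noteq> 0 \<Longrightarrow> cmod (sgn w powi n) = 1"
  by (simp add: norm_power_int norm_sgn)

lemma norm_epw: "cmod (epw s n w) = cmod w powr s"
  by (cases "w = 0") (simp_all add: epw_def norm_mult norm_sgn_powi)

lemma epw_0 [simp]: "epw s n 0 = 0"
  by (simp add: epw_def)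

lemma epw_mult_self: "epw s n w * w = epw (s + 1) (n + 1) w"
proof (cases "w = 0")
  case False
  then have "w = complex_of_real (cmod w) * sgn w"
    by (simp add: sgn_eq)
  then have "epw s n w * w = complex_of_real (cmod w powr s * cmod w) * (sgn w powi n * sgn w)"
    by (metis (no_types, lifting) epw_def mult.assoc mult.left_commute of_real_mult)
  also have "cmod w powr s * cmod w = cmod w powr (s + 1)"
    using False by (simp add: powr_add)
  also have "sgn w powi n * sgn w = sgn w powi (n + 1)"
    using False by (simp add: power_int_add_1 sgn_zero_iff)
  finally show ?thesis by (simp add: epw_def)
qed simp

lemma epw_mult_cnj: "epw s n w * cnj w = epw (s + 1) (n - 1) w"
proof (cases "w = 0")
  case False
  have "cnj w = complex_of_real (cmod w) * inverse (sgn w)"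
    using False complex_norm_square[of w] by (simp add: sgn_eq field_simps power2_eq_square)
  then have "epw s n w * cnj w = complex_of_real (cmod w powr s * cmod w) * (sgn w powi n * inverse (sgn w))"
    by (simp add: epw_def)
  also have "cmod w powr s * cmod w = cmod w powr (s + 1)"
    using False by (simp add: powr_add)
  also have "sgn w powi n * inverse (sgn w) = sgn w powi (n - 1)"
    using False by (simp add: power_int_diff sgn_zero_iff divide_inverse)
  finally show ?thesis by (simp add: epw_def)
qed simp

text \<open>The rule suggested by |w|^t = (w cnj w)^(t/2), derived from the gradient of the
  norm.\<close>

lemma has_wirtinger_norm_powr:
  assumes "w \<noteq> 0"
  shows "has_wirtinger (\<lambda>w. complex_of_real (cmod w powr t))
    (of_real (t / 2 * cmod w powr (t - 2)) * cnj w) (of_real (t / 2 * cmod w powr (t - 2)) * w) w"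
proof -
  have "((\<lambda>w. cmod w powr t) has_derivative (\<lambda>h. (h \<bullet> sgn w) * (t * cmod w powr (t - 1)))) (at w)"
  proof -
    have 1: "(cmod has_derivative (\<lambda>h. h \<bullet> sgn w)) (at w)"
      using has_derivative_norm[OF assms] by (simp add: inner_commute)
    have "((\<lambda>x. x powr t) has_field_derivative t * cmod w powr (t - 1)) (at (cmod w))"
      using assms by (intro has_real_derivative_powr) auto
    from DERIV_compose_FDERIV[OF this 1] show ?thesis by (simp add: mult.commute)
  qed
  from bounded_linear.has_derivative[OF bounded_linear_of_real this]
  have "((\<lambda>w. complex_of_real (cmod w powr t)) has_derivative
      (\<lambda>h. complex_of_real ((h \<bullet> sgn w) * (t * cmod w powr (t - 1))))) (at w)" .
  moreover have "complex_of_real ((h \<bullet> sgn w) * (t * cmod w powr (t - 1)))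
      = of_real (t / 2 * cmod w powr (t - 2)) * cnj w * h + of_real (t / 2 * cmod w powr (t - 2)) * w * cnj h" for h
  proof -
    have "cmod w powr (t - 1) = cmod w powr (t - 2) * cmod w"
      using assms powr_add[of "cmod w" "t - 2" 1] by simp
    moreover have "(h \<bullet> sgn w) * cmod w = h \<bullet> w"
      using assms by (simp add: sgn_div_norm)
    ultimately have "(h \<bullet> sgn w) * (t * cmod w powr (t - 1)) = t * cmod w powr (t - 2) * (h \<bullet> w)"
      by (simp add: mult_ac)
    moreover have "complex_of_real (h \<bullet> w) = (cnj w * h + w * cnj h) / 2"
      by (simp add: complex_eq_iff inner_complex_def)
    ultimately show ?thesis
      by (simp only: of_real_mult) (simp add: field_simps)
  qed
  ultimately show ?thesis
    by (simp add: has_wirtinger_def)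
qed

lemma epw_eq: "w \<noteq> 0 \<Longrightarrow> epw s n w = complex_of_real (cmod w powr (s - n)) * w powi n"
proof -
  assume w: "w \<noteq> 0"
  have "sgn w powi n = w powi n * complex_of_real (cmod w powr - n)"
    using w by (simp add: sgn_eq power_int_divide_distrib powr_minus powr_real_of_int' field_simps
       power_int_minus)
  moreover have "cmod w powr (s - n) = cmod w powr s * cmod w powr - n"
    by (simp add: powr_add[symmetric])
  ultimately show ?thesis by (simp add: epw_def)
qed

lemma has_wirtinger_epw_0:
  assumes s: "s > 1"
  shows "has_wirtinger (epw s n) 0 0 0"
  unfolding has_wirtinger_def has_derivative_at
proof (intro conjI)
  have "((\<lambda>h. cmod h powr (s - 1)) \<longlongrightarrow> 0) (at (0::complex))"
    using s by (intro tendsto_eq_intros) (auto intro!: tendsto_eq_intros)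
  moreover have "cmod (epw s n h) / cmod h = cmod h powr (s - 1)" for h
    using powr_diff[of "cmod h" s 1] by (cases "h = 0") (simp_all add: norm_epw)
  ultimately show "((\<lambda>h. norm (epw s n (0 + h) - epw s n 0 - (0 * h + 0 * cnj h)) / norm h) \<longlongrightarrow> 0) (at 0)"
    by simp
qed auto

text \<open>Formally the function is w^((s+n)/2) (cnj w)^((s-n)/2), which explains the two factors
  and why a derivative lowers s by one while moving n down or up by one. At 0 the function is o(|w|)
  because s > 1.\<close>

lemma has_wirtinger_epw:
  assumes "w \<noteq> 0 \<or> s > 1"
  shows "has_wirtinger (epw s n) (of_real ((s + n) / 2) * epw (s - 1) (n - 1) w)
    (of_real ((s - n) / 2) * epw (s - 1) (n + 1) w) w"
proof (cases "w = 0")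
  case True
  then show ?thesis using assms has_wirtinger_epw_0[of s n] by simp
next
  case w: False
  \<comment> \<open>Off 0 the function is the radial factor |w|^t times the holomorphic power w^n,
    and the product rule applies.\<close>
  define t where "t = s - n"
  have p: "has_wirtinger (\<lambda>w. w powi n) (of_int n * w powi (n - 1)) 0 w"
    using w by (intro has_wirtinger_holomorphic) (auto intro!: derivative_eq_intros)
  note m = has_wirtinger_mult[OF has_wirtinger_norm_powr[OF w, of t] p]
  have A: "cmod w powr t = cmod w powr (t - 2) * (cmod w * cmod w)"
    using w powr_add[of "cmod w" "t - 2" 2] by (simp add: powr_numeral power2_eq_square)
  have B: "complex_of_real (cmod w) * complex_of_real (cmod w) = cnj w * w"
    using complex_norm_square[of w] by (simp add: power2_eq_square mult.commute)
  have C: "w powi n = w * w powi (n - 1)"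
    using w power_int_add_1'[of w "n - 1"] by simp
  have D: "w powi (n + 1) = w * w powi n"
    using w power_int_add_1'[of w n] by simp
  have e1: "epw (s - 1) (n - 1) w = complex_of_real (cmod w powr t) * w powi (n - 1)"
    using w by (simp add: epw_eq t_def)
  have e2: "epw (s - 1) (n + 1) w = complex_of_real (cmod w powr (t - 2)) * w powi (n + 1)"
    using w by (simp add: epw_eq t_def algebra_simps)
  have "of_real (t / 2 * cmod w powr (t - 2)) * cnj w * w powi n
      + complex_of_real (cmod w powr t) * (of_int n * w powi (n - 1))
      = of_real ((s + n) / 2) * epw (s - 1) (n - 1) w"
  proof -
    have "of_real (cmod w powr (t - 2)) * cnj w * w powi n = complex_of_real (cmod w powr t) * w powi (n - 1)"
      unfolding C A by (simp add: B mult_ac)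
    then have "of_real (t / 2 * cmod w powr (t - 2)) * cnj w * w powi n
        = of_real (t / 2) * (complex_of_real (cmod w powr t) * w powi (n - 1))"
      by (simp only: of_real_mult mult.assoc)
    moreover have "complex_of_real ((s + n) / 2) = of_real (t / 2) + of_int n"
      by (simp add: t_def complex_eq_iff field_simps)
    ultimately show ?thesis unfolding e1 by (simp only: distrib_right) (simp add: mult_ac)
  qed
  note r1 = this
  have r2: "of_real (t / 2 * cmod w powr (t - 2)) * w * w powi n + complex_of_real (cmod w powr t) * 0
      = of_real ((s - n) / 2) * epw (s - 1) (n + 1) w"
    unfolding e2 D by (simp add: t_def)
  have "has_wirtinger (\<lambda>w. complex_of_real (cmod w powr t) * w powi n)
    (of_real ((s + n) / 2) * epw (s - 1) (n - 1) w) (of_real ((s - n) / 2) * epw (s - 1) (n + 1) w) w"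
    using m by (simp only: r1 r2)
  then show ?thesis
    unfolding has_wirtinger_def
    by (rule has_derivative_transform_within_open[of _ _ _ _ "- {0}"]) (use w in \<open>auto simp: epw_eq t_def\<close>)
qed

section \<open>Continuity and Hoelder continuity of \<open>epw\<close>\<close>

lemma continuous_on_epw:
  assumes s: "s > 0"
  shows "continuous_on UNIV (epw s n)"
  unfolding continuous_on_eq_continuous_at[OF open_UNIV]
proof
  fix w :: complex
  show "isCont (epw s n) w"
  proof (cases "w = 0")
    case True
    have "((\<lambda>h. cmod h powr s) \<longlongrightarrow> 0) (at (0::complex))"
      using s by (intro tendsto_eq_intros) (auto intro!: tendsto_eq_intros)
    then have "(epw s n \<longlongrightarrow> 0) (at 0)"
      by (intro tendsto_norm_zero_cancel[of "epw s n"]) (simp add: norm_epw)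
    then show ?thesis using True by (simp add: isCont_def)
  next
    case False
    then show ?thesis
      using has_wirtinger_epw[of w s n] has_derivative_continuous by (auto simp: has_wirtinger_def)
  qed
qed

text \<open>Subadditivity of the power: after scaling to a = 1 it follows from x \<le> x^s on the
  unit interval.\<close>

lemma abs_powr_diff_le:
  fixes a b :: real
  assumes s: "0 < s" "s \<le> 1" and ab: "0 \<le> b" "b \<le> a"
  shows "a powr s - b powr s \<le> (a - b) powr s"
proof (cases "a = 0")
  case False
  with ab have a: "a > 0" by simp
  have le: "x \<le> x powr s" if "0 \<le> x" "x \<le> 1" for x :: real
    using powr_mono'[of s 1 x] s that by simp
  have "1 = b / a + (a - b) / a" using a by (simp add: field_simps)
  also have "\<dots> \<le> (b / a) powr s + ((a - b) / a) powr s"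
    using a ab by (intro add_mono le) (auto simp: field_simps)
  also have "\<dots> = (b powr s + (a - b) powr s) / a powr s"
    using a ab by (simp add: powr_divide add_divide_distrib)
  finally show ?thesis using a by (simp add: field_simps)
qed (use ab in auto)

lemma norm_sgn_diff_le:
  fixes w w' :: complex
  assumes "w \<noteq> 0" "w' \<noteq> 0"
  shows "cmod (sgn w - sgn w') \<le> 2 * cmod (w - w') / cmod w"
proof -
  have "sgn w - sgn w' = (w - w') / cmod w + sgn w' * of_real ((cmod w' - cmod w) / cmod w)"
    using assms by (simp add: sgn_eq field_simps)
  also have "cmod \<dots> \<le> cmod (w - w') / cmod w + \<bar>cmod w' - cmod w\<bar> / cmod w"
    using assms by (intro order_trans[OF norm_triangle_ineq]) (simp add: norm_mult norm_divide norm_sgn flip: of_real_diff)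
  also have "\<bar>cmod w' - cmod w\<bar> \<le> cmod (w - w')"
    by (metis abs_minus_commute norm_triangle_ineq3)
  finally show ?thesis by (simp add: add_divide_distrib[symmetric] divide_right_mono)
qed

lemma norm_powi_diff_le:
  fixes u v :: complex
  assumes "cmod u = 1" "cmod v = 1"
  shows "cmod (u powi n - v powi n) \<le> real_of_int \<bar>n\<bar> * cmod (u - v)"
proof (cases "n \<ge> 0")
  case True
  then show ?thesis
    using norm_power_diff[of u v "nat n"] assms by (simp add: power_int_def)
next
  case False
  have i: "inverse u = cnj u" "inverse v = cnj v"
    using assms by (auto simp: inverse_complex_def complex_eq_iff cmod_power2[symmetric])
  have "cmod (u powi n - v powi n) = cmod (cnj u ^ nat (- n) - cnj v ^ nat (- n))"
    using False i by (simp add: power_int_def)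
  also have "\<dots> \<le> nat (- n) * cmod (cnj u - cnj v)"
    using assms by (intro norm_power_diff) auto
  also have "cmod (cnj u - cnj v) = cmod (u - v)"
    by (metis complex_cnj_diff complex_mod_cnj)
  finally show ?thesis using False by simp
qed

text \<open>With w of larger modulus and x = |w - w'| / |w|, the phases differ by at most 2 if x
  \<ge> 1 and by at most 2 |n| x \<le> 2 |n| x^s otherwise; multiplied by |w|^s this is a multiple
  of |w - w'|^s. The moduli contribute one more |w - w'|^s by subadditivity, whence the constant 3 +
  2 |n|.\<close>

lemma epw_holder:
  assumes s: "0 < s" "s < 1"
  shows "cmod (epw s n w - epw s n w') \<le> (3 + 2 * \<bar>real_of_int n\<bar>) * cmod (w - w') powr s"
proof -
  have main: "cmod (epw s n w - epw s n w') \<le> (3 + 2 * \<bar>real_of_int n\<bar>) * cmod (w - w') powr s"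
    if le: "cmod w' \<le> cmod w" for w w'
  proof (cases "w = w' \<or> w' = 0")
    case True
    have "1 * cmod (w - 0) powr s \<le> (3 + 2 * \<bar>real_of_int n\<bar>) * cmod (w - 0) powr s"
      by (intro mult_right_mono) auto
    with True show ?thesis by (auto simp: norm_epw)
  next
    case False
    then have w: "w \<noteq> 0" "w' \<noteq> 0" using le by auto
    define x where "x = cmod (w - w') / cmod w"
    have x: "x > 0" using False w by (simp add: x_def)
    have d: "cmod (sgn w powi n - sgn w' powi n) \<le> (2 + 2 * \<bar>n\<bar>) * x powr s"
    proof (cases "x \<ge> 1")
      case True
      have "cmod (sgn w powi n - sgn w' powi n) \<le> 1 + 1"
        by (intro order_trans[OF norm_triangle_ineq4]) (simp add: norm_sgn_powi w)
      also have "1 \<le> x powr s" using True s by (simp add: ge_one_powr_ge_zero)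
      then have "1 + 1 \<le> (2 + 2 * \<bar>n\<bar>) * x powr s"
        using mult_mono[of 2 "2 + 2 * \<bar>real_of_int n\<bar>" 1 "x powr s"] by simp
      finally show ?thesis .
    next
      case False
      have "cmod (sgn w powi n - sgn w' powi n) \<le> \<bar>n\<bar> * cmod (sgn w - sgn w')"
        using norm_powi_diff_le[of "sgn w" "sgn w'" n] w by (simp add: norm_sgn)
      also have "\<dots> \<le> \<bar>n\<bar> * (2 * x)"
        using norm_sgn_diff_le[OF w] by (intro mult_left_mono) (auto simp: x_def)
      also have "x \<le> x powr s"
        using powr_mono'[of s 1 x] s x False by simp
      then have "\<bar>n\<bar> * (2 * x) \<le> (2 + 2 * \<bar>n\<bar>) * x powr s"
        using x s mult_mono[of "2 * \<bar>real_of_int n\<bar>" "2 + 2 * \<bar>real_of_int n\<bar>" x "x powr s"] by simp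
      finally show ?thesis .
    qed
    have "epw s n w - epw s n w' = of_real (cmod w powr s) * (sgn w powi n - sgn w' powi n)
        + of_real (cmod w powr s - cmod w' powr s) * sgn w' powi n"
      by (simp add: epw_def algebra_simps)
    also have "cmod \<dots> \<le> cmod w powr s * cmod (sgn w powi n - sgn w' powi n) + \<bar>cmod w powr s - cmod w' powr s\<bar>"
      using w by (intro order_trans[OF norm_triangle_ineq]) (simp add: norm_mult norm_sgn_powi)
    also have "\<dots> \<le> cmod w powr s * ((2 + 2 * \<bar>n\<bar>) * x powr s) + cmod (w - w') powr s"
    proof (intro add_mono mult_left_mono d)
      have "\<bar>cmod w powr s - cmod w' powr s\<bar> = cmod w powr s - cmod w' powr s"
        using le s by (simp add: powr_mono2)
      also have "\<dots> \<le> (cmod w - cmod w') powr s"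
        using le s by (intro abs_powr_diff_le) auto
      also have "\<dots> \<le> cmod (w - w') powr s"
        using le s norm_triangle_ineq2[of w w'] by (intro powr_mono2) auto
      finally show "\<bar>cmod w powr s - cmod w' powr s\<bar> \<le> cmod (w - w') powr s" .
    qed auto
    also have "cmod w powr s * ((2 + 2 * \<bar>n\<bar>) * x powr s) = (2 + 2 * \<bar>n\<bar>) * cmod (w - w') powr s"
      using w by (simp add: x_def powr_divide)
    finally show ?thesis by (simp add: algebra_simps)
  qed
  show ?thesis
    using main[of w' w] main[of w w'] by (metis linear norm_minus_commute)
qed

section \<open>Sums of \<open>epw\<close> terms with coefficients from a bounded algebra\<close>

lemma has_wirtinger_cong:
  assumes "has_wirtinger f a b z" "a = a'" "b = b'"
  shows "has_wirtinger f a' b' z"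
  using assms by simp

text \<open>The class in which derivatives of the map are followed: a derivative maps exponent s to
  s - 1 and leaves the coefficients in the algebra. Different phases n must be allowed in one sum
  because the two Wirtinger derivatives shift n in opposite directions.\<close>

inductive_set epw_sums :: "(complex \<Rightarrow> complex) \<Rightarrow> (complex \<Rightarrow> complex) set \<Rightarrow> real \<Rightarrow> (complex \<Rightarrow> complex) set"
  for f X s where
  epw_sums_term: "c \<in> star_alg X \<Longrightarrow> (\<lambda>z. epw s n (f z) * c z) \<in> epw_sums f X s"
| epw_sums_add: "u \<in> epw_sums f X s \<Longrightarrow> v \<in> epw_sums f X s \<Longrightarrow> (\<lambda>z. u z + v z) \<in> epw_sums f X s"

lemma epw_sums_cmult:
  assumes "u \<in> epw_sums f X s"
  shows "(\<lambda>z. k * u z) \<in> epw_sums f X s"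
  using assms
proof (induction rule: epw_sums.induct)
  case (epw_sums_term c n)
  have "(\<lambda>z. epw s n (f z) * (k * c z)) \<in> epw_sums f X s"
    using epw_sums_term by (intro epw_sums.epw_sums_term star_alg_mult star_alg_const)
  then show ?case by (simp add: mult_ac)
next
  case (epw_sums_add u v)
  then show ?case using epw_sums.epw_sums_add[of "\<lambda>z. k * u z" f X s "\<lambda>z. k * v z"]
    by (simp add: distrib_left)
qed

text \<open>Closure under derivatives together with boundedness makes every element of the algebra
  bounded with bounded derivatives; convexity of S then makes it Lipschitz.\<close>

locale bounded_wirtinger_algebra =
  fixes X :: "(complex \<Rightarrow> complex) set" and S :: "complex set" and f f' :: "complex \<Rightarrow> complex"
  assumes open_S: "open S" and convex_S: "convex S"
    and gen_wirtinger:
      "\<And>u. u \<in> X \<Longrightarrow> \<exists>a\<in>star_alg X. \<exists>b\<in>star_alg X. \<forall>z\<in>S. has_wirtinger u (a z) (b z) z"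
    and gen_bounded: "\<And>u. u \<in> X \<Longrightarrow> \<exists>C. \<forall>z\<in>S. cmod (u z) \<le> C"
    and f: "f \<in> star_alg X" and f': "f' \<in> star_alg X"
    and f_deriv: "\<And>z. z \<in> S \<Longrightarrow> (f has_field_derivative f' z) (at z)"
begin

lemma star_alg_bounded:
  assumes "u \<in> star_alg X"
  obtains C where "\<And>z. z \<in> S \<Longrightarrow> cmod (u z) \<le> C"
proof -
  have "\<exists>C N. \<forall>z\<in>S. cmod (u z) \<le> C * 1 ^ N"
    by (rule star_alg_growth[OF _ _ assms]) (use gen_bounded in auto)
  then show ?thesis using that by auto
qed

lemma star_alg_lipschitz:
  assumes "u \<in> star_alg X"
  obtains C where "C \<ge> 0" "\<And>x y. x \<in> S \<Longrightarrow> y \<in> S \<Longrightarrow> cmod (u x - u y) \<le> C * cmod (x - y)"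
proof -
  from star_alg_has_wirtinger[of X S u, OF gen_wirtinger assms] obtain a b
    where ab: "a \<in> star_alg X" "b \<in> star_alg X" "\<And>z. z \<in> S \<Longrightarrow> has_wirtinger u (a z) (b z) z" by blast
  obtain A B where A: "\<And>z. z \<in> S \<Longrightarrow> cmod (a z) \<le> A" and B: "\<And>z. z \<in> S \<Longrightarrow> cmod (b z) \<le> B"
    using star_alg_bounded ab(1,2) by metis
  have "cmod (u x - u y) \<le> (\<bar>A\<bar> + \<bar>B\<bar>) * cmod (x - y)" if "x \<in> S" "y \<in> S" for x y
  proof (rule differentiable_bound[OF convex_S _ _ that, where f'="\<lambda>z h. a z * h + b z * cnj h"])
    show "(u has_derivative (\<lambda>h. a z * h + b z * cnj h)) (at z within S)" if "z \<in> S" for z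
      using ab(3)[OF that] by (simp add: has_wirtinger_def has_derivative_at_withinI)
    show "onorm (\<lambda>h. a z * h + b z * cnj h) \<le> \<bar>A\<bar> + \<bar>B\<bar>" if "z \<in> S" for z
    proof (rule onorm_bound)
      fix h
      have "cmod (a z * h + b z * cnj h) \<le> cmod (a z) * cmod h + cmod (b z) * cmod h"
        by (intro order_trans[OF norm_triangle_ineq]) (simp add: norm_mult)
      also have "\<dots> \<le> \<bar>A\<bar> * cmod h + \<bar>B\<bar> * cmod h"
        using A[OF that] B[OF that] by (intro add_mono mult_right_mono) auto
      finally show "cmod (a z * h + b z * cnj h) \<le> (\<bar>A\<bar> + \<bar>B\<bar>) * cmod h"
        by (simp add: algebra_simps)
    qed simp
  qed
  then show ?thesis using that[of "\<bar>A\<bar> + \<bar>B\<bar>"] by auto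
qed

lemma star_alg_continuous:
  assumes "u \<in> star_alg X"
  shows "continuous_on S u"
  using star_alg_has_wirtinger[of X S u, OF gen_wirtinger assms]
  unfolding has_wirtinger_def
  by (meson continuous_at_imp_continuous_on has_derivative_continuous)

lemma epw_sums_has_wirtinger:
  assumes s: "s > 1" and u: "u \<in> epw_sums f X s"
  shows "\<exists>a\<in>epw_sums f X (s - 1). \<exists>b\<in>epw_sums f X (s - 1). \<forall>z\<in>S. has_wirtinger u (a z) (b z) z"
  using u
proof (induction rule: epw_sums.induct)
  case (epw_sums_term c n)
  from star_alg_has_wirtinger[of X S c, OF gen_wirtinger epw_sums_term] obtain c1 c2
    where c: "c1 \<in> star_alg X" "c2 \<in> star_alg X" "\<And>z. z \<in> S \<Longrightarrow> has_wirtinger c (c1 z) (c2 z) z" by blast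
  define k where "k = complex_of_real ((s + n) / 2)"
  define l where "l = complex_of_real ((s - n) / 2)"
  define a where "a z = epw (s - 1) (n - 1) (f z) * (k * f' z * c z + f z * c1 z)" for z
  define b where "b z = epw (s - 1) (n + 1) (f z) * (l * cnj (f' z) * c z)
      + epw (s - 1) (n - 1) (f z) * (f z * c2 z)" for z
  have "a \<in> epw_sums f X (s - 1)" "b \<in> epw_sums f X (s - 1)"
    unfolding a_def b_def
    by (intro epw_sums.epw_sums_term epw_sums.epw_sums_add star_alg_add star_alg_mult
        star_alg_const star_alg_cnj c(1,2) epw_sums_term f f')+
  moreover have "has_wirtinger (\<lambda>z. epw s n (f z) * c z) (a z) (b z) z" if z: "z \<in> S" for z
  proof -
    have "has_wirtinger (\<lambda>z. epw s n (f z)) (k * epw (s - 1) (n - 1) (f z) * f' z)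
        (l * epw (s - 1) (n + 1) (f z) * cnj (f' z)) z"
      by (rule has_wirtinger_cong[OF has_wirtinger_compose[OF has_wirtinger_epw
            has_wirtinger_holomorphic[OF f_deriv[OF z]]]])
        (use s in \<open>simp_all add: k_def l_def\<close>)
    note w = has_wirtinger_mult[OF this c(3)[OF z]]
    \<comment> \<open>Where the coefficient is differentiated the exponent is still s; one factor
      \<open>f\<close> is moved into the coefficient to reach s - 1.\<close>
    have "epw s n (f z) = epw (s - 1) (n - 1) (f z) * f z"
      by (simp add: epw_mult_self)
    then show ?thesis
      by (intro has_wirtinger_cong[OF w]) (simp_all add: a_def b_def algebra_simps)
  qed
  ultimately show ?case by blast
next
  case (epw_sums_add u v)
  then obtain a b c d where "a \<in> epw_sums f X (s - 1)" "b \<in> epw_sums f X (s - 1)"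
    "c \<in> epw_sums f X (s - 1)" "d \<in> epw_sums f X (s - 1)"
    "\<forall>z\<in>S. has_wirtinger u (a z) (b z) z" "\<forall>z\<in>S. has_wirtinger v (c z) (d z) z" by blast
  then show ?case
    by (intro bexI[of _ "\<lambda>z. a z + c z"] bexI[of _ "\<lambda>z. b z + d z"])
      (auto intro: has_wirtinger_add epw_sums.epw_sums_add)
qed

lemma epw_sums_bounded:
  assumes s: "s > 0" and u: "u \<in> epw_sums f X s"
  shows "\<exists>C. \<forall>z\<in>S. cmod (u z) \<le> C"
  using u
proof (induction rule: epw_sums.induct)
  case (epw_sums_term c n)
  obtain A where A: "\<And>z. z \<in> S \<Longrightarrow> cmod (f z) \<le> A" using star_alg_bounded[OF f] by blast
  obtain B where B: "\<And>z. z \<in> S \<Longrightarrow> cmod (c z) \<le> B" using star_alg_bounded[OF epw_sums_term] by blast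
  have "cmod (epw s n (f z) * c z) \<le> A powr s * B" if z: "z \<in> S" for z
    unfolding norm_mult norm_epw using A[OF z] B[OF z] s by (intro mult_mono powr_mono2) auto
  then show ?case by blast
next
  case (epw_sums_add u v)
  then obtain A B where "\<forall>z\<in>S. cmod (u z) \<le> A" "\<forall>z\<in>S. cmod (v z) \<le> B" by blast
  then have "\<forall>z\<in>S. cmod (u z + v z) \<le> A + B"
    using norm_triangle_ineq order_trans add_mono by (metis (no_types, lifting))
  then show ?case by blast
qed

lemma epw_sums_continuous:
  assumes s: "s > 0" and u: "u \<in> epw_sums f X s"
  shows "continuous_on S u"
  using u
proof (induction rule: epw_sums.induct)
  case (epw_sums_term c n)
  show ?case
    by (intro continuous_on_mult star_alg_continuous epw_sums_term
        continuous_on_compose2[OF continuous_on_epw[OF s] star_alg_continuous[OF f]]) auto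
qed (intro continuous_on_add)

text \<open>\<open>epw_holder\<close> composed with the Lipschitz function f handles the powers. The
  coefficients are Lipschitz, and distances of at most 2 turn this into Hoelder continuity of
  exponent s.\<close>

lemma epw_sums_holder:
  assumes s: "0 < s" "s < 1" and u: "u \<in> epw_sums f X s"
    and S2: "\<And>x y. x \<in> S \<Longrightarrow> y \<in> S \<Longrightarrow> dist x y \<le> 2"
  shows "holder_continuous_on s S u"
  using u
proof (induction rule: epw_sums.induct)
  case (epw_sums_term c n)
  obtain A where A: "\<And>z. z \<in> S \<Longrightarrow> cmod (f z) \<le> A" using star_alg_bounded[OF f] by blast
  obtain B where B: "\<And>z. z \<in> S \<Longrightarrow> cmod (c z) \<le> B" using star_alg_bounded[OF epw_sums_term] by blast
  obtain M where M: "M \<ge> 0" "\<And>x y. x \<in> S \<Longrightarrow> y \<in> S \<Longrightarrow> cmod (f x - f y) \<le> M * cmod (x - y)"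
    using star_alg_lipschitz[OF f] by blast
  obtain N where N: "N \<ge> 0" "\<And>x y. x \<in> S \<Longrightarrow> y \<in> S \<Longrightarrow> cmod (c x - c y) \<le> N * cmod (x - y)"
    using star_alg_lipschitz[OF epw_sums_term] by blast
  let ?k = "3 + 2 * \<bar>real_of_int n\<bar>"
  have "cmod (epw s n (f x) * c x - epw s n (f y) * c y)
      \<le> (?k * M powr s * \<bar>B\<bar> + \<bar>A\<bar> powr s * N * 2) * dist x y powr s"
    if x: "x \<in> S" and y: "y \<in> S" for x y
  proof -
    have "cmod (epw s n (f x) - epw s n (f y)) \<le> ?k * cmod (f x - f y) powr s"
      by (rule epw_holder[OF s])
    also have "\<dots> \<le> ?k * (M * dist x y) powr s"
      using M(2)[OF x y] s by (intro mult_left_mono powr_mono2) (auto simp: dist_norm)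
    finally have 1: "cmod (epw s n (f x) - epw s n (f y)) \<le> ?k * M powr s * dist x y powr s"
      using M(1) by (simp add: powr_mult mult_ac)
    have "dist x y \<le> 2 * dist x y powr s"
    proof (cases "x = y")
      case False
      have "dist x y = dist x y powr (1 - s) * dist x y powr s"
        using False by (simp flip: powr_add)
      also have "\<dots> \<le> 2 powr (1 - s) * dist x y powr s"
        using S2[OF x y] s by (intro mult_right_mono powr_mono2) auto
      also have "\<dots> \<le> 2 powr 1 * dist x y powr s"
        using s by (intro mult_right_mono powr_mono) auto
      finally show ?thesis by simp
    qed simp
    with N(1) have "N * dist x y \<le> N * (2 * dist x y powr s)" by (intro mult_left_mono)
    with N(2)[OF x y] have 2: "cmod (c x - c y) \<le> N * 2 * dist x y powr s"
      by (simp add: dist_norm)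
    have "cmod (epw s n (f x) * c x - epw s n (f y) * c y)
        = cmod ((epw s n (f x) - epw s n (f y)) * c x + epw s n (f y) * (c x - c y))"
      by (simp add: algebra_simps)
    also have "\<dots> \<le> cmod (epw s n (f x) - epw s n (f y)) * cmod (c x) + cmod (f y) powr s * cmod (c x - c y)"
      by (intro order_trans[OF norm_triangle_ineq]) (simp add: norm_mult norm_epw)
    also have "\<dots> \<le> (?k * M powr s * dist x y powr s) * \<bar>B\<bar> + \<bar>A\<bar> powr s * (N * 2 * dist x y powr s)"
      using 1 2 A[OF y] B[OF x] s N(1) M(1)
      by (intro add_mono mult_mono powr_mono2) auto
    finally show ?thesis by (simp add: algebra_simps)
  qed
  then show ?case
    unfolding holder_continuous_on_def dist_norm[where 'a=complex and y="epw s n (f _) * c _"] by blast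
next
  case (epw_sums_add u v)
  then obtain A B where AB: "\<And>x y. x \<in> S \<Longrightarrow> y \<in> S \<Longrightarrow> dist (u x) (u y) \<le> A * dist x y powr s"
    "\<And>x y. x \<in> S \<Longrightarrow> y \<in> S \<Longrightarrow> dist (v x) (v y) \<le> B * dist x y powr s"
    unfolding holder_continuous_on_def by blast
  have "dist (u x + v x) (u y + v y) \<le> (A + B) * dist x y powr s" if "x \<in> S" "y \<in> S" for x y
    using AB[OF that] dist_triangle_add[of "u x" "v x" "u y" "v y"] by (simp add: algebra_simps)
  then show ?case unfolding holder_continuous_on_def by blast
qed

end

section \<open>The holomorphic function\<close>

text \<open>The plane cut along the real half-line from 1 to infinity. It contains the closed unit
  disc except for the point 1, so statements on it cover the rest of the circle too.\<close>

definition slit :: "complex set" where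
  "slit = {z. 1 - z \<notin> \<real>\<^sub>\<le>\<^sub>0}"

definition zeta :: "complex \<Rightarrow> complex" where
  "zeta z = Ln (1 - z)"

text \<open>That is, (1 - z)^a times a power of zeta times the Gaussian factor. As the derivative of
  zeta is - exp (- zeta), differentiation only shifts a by -1 and changes l by at most one; this
  makes the family closed under derivatives.\<close>

definition flat_gen :: "complex \<Rightarrow> nat \<Rightarrow> complex \<Rightarrow> complex" where
  "flat_gen a l z = zeta z ^ l * exp (a * zeta z - (zeta z)\<^sup>2)"

text \<open>Written as a linear combination of generators, with \<open>(- 1) *\<close> in place of a
  subtraction, so that membership in \<open>star_alg\<close> follows from its introduction
  rules.\<close>

definition sw_fun :: "complex \<Rightarrow> complex" where
  "sw_fun z = flat_gen \<i> 0 z + (- 1) * flat_gen 0 0 z"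

definition sw_fun' :: "complex \<Rightarrow> complex" where
  "sw_fun' z = (- \<i>) * flat_gen (\<i> - 1) 0 z + (2 * flat_gen (\<i> - 1) 1 z + (- 2) * flat_gen (- 1) 1 z)"

text \<open>The polar part of the logarithmic derivative: with E = exp (i zeta), E / (E - 1) = 1 + 1
  / (E - 1). At the zeros of \<open>sw_fun\<close> the value is 1 / 0 = 0.\<close>

definition sw_quot :: "complex \<Rightarrow> complex" where
  "sw_quot z = 1 / (exp (\<i> * zeta z) - 1)"

text \<open>The derivative of zeta, which is -1 / (1 - z), times i E / (E - 1) - 2 zeta, where E =
  exp (i zeta).\<close>

definition sw_logderiv :: "complex \<Rightarrow> complex" where
  "sw_logderiv z = (- 1) * (1 / (1 - z)) * (\<i> * (1 + sw_quot z) + (- 2) * zeta z)"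

lemma open_slit: "open slit"
proof -
  have "slit = (\<lambda>z. 1 - z) -` (- \<real>\<^sub>\<le>\<^sub>0)" by (auto simp: slit_def)
  then show ?thesis
    using open_vimage[of "- \<real>\<^sub>\<le>\<^sub>0" "\<lambda>z::complex. 1 - z"]
    by (simp add: open_Compl closed_nonpos_Reals_complex continuous_intros)
qed

lemma cball_in_slit: "cmod z \<le> 1 \<Longrightarrow> z \<noteq> 1 \<Longrightarrow> z \<in> slit"
proof -
  assume z: "cmod z \<le> 1" "z \<noteq> 1"
  have "Re z \<le> 1" using complex_Re_le_cmod[of z] z by simp
  moreover have "Re z = 1 \<Longrightarrow> Im z = 0 \<Longrightarrow> z = 1" by (simp add: complex_eq_iff)
  ultimately show "z \<in> slit"
    using z(2) by (auto simp: slit_def complex_nonpos_Reals_iff)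
qed

lemma disc_subset_slit: "disc \<subseteq> slit"
proof
  fix z :: complex assume "z \<in> disc"
  then show "z \<in> slit" by (intro cball_in_slit) auto
qed

lemma one_notin_slit: "z \<in> slit \<Longrightarrow> z \<noteq> 1"
  by (auto simp: slit_def)

lemma exp_zeta: "z \<noteq> 1 \<Longrightarrow> exp (zeta z) = 1 - z"
  by (simp add: zeta_def)

lemma Re_zeta: "z \<noteq> 1 \<Longrightarrow> Re (zeta z) = ln (cmod (1 - z))"
  by (simp add: zeta_def)

lemma Im_zeta_le: "z \<noteq> 1 \<Longrightarrow> \<bar>Im (zeta z)\<bar> \<le> pi"
  using mpi_less_Im_Ln[of "1 - z"] Im_Ln_le_pi[of "1 - z"] by (auto simp: zeta_def)

lemma zeta_deriv:
  assumes "z \<in> slit"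
  shows "(zeta has_field_derivative - (1 / (1 - z))) (at z)"
  unfolding zeta_def
  by (rule derivative_eq_intros refl | use assms in \<open>simp add: slit_def inverse_eq_divide\<close>)+

lemma flat_gen_deriv:
  assumes z: "z \<in> slit"
  shows "(flat_gen a l has_field_derivative
    (- a) * flat_gen (a - 1) l z + (2 * flat_gen (a - 1) (l + 1) z + (- of_nat l) * flat_gen (a - 1) (l - 1) z)) (at z)"
proof -
  have e: "exp (b * zeta z - (zeta z)\<^sup>2) * (1 / (1 - z)) = exp ((b - 1) * zeta z - (zeta z)\<^sup>2)" for b
  proof -
    have "exp ((b - 1) * zeta z - (zeta z)\<^sup>2) = exp (b * zeta z - (zeta z)\<^sup>2 - zeta z)"
      by (simp add: algebra_simps)
    also have "\<dots> = exp (b * zeta z - (zeta z)\<^sup>2) / exp (zeta z)" by (rule exp_diff)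
    finally show ?thesis using exp_zeta[OF one_notin_slit[OF z]] by simp
  qed
  define E where "E = exp (a * zeta z - (zeta z)\<^sup>2)"
  define r where "r = 1 / (1 - z)"
  have "(flat_gen a l has_field_derivative
      (of_nat l * zeta z ^ (l - 1) * (- r)) * E + zeta z ^ l * (E * (a * (- r) - 2 * zeta z * (- r)))) (at z)"
    unfolding flat_gen_def E_def r_def using zeta_deriv[OF z]
    by (auto intro!: derivative_eq_intros simp: power2_eq_square algebra_simps)
  moreover have "(of_nat l * zeta z ^ (l - 1) * (- r)) * E + zeta z ^ l * (E * (a * (- r) - 2 * zeta z * (- r)))
      = (- a) * flat_gen (a - 1) l z + (2 * flat_gen (a - 1) (l + 1) z + (- of_nat l) * flat_gen (a - 1) (l - 1) z)"
    unfolding flat_gen_def e[of a, symmetric] E_def[symmetric] r_def[symmetric]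
    by (simp add: algebra_simps)
  ultimately show ?thesis by simp
qed

lemma sw_fun_deriv: "z \<in> slit \<Longrightarrow> (sw_fun has_field_derivative sw_fun' z) (at z)"
proof -
  assume z: "z \<in> slit"
  show ?thesis
    unfolding sw_fun_def sw_fun'_def
    by (rule derivative_eq_intros flat_gen_deriv[OF z] refl)+ (simp add: algebra_simps)
qed

text \<open>From x \<le> exp x at x = t / l. For l = 0 the constant is 0^0 = 1.\<close>

lemma power_le_exp:
  fixes t :: real
  assumes "t \<ge> 0"
  shows "t ^ l \<le> real l ^ l * exp t"
proof (cases "l = 0")
  case False
  have "t / l \<le> exp (t / l)" using exp_ge_add_one_self[of "t / l"] by linarith
  then have "(t / l) ^ l \<le> exp (t / l) ^ l"
    using assms by (intro power_mono) auto
  also have "\<dots> = exp t" using False by (simp flip: exp_of_nat_mult)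
  finally show ?thesis using False by (simp add: power_divide field_simps)
qed (use assms in simp)

text \<open>Since |Im zeta| \<le> pi, Re (zeta^2) is at least |zeta|^2 - 2 pi^2, and completing the
  square in |zeta| absorbs every linear term. In A = 1 + |a| the summand 1 pays for zeta^l, which is
  bounded by a multiple of exp |zeta|.\<close>

lemma flat_gen_bounded:
  "\<exists>C. \<forall>z\<in>slit. cmod (flat_gen a l z) \<le> C"
proof -
  define A where "A = 1 + cmod a"
  have "cmod (flat_gen a l z) \<le> real l ^ l * exp (A\<^sup>2 / 4 + 2 * pi\<^sup>2)" if z: "z \<in> slit" for z
  proof -
    define t where "t = cmod (zeta z)"
    have "\<bar>Im (zeta z)\<bar>\<^sup>2 \<le> pi\<^sup>2"
      using Im_zeta_le[OF one_notin_slit[OF z]] by (intro power_mono) auto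
    then have "Re ((zeta z)\<^sup>2) \<ge> t\<^sup>2 - 2 * pi\<^sup>2"
      using cmod_power2[of "zeta z"] by (simp add: t_def power2_eq_square)
    moreover have "Re (a * zeta z) \<le> cmod a * t"
      using complex_Re_le_cmod[of "a * zeta z"] by (simp add: t_def norm_mult)
    moreover have "t\<^sup>2 - A * t + A\<^sup>2 / 4 = (t - A / 2)\<^sup>2"
      by (simp add: power2_eq_square field_simps)
    then have "A * t - t\<^sup>2 \<le> A\<^sup>2 / 4"
      using zero_le_power2[of "t - A / 2"] by linarith
    ultimately have "t + Re (a * zeta z - (zeta z)\<^sup>2) \<le> A\<^sup>2 / 4 + 2 * pi\<^sup>2"
      by (simp add: A_def algebra_simps)
    then have "exp (t + Re (a * zeta z - (zeta z)\<^sup>2)) \<le> exp (A\<^sup>2 / 4 + 2 * pi\<^sup>2)"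
      by (simp only: exp_le_cancel_iff)
    then have "real l ^ l * (exp t * exp (Re (a * zeta z - (zeta z)\<^sup>2))) \<le> real l ^ l * exp (A\<^sup>2 / 4 + 2 * pi\<^sup>2)"
      unfolding exp_add by (intro mult_left_mono) auto
    moreover have "cmod (flat_gen a l z) \<le> (real l ^ l * exp t) * exp (Re (a * zeta z - (zeta z)\<^sup>2))"
      unfolding flat_gen_def norm_mult norm_power norm_exp_eq_Re t_def[symmetric]
      by (intro mult_right_mono power_le_exp) (auto simp: t_def)
    ultimately show ?thesis by (simp add: mult.assoc)
  qed
  then show ?thesis by blast
qed

abbreviation "flat_gens \<equiv> range (\<lambda>(a, l). flat_gen a l)"

lemma flat_gen_in: "flat_gen a l \<in> star_alg flat_gens"
  by (rule star_alg_gen, rule image_eqI[of _ _ "(a, l)"]) simp_all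

interpretation sw_fun_alg: bounded_wirtinger_algebra flat_gens disc sw_fun sw_fun'
proof
  show "sw_fun \<in> star_alg flat_gens" "sw_fun' \<in> star_alg flat_gens"
    unfolding sw_fun_def[abs_def] sw_fun'_def[abs_def] by (intro star_alg_add star_alg_mult star_alg_const flat_gen_in)+
  show "(sw_fun has_field_derivative sw_fun' z) (at z)" if "z \<in> disc" for z
    using sw_fun_deriv disc_subset_slit that by blast
  fix u assume "u \<in> flat_gens"
  then obtain a l where u: "u = flat_gen a l" by auto
  obtain C where C: "\<forall>z\<in>slit. cmod (flat_gen a l z) \<le> C"
    using flat_gen_bounded by blast
  show "\<exists>C. \<forall>z\<in>disc. cmod (u z) \<le> C"
    unfolding u using C disc_subset_slit by (intro exI[of _ C]) auto
  define d where "d z = (- a) * flat_gen (a - 1) l z + (2 * flat_gen (a - 1) (l + 1) z + (- of_nat l) * flat_gen (a - 1) (l - 1) z)" for z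
  have "d \<in> star_alg flat_gens"
    unfolding d_def by (intro star_alg_add star_alg_mult star_alg_const flat_gen_in)
  moreover have "has_wirtinger u (d z) 0 z" if "z \<in> disc" for z
    unfolding u d_def using that disc_subset_slit by (intro has_wirtinger_holomorphic flat_gen_deriv) auto
  ultimately show "\<exists>a\<in>star_alg flat_gens. \<exists>b\<in>star_alg flat_gens. \<forall>z\<in>disc. has_wirtinger u (a z) (b z) z"
    by (intro bexI[of _ d] bexI[of _ "\<lambda>_. 0"]) (auto intro: star_alg_const)
qed auto

lemma sw_fun_eq: "sw_fun z = (exp (\<i> * zeta z) - 1) * exp (- (zeta z)\<^sup>2)"
  by (simp add: sw_fun_def flat_gen_def exp_diff exp_minus field_simps)

lemma sw_fun_eq_0_iff: "sw_fun z = 0 \<longleftrightarrow> exp (\<i> * zeta z) = 1"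
  by (simp add: sw_fun_eq)

lemma sw_fun'_eq:
  assumes "z \<in> slit" "sw_fun z \<noteq> 0"
  shows "sw_fun' z = sw_logderiv z * sw_fun z"
proof -
  define E where "E = exp (\<i> * zeta z)"
  define G where "G = exp (- (zeta z)\<^sup>2)"
  have w: "exp (- zeta z) = 1 / (1 - z)"
    using exp_zeta[OF one_notin_slit[OF assms(1)]] by (simp add: exp_minus inverse_eq_divide)
  have E: "E \<noteq> 1" using assms(2) by (simp add: sw_fun_eq_0_iff E_def)
  have e1: "exp ((\<i> - 1) * zeta z - (zeta z)\<^sup>2) = E * (1 / (1 - z)) * G"
    unfolding w[symmetric] E_def G_def by (simp add: algebra_simps flip: exp_add)
  have e2: "exp (- 1 * zeta z - (zeta z)\<^sup>2) = (1 / (1 - z)) * G"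
    unfolding w[symmetric] G_def by (simp add: algebra_simps flip: exp_add)
  have q: "(1 + sw_quot z) * (E - 1) = E"
    using E by (simp add: sw_quot_def E_def[symmetric] field_simps)
  have "sw_logderiv z * sw_fun z = (- 1) * (1 / (1 - z)) * G * (\<i> * ((1 + sw_quot z) * (E - 1)) + (- 2) * zeta z * (E - 1))"
    by (simp add: sw_logderiv_def sw_fun_eq E_def G_def algebra_simps)
  also have "\<dots> = sw_fun' z"
    unfolding q sw_fun'_def flat_gen_def e1 e2 by (simp add: algebra_simps)
  finally show ?thesis by simp
qed

text \<open>With x = ln |1 - z|, completing the square gives -x^2 \<le> N x + N^2 / 4, and exp (N x)
  is the power of |1 - z|. The imaginary part of zeta only contributes bounded factors.\<close>

lemma sw_fun_decay:
  obtains C where "\<And>z. z \<noteq> 1 \<Longrightarrow> cmod (sw_fun z) \<le> C * cmod (1 - z) powr N"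
proof -
  have "cmod (sw_fun z) \<le> (exp pi + 1) * exp (pi\<^sup>2 + N\<^sup>2 / 4) * cmod (1 - z) powr N" if z: "z \<noteq> 1" for z
  proof -
    define x where "x = Re (zeta z)"
    define y where "y = Im (zeta z)"
    have y: "\<bar>y\<bar> \<le> pi" using Im_zeta_le[OF z] by (simp add: y_def)
    have "cmod (exp (\<i> * zeta z) - 1) \<le> exp (- y) + 1"
      by (intro order_trans[OF norm_triangle_ineq4]) (simp add: y_def)
    also have "\<dots> \<le> exp pi + 1" using y by simp
    finally have 1: "cmod (exp (\<i> * zeta z) - 1) \<le> exp pi + 1" .
    have "\<bar>y\<bar>\<^sup>2 \<le> pi\<^sup>2" using y by (intro power_mono) auto
    moreover have "(x + N / 2)\<^sup>2 = x\<^sup>2 + N * x + N\<^sup>2 / 4"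
      by (simp add: power2_eq_square field_simps)
    then have "- (x\<^sup>2) \<le> N * x + N\<^sup>2 / 4" using zero_le_power2[of "x + N / 2"] by linarith
    moreover have re: "Re ((zeta z)\<^sup>2) = x\<^sup>2 - y\<^sup>2" by (simp add: power2_eq_square x_def y_def)
    ultimately have "- (x\<^sup>2 - y\<^sup>2) \<le> (pi\<^sup>2 + N\<^sup>2 / 4) + N * x" by simp
    then have "cmod (exp (- (zeta z)\<^sup>2)) \<le> exp (pi\<^sup>2 + N\<^sup>2 / 4) * exp (N * x)"
      by (simp add: re flip: exp_add)
    also have "exp (N * x) = cmod (1 - z) powr N"
      using z by (simp add: x_def Re_zeta powr_def)
    finally show ?thesis
      unfolding sw_fun_eq norm_mult using 1 mult_mono[OF 1] by (simp add: mult.assoc)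
  qed
  then show ?thesis by (rule that)
qed

text \<open>1 / (E - 1) satisfies a Riccati equation, because E / (E - 1)^2 is the quotient plus its
  square. This keeps polynomials in \<open>sw_quot\<close> closed under differentiation.\<close>

lemma sw_quot_deriv:
  assumes "z \<in> slit" "sw_fun z \<noteq> 0"
  shows "(sw_quot has_field_derivative \<i> * (1 / (1 - z)) * (sw_quot z + sw_quot z * sw_quot z)) (at z)"
proof -
  define E where "E = exp (\<i> * zeta z)"
  have E: "E - 1 \<noteq> 0" using assms(2) by (simp add: sw_fun_eq_0_iff E_def)
  have "(sw_quot has_field_derivative - (\<i> * (- (1 / (1 - z))) * E) / (E - 1)\<^sup>2) (at z)"
    unfolding sw_quot_def E_def using E zeta_deriv[OF assms(1)]
    by (auto intro!: derivative_eq_intros simp: E_def power2_eq_square)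
  moreover have "- (\<i> * (- (1 / (1 - z))) * E) / (E - 1)\<^sup>2 = \<i> * (1 / (1 - z)) * (E / (E - 1)\<^sup>2)"
    by simp
  moreover have "E / (E - 1)\<^sup>2 = sw_quot z + sw_quot z * sw_quot z"
  proof -
    have "sw_quot z = 1 / (E - 1)" by (simp add: sw_quot_def E_def)
    moreover have "1 / (E - 1) + 1 / (E - 1) * (1 / (E - 1)) = E / (E - 1)\<^sup>2"
      using E by (simp add: power2_eq_square divide_simps)
    ultimately show ?thesis by simp
  qed
  ultimately show ?thesis by simp
qed

section \<open>The zeros and estimates at their scale\<close>

definition zero_gap :: "nat \<Rightarrow> real" where "zero_gap n = exp (- (2 * pi * n))"

definition zero_pt :: "nat \<Rightarrow> complex" where "zero_pt n = 1 - complex_of_real (zero_gap n)"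

text \<open>The singularity at 0 is removable, so compactness compares |exp u - 1| with |u| from
  both sides.\<close>

lemma exp_quotient_continuous:
  "continuous_on UNIV (\<lambda>u::complex. if u = 0 then 1 else (exp u - 1) / u)"
proof -
  have "isCont (\<lambda>u::complex. if u = 0 then 1 else (exp u - 1) / u) u" for u
  proof (cases "u = 0")
    case True
    have "((\<lambda>h::complex. (exp (0 + h) - exp 0) / h) \<longlongrightarrow> 1) (at 0)"
      using DERIV_exp[of "0::complex"] by (simp add: DERIV_def)
    moreover have "\<forall>\<^sub>F h in at (0::complex). (exp (0 + h) - exp 0) / h = (if h = 0 then 1 else (exp h - 1) / h)"
      by (simp add: eventually_at_filter)
    ultimately have "((\<lambda>u::complex. if u = 0 then 1 else (exp u - 1) / u) \<longlongrightarrow> 1) (at 0)"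
      by (rule Lim_transform_eventually)
    then show ?thesis using True by (simp add: isCont_def)
  next
    case False
    have "isCont (\<lambda>u::complex. (exp u - 1) / u) u"
      using False by (intro continuous_intros) auto
    moreover have "\<forall>\<^sub>F v in nhds u. (exp v - 1) / v = (if v = 0 then 1 else (exp v - 1) / v)"
      using eventually_nhds_in_open[of "- {0}" u] False by (auto elim!: eventually_mono)
    ultimately show ?thesis
      using isCont_cong by fast
  qed
  then show ?thesis by (simp add: continuous_at_imp_continuous_on)
qed

text \<open>Both \<open>1 - z\<close> and \<open>exp (\<i> * zeta z)\<close> are functions of \<open>zeta z\<close>, and translating \<open>zeta\<close> by
  \<open>2\<pi>n\<close> rescales the former and fixes the latter. This reduces all estimates to a fundamental rectangle.\<close>

lemma disc_estimate:
  obtains C where "C \<ge> 1"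
    "\<And>z. z \<in> disc \<Longrightarrow> \<exists>n. cmod (z - zero_pt n) \<le> C * zero_gap n \<and> zero_gap n \<le> C * cmod (1 - z) \<and> cmod (1 - z) \<le> C * zero_gap n
      \<and> cmod (sw_quot z) \<le> C * zero_gap n / cmod (z - zero_pt n) \<and> cmod (zeta z) \<le> C * (1 + real n)"
proof -
  define h where "h u = (if u = 0 then 1 else (exp u - 1) / u)" for u :: complex
  have hc: "continuous_on T h" for T
    unfolding h_def by (rule continuous_on_subset[OF exp_quotient_continuous]) auto
  have hmult: "exp u - 1 = u * h u" for u by (simp add: h_def)
  \<comment> \<open>This rectangle contains i w for every w with |Re w| \<le> pi and |Im w| \<le> pi
    / 2. The only multiple of 2 pi i in it is 0, where h is 1, so h has a positive lower bound on
    it.\<close>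
  define K where "K = cbox (Complex (- pi / 2) (- pi)) (Complex (pi / 2) pi)"
  have K: "u \<in> K \<longleftrightarrow> \<bar>Re u\<bar> \<le> pi / 2 \<and> \<bar>Im u\<bar> \<le> pi" for u
    by (auto simp: K_def in_cbox_complex_iff)
  have "h u \<noteq> 0" if u: "u \<in> K" for u
  proof
    assume "h u = 0"
    then have "u \<noteq> 0" "exp u = 1" using hmult[of u] by (auto simp: h_def)
    then obtain n :: int where n: "Re u = 0" "Im u = of_int (2 * n) * pi" by (auto simp: exp_eq_1)
    have "\<bar>of_int n\<bar> * (2 * pi) \<le> pi" using u n by (simp add: K abs_mult)
    then have "\<bar>real_of_int n\<bar> \<le> 1 / 2" by (simp add: field_simps)
    then have "n = 0" by linarith
    with n \<open>u \<noteq> 0\<close> show False by (simp add: complex_eq_iff)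
  qed
  moreover have "0 \<in> K" by (simp add: K)
  moreover have "\<exists>u\<in>K. \<forall>v\<in>K. cmod (h u) \<le> cmod (h v)"
    using \<open>0 \<in> K\<close> by (intro continuous_attains_inf continuous_on_norm hc) (auto simp: K_def)
  ultimately obtain c where c: "c > 0" "\<And>u. u \<in> K \<Longrightarrow> c \<le> cmod (h u)"
    by (metis zero_less_norm_iff)
  have "bounded (h ` cball 0 (2 * pi))"
    by (intro compact_imp_bounded compact_continuous_image hc) auto
  then obtain B where "\<forall>v\<in>h ` cball 0 (2 * pi). cmod v \<le> B" unfolding bounded_iff by blast
  then have B: "\<And>u. cmod u \<le> 2 * pi \<Longrightarrow> cmod (h u) \<le> B" by auto
  have B0: "B > 0" using B[of 0] by (simp add: h_def)
  \<comment> \<open>exp pi + 1 bounds |exp w| and |exp w - 1|, B / c compares exp (i w) - 1 with exp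
    w - 1 through w, and 2 pi bounds zeta up to the factor 1 + n.\<close>
  define C where "C = Max {exp pi + 1, B / c, 2 * pi}"
  have C: "exp pi + 1 \<le> C" "B / c \<le> C" "2 * pi \<le> C" by (auto simp: C_def)
  have C1: "C \<ge> 1" using C(1) exp_gt_zero[of pi] by linarith
  have "\<exists>n. cmod (z - zero_pt n) \<le> C * zero_gap n \<and> zero_gap n \<le> C * cmod (1 - z) \<and> cmod (1 - z) \<le> C * zero_gap n
      \<and> cmod (sw_quot z) \<le> C * zero_gap n / cmod (z - zero_pt n) \<and> cmod (zeta z) \<le> C * (1 + real n)" if z: "z \<in> disc" for z
  proof -
    have z1: "z \<noteq> 1" using z by auto
    have "Re z < 1" using z complex_Re_le_cmod[of z] by auto
    then have y: "\<bar>Im (zeta z)\<bar> \<le> pi / 2"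
      unfolding zeta_def using Re_Ln_pos_lt_imp[of "1 - z"] by simp
    have "cmod (1 - z) \<le> 2" using norm_triangle_ineq4[of 1 z] z by simp
    then have "Re (zeta z) \<le> ln 2" using z1 by (simp add: Re_zeta)
    also have "ln 2 < (1::real)" using ln_2_less_1 .
    finally have x: "Re (zeta z) < pi" using pi_gt3 by linarith
    \<comment> \<open>The number of periods that brings Re w into (-pi, pi]. It is nonnegative
      because |1 - z| \<le> 2 forces Re zeta < pi.\<close>
    define m where "m = \<lfloor>(pi - Re (zeta z)) / (2 * pi)\<rfloor>"
    have "m \<ge> 0" using x by (simp add: m_def)
    define n where "n = nat m"
    have n: "real n = of_int m" using \<open>m \<ge> 0\<close> by (simp add: n_def)
    have "of_int m \<le> (pi - Re (zeta z)) / (2 * pi)" "(pi - Re (zeta z)) / (2 * pi) < of_int m + 1"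
      by (auto simp: m_def)
    then have nx: "2 * pi * n + Re (zeta z) \<le> pi" "2 * pi * n + Re (zeta z) > - pi"
      unfolding n by (auto simp: field_simps)
    define w where "w = zeta z + complex_of_real (2 * pi * n)"
    have w: "\<bar>Re w\<bar> \<le> pi" "\<bar>Im w\<bar> \<le> pi / 2" using nx y by (auto simp: w_def)
    have wn: "cmod w \<le> 2 * pi" using cmod_le[of w] w pi_gt_zero by linarith
    have zz: "1 - z = of_real (zero_gap n) * exp w"
      using exp_zeta[OF z1] by (simp add: w_def zero_gap_def exp_add exp_minus flip: exp_of_real)
    have q0: "zero_gap n > 0" by (simp add: zero_gap_def)
    have za: "z - zero_pt n = - of_real (zero_gap n) * (exp w - 1)"
      using zz by (simp add: zero_pt_def algebra_simps)
    have ew: "exp (- pi) \<le> cmod (exp w)" "cmod (exp w) \<le> exp pi"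
      using w by (auto simp: abs_le_iff)
    have "cmod (z - zero_pt n) = zero_gap n * cmod (exp w - 1)"
      unfolding za using q0 by (simp add: norm_mult)
    also have "cmod (exp w - 1) \<le> exp pi + 1"
      using norm_triangle_ineq4[of "exp w" 1] ew(2) unfolding norm_one by linarith
    also have "\<dots> \<le> C" by (rule C(1))
    finally have p1: "cmod (z - zero_pt n) \<le> C * zero_gap n" using q0 by (simp add: mult.commute)
    have p2: "zero_gap n \<le> C * cmod (1 - z)"
    proof -
      have "1 = exp pi * exp (- pi)" by (simp flip: exp_add)
      also have "\<dots> \<le> C * cmod (exp w)" using ew C(1) C1 by (intro mult_mono) auto
      finally have "zero_gap n * 1 \<le> zero_gap n * (C * cmod (exp w))" using q0 by (intro mult_left_mono) auto
      then show ?thesis unfolding zz using q0 by (simp add: norm_mult mult_ac)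
    qed
    have p3: "cmod (1 - z) \<le> C * zero_gap n"
    proof -
      have "cmod (exp w) \<le> C" using ew(2) C(1) by linarith
      then have "zero_gap n * cmod (exp w) \<le> zero_gap n * C" using q0 by (intro mult_left_mono) auto
      then show ?thesis unfolding zz using q0 by (simp add: norm_mult mult_ac)
    qed
    have "\<i> * w = \<i> * zeta z + of_nat n * (2 * of_real pi * \<i>)"
      by (simp add: w_def algebra_simps)
    then have "exp (\<i> * w) = exp (\<i> * zeta z) * exp (2 * of_real pi * \<i>) ^ n"
      by (simp only: exp_add exp_of_nat_mult)
    then have eiw: "exp (\<i> * w) = exp (\<i> * zeta z)" by (simp only: exp_two_pi_i power_one mult_1_right)
    have p4: "cmod (sw_quot z) \<le> C * zero_gap n / cmod (z - zero_pt n)"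
    proof (cases "w = 0")
      \<comment> \<open>At the zero itself \<open>sw_quot\<close> has its default value 0, so the
        bound is trivial.\<close>
      case True
      then have "exp (\<i> * zeta z) = 1"
        using eiw by simp
      then show ?thesis using C1 q0 by (simp add: sw_quot_def)
    next
      case False
      have iw: "\<i> * w \<in> K" using w by (simp add: K)
      have "cmod (exp (\<i> * zeta z) - 1) = cmod w * cmod (h (\<i> * w))"
        unfolding eiw[symmetric] hmult by (simp add: norm_mult)
      also have "\<dots> \<ge> cmod w * c" using c(2)[OF iw] by (intro mult_left_mono) auto
      finally have "cmod (sw_quot z) \<le> 1 / (cmod w * c)"
        unfolding sw_quot_def norm_divide using False c(1) by (simp add: frac_le)
      also have "\<dots> = (B / c) * zero_gap n / (zero_gap n * (cmod w * B))"
        using B0 q0 c(1) False by (simp add: field_simps)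
      also have "\<dots> \<le> C * zero_gap n / (zero_gap n * (cmod w * B))"
        using B0 q0 by (intro divide_right_mono mult_right_mono C) auto
      also have "\<dots> \<le> C * zero_gap n / cmod (z - zero_pt n)"
      proof (rule divide_left_mono)
        show "cmod (z - zero_pt n) \<le> zero_gap n * (cmod w * B)"
          unfolding za using q0 B[OF wn] hmult[of w] by (simp add: norm_mult mult_left_mono)
        have "exp w \<noteq> 1"
        proof
          assume "exp w = 1"
          then obtain k :: int where k: "Re w = 0" "Im w = of_int (2 * k) * pi" by (auto simp: exp_eq_1)
          have "\<bar>of_int k\<bar> * (2 * pi) \<le> pi / 2" using w(2) k by (simp add: abs_mult)
          then have "\<bar>real_of_int k\<bar> \<le> 1 / 4" by (simp add: field_simps)
          then have "k = 0" by linarith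
          with k False show False by (simp add: complex_eq_iff)
        qed
        then show "0 < zero_gap n * (cmod w * B) * cmod (z - zero_pt n)"
          unfolding za norm_mult norm_minus_cancel norm_of_real using q0 B0 False
          by (intro mult_pos_pos) auto
      qed (use q0 C1 in auto)
      finally show ?thesis .
    qed
    have "cmod (zeta z) \<le> cmod w + 2 * pi * n"
      using norm_triangle_ineq4[of w "complex_of_real (2 * pi * n)"] by (simp add: w_def norm_mult)
    also have "\<dots> \<le> 2 * pi * (1 + n)" using wn by (simp add: algebra_simps)
    also have "\<dots> \<le> C * (1 + n)" using C(3) by (intro mult_right_mono) auto
    finally have "cmod (zeta z) \<le> C * (1 + real n)" by simp
    with p1 p2 p3 p4 show ?thesis by (intro exI[of _ n] conjI)
  qed
  with C1 show ?thesis by (rule that)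
qed

section \<open>Smoothness off the zeros and on the circle\<close>

text \<open>Bounded linear maps commute with iterated partial derivatives. Taking a pair as argument
  allows a map into the plane vectors to be assembled from its two components by
  \<open>vec2\<close>.\<close>

lemma smooth_on_linear_pair:
  fixes u :: "'a::euclidean_space \<Rightarrow> 'b::real_normed_vector" and v :: "'a \<Rightarrow> 'c::real_normed_vector"
    and L :: "'b \<times> 'c \<Rightarrow> 'd::real_normed_vector"
  assumes S: "open S" and u: "smooth_on S u" and v: "smooth_on S v" and L: "bounded_linear L"
  shows "smooth_on S (\<lambda>z. L (u z, v z))"
proof (rule smooth_on_class[OF S, where P="\<lambda>w. \<exists>vs\<in>lists Basis. w = (\<lambda>z. L (iter_partial vs u z, iter_partial vs v z))"])
  show "\<exists>vs\<in>lists Basis. (\<lambda>z. L (u z, v z)) = (\<lambda>z. L (iter_partial vs u z, iter_partial vs v z))"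
    by (rule bexI[of _ "[]"]) auto
  fix w and b :: 'a
  assume "\<exists>vs\<in>lists Basis. w = (\<lambda>z. L (iter_partial vs u z, iter_partial vs v z))" and b: "b \<in> Basis"
  then obtain vs where vs: "vs \<in> lists Basis" and w: "w = (\<lambda>z. L (iter_partial vs u z, iter_partial vs v z))"
    by auto
  let ?w = "\<lambda>z. L (iter_partial (b # vs) u z, iter_partial (b # vs) v z)"
  have "\<exists>D. (w has_derivative D) (at z) \<and> D b = ?w z" if z: "z \<in> S" for z
  proof -
    have "iter_partial vs u differentiable at z" "iter_partial vs v differentiable at z"
      using u v vs z S by (auto simp: smooth_on_iff differentiable_on_eq_differentiable_at)
    from bounded_linear.has_derivative[OF L has_derivative_Pair[OF this[THEN has_derivative_frechet]]]
    show ?thesis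
      unfolding w by (intro exI conjI, assumption) (simp add: partial_deriv_def)
  qed
  moreover have "b # vs \<in> lists Basis" using vs b by simp
  ultimately show "\<exists>u'. (\<exists>vs\<in>lists Basis. u' = (\<lambda>z. L (iter_partial vs u z, iter_partial vs v z))) \<and>
      (\<forall>z\<in>S. \<exists>D. (w has_derivative D) (at z) \<and> D b = u' z)"
    by (intro exI[of _ ?w] conjI bexI[of _ "b # vs"]) auto
qed

lemma smooth_on_linear:
  fixes u :: "'a::euclidean_space \<Rightarrow> 'b::real_normed_vector" and L :: "'b \<Rightarrow> 'd::real_normed_vector"
  assumes "open S" "smooth_on S u" "bounded_linear L"
  shows "smooth_on S (\<lambda>z. L (u z))"
  using smooth_on_linear_pair[OF assms(1,2,2), of "\<lambda>p. L (fst p)"] bounded_linear_compose[OF assms(3) bounded_linear_fst]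
  by simp

definition vec2 :: "complex \<times> complex \<Rightarrow> complex^2" where
  "vec2 p = vector [fst p, snd p]"

lemma vec2_nth [simp]: "vec2 (a, b) $ 1 = a" "vec2 (a, b) $ 2 = b"
  by (simp_all add: vec2_def)

lemma bounded_linear_vec2: "bounded_linear vec2"
proof (rule linear_conv_bounded_linear[THEN iffD1])
  show "linear vec2"
    by (rule linearI) (auto simp: vec2_def vec_eq_iff forall_2)
qed

lemma norm_vec2: "(norm (vec2 (a, b)))\<^sup>2 = (cmod a)\<^sup>2 + (cmod b)\<^sup>2"
  by (simp add: norm_vec_def L2_set_def sum_2)

lemma norm_vec2_le: "norm (vec2 (a, b)) \<le> cmod a + cmod b"
  by (rule power2_le_imp_le) (auto simp: norm_vec2 power2_sum)

section \<open>Smoothness away from the zeros\<close>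

definition sw_dom :: "complex set" where
  "sw_dom = {z \<in> slit. sw_fun z \<noteq> 0}"

lemma continuous_on_sw_fun: "continuous_on slit sw_fun"
  using sw_fun_deriv by (meson DERIV_isCont continuous_at_imp_continuous_on)

lemma open_sw_dom: "open sw_dom"
proof -
  have "sw_dom = slit \<inter> sw_fun -` (- {0})" by (auto simp: sw_dom_def)
  then show ?thesis
    using continuous_open_preimage[OF continuous_on_sw_fun open_slit, of "- {0}"] open_Compl[of "{0::complex}"]
    by simp
qed

text \<open>Closed under differentiation on \<open>sw_dom\<close>. Unlike \<open>flat_gens\<close>,
  all of these except the identity are unbounded on the disc. The identity is included for the
  tangent vector i z of the circle.\<close>

abbreviation "log_gens \<equiv> {\<lambda>z. z, zeta, \<lambda>z. 1 / (1 - z), sw_quot}"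

lemma log_gens_in:
  "(\<lambda>z. z) \<in> star_alg log_gens" "zeta \<in> star_alg log_gens" "(\<lambda>z. 1 / (1 - z)) \<in> star_alg log_gens"
  "sw_quot \<in> star_alg log_gens"
  by (auto intro: star_alg_gen)

lemma sw_logderiv_in: "sw_logderiv \<in> star_alg log_gens"
  unfolding sw_logderiv_def[abs_def]
  by (intro star_alg_mult star_alg_add star_alg_const log_gens_in)

lemma log_gens_wirtinger:
  assumes "u \<in> log_gens"
  shows "\<exists>a\<in>star_alg log_gens. \<exists>b\<in>star_alg log_gens. \<forall>z\<in>sw_dom. has_wirtinger u (a z) (b z) z"
proof -
  have *: ?thesis if "a \<in> star_alg log_gens" "\<And>z. z \<in> sw_dom \<Longrightarrow> (u has_field_derivative a z) (at z)" for a
    using that by (intro bexI[of _ a] bexI[of _ "\<lambda>_. 0"])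
      (auto intro: has_wirtinger_holomorphic star_alg_const)
  from assms consider "u = (\<lambda>z. z)" | "u = zeta" | "u = (\<lambda>z. 1 / (1 - z))" | "u = sw_quot" by blast
  then show ?thesis
  proof cases
    case 1
    then show ?thesis by (intro *[of "\<lambda>_. 1"] star_alg_const) auto
  next
    case 2
    have "(\<lambda>z. (- 1) * (1 / (1 - z))) \<in> star_alg log_gens"
      by (intro star_alg_mult star_alg_const log_gens_in)
    then show ?thesis
      by (rule *) (use zeta_deriv 2 in \<open>auto simp: sw_dom_def\<close>)
  next
    case 3
    have "(\<lambda>z. (1 / (1 - z)) * (1 / (1 - z))) \<in> star_alg log_gens"
      by (intro star_alg_mult log_gens_in)
    then show ?thesis
    proof (rule *)
      fix z assume "z \<in> sw_dom"
      then have "1 - z \<noteq> 0" by (auto simp: sw_dom_def slit_def)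
      then show "(u has_field_derivative (1 / (1 - z)) * (1 / (1 - z))) (at z)"
        unfolding 3 by (auto intro!: derivative_eq_intros)
    qed
  next
    case 4
    have "(\<lambda>z. \<i> * (1 / (1 - z)) * (sw_quot z + sw_quot z * sw_quot z)) \<in> star_alg log_gens"
      by (intro star_alg_mult star_alg_add star_alg_const log_gens_in)
    then show ?thesis
      by (rule *) (use sw_quot_deriv 4 in \<open>auto simp: sw_dom_def\<close>)
  qed
qed

text \<open>Logarithmic differentiation: off the zeros a derivative multiplies the power by a
  combination of f' / f and its conjugate. Both exponents stay fixed and only the coefficient
  changes, so there is no loss of regularity here.\<close>

lemma epw_sw_fun_wirtinger:
  assumes c: "c \<in> star_alg log_gens"
  shows "\<exists>a\<in>star_alg log_gens. \<exists>b\<in>star_alg log_gens. \<forall>z\<in>sw_dom.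
    has_wirtinger (\<lambda>z. epw s n (sw_fun z) * c z) (epw s n (sw_fun z) * a z) (epw s n (sw_fun z) * b z) z"
proof -
  from star_alg_has_wirtinger[OF log_gens_wirtinger c] obtain c1 c2 where
    c12: "c1 \<in> star_alg log_gens" "c2 \<in> star_alg log_gens" "\<And>z. z \<in> sw_dom \<Longrightarrow> has_wirtinger c (c1 z) (c2 z) z"
    by blast
  define k where "k = complex_of_real ((s + n) / 2)"
  define l where "l = complex_of_real ((s - n) / 2)"
  define a where "a = (\<lambda>z. k * sw_logderiv z * c z + c1 z)"
  define b where "b = (\<lambda>z. l * cnj (sw_logderiv z) * c z + c2 z)"
  have "a \<in> star_alg log_gens" "b \<in> star_alg log_gens"
    unfolding a_def b_def by (intro star_alg_add star_alg_mult star_alg_cnj star_alg_const sw_logderiv_in c c12)+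
  moreover have "has_wirtinger (\<lambda>z. epw s n (sw_fun z) * c z) (epw s n (sw_fun z) * a z) (epw s n (sw_fun z) * b z) z"
    if z: "z \<in> sw_dom" for z
  proof -
    have z': "z \<in> slit" "sw_fun z \<noteq> 0" using z by (auto simp: sw_dom_def)
    have e: "epw (s - 1) (n - 1) (sw_fun z) * sw_fun z = epw s n (sw_fun z)"
      "epw (s - 1) (n + 1) (sw_fun z) * cnj (sw_fun z) = epw s n (sw_fun z)"
      by (simp_all add: epw_mult_self epw_mult_cnj)
    have "has_wirtinger (\<lambda>z. epw s n (sw_fun z)) (k * epw (s - 1) (n - 1) (sw_fun z) * sw_fun' z)
        (l * epw (s - 1) (n + 1) (sw_fun z) * cnj (sw_fun' z)) z"
      by (rule has_wirtinger_cong[OF has_wirtinger_compose[OF has_wirtinger_epw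
            has_wirtinger_holomorphic[OF sw_fun_deriv[OF z'(1)]]]])
        (use z' in \<open>simp_all add: k_def l_def\<close>)
    moreover have "k * epw (s - 1) (n - 1) (sw_fun z) * sw_fun' z = epw s n (sw_fun z) * (k * sw_logderiv z)"
      unfolding sw_fun'_eq[OF z'] e(1)[symmetric] by (simp add: mult_ac)
    moreover have "l * epw (s - 1) (n + 1) (sw_fun z) * cnj (sw_fun' z) = epw s n (sw_fun z) * (l * cnj (sw_logderiv z))"
      unfolding sw_fun'_eq[OF z'] e(2)[symmetric] by (simp add: mult_ac)
    ultimately have "has_wirtinger (\<lambda>z. epw s n (sw_fun z)) (epw s n (sw_fun z) * (k * sw_logderiv z)) (epw s n (sw_fun z) * (l * cnj (sw_logderiv z))) z"
      by simp
    note w = has_wirtinger_mult[OF this c12(3)[OF z]]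
    show ?thesis
      by (intro has_wirtinger_cong[OF w]) (simp_all add: a_def b_def algebra_simps)
  qed
  ultimately show ?thesis by blast
qed

lemma smooth_on_epw_sw_fun:
  assumes c: "c \<in> star_alg log_gens"
  shows "smooth_on sw_dom (\<lambda>z. epw s n (sw_fun z) * c z)"
proof (rule smooth_on_class[OF open_sw_dom, where P="\<lambda>u. \<exists>c\<in>star_alg log_gens. u = (\<lambda>z. epw s n (sw_fun z) * c z)"])
  show "\<exists>d\<in>star_alg log_gens. (\<lambda>z. epw s n (sw_fun z) * c z) = (\<lambda>z. epw s n (sw_fun z) * d z)"
    using c by blast
  fix u and v :: complex
  assume "\<exists>c\<in>star_alg log_gens. u = (\<lambda>z. epw s n (sw_fun z) * c z)"
  then obtain c where "c \<in> star_alg log_gens" and u: "u = (\<lambda>z. epw s n (sw_fun z) * c z)" by blast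
  from epw_sw_fun_wirtinger[OF this(1)] obtain a b where ab: "a \<in> star_alg log_gens" "b \<in> star_alg log_gens"
    "\<And>z. z \<in> sw_dom \<Longrightarrow> has_wirtinger u (epw s n (sw_fun z) * a z) (epw s n (sw_fun z) * b z) z"
    unfolding u by blast
  let ?d = "\<lambda>z. a z * v + b z * cnj v"
  have "?d \<in> star_alg log_gens"
    by (intro star_alg_add star_alg_mult star_alg_const ab)
  moreover have "\<exists>D. (u has_derivative D) (at z) \<and> D v = epw s n (sw_fun z) * ?d z" if "z \<in> sw_dom" for z
    using ab(3)[OF that] unfolding has_wirtinger_def
    by (intro exI conjI, assumption) (simp add: algebra_simps)
  ultimately show "\<exists>u'. (\<exists>c\<in>star_alg log_gens. u' = (\<lambda>z. epw s n (sw_fun z) * c z)) \<and>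
      (\<forall>z\<in>sw_dom. \<exists>D. (u has_derivative D) (at z) \<and> D v = u' z)"
    by (intro exI[of _ "\<lambda>z. epw s n (sw_fun z) * ?d z"] conjI bexI[of _ ?d]) auto
qed

text \<open>Let zeta = x + i y. If |y| \<ge> pi/4, the modulus exp (-y) of exp (i zeta) is away from
  1. Otherwise |z| = 1 gives |1 - z| = 2 cos y, which lies between sqrt 2 and 2, so x lies between
  (ln 2) / 2 and ln 2 and the imaginary part exp (-y) sin x is bounded below. Hence the boundary
  values avoid the zeros and \<open>sw_quot\<close> is bounded on the circle.\<close>

lemma circle_E_bound:
  obtains c where "c > 0" "\<And>z. cmod z = 1 \<Longrightarrow> z \<noteq> 1 \<Longrightarrow> c \<le> cmod (exp (\<i> * zeta z) - 1)"
proof -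
  define c where "c = min (1 - exp (- pi / 4)) (exp (- pi) * sin (ln 2 / 2))"
  have l2: "0 < ln (2::real)" "ln (2::real) < 1" using ln_2_less_1 by auto
  have "sin (ln 2 / 2 :: real) > 0" using l2 pi_gt3 by (intro sin_gt_zero) auto
  then have "c > 0" by (simp add: c_def)
  moreover have "c \<le> cmod (exp (\<i> * zeta z) - 1)" if z: "cmod z = 1" "z \<noteq> 1" for z
  proof -
    define x where "x = Re (zeta z)"
    define y where "y = Im (zeta z)"
    have y: "\<bar>y\<bar> \<le> pi" using Im_zeta_le[OF z(2)] by (simp add: y_def)
    have w0: "cmod (1 - z) > 0" using z by simp
    have x: "x = ln (cmod (1 - z))" using z by (simp add: x_def Re_zeta)
    have w2: "cmod (1 - z) \<le> 2" using norm_triangle_ineq4[of 1 z] z by simp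
    show ?thesis
    proof (cases "\<bar>y\<bar> \<ge> pi / 4")
      case True
      have nE: "cmod (exp (\<i> * zeta z)) = exp (- y)" by (simp add: y_def)
      have "1 - exp (- pi / 4) \<le> \<bar>exp (- y) - 1\<bar>"
      proof (cases "y \<ge> 0")
        case True
        with \<open>\<bar>y\<bar> \<ge> pi / 4\<close> have "exp (- y) \<le> exp (- pi / 4)" by simp
        then show ?thesis by linarith
      next
        case False
        with True have "exp (- y) \<ge> exp (pi / 4)" by simp
        \<comment> \<open>The inequality b + 1 / b \<ge> 2 makes exp (pi/4) - 1 at least 1 - exp
          (-pi/4), so one constant serves both signs of y.\<close>
        moreover have "exp (pi / 4) + exp (- pi / 4) \<ge> (2::real)"
          using cosh_real_ge_1[of "pi / 4"] by (simp add: cosh_def)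
        ultimately show ?thesis by linarith
      qed
      also have "\<dots> \<le> cmod (exp (\<i> * zeta z) - 1)"
        using norm_triangle_ineq3[of "exp (\<i> * zeta z)" 1] unfolding nE by simp
      finally show ?thesis by (simp add: c_def)
    next
      case False
      have "(Re z)\<^sup>2 + (Im z)\<^sup>2 = 1" using z(1) cmod_power2[of z] by simp
      moreover have "(cmod (1 - z))\<^sup>2 = (1 - Re z)\<^sup>2 + (Im z)\<^sup>2" by (simp add: cmod_power2)
      ultimately have "(cmod (1 - z))\<^sup>2 = 2 * (1 - Re z)"
        by (simp add: power2_diff)
      moreover have "1 - Re z = cmod (1 - z) * cos y"
      proof -
        have "1 - Re z = Re (exp (zeta z))" using exp_zeta[OF z(2)] by simp
        also have "\<dots> = cmod (exp (zeta z)) * cos y" by (simp add: Re_exp y_def)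
        finally show ?thesis using exp_zeta[OF z(2)] by simp
      qed
      ultimately have wy: "cmod (1 - z) = 2 * cos y" using w0 by (simp add: power2_eq_square)
      have "cos (pi / 4) \<le> cos \<bar>y\<bar>"
        using False by (intro cos_monotone_0_pi_le) auto
      then have "sqrt 2 \<le> cmod (1 - z)" unfolding wy by (simp add: cos_45)
      then have "ln (sqrt 2) \<le> x" unfolding x using w0 by (subst ln_le_cancel_iff) auto
      then have x1: "ln 2 / 2 \<le> x" by (simp add: ln_sqrt)
      have x2: "x \<le> ln 2" unfolding x using w0 w2 by (subst ln_le_cancel_iff) auto
      have "exp (- pi) * sin (ln 2 / 2) \<le> exp (- y) * sin x"
      proof (intro mult_mono)
        show "sin (ln 2 / 2) \<le> sin x"
          using x1 x2 l2 pi_gt3 by (intro sin_monotone_2pi_le) auto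
      qed (use y \<open>sin (ln 2 / 2 :: real) > 0\<close> in auto)
      also have "\<dots> = Im (exp (\<i> * zeta z) - 1)" by (simp add: Im_exp x_def y_def)
      also have "\<dots> \<le> cmod (exp (\<i> * zeta z) - 1)" using abs_Im_le_cmod abs_le_D1 by blast
      finally show ?thesis by (simp add: c_def)
    qed
  qed
  ultimately show ?thesis by (rule that)
qed

lemma circle_in_sw_dom: "cmod z = 1 \<Longrightarrow> z \<noteq> 1 \<Longrightarrow> z \<in> sw_dom"
proof -
  assume z: "cmod z = 1" "z \<noteq> 1"
  obtain c where "c > 0" "\<And>z. cmod z = 1 \<Longrightarrow> z \<noteq> 1 \<Longrightarrow> c \<le> cmod (exp (\<i> * zeta z) - 1)"
    by (rule circle_E_bound) blast
  from this(1) this(2)[OF z] have "exp (\<i> * zeta z) \<noteq> 1" by auto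
  then show ?thesis using z cball_in_slit by (simp add: sw_dom_def sw_fun_eq_0_iff)
qed

text \<open>On the circle zeta is logarithmic in |1 - z| and \<open>sw_quot\<close> is bounded, so
  every coefficient grows at most like a power of 1 / |1 - z|. The factor 2, the diameter, makes the
  weight at least 1.\<close>

lemma circle_growth:
  assumes c: "c \<in> star_alg log_gens"
  shows "\<exists>C N. \<forall>z\<in>sphere 0 1 - {1}. cmod (c z) \<le> C * (2 / cmod (1 - z)) ^ N"
proof (rule star_alg_growth[OF _ _ c])
  have w2: "cmod (1 - z) \<le> 2" "cmod (1 - z) > 0" if "z \<in> sphere 0 1 - {1}" for z
    using norm_triangle_ineq4[of 1 z] that by auto
  show ge1: "1 \<le> 2 / cmod (1 - z)" if "z \<in> sphere 0 1 - {1}" for z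
    using w2[OF that] by simp
  obtain e where e: "e > 0" "\<And>z. cmod z = 1 \<Longrightarrow> z \<noteq> 1 \<Longrightarrow> e \<le> cmod (exp (\<i> * zeta z) - 1)"
    by (rule circle_E_bound) blast
  fix u assume "u \<in> log_gens"
  then consider "u = (\<lambda>z. z)" | "u = zeta" | "u = (\<lambda>z. 1 / (1 - z))" | "u = sw_quot" by blast
  then show "\<exists>C N. \<forall>z\<in>sphere 0 1 - {1}. cmod (u z) \<le> C * (2 / cmod (1 - z)) ^ N"
  proof cases
    case 1
    then show ?thesis by (intro exI[of _ 1] exI[of _ 0]) auto
  next
    case 2
    have "cmod (zeta z) \<le> (pi + 3) * (2 / cmod (1 - z)) ^ 1" if z: "z \<in> sphere 0 1 - {1}" for z
    proof -
      define r where "r = cmod (1 - z)"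
      have r: "0 < r" "r \<le> 2" using w2[OF z] by (auto simp: r_def)
      have "ln r \<le> r" using ln_bound[OF r(1)] .
      moreover have "ln (1 / r) \<le> 1 / r" using r by (intro ln_bound) auto
      moreover have "ln (1 / r) = - ln r" using r by (simp add: ln_div)
      moreover have "1 / r > 0" using r by simp
      ultimately have "\<bar>ln r\<bar> \<le> 2 + 1 / r" using r by linarith
      moreover have "\<bar>Im (zeta z)\<bar> \<le> pi" using Im_zeta_le z by auto
      ultimately have "cmod (zeta z) \<le> 2 + 1 / r + pi"
        using cmod_le[of "zeta z"] Re_zeta[of z] z by (simp add: r_def)
      also have "\<dots> \<le> (pi + 3) * (2 / r)"
      proof -
        have "1 \<le> 2 / r" using r by simp
        then have "(pi + 2) * 1 \<le> (pi + 2) * (2 / r)" using pi_gt_zero by (intro mult_left_mono) auto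
        moreover have "1 / r \<le> 2 / r" using r by (simp add: field_simps)
        ultimately have "(pi + 2) * 1 + 1 / r \<le> (pi + 2) * (2 / r) + 2 / r" by (rule add_mono)
        also have "\<dots> = (pi + 3) * (2 / r)" using r by (simp add: field_simps)
        finally show ?thesis by simp
      qed
      finally show ?thesis by (simp add: r_def)
    qed
    then show ?thesis unfolding 2 by blast
  next
    case 3
    show ?thesis unfolding 3
      by (intro exI[of _ "1/2"] exI[of _ 1]) (auto simp: norm_divide)
  next
    case 4
    have "cmod (sw_quot z) \<le> (1 / e) * (2 / cmod (1 - z)) ^ 0" if z: "z \<in> sphere 0 1 - {1}" for z
      using e(1) e(2)[of z] z by (simp add: sw_quot_def norm_divide frac_le)
    then show ?thesis unfolding 4 by blast
  qed
qed

lemma cis_minus_1_le: "cis a = 1 \<Longrightarrow> cmod (1 - cis t) \<le> \<bar>t - a\<bar>"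
proof -
  assume a: "cis a = 1"
  have "cis t = cis (t - a)" using a by (simp add: cis_divide[symmetric])
  then have "cmod (1 - cis t) = 2 * \<bar>sin ((t - a) / 2)\<bar>"
    using dist_exp_i_1[of "t - a"] by (simp add: cis_conv_exp norm_minus_commute)
  also have "\<dots> \<le> 2 * \<bar>(t - a) / 2\<bar>" by (intro mult_left_mono abs_sin_x_le_abs_x) simp
  finally show ?thesis by simp
qed

text \<open>The family \<open>k c\<close>, with c in the algebra, is closed under d/dt. Away from
  the point 1 this is logarithmic differentiation along the tangent i z. At the point 1 the decay of
  f beats the growth of any coefficient, so both the function and its derivative vanish
  there.\<close>

lemma smooth_trace:
  assumes s: "s > 0" and c: "c \<in> star_alg log_gens"
  shows "smooth_on UNIV (\<lambda>t. if cis t = 1 then 0 else epw s n (sw_fun (cis t)) * c (cis t))"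
proof -
  define k where "k c t = (if cis t = 1 then 0 else epw s n (sw_fun (cis t)) * c (cis t))" for c t
  have "smooth_on UNIV (k c)"
  proof (rule smooth_on_class[where P="\<lambda>u. \<exists>c\<in>star_alg log_gens. u = k c"])
    show "\<exists>d\<in>star_alg log_gens. k c = k d" using c by blast
    fix u and v :: real
    assume "\<exists>c\<in>star_alg log_gens. u = k c" and "v \<in> Basis"
    then obtain c where c: "c \<in> star_alg log_gens" and u: "u = k c" and v: "v = 1" by auto
    from epw_sw_fun_wirtinger[OF c] obtain a b where ab: "a \<in> star_alg log_gens" "b \<in> star_alg log_gens"
      "\<And>z. z \<in> sw_dom \<Longrightarrow> has_wirtinger (\<lambda>z. epw s n (sw_fun z) * c z) (epw s n (sw_fun z) * a z) (epw s n (sw_fun z) * b z) z"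
      by blast
    define d where "d = (\<lambda>z. a z * (\<i> * z) + b z * cnj (\<i> * z))"
    have d: "d \<in> star_alg log_gens"
      unfolding d_def by (intro star_alg_add star_alg_mult star_alg_const star_alg_cnj ab log_gens_in)
    have "\<exists>D. (k c has_derivative D) (at t) \<and> D v = k d t" for t
    proof (cases "cis t = 1")
      case True
      from circle_growth[OF c] obtain C N where
        C: "\<And>z. z \<in> sphere 0 1 - {1} \<Longrightarrow> cmod (c z) \<le> C * (2 / cmod (1 - z)) ^ N" by blast
      \<comment> \<open>The exponent (N + 2) / s is such that |f|^s decays like |1 - z|^(N+2);
        against growth of order N two powers remain, enough for a vanishing derivative.\<close>
      obtain A where A: "\<And>z. z \<noteq> 1 \<Longrightarrow> cmod (sw_fun z) \<le> A * cmod (1 - z) powr ((N + 2) / s)"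
        by (rule sw_fun_decay) blast
      define B where "B = \<bar>A\<bar> powr s * (\<bar>C\<bar> * 2 ^ N)"
      have bound: "cmod (k c x) \<le> B * (x - t)\<^sup>2" for x
      proof (cases "cis x = 1")
        case False
        define r where "r = cmod (1 - cis x)"
        have r: "r > 0" using False by (simp add: r_def)
        have "cmod (k c x) = cmod (sw_fun (cis x)) powr s * cmod (c (cis x))"
          using False by (simp add: k_def norm_mult norm_epw)
        also have "\<dots> \<le> (\<bar>A\<bar> * r powr ((N + 2) / s)) powr s * (\<bar>C\<bar> * (2 / r) ^ N)"
        proof (intro mult_mono powr_mono2)
          show "cmod (sw_fun (cis x)) \<le> \<bar>A\<bar> * r powr ((N + 2) / s)"
            by (rule order_trans[OF A[OF False]], unfold r_def, intro mult_right_mono) auto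
          show "cmod (c (cis x)) \<le> \<bar>C\<bar> * (2 / r) ^ N"
            by (rule order_trans[OF C], use False in simp, unfold r_def, intro mult_right_mono) auto
        qed (use s in auto)
        also have "\<dots> = \<bar>A\<bar> powr s * r powr (N + 2) * (\<bar>C\<bar> * (2 / r) ^ N)"
          using s by (simp add: powr_mult powr_powr)
        also have "r powr (N + 2) = r ^ N * r\<^sup>2"
          using r powr_realpow[of r "N + 2"] by (simp add: power_add power2_eq_square)
        also have "\<bar>A\<bar> powr s * (r ^ N * r\<^sup>2) * (\<bar>C\<bar> * (2 / r) ^ N) = B * r\<^sup>2"
          using r by (simp add: B_def power_divide)
        also have "\<dots> \<le> B * \<bar>x - t\<bar>\<^sup>2"
          using cis_minus_1_le[OF True, of x] r
          by (intro mult_left_mono power_mono) (auto simp: r_def B_def)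
        finally show ?thesis by simp
      qed (auto simp: k_def B_def)
      have "k c t = 0" using True by (simp add: k_def)
      have "(k c has_derivative (\<lambda>_. 0)) (at t)"
        unfolding has_derivative_at
      proof (intro conjI)
        have "((\<lambda>h. B * \<bar>h\<bar>) \<longlongrightarrow> B * \<bar>0\<bar>) (at 0)" by (intro tendsto_intros)
        then have lim: "((\<lambda>h. B * \<bar>h\<bar>) \<longlongrightarrow> 0) (at 0)" by simp
        show "((\<lambda>h. norm (k c (t + h) - k c t - 0) / norm h) \<longlongrightarrow> 0) (at 0)"
        proof (rule tendsto_0_le[OF lim, where K=1], rule eventually_mono[OF eventually_neq_at_within])
          fix h :: real assume "h \<noteq> 0"
          have "norm (k c (t + h)) \<le> B * h\<^sup>2" using bound[of "t + h"] by simp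
          then have "norm (k c (t + h)) / \<bar>h\<bar> \<le> B * \<bar>h\<bar>"
            using \<open>h \<noteq> 0\<close> by (simp add: field_simps power2_eq_square abs_mult_self_eq)
          moreover have "B \<ge> 0" by (simp add: B_def)
          ultimately show "norm (norm (k c (t + h) - k c t - 0) / norm h) \<le> norm (B * \<bar>h\<bar>) * 1"
            using \<open>k c t = 0\<close> by (simp add: abs_mult)
        qed
      qed simp
      then show ?thesis using True by (intro exI[of _ "\<lambda>_. 0"]) (simp add: k_def)
    next
      case False
      have z: "cis t \<in> sw_dom" using False by (intro circle_in_sw_dom) auto
      define z where "z = cis t"
      define e where "e = epw s n (sw_fun z)"
      have 1: "(cis has_derivative (\<lambda>h. h *\<^sub>R (\<i> * z))) (at t)"
        using has_derivative_cis[OF has_derivative_ident, of t UNIV] by (simp add: z_def)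
      have "((\<lambda>z. epw s n (sw_fun z) * c z) has_derivative (\<lambda>h. e * a z * h + e * b z * cnj h)) (at (cis t))"
        using ab(3)[OF z] by (simp add: has_wirtinger_def z_def e_def)
      from has_derivative_compose[OF 1 this]
      have "((\<lambda>t. epw s n (sw_fun (cis t)) * c (cis t)) has_derivative
          (\<lambda>h. e * a z * (h *\<^sub>R (\<i> * z)) + e * b z * cnj (h *\<^sub>R (\<i> * z)))) (at t)" .
      then have "(k c has_derivative (\<lambda>h. e * a z * (h *\<^sub>R (\<i> * z)) + e * b z * cnj (h *\<^sub>R (\<i> * z)))) (at t)"
      proof (rule has_derivative_transform_within_open)
        show "open (cis -` (- {1}))"
          by (intro open_vimage) (auto intro: continuous_intros)
      qed (use False in \<open>auto simp: k_def\<close>)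
      moreover have "e * a z * (v *\<^sub>R (\<i> * z)) + e * b z * cnj (v *\<^sub>R (\<i> * z)) = k d t"
        using False by (simp add: v k_def d_def e_def z_def algebra_simps)
      ultimately show ?thesis by blast
    qed
    then show "\<exists>u'. (\<exists>c\<in>star_alg log_gens. u' = k c) \<and> (\<forall>z\<in>UNIV. \<exists>D. (u has_derivative D) (at z) \<and> D v = u' z)"
      using d u by blast
  qed auto
  then show ?thesis by (simp add: k_def[abs_def])
qed

section \<open>The map\<close>

lemma epw_mult: "epw s n w * epw t m w = epw (s + t) (n + m) w"
  by (cases "w = 0") (simp_all add: epw_def powr_add power_int_add sgn_zero_iff mult_ac)

lemma cnj_epw: "cnj (epw s n w) = epw s (- n) w"
proof (cases "w = 0")
  case False
  then have "cnj (sgn w) = inverse (sgn w)"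
    using complex_norm_square[of "sgn w"] by (simp add: norm_sgn sgn_zero_iff field_simps)
  then have "cnj (sgn w powi n) = inverse (sgn w) powi n"
    by (simp add: power_int_def)
  then show ?thesis by (simp add: epw_def power_int_minus power_int_inverse)
qed simp

lemma epw_mult_cnj_epw: "epw s n w * cnj (epw t m w) = epw (s + t) (n - m) w"
  by (simp add: cnj_epw epw_mult)

text \<open>The hypothesis says that the Hermitian product of the two Wirtinger derivatives
  vanishes. Its imaginary part is, up to a factor, the inner product of the partial derivatives, and
  its real part the difference of their squared lengths.\<close>

lemma wirtinger_conformal:
  assumes "A1 * cnj B1 + A2 * cnj B2 = 0"
  defines "u \<equiv> vec2 (A1 + B1, A2 + B2)" and "v \<equiv> vec2 (\<i> * (A1 - B1), \<i> * (A2 - B2))"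
  shows "u \<bullet> v = 0" "(norm u)\<^sup>2 = (norm v)\<^sup>2"
    "(norm u)\<^sup>2 = (cmod A1)\<^sup>2 + (cmod B1)\<^sup>2 + (cmod A2)\<^sup>2 + (cmod B2)\<^sup>2"
proof -
  have r: "Re A1 * Re B1 + Im A1 * Im B1 + (Re A2 * Re B2 + Im A2 * Im B2) = 0"
    using arg_cong[OF assms(1), of Re] by simp
  have i: "Im A1 * Re B1 - Re A1 * Im B1 + (Im A2 * Re B2 - Re A2 * Im B2) = 0"
    using arg_cong[OF assms(1), of Im] by simp
  have "u \<bullet> v = - 2 * (Im A1 * Re B1 - Re A1 * Im B1 + (Im A2 * Re B2 - Re A2 * Im B2))"
    by (simp add: u_def v_def inner_vec_def sum_2 inner_complex_def algebra_simps)
  then show "u \<bullet> v = 0" unfolding i by simp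
  have nu: "(norm u)\<^sup>2 = (cmod A1)\<^sup>2 + (cmod B1)\<^sup>2 + (cmod A2)\<^sup>2 + (cmod B2)\<^sup>2
      + 2 * (Re A1 * Re B1 + Im A1 * Im B1 + (Re A2 * Re B2 + Im A2 * Im B2))"
    unfolding u_def norm_vec2 cmod_power2 by (simp add: power2_eq_square algebra_simps)
  then show "(norm u)\<^sup>2 = (cmod A1)\<^sup>2 + (cmod B1)\<^sup>2 + (cmod A2)\<^sup>2 + (cmod B2)\<^sup>2"
    unfolding r by simp
  have "(norm v)\<^sup>2 = (cmod A1)\<^sup>2 + (cmod B1)\<^sup>2 + (cmod A2)\<^sup>2 + (cmod B2)\<^sup>2
      - 2 * (Re A1 * Re B1 + Im A1 * Im B1 + (Re A2 * Re B2 + Im A2 * Im B2))"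
    unfolding v_def norm_vec2 cmod_power2 by (simp add: power2_eq_square algebra_simps)
  then show "(norm u)\<^sup>2 = (norm v)\<^sup>2" unfolding nu r by simp
qed

lemma wirtinger_omega:
  "omega (vec2 (A1 + B1, A2 + B2)) (vec2 (\<i> * (A1 - B1), \<i> * (A2 - B2)))
    = (cmod A1)\<^sup>2 - (cmod B1)\<^sup>2 + (cmod A2)\<^sup>2 - (cmod B2)\<^sup>2"
  unfolding cmod_power2 by (simp add: omega_def sum_2 power2_eq_square algebra_simps)

lemma wirtinger_dz1_dz2:
  "dz1_dz2 (vec2 (A1 + B1, A2 + B2)) (vec2 (\<i> * (A1 - B1), \<i> * (A2 - B2))) = 2 * \<i> * (B1 * A2 - A1 * B2)"
  by (simp add: dz1_dz2_def algebra_simps)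

lemma bounded_continuous_in_Lp_space:
  fixes u :: "complex \<Rightarrow> 'b::euclidean_space"
  assumes c: "continuous_on disc u" and b: "\<And>z. z \<in> disc \<Longrightarrow> norm (u z) \<le> C"
    and p: "p > 0"
  shows "u \<in> Lp_space p disc"
proof -
  have m: "u \<in> borel_measurable (lebesgue_on disc)"
    by (rule continuous_imp_measurable_on_sets_lebesgue[OF c]) auto
  have "disc \<in> lmeasurable" by simp
  then have "finite_measure (lebesgue_on disc)" by (rule finite_measure_lebesgue_on)
  then have "integrable (lebesgue_on disc) (\<lambda>z. \<bar>C\<bar> powr p)"
    by (simp add: finite_measure.integrable_const)
  then have "integrable (lebesgue_on disc) (\<lambda>z. norm (u z) powr p)"
  proof (rule Bochner_Integration.integrable_bound)
    show "AE z in lebesgue_on disc. norm (norm (u z) powr p) \<le> norm (\<bar>C\<bar> powr p)"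
    proof (rule AE_I2)
      fix z assume "z \<in> space (lebesgue_on disc)"
      then have "norm (u z) \<le> \<bar>C\<bar>" using b[of z] by (auto simp: space_restrict_space)
      then show "norm (norm (u z) powr p) \<le> norm (\<bar>C\<bar> powr p)"
        using p by (simp add: powr_mono2)
    qed
  qed (use m in measurable)
  with m show ?thesis by (simp add: Lp_space_def)
qed

section \<open>The map, its first derivatives and its Lagrangian angle\<close>

definition sw_alpha :: "nat \<Rightarrow> real" where
  "sw_alpha j = sqrt (real (j\<^sup>2 + j))"

definition sw_map :: "nat \<Rightarrow> complex \<Rightarrow> complex^2" where
  "sw_map j z = vec2 (epw (sw_alpha j) (int j) (sw_fun z) * complex_of_real (sqrt (real j + 1)),
    epw (sw_alpha j) (- int j - 1) (sw_fun z) * (\<i> * complex_of_real (sqrt (real j))))"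

text \<open>The value 1 at the zeros is arbitrary, but \<open>lagrangian_angle\<close> asks for
  modulus 1 everywhere in the disc.\<close>

definition sw_dir :: "complex \<Rightarrow> complex" where
  "sw_dir z = (if sw_fun z = 0 then 1 else sgn (sw_fun z))"

lemma norm_sw_dir: "cmod (sw_dir z) = 1"
  by (simp add: sw_dir_def norm_sgn)

lemma sw_dir_measurable: "sw_dir \<in> borel_measurable (lebesgue_on disc)"
proof -
  have [measurable]: "sw_fun \<in> borel_measurable (lebesgue_on disc)"
    by (rule continuous_imp_measurable_on_sets_lebesgue)
      (auto intro: continuous_on_subset[OF continuous_on_sw_fun disc_subset_slit])
  have "(\<lambda>z. if sw_fun z = 0 then 1 else sw_fun z / of_real (cmod (sw_fun z))) \<in> borel_measurable (lebesgue_on disc)"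
    by measurable
  then show ?thesis by (simp add: sw_dir_def[abs_def] sgn_eq)
qed

context
  fixes j :: nat
  assumes j: "j \<ge> 1"
begin

private definition "\<alpha> = sw_alpha j"
private definition "p = sqrt (real j + 1)"
private definition "q = sqrt (real j)"
text \<open>As \<alpha> = p q with q^2 = j and p^2 = j + 1, the Wirtinger factors (\<alpha> + j) p /
  2 and (\<alpha> + j + 1) q / 2 both equal s, while (\<alpha> - j) p / 2 = t and (\<alpha> - j - 1)
  q / 2 = -t. This coincidence is what makes the mode conformal and Lagrangian.\<close>

private definition "s = \<alpha> * (p + q) / 2"
private definition "t = \<alpha> * (p - q) / 2"

text \<open>j^2 < j^2 + j < (j + 1)^2, so the integer part of the exponent is j. Being above 1, the
  exponent gives a C^1 map with vanishing differential at the zeros of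
  \<open>sw_fun\<close>.\<close>

lemma alpha_bounds: "real j < sw_alpha j" "sw_alpha j < real j + 1" "sw_alpha j > 1"
proof -
  show "real j < sw_alpha j"
    unfolding sw_alpha_def using j by (intro real_less_rsqrt) auto
  show "sw_alpha j < real j + 1"
    unfolding sw_alpha_def using j by (intro real_less_lsqrt) (auto simp: power2_eq_square algebra_simps)
  show "sw_alpha j > 1" using \<open>real j < sw_alpha j\<close> j by linarith
qed

private lemma alpha_eq: "\<alpha> = p * q"
  by (simp add: \<alpha>_def sw_alpha_def p_def q_def power2_eq_square algebra_simps flip: real_sqrt_mult)

private lemma pq: "p\<^sup>2 = real j + 1" "q\<^sup>2 = real j" "p > q" "q > 0"
  using j by (auto simp: p_def q_def)

private lemma alpha_pos: "\<alpha> > 0" using alpha_eq pq by simp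

private lemma st: "s > t" "t > 0"
  using alpha_pos pq by (auto simp: s_def t_def intro!: divide_strict_right_mono)

private definition "A1 z = complex_of_real s * epw (\<alpha> - 1) (int j - 1) (sw_fun z) * sw_fun' z"
private definition "B1 z = complex_of_real t * epw (\<alpha> - 1) (int j + 1) (sw_fun z) * cnj (sw_fun' z)"
private definition "A2 z = - (\<i> * complex_of_real t) * epw (\<alpha> - 1) (- int j - 2) (sw_fun z) * sw_fun' z"
private definition "B2 z = \<i> * complex_of_real s * epw (\<alpha> - 1) (- int j) (sw_fun z) * cnj (sw_fun' z)"

private lemma wirtinger_12:
  assumes z: "z \<in> disc"
  shows "has_wirtinger (\<lambda>z. epw \<alpha> (int j) (sw_fun z) * complex_of_real p) (A1 z) (B1 z) z"
    "has_wirtinger (\<lambda>z. epw \<alpha> (- int j - 1) (sw_fun z) * (\<i> * complex_of_real q)) (A2 z) (B2 z) z"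
proof -
  have a1: "\<alpha> > 1" using alpha_bounds(3) by (simp add: \<alpha>_def)
  have w: "has_wirtinger (\<lambda>z. epw \<alpha> n (sw_fun z)) (of_real ((\<alpha> + n) / 2) * epw (\<alpha> - 1) (n - 1) (sw_fun z) * sw_fun' z)
        (of_real ((\<alpha> - n) / 2) * epw (\<alpha> - 1) (n + 1) (sw_fun z) * cnj (sw_fun' z)) z" for n
    by (rule has_wirtinger_cong[OF has_wirtinger_compose[OF has_wirtinger_epw
            has_wirtinger_holomorphic[OF sw_fun_alg.f_deriv[OF z]]]]) (use a1 in simp_all)
  have e: "(\<alpha> + real j) / 2 * p = s" "(\<alpha> - real j) / 2 * p = t"
    "(\<alpha> - real j - 1) / 2 * q = - t" "(\<alpha> + real j + 1) / 2 * q = s"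
  proof -
    have j1: "real j = q\<^sup>2" "real j + 1 = p\<^sup>2" using pq by auto
    have "(\<alpha> + q\<^sup>2) / 2 * p = s" "(\<alpha> - q\<^sup>2) / 2 * p = t" "(\<alpha> - p\<^sup>2) / 2 * q = - t" "(\<alpha> + p\<^sup>2) / 2 * q = s"
      by (simp_all add: s_def t_def alpha_eq power2_eq_square field_simps)
    then show "(\<alpha> + real j) / 2 * p = s" "(\<alpha> - real j) / 2 * p = t"
      "(\<alpha> - real j - 1) / 2 * q = - t" "(\<alpha> + real j + 1) / 2 * q = s"
      unfolding j1(2)[symmetric] j1(1)[symmetric] by (simp_all add: algebra_simps)
  qed
  have e': "complex_of_real ((\<alpha> + real j) / 2) * of_real p = of_real s" "complex_of_real ((\<alpha> - real j) / 2) * of_real p = of_real t"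
    "complex_of_real ((\<alpha> - real j - 1) / 2) * of_real q = - of_real t" "complex_of_real ((\<alpha> + real j + 1) / 2) * of_real q = of_real s"
    unfolding of_real_mult[symmetric] e by simp_all
  show "has_wirtinger (\<lambda>z. epw \<alpha> (int j) (sw_fun z) * complex_of_real p) (A1 z) (B1 z) z"
    by (rule has_wirtinger_cong[OF has_wirtinger_mult[OF w has_wirtinger_const]])
      (simp_all add: A1_def B1_def e'[symmetric] mult_ac)
  have n: "real_of_int (- int j - 1) = - real j - 1" by simp
  show "has_wirtinger (\<lambda>z. epw \<alpha> (- int j - 1) (sw_fun z) * (\<i> * complex_of_real q)) (A2 z) (B2 z) z"
  proof (rule has_wirtinger_cong[OF has_wirtinger_mult[OF w has_wirtinger_const]])
    have "of_real ((\<alpha> + real_of_int (- int j - 1)) / 2) * of_real q = - complex_of_real t"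
      using e'(3) unfolding n by (simp add: algebra_simps)
    then have "\<i> * (of_real ((\<alpha> + real_of_int (- int j - 1)) / 2) * of_real q) * epw (\<alpha> - 1) (- int j - 2) (sw_fun z) * sw_fun' z = A2 z"
      by (simp only:) (simp add: A2_def)
    moreover have "- int j - 1 - 1 = - int j - 2" by simp
    ultimately show "of_real ((\<alpha> + real_of_int (- int j - 1)) / 2) * epw (\<alpha> - 1) (- int j - 1 - 1) (sw_fun z) * sw_fun' z * (\<i> * complex_of_real q) +
      epw \<alpha> (- int j - 1) (sw_fun z) * 0 = A2 z"
      by (simp only: mult_ac mult_zero_left mult_zero_right add_0_right)
    have "of_real ((\<alpha> - real_of_int (- int j - 1)) / 2) * of_real q = complex_of_real s"
      using e'(4) unfolding n by (simp add: algebra_simps)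
    then have "\<i> * (of_real ((\<alpha> - real_of_int (- int j - 1)) / 2) * of_real q) * epw (\<alpha> - 1) (- int j - 1 + 1) (sw_fun z) * cnj (sw_fun' z) = B2 z"
      by (simp only:) (simp add: B2_def)
    then show "of_real ((\<alpha> - real_of_int (- int j - 1)) / 2) * epw (\<alpha> - 1) (- int j - 1 + 1) (sw_fun z) * cnj (sw_fun' z) * (\<i> * complex_of_real q) +
      epw \<alpha> (- int j - 1) (sw_fun z) * 0 = B2 z"
      by (simp only: mult_ac mult_zero_left mult_zero_right add_0_right)
  qed
qed

private definition "D_sw_map z h = vec2 (A1 z * h + B1 z * cnj h, A2 z * h + B2 z * cnj h)"

private definition "sw_map_x z = vec2 (A1 z + B1 z, A2 z + B2 z)"
private definition "sw_map_y z = vec2 (\<i> * (A1 z - B1 z), \<i> * (A2 z - B2 z))"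

private lemma sw_map_deriv:
  assumes z: "z \<in> disc"
  shows "(sw_map j has_derivative D_sw_map z) (at z)"
  using bounded_linear.has_derivative[OF bounded_linear_vec2
      has_derivative_Pair[OF wirtinger_12[OF z, unfolded has_wirtinger_def]]]
  by (simp add: sw_map_def[abs_def] D_sw_map_def[abs_def] \<alpha>_def p_def q_def)

private lemma AB_in:
  "A1 \<in> epw_sums sw_fun flat_gens (\<alpha> - 1)" "B1 \<in> epw_sums sw_fun flat_gens (\<alpha> - 1)"
  "A2 \<in> epw_sums sw_fun flat_gens (\<alpha> - 1)" "B2 \<in> epw_sums sw_fun flat_gens (\<alpha> - 1)"
proof -
  have "(\<lambda>z. k * (epw (\<alpha> - 1) n (sw_fun z) * sw_fun' z)) \<in> epw_sums sw_fun flat_gens (\<alpha> - 1)"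
    "(\<lambda>z. k * (epw (\<alpha> - 1) n (sw_fun z) * cnj (sw_fun' z))) \<in> epw_sums sw_fun flat_gens (\<alpha> - 1)" for k n
    by (intro epw_sums_cmult epw_sums_term sw_fun_alg.f' star_alg_cnj)+
  then show "A1 \<in> epw_sums sw_fun flat_gens (\<alpha> - 1)" "B1 \<in> epw_sums sw_fun flat_gens (\<alpha> - 1)"
    "A2 \<in> epw_sums sw_fun flat_gens (\<alpha> - 1)" "B2 \<in> epw_sums sw_fun flat_gens (\<alpha> - 1)"
    unfolding A1_def[abs_def] B1_def[abs_def] A2_def[abs_def] B2_def[abs_def] mult.assoc[of _ "epw _ _ _"]
    by blast+
qed

private lemma am1: "\<alpha> - 1 > 0" using alpha_bounds(3) by (simp add: \<alpha>_def)

private lemma AB_cont: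
  "continuous_on disc A1" "continuous_on disc B1" "continuous_on disc A2" "continuous_on disc B2"
  using AB_in by (auto intro: sw_fun_alg.epw_sums_continuous[OF am1])

private lemma continuous_on_vec2:
  assumes "continuous_on S a" "continuous_on S b"
  shows "continuous_on S (\<lambda>z. vec2 (a z, b z))"
  by (rule bounded_linear.continuous_on[OF bounded_linear_vec2]) (intro continuous_on_Pair assms)

private lemma sw_map_weak_gradient: "weak_gradient disc (sw_map j) sw_map_x sw_map_y"
proof -
  have "weak_partial disc v (sw_map j) (\<lambda>z. D_sw_map z v)" if "v \<in> Basis" for v
    using that
    by (intro weak_partial_C1 sw_map_deriv)
      (auto simp: D_sw_map_def intro!: continuous_on_vec2 continuous_intros AB_cont)
  from this[of 1] this[of \<i>] show ?thesis
    by (simp add: weak_gradient_def Basis_complex_def D_sw_map_def sw_map_x_def[abs_def] sw_map_y_def[abs_def] algebra_simps)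
qed

private lemma vec2_Lp:
  assumes a: "a \<in> epw_sums sw_fun flat_gens r" and b: "b \<in> epw_sums sw_fun flat_gens r" and r: "r > 0" and e: "e > 0"
  shows "(\<lambda>z. vec2 (a z, b z)) \<in> Lp_space e disc"
proof -
  from sw_fun_alg.epw_sums_bounded[OF r a] sw_fun_alg.epw_sums_bounded[OF r b] obtain C D
    where "\<forall>z\<in>disc. cmod (a z) \<le> C" "\<forall>z\<in>disc. cmod (b z) \<le> D" by blast
  then have "norm (vec2 (a z, b z)) \<le> C + D" if "z \<in> disc" for z
    using that norm_vec2_le[of "a z" "b z"] by fastforce
  then show ?thesis
    using sw_fun_alg.epw_sums_continuous[OF r a] sw_fun_alg.epw_sums_continuous[OF r b] e
    by (intro bounded_continuous_in_Lp_space[where C="C + D"] continuous_on_vec2)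
qed

private lemma sw_map_comp_in:
  "(\<lambda>z. epw (sw_alpha j) (int j) (sw_fun z) * complex_of_real (sqrt (real j + 1))) \<in> epw_sums sw_fun flat_gens (sw_alpha j)"
  "(\<lambda>z. epw (sw_alpha j) (- int j - 1) (sw_fun z) * (\<i> * complex_of_real (sqrt (real j)))) \<in> epw_sums sw_fun flat_gens (sw_alpha j)"
  by (intro epw_sums_term star_alg_const)+

private lemma sw_map_sobolev:
  assumes e: "e > 0"
  shows "sobolev_gradient e disc (sw_map j) sw_map_x sw_map_y"
proof -
  have 1: "sw_map j \<in> Lp_space e disc"
    unfolding sw_map_def[abs_def]
    by (rule vec2_Lp[OF sw_map_comp_in _ e]) (use alpha_bounds(3) in simp)
  have m: "(\<lambda>z. (- 1) * u z) \<in> epw_sums sw_fun flat_gens (\<alpha> - 1)" if "u \<in> epw_sums sw_fun flat_gens (\<alpha> - 1)" for u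
    by (rule epw_sums_cmult[OF that])
  have 2: "sw_map_x \<in> Lp_space e disc"
    unfolding sw_map_x_def[abs_def] by (intro vec2_Lp[OF _ _ am1 e] epw_sums_add AB_in)
  have "(\<lambda>z. vec2 (\<i> * (A1 z + (- 1) * B1 z), \<i> * (A2 z + (- 1) * B2 z))) \<in> Lp_space e disc"
    by (intro vec2_Lp[OF _ _ am1 e] epw_sums_cmult epw_sums_add AB_in m)
  then have 3: "sw_map_y \<in> Lp_space e disc"
    by (simp add: sw_map_y_def[abs_def])
  show ?thesis using 1 2 3 sw_map_weak_gradient by (simp add: sobolev_gradient_def)
qed

text \<open>All four derivatives have modulus |f|^(\<alpha>-1) |f'| times s, t, t, s. In the first
  relation the two products carry the same phase and the coefficients s t and - s t. In the second
  the squares cancel in pairs. In the third the phases (j + 1) + (- j - 2) and (j - 1) + (- j) are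
  both -1, which is the conjugate of g.\<close>

private lemma AB_rel:
  "A1 z * cnj (B1 z) + A2 z * cnj (B2 z) = 0"
  "(cmod (A1 z))\<^sup>2 - (cmod (B1 z))\<^sup>2 + (cmod (A2 z))\<^sup>2 - (cmod (B2 z))\<^sup>2 = 0"
  "2 * \<i> * (B1 z * A2 z - A1 z * B2 z) = of_real ((cmod (A1 z))\<^sup>2 + (cmod (B1 z))\<^sup>2 + (cmod (A2 z))\<^sup>2 + (cmod (B2 z))\<^sup>2) * cnj (sw_dir z)"
proof -
  define e where "e n = epw (\<alpha> - 1) n (sw_fun z)" for n
  define E where "E n = epw (\<alpha> - 1 + (\<alpha> - 1)) n (sw_fun z)" for n
  have ee: "e n * cnj (e m) = E (n - m)" "e n * e m = E (n + m)" for n m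
    by (simp_all add: e_def E_def epw_mult_cnj_epw epw_mult)
  have n: "cmod (e n) = cmod (sw_fun z) powr (\<alpha> - 1)" for n by (simp add: e_def norm_epw)
  have A: "A1 z = of_real s * e (int j - 1) * sw_fun' z" "B1 z = of_real t * e (int j + 1) * cnj (sw_fun' z)"
    "A2 z = - (\<i> * of_real t) * e (- int j - 2) * sw_fun' z" "B2 z = \<i> * of_real s * e (- int j) * cnj (sw_fun' z)"
    by (simp_all add: A1_def B1_def A2_def B2_def e_def)
  have "A1 z * cnj (B1 z) = of_real (s * t) * (e (int j - 1) * cnj (e (int j + 1))) * (sw_fun' z)\<^sup>2"
    by (simp add: A power2_eq_square mult_ac)
  moreover have "A2 z * cnj (B2 z) = - of_real (s * t) * (e (- int j - 2) * cnj (e (- int j))) * (sw_fun' z)\<^sup>2"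
    by (simp add: A power2_eq_square mult_ac) 
  ultimately show "A1 z * cnj (B1 z) + A2 z * cnj (B2 z) = 0" by (simp add: ee)
  define N where "N = (cmod (sw_fun z) powr (\<alpha> - 1) * cmod (sw_fun' z))\<^sup>2"
  have sq: "(cmod (A1 z))\<^sup>2 = s\<^sup>2 * N" "(cmod (B1 z))\<^sup>2 = t\<^sup>2 * N"
    "(cmod (A2 z))\<^sup>2 = t\<^sup>2 * N" "(cmod (B2 z))\<^sup>2 = s\<^sup>2 * N"
    unfolding A norm_mult norm_minus_cancel n by (simp_all add: N_def power_mult_distrib)
  then show "(cmod (A1 z))\<^sup>2 - (cmod (B1 z))\<^sup>2 + (cmod (A2 z))\<^sup>2 - (cmod (B2 z))\<^sup>2 = 0" by simp
  have m: "sw_fun' z * cnj (sw_fun' z) = of_real ((cmod (sw_fun' z))\<^sup>2)"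
    using complex_norm_square[of "sw_fun' z"] by simp
  have "B1 z * A2 z = - (\<i> * of_real (t\<^sup>2)) * (e (int j + 1) * e (- int j - 2)) * (sw_fun' z * cnj (sw_fun' z))"
    by (simp add: A power2_eq_square mult_ac)
  moreover have "A1 z * B2 z = \<i> * of_real (s\<^sup>2) * (e (int j - 1) * e (- int j)) * (sw_fun' z * cnj (sw_fun' z))"
    by (simp add: A power2_eq_square mult_ac)
  ultimately have "2 * \<i> * (B1 z * A2 z - A1 z * B2 z) = 2 * of_real (s\<^sup>2 + t\<^sup>2) * E (- 1) * of_real ((cmod (sw_fun' z))\<^sup>2)"
    unfolding m by (simp add: ee algebra_simps)
  also have "E (- 1) = of_real ((cmod (sw_fun z) powr (\<alpha> - 1))\<^sup>2) * cnj (sw_dir z)"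
  proof (cases "sw_fun z = 0")
    case False
    then have "cnj (sgn (sw_fun z)) = inverse (sgn (sw_fun z))"
      using complex_norm_square[of "sgn (sw_fun z)"] by (simp add: norm_sgn sgn_zero_iff field_simps)
    moreover have "cmod (sw_fun z) powr (\<alpha> - 1 + (\<alpha> - 1)) = (cmod (sw_fun z) powr (\<alpha> - 1))\<^sup>2"
      by (simp only: powr_add power2_eq_square)
    ultimately show ?thesis
      using False by (simp only: E_def epw_def sw_dir_def if_False power_int_minus power_int_1_right)
  qed (simp add: E_def)
  also have "2 * of_real (s\<^sup>2 + t\<^sup>2) * (of_real ((cmod (sw_fun z) powr (\<alpha> - 1))\<^sup>2) * cnj (sw_dir z)) * of_real ((cmod (sw_fun' z))\<^sup>2)
      = complex_of_real (2 * (s\<^sup>2 + t\<^sup>2) * N) * cnj (sw_dir z)"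
    by (simp add: N_def power_mult_distrib mult_ac)
  finally show "2 * \<i> * (B1 z * A2 z - A1 z * B2 z) = of_real ((cmod (A1 z))\<^sup>2 + (cmod (B1 z))\<^sup>2 + (cmod (A2 z))\<^sup>2 + (cmod (B2 z))\<^sup>2) * cnj (sw_dir z)"
    unfolding sq by (simp add: algebra_simps)
qed

lemma sw_map_lagrangian: "lagrangian (sw_map j)"
  unfolding lagrangian_def
  by (intro exI[of _ sw_map_x] exI[of _ sw_map_y] conjI sw_map_sobolev AE_I2)
    (simp_all add: sw_map_x_def sw_map_y_def wirtinger_omega AB_rel)

lemma sw_map_weakly_conformal: "weakly_conformal (sw_map j)"
  unfolding weakly_conformal_def
proof (rule exI[of _ sw_map_x], rule exI[of _ sw_map_y], intro conjI sw_map_sobolev AE_I2)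
  show "sw_map_x z \<bullet> sw_map_y z = 0" "(norm (sw_map_x z))\<^sup>2 = (norm (sw_map_y z))\<^sup>2" for z
    unfolding sw_map_x_def sw_map_y_def by (rule wirtinger_conformal[OF AB_rel(1)])+
qed simp

lemma sw_map_lagrangian_angle: "lagrangian_angle (sw_map j) (\<lambda>z. cnj (sw_dir z))"
  unfolding lagrangian_angle_def
proof (intro conjI sw_map_lagrangian sw_map_weakly_conformal ballI)
  show "(\<lambda>z. cnj (sw_dir z)) \<in> borel_measurable (lebesgue_on disc)"
    by (rule measurable_compose[OF sw_dir_measurable
          borel_measurable_continuous_onI[OF continuous_on_cnj[OF continuous_on_id]]])
  show "\<exists>\<Phi>x \<Phi>y. sobolev_gradient 2 disc (sw_map j) \<Phi>x \<Phi>y \<and>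
     (AE z in lebesgue_on disc. dz1_dz2 (\<Phi>x z) (\<Phi>y z) = complex_of_real ((norm (\<Phi>x z))\<^sup>2) * cnj (sw_dir z))"
  proof (rule exI[of _ sw_map_x], rule exI[of _ sw_map_y], intro conjI sw_map_sobolev AE_I2)
    show "dz1_dz2 (sw_map_x z) (sw_map_y z) = complex_of_real ((norm (sw_map_x z))\<^sup>2) * cnj (sw_dir z)" for z
      unfolding sw_map_x_def sw_map_y_def wirtinger_dz1_dz2 wirtinger_conformal(3)[OF AB_rel(1)]
      by (rule AB_rel(3))
  qed simp
qed (simp add: norm_sw_dir)

text \<open>The first component alone suffices: s > t > 0 gives |A1| > |B1|, so h -> A1 h + B1 cnj h
  has no kernel.\<close>

private lemma D_sw_map_inj:
  assumes "sw_fun z \<noteq> 0" "sw_fun' z \<noteq> 0"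
  shows "inj (D_sw_map z)"
proof (rule injI)
  fix h k assume "D_sw_map z h = D_sw_map z k"
  then have "A1 z * h + B1 z * cnj h = A1 z * k + B1 z * cnj k"
    unfolding D_sw_map_def by (metis vec2_nth(1))
  then have "A1 z * (h - k) = - (B1 z * cnj (h - k))" by (simp add: algebra_simps)
  then have "cmod (A1 z) * cmod (h - k) = cmod (B1 z) * cmod (h - k)"
    by (metis complex_mod_cnj norm_minus_cancel norm_mult)
  moreover have "cmod (B1 z) < cmod (A1 z)"
    unfolding A1_def B1_def norm_mult norm_epw using assms st by (simp add: mult_strict_right_mono)
  ultimately show "h = k" by auto
qed

lemma sw_map_immersed_at:
  assumes "z \<in> disc" "sw_fun z \<noteq> 0" "sw_fun' z \<noteq> 0"
  shows "immersed_at (sw_map j) z"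
  using D_sw_map_inj[OF assms(2,3)] sw_map_deriv[OF assms(1)] frechet_derivative_at[OF sw_map_deriv[OF assms(1)]]
  by (auto simp: immersed_at_def differentiable_def)

lemma sw_map_critical_iff:
  assumes z: "z \<in> disc"
  shows "(sw_map j has_derivative (\<lambda>_. 0)) (at z) \<longleftrightarrow> sw_fun z = 0 \<or> sw_fun' z = 0"
proof
  assume "(sw_map j has_derivative (\<lambda>_. 0)) (at z)"
  then have "D_sw_map z = (\<lambda>_. 0)" using sw_map_deriv[OF z] has_derivative_unique by blast
  then have "\<not> inj (D_sw_map z)" by (metis injD zero_neq_one)
  then show "sw_fun z = 0 \<or> sw_fun' z = 0" using D_sw_map_inj by blast
next
  assume "sw_fun z = 0 \<or> sw_fun' z = 0"
  then have "A1 z = 0" "B1 z = 0" "A2 z = 0" "B2 z = 0"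
    by (auto simp: A1_def B1_def A2_def B2_def)
  then have "D_sw_map z = (\<lambda>_. 0)" 
    using linear_0[OF bounded_linear.linear[OF bounded_linear_vec2]] by (simp add: D_sw_map_def[abs_def] zero_prod_def)
  then show "(sw_map j has_derivative (\<lambda>_. 0)) (at z)" using sw_map_deriv[OF z] by simp
qed

text \<open>Grade k means that k derivatives may still be taken. At grade 0 the exponent is \<alpha>
  - j, which lies in (0, 1) and is the Hoelder exponent of the derivatives of order j.\<close>

private definition "sw_class k u \<longleftrightarrow> (\<exists>a\<in>epw_sums sw_fun flat_gens (\<alpha> - j + real k). \<exists>b\<in>epw_sums sw_fun flat_gens (\<alpha> - j + real k).
  u = (\<lambda>z. vec2 (a z, b z)))"

private lemma aj: "0 < \<alpha> - j" "\<alpha> - j < 1" using alpha_bounds by (auto simp: \<alpha>_def)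

private lemma sw_class_step:
  assumes u: "sw_class (Suc k) u"
  shows "\<exists>u'. sw_class k u' \<and> (\<forall>z\<in>disc. \<exists>D. (u has_derivative D) (at z) \<and> D v = u' z)"
proof -
  let ?s = "\<alpha> - j + real (Suc k)"
  have s: "?s > 1" using aj by simp
  from u obtain a b where ab: "a \<in> epw_sums sw_fun flat_gens ?s" "b \<in> epw_sums sw_fun flat_gens ?s"
    and u: "u = (\<lambda>z. vec2 (a z, b z))" unfolding sw_class_def by blast
  from sw_fun_alg.epw_sums_has_wirtinger[OF s ab(1)] obtain a1 a2 where
    a: "a1 \<in> epw_sums sw_fun flat_gens (?s - 1)" "a2 \<in> epw_sums sw_fun flat_gens (?s - 1)"
      "\<And>z. z \<in> disc \<Longrightarrow> has_wirtinger a (a1 z) (a2 z) z" by blast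
  from sw_fun_alg.epw_sums_has_wirtinger[OF s ab(2)] obtain b1 b2 where
    b: "b1 \<in> epw_sums sw_fun flat_gens (?s - 1)" "b2 \<in> epw_sums sw_fun flat_gens (?s - 1)"
      "\<And>z. z \<in> disc \<Longrightarrow> has_wirtinger b (b1 z) (b2 z) z" by blast
  have s1: "?s - 1 = \<alpha> - j + real k" by simp
  let ?u = "\<lambda>z. vec2 (v * a1 z + cnj v * a2 z, v * b1 z + cnj v * b2 z)"
  have "sw_class k ?u"
    unfolding sw_class_def s1[symmetric]
    by (intro bexI[of _ "\<lambda>z. v * a1 z + cnj v * a2 z"] bexI[of _ "\<lambda>z. v * b1 z + cnj v * b2 z"]
        epw_sums_add epw_sums_cmult a b refl)
  moreover have "\<exists>D. (u has_derivative D) (at z) \<and> D v = ?u z" if z: "z \<in> disc" for z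
    unfolding u
    by (rule exI, rule conjI, rule bounded_linear.has_derivative[OF bounded_linear_vec2
          has_derivative_Pair[OF a(3)[OF z, unfolded has_wirtinger_def] b(3)[OF z, unfolded has_wirtinger_def]]])
      (simp add: mult.commute)
  ultimately show ?thesis by blast
qed

private lemma sw_class_cont:
  assumes "sw_class k u"
  shows "continuous_on disc u"
proof -
  have "\<alpha> - j + real k > 0" using aj by simp
  with assms show ?thesis
    unfolding sw_class_def by (auto intro!: continuous_on_vec2 sw_fun_alg.epw_sums_continuous)
qed

private lemma sw_class_sw_map: "sw_class j (sw_map j)"
proof -
  have "\<alpha> - j + real j = sw_alpha j" by (simp add: \<alpha>_def)
  then show ?thesis
    unfolding sw_class_def using sw_map_comp_in by (auto simp: sw_map_def[abs_def])
qed

lemma sw_map_Ck_on: "Ck_on j disc (sw_map j)"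
  by (rule Ck_on_graded[where P=sw_class]) (auto intro: sw_class_step sw_class_cont sw_class_sw_map)

lemma sw_map_holder_space: "sw_map j \<in> holder_space (sqrt (real (j\<^sup>2 + j))) disc"
proof -
  have fl: "\<lfloor>sqrt (real (j\<^sup>2 + j))\<rfloor> = int j"
    using alpha_bounds unfolding sw_alpha_def by (simp add: floor_eq_iff)
  have agree: "\<exists>u'. sw_class k u' \<and> (\<forall>z\<in>disc. iter_partial vs (sw_map j) z = u' z)"
    if "vs \<in> lists Basis" "j = k + length vs" for vs :: "complex list" and k
  proof (rule iter_partial_graded[where P=sw_class, OF open_ball sw_class_step that(1)])
    show "sw_class (k + length vs) (sw_map j)"
      unfolding that(2)[symmetric] by (rule sw_class_sw_map)
  qed
  have 1: "bounded (iter_partial vs (sw_map j) ` disc)" if vs: "vs \<in> lists Basis" "length vs \<le> j" for vs :: "complex list"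
  proof -
    obtain k where k: "j = k + length vs" using vs(2) by (metis le_add_diff_inverse2)
    from agree[OF vs(1) k] obtain a b where ab: "a \<in> epw_sums sw_fun flat_gens (\<alpha> - j + real k)"
      "b \<in> epw_sums sw_fun flat_gens (\<alpha> - j + real k)"
      "\<And>z. z \<in> disc \<Longrightarrow> iter_partial vs (sw_map j) z = vec2 (a z, b z)" unfolding sw_class_def by auto
    have pos: "\<alpha> - j + real k > 0" using aj by simp
    from sw_fun_alg.epw_sums_bounded[OF pos ab(1)] sw_fun_alg.epw_sums_bounded[OF pos ab(2)] obtain C D
      where CD: "\<forall>z\<in>disc. cmod (a z) \<le> C" "\<forall>z\<in>disc. cmod (b z) \<le> D" by blast
    have "norm (iter_partial vs (sw_map j) z) \<le> C + D" if "z \<in> disc" for z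
      using that CD norm_vec2_le[of "a z" "b z"] ab(3)[OF that] by fastforce
    then show ?thesis unfolding bounded_iff by (intro exI[of _ "C + D"]) blast
  qed
  have 2: "holder_continuous_on (\<alpha> - j) disc (iter_partial vs (sw_map j))"
    if vs: "vs \<in> lists Basis" "length vs = j" for vs :: "complex list"
  proof -
    from agree[OF vs(1), of 0] vs(2) obtain a b where ab: "a \<in> epw_sums sw_fun flat_gens (\<alpha> - j)"
      "b \<in> epw_sums sw_fun flat_gens (\<alpha> - j)"
      "\<And>z. z \<in> disc \<Longrightarrow> iter_partial vs (sw_map j) z = vec2 (a z, b z)" unfolding sw_class_def by auto
    have d2: "dist x y \<le> 2" if "x \<in> disc" "y \<in> disc" for x y :: complex
      using that dist_triangle2[of x y 0] by (auto simp: dist_commute)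
    from sw_fun_alg.epw_sums_holder[OF aj ab(1) d2] sw_fun_alg.epw_sums_holder[OF aj ab(2) d2] obtain A B where
      AB: "\<forall>x\<in>disc. \<forall>y\<in>disc. dist (a x) (a y) \<le> A * dist x y powr (\<alpha> - j)"
        "\<forall>x\<in>disc. \<forall>y\<in>disc. dist (b x) (b y) \<le> B * dist x y powr (\<alpha> - j)"
      unfolding holder_continuous_on_def by blast
    have "dist (iter_partial vs (sw_map j) x) (iter_partial vs (sw_map j) y) \<le> (A + B) * dist x y powr (\<alpha> - j)"
      if "x \<in> disc" "y \<in> disc" for x y
    proof -
      have "vec2 (a x, b x) - vec2 (a y, b y) = vec2 (a x - a y, b x - b y)"
        using linear_diff[OF bounded_linear.linear[OF bounded_linear_vec2], of "(a x, b x)" "(a y, b y)"] by simp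
      then have "dist (iter_partial vs (sw_map j) x) (iter_partial vs (sw_map j) y) \<le> dist (a x) (a y) + dist (b x) (b y)"
        using norm_vec2_le[of "a x - a y" "b x - b y"] that by (simp add: ab(3) dist_norm)
      also have "\<dots> \<le> A * dist x y powr (\<alpha> - j) + B * dist x y powr (\<alpha> - j)"
        using AB that by (intro add_mono) auto
      finally show ?thesis by (simp add: algebra_simps)
    qed
    then show ?thesis unfolding holder_continuous_on_def by blast
  qed
  show ?thesis
    unfolding holder_space_def mem_Collect_eq fl
    using sw_map_Ck_on 1 2 by (simp add: \<alpha>_def sw_alpha_def)
qed

end

section \<open>Integrability of the logarithmic derivative\<close>

lemma zeta_zero_pt: "zeta (zero_pt n) = - complex_of_real (2 * pi * n)"
proof -
  have "zeta (zero_pt n) = of_real (ln (zero_gap n))"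
    by (simp add: zeta_def zero_pt_def zero_gap_def Ln_of_real)
  then show ?thesis by (simp add: zero_gap_def)
qed

lemma zero_gap_bounds: "0 < zero_gap n" "zero_gap n \<le> 1"
  by (simp_all add: zero_gap_def)

lemma zero_pt_in_disc: "zero_pt n \<in> disc"
proof -
  have "cmod (zero_pt n) = \<bar>1 - zero_gap n\<bar>"
    unfolding zero_pt_def by (metis norm_of_real of_real_1 of_real_diff)
  then show ?thesis using zero_gap_bounds[of n] by simp
qed

lemma sw_fun_zero_pt: "sw_fun (zero_pt n) = 0"
proof -
  have "\<i> * zeta (zero_pt n) = - (of_nat n * (2 * of_real pi * \<i>))"
    by (simp add: zeta_zero_pt)
  then have "exp (\<i> * zeta (zero_pt n)) = 1"
    by (simp only: exp_minus exp_of_nat_mult exp_two_pi_i power_one inverse_1)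
  then show ?thesis by (simp add: sw_fun_eq_0_iff)
qed

text \<open>A zero forces zeta = 2 pi k with k an integer, and |1 - z| \<le> 2 gives 2 pi k \<le> ln
  2 < 1, which leaves only k \<le> 0.\<close>

lemma disc_sw_fun_eq_0:
  assumes z: "z \<in> disc" and f: "sw_fun z = 0"
  shows "z \<in> range zero_pt"
proof -
  have z1: "z \<noteq> 1" using z by auto
  have "exp (\<i> * zeta z) = 1" using f by (simp add: sw_fun_eq_0_iff)
  then obtain k :: int where k: "Re (\<i> * zeta z) = 0" "Im (\<i> * zeta z) = of_int (2 * k) * pi"
    by (auto simp: exp_eq_1)
  then have zk: "zeta z = of_real (2 * pi * k)" by (simp add: complex_eq_iff)
  have "cmod (1 - z) \<le> 2" using norm_triangle_ineq4[of 1 z] z by simp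
  then have "Re (zeta z) \<le> ln 2" using z1 by (simp add: Re_zeta)
  also have "ln 2 < (1::real)" using ln_2_less_1 .
  finally have lt: "2 * pi * k < 1" by (simp add: zk)
  have "k \<le> 0"
  proof (rule ccontr)
    assume "\<not> k \<le> 0"
    then have "2 * pi * 1 \<le> 2 * pi * real_of_int k" by (intro mult_left_mono) auto
    with lt pi_gt3 show False by linarith
  qed
  define n where "n = nat (- k)"
  have "real_of_int k = - real n" using \<open>k \<le> 0\<close> by (simp add: n_def)
  then have "1 - z = of_real (zero_gap n)"
    using exp_zeta[OF z1] by (simp add: zk zero_gap_def flip: exp_of_real)
  then show ?thesis by (auto simp: zero_pt_def algebra_simps intro!: image_eqI[of _ _ n])
qed

lemma inj_zero_pt: "inj zero_pt"
  by (rule injI) (simp add: zero_pt_def zero_gap_def)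

text \<open>Near the n-th zero, with gap r and distance d from it, 1 / |1 - z| is at most C / r and
  \<open>sw_quot\<close> at most C r / d. The bounded terms are absorbed through 1 \<le> C r / d,
  and the factor 1 + n comes from zeta. The three summands together give the constant 2 C^2 + 2
  C^3.\<close>

lemma sw_logderiv_estimate:
  obtains C where "C \<ge> 1"
    "\<And>z. z \<in> disc - range zero_pt \<Longrightarrow> \<exists>n. cmod (z - zero_pt n) \<le> C * zero_gap n \<and> cmod (1 - z) \<le> C * zero_gap n
      \<and> cmod (sw_quot z) \<le> C * zero_gap n / cmod (z - zero_pt n) \<and> cmod (sw_logderiv z) \<le> C * (1 + real n) / cmod (z - zero_pt n)"
proof -
  obtain C where C: "C \<ge> 1" "\<And>z. z \<in> disc \<Longrightarrow> \<exists>n. cmod (z - zero_pt n) \<le> C * zero_gap n \<and> zero_gap n \<le> C * cmod (1 - z)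
      \<and> cmod (1 - z) \<le> C * zero_gap n
      \<and> cmod (sw_quot z) \<le> C * zero_gap n / cmod (z - zero_pt n) \<and> cmod (zeta z) \<le> C * (1 + real n)"
    by (rule disc_estimate) blast
  define B where "B = 2 * C ^ 2 + 2 * C ^ 3"
  have CC: "1 \<le> C * C" using mult_mono[OF C(1) C(1)] C(1) by simp
  then have CB: "C \<le> B"
  proof -
    have "C * 1 \<le> C * C" using C(1) by (intro mult_left_mono) auto
    then have "C \<le> C ^ 2" by (simp add: power2_eq_square)
    moreover have "0 \<le> C ^ 2" "0 \<le> C ^ 3" using C(1) by simp_all
    ultimately show ?thesis unfolding B_def by linarith
  qed
  have "\<exists>n. cmod (z - zero_pt n) \<le> B * zero_gap n \<and> cmod (1 - z) \<le> B * zero_gap n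
      \<and> cmod (sw_quot z) \<le> B * zero_gap n / cmod (z - zero_pt n) \<and> cmod (sw_logderiv z) \<le> B * (1 + real n) / cmod (z - zero_pt n)"
    if z: "z \<in> disc - range zero_pt" for z
  proof -
    from C(2) z obtain n where n: "cmod (z - zero_pt n) \<le> C * zero_gap n" "zero_gap n \<le> C * cmod (1 - z)"
      "cmod (1 - z) \<le> C * zero_gap n" "cmod (sw_quot z) \<le> C * zero_gap n / cmod (z - zero_pt n)" "cmod (zeta z) \<le> C * (1 + real n)"
      by blast
    define d where "d = cmod (z - zero_pt n)"
    have d: "d > 0" using z by (auto simp: d_def)
    have q: "zero_gap n > 0" by (rule zero_gap_bounds)
    have w: "cmod (1 - z) > 0" using z by auto
    have one: "1 \<le> C * zero_gap n / d" using n(1) d by (simp add: d_def)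
    have le: "C * zero_gap n \<le> B * zero_gap n" using CB q by (intro mult_right_mono) auto
    have "cmod (sw_logderiv z) = (1 / cmod (1 - z)) * cmod (\<i> * (1 + sw_quot z) + (- 2) * zeta z)"
      unfolding sw_logderiv_def norm_mult by (simp add: norm_divide)
    also have "\<dots> \<le> (C / zero_gap n) * (C * zero_gap n / d + C * zero_gap n / d + 2 * (C * (1 + real n) * (C * zero_gap n / d)))"
    proof (intro mult_mono)
      show "1 / cmod (1 - z) \<le> C / zero_gap n" using n(2) q w by (simp add: field_simps)
      have "cmod (\<i> * (1 + sw_quot z) + (- 2) * zeta z) \<le> cmod (\<i> * (1 + sw_quot z)) + cmod ((- 2) * zeta z)"
        by (rule norm_triangle_ineq)
      also have "\<dots> \<le> 1 + cmod (sw_quot z) + 2 * cmod (zeta z)"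
        using norm_triangle_ineq[of 1 "sw_quot z"] by (simp add: norm_mult)
      also have "\<dots> \<le> C * zero_gap n / d + C * zero_gap n / d + 2 * (C * (1 + real n) * (C * zero_gap n / d))"
      proof (intro add_mono one mult_left_mono)
        show "cmod (sw_quot z) \<le> C * zero_gap n / d" using n(4) by (simp add: d_def)
        have "cmod (zeta z) * 1 \<le> C * (1 + real n) * (C * zero_gap n / d)"
          by (intro mult_mono n(5) one) (use C(1) in auto)
        then show "cmod (zeta z) \<le> C * (1 + real n) * (C * zero_gap n / d)" by simp
      qed simp
      finally show "cmod (\<i> * (1 + sw_quot z) + (- 2) * zeta z)
        \<le> C * zero_gap n / d + C * zero_gap n / d + 2 * (C * (1 + real n) * (C * zero_gap n / d))" .
    qed (use C(1) q in auto)
    also have "\<dots> = (2 * C ^ 2 + 2 * C ^ 3 * (1 + real n)) / d"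
      using q d by (simp add: field_simps power2_eq_square power3_eq_cube)
    also have "\<dots> \<le> (B * (1 + real n)) / d"
    proof (intro divide_right_mono)
      have "2 * C ^ 2 * 1 \<le> 2 * C ^ 2 * (1 + real n)" by (intro mult_left_mono) auto
      then show "2 * C ^ 2 + 2 * C ^ 3 * (1 + real n) \<le> B * (1 + real n)"
        unfolding B_def distrib_right[of _ _ "1 + real n"] by simp
    qed (use d in simp)
    finally have L: "cmod (sw_logderiv z) \<le> B * (1 + real n) / cmod (z - zero_pt n)" by (simp add: d_def)
    have "cmod (sw_quot z) \<le> B * zero_gap n / cmod (z - zero_pt n)"
      by (rule order_trans[OF n(4) divide_right_mono[OF le]]) simp
    then show ?thesis
      using n(1,3) le L by (intro exI[of _ n] conjI) linarith+
  qed
  moreover have "B \<ge> 1" using CB C(1) by linarith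
  ultimately show ?thesis using that by blast
qed

lemma countable_range_zero_pt: "countable (range zero_pt)" by simp

lemma zeta_measurable: "zeta \<in> borel_measurable (lebesgue_on disc)"
proof (rule continuous_imp_measurable_on_sets_lebesgue)
  have "isCont zeta z" if "z \<in> disc" for z
    using zeta_deriv[of z] disc_subset_slit that DERIV_isCont by blast
  then show "continuous_on disc zeta" by (simp add: continuous_at_imp_continuous_on)
qed simp

lemma sw_quot_measurable: "sw_quot \<in> borel_measurable (lebesgue_on disc)"
  unfolding sw_quot_def[abs_def] using zeta_measurable by measurable

lemma sw_logderiv_measurable: "sw_logderiv \<in> borel_measurable (lebesgue_on disc)"
proof -
  have [measurable]: "(\<lambda>z. z) \<in> borel_measurable (lebesgue_on disc)"
    by (rule continuous_imp_measurable_on_sets_lebesgue) auto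
  show ?thesis
    unfolding sw_logderiv_def[abs_def] using zeta_measurable sw_quot_measurable by measurable
qed

text \<open>The gaps contribute exp (- 2 k n) with k = pi (2 - p). One half of this decay absorbs
  the polynomial factor (1 + n)^p \<le> (1 + n)^2, the other half is a geometric series.\<close>

lemma kernel_summable:
  assumes p: "0 < p" "p < 2" and C: "C \<ge> 0"
  shows "summable (\<lambda>n. (C * (1 + real n)) powr p * (C * zero_gap n) powr (2 - p))"
proof -
  define k where "k = pi * (2 - p)"
  have k: "k > 0" using p by (simp add: k_def)
  have bound: "(C * (1 + real n)) powr p * (C * zero_gap n) powr (2 - p)
      \<le> (C powr p * C powr (2 - p) * (4 * exp k / k\<^sup>2)) * exp (- k) ^ n" for n
  proof -
    have "(1 + real n) powr p \<le> (1 + real n) powr 2"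
      using p by (intro powr_mono) auto
    also have "\<dots> = (1 + real n)\<^sup>2" by (simp add: powr_numeral)
    also have "\<dots> = (k * (1 + real n))\<^sup>2 / k\<^sup>2" using k by (simp add: power_mult_distrib)
    also have "\<dots> \<le> (4 * exp (k * (1 + real n))) / k\<^sup>2"
      using power_le_exp[of "k * (1 + real n)" 2] k by (intro divide_right_mono) auto
    finally have 1: "(1 + real n) powr p \<le> 4 * exp (k * (1 + real n)) / k\<^sup>2" .
    have 2: "zero_gap n powr (2 - p) = exp (- (2 * k * n))"
      by (simp add: zero_gap_def powr_def k_def algebra_simps)
    have "(C * (1 + real n)) powr p * (C * zero_gap n) powr (2 - p)
        = (C powr p * C powr (2 - p)) * ((1 + real n) powr p * zero_gap n powr (2 - p))"
      using C zero_gap_bounds(1)[of n] by (simp add: powr_mult)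
    also have "\<dots> \<le> (C powr p * C powr (2 - p)) * ((4 * exp (k * (1 + real n)) / k\<^sup>2) * exp (- (2 * k * n)))"
      unfolding 2 by (intro mult_left_mono mult_right_mono 1) auto
    also have "exp (k * (1 + real n)) * exp (- (2 * k * n)) = exp k * exp (- k) ^ n"
      by (simp add: algebra_simps flip: exp_add exp_of_nat_mult)
    then have "(4 * exp (k * (1 + real n)) / k\<^sup>2) * exp (- (2 * k * n)) = (4 * exp k / k\<^sup>2) * exp (- k) ^ n"
      by (metis (no_types, lifting) mult.assoc times_divide_eq_left)
    finally show ?thesis by (simp add: mult.assoc)
  qed
  show ?thesis
  proof (rule summable_comparison_test'[where N=0])
    show "summable (\<lambda>n. (C powr p * C powr (2 - p) * (4 * exp k / k\<^sup>2)) * exp (- k) ^ n)"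
      using k by (intro summable_mult summable_geometric) auto
    show "norm ((C * (1 + real n)) powr p * (C * zero_gap n) powr (2 - p))
        \<le> (C powr p * C powr (2 - p) * (4 * exp k / k\<^sup>2)) * exp (- k) ^ n" for n
      using bound[of n] by simp
  qed
qed

lemma sw_logderiv_Lp:
  assumes p: "0 < p" "p < 2"
  shows "sw_logderiv \<in> Lp_space p disc" "sw_quot \<in> Lp_space p disc"
proof -
  obtain C where C: "C \<ge> 1" "\<And>z. z \<in> disc - range zero_pt \<Longrightarrow> \<exists>n. cmod (z - zero_pt n) \<le> C * zero_gap n \<and> cmod (1 - z) \<le> C * zero_gap n
      \<and> cmod (sw_quot z) \<le> C * zero_gap n / cmod (z - zero_pt n) \<and> cmod (sw_logderiv z) \<le> C * (1 + real n) / cmod (z - zero_pt n)"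
    by (rule sw_logderiv_estimate) blast
  note K = Lp_space_kernel_bound[OF _ _ p countable_range_zero_pt _ _ _ kernel_summable[OF p, of C]]
  show "sw_logderiv \<in> Lp_space p disc"
  proof (rule K)
    show "\<exists>n. cmod (z - zero_pt n) \<le> C * zero_gap n \<and> cmod (sw_logderiv z) \<le> C * (1 + real n) / cmod (z - zero_pt n)"
      if "z \<in> disc - range zero_pt" for z
      using C(2)[OF that] by blast
  qed (use C(1) sw_logderiv_measurable zero_gap_bounds in \<open>auto simp: less_imp_le\<close>)
  show "sw_quot \<in> Lp_space p disc"
  proof (rule K)
    show "\<exists>n. cmod (z - zero_pt n) \<le> C * zero_gap n \<and> cmod (sw_quot z) \<le> C * (1 + real n) / cmod (z - zero_pt n)"
      if z: "z \<in> disc - range zero_pt" for z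
    proof -
      from C(2)[OF z] obtain n where n: "cmod (z - zero_pt n) \<le> C * zero_gap n" "cmod (sw_quot z) \<le> C * zero_gap n / cmod (z - zero_pt n)" by blast
      have "C * zero_gap n \<le> C * (1 + real n)" using C(1) zero_gap_bounds(2)[of n] by (intro mult_left_mono) auto
      then have "C * zero_gap n / cmod (z - zero_pt n) \<le> C * (1 + real n) / cmod (z - zero_pt n)" by (intro divide_right_mono) auto
      with n show ?thesis by (intro exI[of _ n] conjI) linarith+
    qed
  qed (use C(1) sw_quot_measurable zero_gap_bounds in \<open>auto simp: less_imp_le\<close>)
qed

text \<open>A compact subset of the disc keeps a distance from 1, while |1 - z| is at most a
  multiple of the gap. Hence only finitely many zeros are involved and the factors 1 + n are
  bounded.\<close>

lemma sw_logderiv_weak_L2: "sw_logderiv \<in> weak_L2_loc disc"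
proof (rule weak_L2_loc_kernel_bound[OF _ sw_logderiv_measurable countable_range_zero_pt])
  fix K :: "complex set" assume K: "compact K" "K \<subseteq> disc"
  obtain C where C: "C \<ge> 1" "\<And>z. z \<in> disc - range zero_pt \<Longrightarrow> \<exists>n. cmod (z - zero_pt n) \<le> C * zero_gap n \<and> cmod (1 - z) \<le> C * zero_gap n
      \<and> cmod (sw_quot z) \<le> C * zero_gap n / cmod (z - zero_pt n) \<and> cmod (sw_logderiv z) \<le> C * (1 + real n) / cmod (z - zero_pt n)"
    by (rule sw_logderiv_estimate) blast
  have "open (- K)" "1 \<in> - K" using K by (auto simp: compact_imp_closed open_Compl)
  then obtain d where d: "d > 0" "ball 1 d \<subseteq> - K" using open_contains_ball by blast
  have Kd: "d \<le> cmod (1 - z)" if "z \<in> K" for z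
  proof (rule ccontr)
    assume "\<not> d \<le> cmod (1 - z)"
    then have "z \<in> ball 1 d" by (simp add: dist_norm)
    with d(2) that show False by blast
  qed
  have "(\<lambda>n. C * zero_gap n) \<longlonglongrightarrow> C * 0"
  proof (intro tendsto_mult tendsto_const)
    have "(\<lambda>n. exp (- (2 * pi)) ^ n) \<longlonglongrightarrow> (0::real)" by (intro LIMSEQ_power_zero) simp
    then show "zero_gap \<longlonglongrightarrow> 0" by (simp add: zero_gap_def[abs_def] mult_ac flip: exp_of_nat_mult)
  qed
  then have "\<forall>\<^sub>F n in sequentially. C * zero_gap n < d" using d(1) by (intro order_tendstoD(2)) auto
  then obtain N where N: "\<And>n. n \<ge> N \<Longrightarrow> C * zero_gap n < d" by (auto simp: eventually_sequentially)
  show "\<exists>A c. finite A \<and> (\<forall>z\<in>K - range zero_pt. \<exists>a\<in>A. cmod (sw_logderiv z) \<le> c / cmod (z - a))"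
  proof (rule exI[of _ "zero_pt ` {..<N}"], rule exI[of _ "C * (1 + real N)"], intro conjI ballI)
    show "finite (zero_pt ` {..<N})" by simp
    fix z assume z: "z \<in> K - range zero_pt"
    with K have "z \<in> disc - range zero_pt" by blast
    from C(2)[OF this] obtain n where n: "cmod (1 - z) \<le> C * zero_gap n" "cmod (sw_logderiv z) \<le> C * (1 + real n) / cmod (z - zero_pt n)" by blast
    have nN: "n < N"
    proof (rule ccontr)
      assume "\<not> n < N"
      then have "C * zero_gap n < d" by (intro N) simp
      with n(1) Kd[of z] z show False by auto
    qed
    have "C * (1 + real n) \<le> C * (1 + real N)" using nN C(1) by (intro mult_left_mono) auto
    then have "C * (1 + real n) / cmod (z - zero_pt n) \<le> C * (1 + real N) / cmod (z - zero_pt n)" by (intro divide_right_mono) auto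
    with n(2) have "cmod (sw_logderiv z) \<le> C * (1 + real N) / cmod (z - zero_pt n)" by linarith
    then show "\<exists>a\<in>zero_pt ` {..<N}. cmod (sw_logderiv z) \<le> C * (1 + real N) / cmod (z - a)" using nN by blast
  qed
qed simp

lemma Lp_imp_locally_integrable:
  fixes f :: "complex \<Rightarrow> 'b::euclidean_space"
  assumes "f \<in> Lp_space 1 S" "S \<in> sets lebesgue"
  shows "locally_integrable_on S f"
  unfolding locally_integrable_on_def
proof safe
  fix K assume K: "compact K" "K \<subseteq> S"
  have f: "f \<in> borel_measurable (lebesgue_on S)" "integrable (lebesgue_on S) (\<lambda>z. norm (f z))"
    using assms by (auto simp: Lp_space_def)
  then have "integrable (lebesgue_on S) f" using integrable_norm_iff by blast
  then have "set_integrable lebesgue S f"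
    unfolding set_integrable_def using assms(2) by (subst (asm) integrable_restrict_space) auto
  then show "set_integrable lebesgue K f"
    by (rule set_integrable_subset) (use K in \<open>auto simp: borel_compact\<close>)
qed

lemma locally_integrable_on_mult_continuous:
  fixes f :: "complex \<Rightarrow> complex"
  assumes f: "locally_integrable_on S f" and c: "continuous_on S c"
  shows "locally_integrable_on S (\<lambda>z. c z * f z)"
  unfolding locally_integrable_on_def
proof safe
  fix K assume K: "compact K" "K \<subseteq> S"
  have cK: "continuous_on K c" using c K(2) by (rule continuous_on_subset)
  have Kl: "K \<in> sets lebesgue" using K(1) by (simp add: borel_compact)
  show "(\<lambda>z. c z * f z) absolutely_integrable_on K"
  proof (rule absolutely_integrable_bounded_measurable_product[where h="(*)" and f=c and g=f, OF bilinear_times _ Kl])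
    show "c \<in> borel_measurable (lebesgue_on K)" by (rule continuous_imp_measurable_on_sets_lebesgue[OF cK Kl])
    show "bounded (c ` K)" by (rule compact_imp_bounded[OF compact_continuous_image[OF cK K(1)]])
    show "f absolutely_integrable_on K" using f K by (auto simp: locally_integrable_on_def)
  qed
qed

section \<open>Weak gradients\<close>

text \<open>Supplies the radial factor of the regularisations below, which depend on |f| only
  through |f|^2 + \<epsilon>.\<close>

lemma has_wirtinger_norm_sq:
  assumes F: "(F has_field_derivative D) (at ((cmod w)\<^sup>2))"
  shows "has_wirtinger (\<lambda>w. complex_of_real (F ((cmod w)\<^sup>2))) (of_real D * cnj w) (of_real D * w) w"
proof -
  have 1: "((\<lambda>w::complex. (cmod w)\<^sup>2) has_derivative (\<lambda>h. 2 * (w \<bullet> h))) (at w)"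
    unfolding power2_norm_eq_inner by (auto intro!: derivative_eq_intros simp: inner_commute)
  have "((\<lambda>w. F ((cmod w)\<^sup>2)) has_derivative (\<lambda>h. 2 * (w \<bullet> h) * D)) (at w)"
    using DERIV_compose_FDERIV[OF F 1] by simp
  from bounded_linear.has_derivative[OF bounded_linear_of_real this]
  have "((\<lambda>w. complex_of_real (F ((cmod w)\<^sup>2))) has_derivative (\<lambda>h. of_real (2 * (w \<bullet> h) * D))) (at w)" .
  moreover have "complex_of_real (2 * (w \<bullet> h) * D) = of_real D * cnj w * h + of_real D * w * cnj h" for h
    by (simp add: complex_eq_iff inner_complex_def algebra_simps)
  ultimately show ?thesis by (simp add: has_wirtinger_def)
qed

lemma sw_fun'_holomorphic: "sw_fun' holomorphic_on disc"
proof -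
  have "flat_gen a l holomorphic_on disc" for a l
    unfolding holomorphic_on_open[OF open_ball] using flat_gen_deriv disc_subset_slit by blast
  then show ?thesis
    unfolding sw_fun'_def[abs_def] by (intro holomorphic_intros)
qed

lemma sw_fun_continuous_disc: "continuous_on disc sw_fun" "continuous_on disc sw_fun'" "continuous_on disc (deriv sw_fun')"
proof -
  show "continuous_on disc sw_fun" by (rule sw_fun_alg.star_alg_continuous[OF sw_fun_alg.f])
  show "continuous_on disc sw_fun'" by (rule sw_fun_alg.star_alg_continuous[OF sw_fun_alg.f'])
  show "continuous_on disc (deriv sw_fun')"
    by (intro holomorphic_on_imp_continuous_on holomorphic_deriv sw_fun'_holomorphic open_ball)
qed

lemma sw_dom_disc: "z \<in> disc \<Longrightarrow> z \<notin> range zero_pt \<Longrightarrow> z \<in> sw_dom"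
  using disc_sw_fun_eq_0 disc_subset_slit by (auto simp: sw_dom_def)

lemma sw_dom_disc_iff: "disc - range zero_pt = disc \<inter> sw_dom"
  using sw_dom_disc sw_fun_zero_pt by (auto simp: sw_dom_def)

lemma AE_disc_sw_dom: "AE z in lebesgue. z \<in> disc \<longrightarrow> z \<in> sw_dom"
  by (rule eventually_mono[OF AE_not_in_countable[OF countable_range_zero_pt]]) (use sw_dom_disc in auto)

lemma tendsto_shift_inverse: "(\<lambda>n. x + 1 / real (Suc n)) \<longlonglongrightarrow> (x :: real)"
  using LIMSEQ_inverse_real_of_nat_add[of x] by (simp add: inverse_eq_divide)

lemma sw_logderiv_locally_integrable: "locally_integrable_on disc sw_logderiv"
  by (rule Lp_imp_locally_integrable[OF sw_logderiv_Lp(1)]) auto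

lemma sw_logderiv_norm_locally_integrable: "locally_integrable_on disc (\<lambda>z. k * cmod (sw_logderiv z))"
proof (rule locally_integrable_on_bound[where U="\<lambda>z. of_real k * sw_logderiv z"])
  show "(\<lambda>z. k * cmod (sw_logderiv z)) \<in> borel_measurable (lebesgue_on disc)"
    using sw_logderiv_measurable by measurable
  show "locally_integrable_on disc (\<lambda>z. of_real k * sw_logderiv z)"
    by (rule locally_integrable_on_linear[OF bounded_linear_mult_right sw_logderiv_locally_integrable])
qed (auto simp: norm_mult abs_mult)

lemma sw_fun_measurable: "sw_fun \<in> borel_measurable (lebesgue_on disc)"
  by (rule continuous_imp_measurable_on_sets_lebesgue[OF sw_fun_continuous_disc(1)]) simp

lemma sgn_sw_fun_decomp:
  assumes "sw_fun z \<noteq> 0"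
  shows "sw_fun z = of_real (cmod (sw_fun z)) * sw_dir z" "cnj (sw_dir z) * sw_dir z = 1"
proof -
  show "sw_fun z = of_real (cmod (sw_fun z)) * sw_dir z" using assms by (simp add: sw_dir_def sgn_eq)
  show "cnj (sw_dir z) * sw_dir z = 1" using complex_norm_square[of "sw_dir z"] norm_sw_dir[of z] by (simp add: mult.commute)
qed

lemma powr_sq: "r > 0 \<Longrightarrow> (r\<^sup>2) powr t = r powr (2 * t)" for r :: real
  using powr_powr[of r 2 t] by (simp add: powr_numeral)

text \<open>\<open>sw_dir\<close> is the limit of \<open>sw_fun / sqrt (\<bar>sw_fun\<bar>\<^sup>2 + \<epsilon>)\<close>, whose derivatives are dominated by \<open>\<bar>sw_logderiv\<bar>\<close> uniformly in \<open>\<epsilon>\<close>.\<close>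

lemma sw_dir_weak_gradient:
  "weak_gradient disc sw_dir (\<lambda>z. sw_dir z * (\<i> * of_real (Im (sw_logderiv z)))) (\<lambda>z. sw_dir z * (\<i> * of_real (Re (sw_logderiv z))))"
proof -
  define e where "e n = 1 / real (Suc n)" for n
  have e: "e n > 0" for n by (simp add: e_def)
  define rho where "rho n z = (cmod (sw_fun z))\<^sup>2 + e n" for n z
  have rho: "rho n z > 0" for n z using e[of n] by (simp add: rho_def add_nonneg_pos)
  define u where "u n z = of_real (rho n z powr (- 1 / 2)) * sw_fun z" for n z
  define D where "D n z = - 1 / 2 * rho n z powr (- 3 / 2)" for n z
  define a where "a n z = (of_real (D n z) * cnj (sw_fun z) * sw_fun z + of_real (rho n z powr (- 1 / 2))) * sw_fun' z" for n z
  define b where "b n z = of_real (D n z) * sw_fun z * sw_fun z * cnj (sw_fun' z)" for n z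
  have w: "has_wirtinger (u n) (a n z) (b n z) z" if z: "z \<in> disc" for n z
  proof -
    have "((\<lambda>x. (x + e n) powr (- 1 / 2)) has_field_derivative D n z) (at ((cmod (sw_fun z))\<^sup>2))"
      using rho[of n z] unfolding D_def rho_def by (auto intro!: derivative_eq_intros)
    from has_wirtinger_mult[OF has_wirtinger_norm_sq[OF this] has_wirtinger_holomorphic[OF DERIV_ident]]
    have "has_wirtinger (\<lambda>w. of_real (((cmod w)\<^sup>2 + e n) powr (- 1 / 2)) * w)
      (of_real (D n z) * cnj (sw_fun z) * sw_fun z + of_real (rho n z powr (- 1 / 2)) * 1)
      (of_real (D n z) * sw_fun z * sw_fun z + of_real (rho n z powr (- 1 / 2)) * 0) (sw_fun z)"
      by (simp only: rho_def)
    from has_wirtinger_compose[OF this has_wirtinger_holomorphic[OF sw_fun_alg.f_deriv[OF z]]]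
    show ?thesis by (simp add: u_def[abs_def] rho_def a_def b_def)
  qed
  have crho: "continuous_on disc (\<lambda>z. rho n z powr t)" for n t
    using rho[of n] unfolding rho_def
    by (intro continuous_intros sw_fun_continuous_disc) (auto simp: less_imp_neq[THEN not_sym])
  have ca: "continuous_on disc (a n)" "continuous_on disc (b n)" for n
    unfolding a_def b_def D_def by (intro continuous_intros sw_fun_continuous_disc crho)+
  have wg: "weak_gradient disc (u n) (\<lambda>z. a n z + b n z) (\<lambda>z. \<i> * (a n z - b n z))" for n
    by (rule weak_gradient_wirtinger[OF open_ball w ca])
  have rle: "rho n z powr (- 1 / 2) \<le> 1 / cmod (sw_fun z)" if "sw_fun z \<noteq> 0" for n z
  proof -
    have "rho n z powr (- 1 / 2) \<le> ((cmod (sw_fun z))\<^sup>2) powr (- 1 / 2)"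
      using that e[of n] by (intro powr_mono2') (auto simp: rho_def)
    also have "\<dots> = 1 / cmod (sw_fun z)" using that by (simp add: powr_sq powr_minus inverse_eq_divide)
    finally show ?thesis .
  qed
  \<comment> \<open>Since |f|^2 \<le> rho, the term from differentiating the radial factor is at
    most half of the undifferentiated one. Hence both Wirtinger derivatives are at most rho^(-1/2)
    |f'|, which is bounded by |f' / f|.\<close>
  have Dle: "\<bar>D n z\<bar> * (cmod (sw_fun z))\<^sup>2 \<le> rho n z powr (- 1 / 2) / 2" for n z
  proof -
    have "rho n z powr (- 3 / 2) * rho n z = rho n z powr (- 1 / 2)"
      using rho[of n z] powr_add[of "rho n z" "- 3 / 2" 1] by simp
    moreover have "rho n z powr (- 3 / 2) * (cmod (sw_fun z))\<^sup>2 \<le> rho n z powr (- 3 / 2) * rho n z"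
      using e[of n] by (intro mult_left_mono) (auto simp: rho_def)
    ultimately show ?thesis by (simp add: D_def abs_mult)
  qed
  have ble: "cmod (b n z) \<le> cmod (sw_logderiv z)" and ale: "cmod (a n z) \<le> cmod (sw_logderiv z)" if z: "z \<in> sw_dom" for n z
  proof -
    have f: "sw_fun z \<noteq> 0" and sl: "z \<in> slit" using z by (auto simp: sw_dom_def)
    have fL: "cmod (sw_fun' z) = cmod (sw_logderiv z) * cmod (sw_fun z)" using sw_fun'_eq[OF sl f] by (simp add: norm_mult)
    have "cmod (b n z) = (\<bar>D n z\<bar> * (cmod (sw_fun z))\<^sup>2) * cmod (sw_fun' z)"
      by (simp add: b_def norm_mult power2_eq_square)
    also have "\<dots> \<le> (rho n z powr (- 1 / 2) / 2) * cmod (sw_fun' z)" by (intro mult_right_mono Dle) simp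
    also have "\<dots> \<le> (1 / cmod (sw_fun z)) * cmod (sw_fun' z)"
    proof (intro mult_right_mono)
      show "rho n z powr (- 1 / 2) / 2 \<le> 1 / cmod (sw_fun z)"
        using rle[OF f, of n] powr_ge_zero[of "rho n z" "- 1 / 2"] by linarith
    qed simp
    also have "\<dots> = cmod (sw_logderiv z)" using f by (simp add: fL)
    finally show "cmod (b n z) \<le> cmod (sw_logderiv z)" .
    have "a n z = of_real (rho n z powr (- 1 / 2) - \<bar>D n z\<bar> * (cmod (sw_fun z))\<^sup>2) * sw_fun' z"
      using complex_norm_square[of "sw_fun z"] by (simp add: a_def D_def algebra_simps)
    then have "cmod (a n z) = \<bar>rho n z powr (- 1 / 2) - \<bar>D n z\<bar> * (cmod (sw_fun z))\<^sup>2\<bar> * cmod (sw_fun' z)"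
      by (simp only: norm_mult norm_of_real)
    also have "\<dots> \<le> (1 / cmod (sw_fun z)) * cmod (sw_fun' z)"
    proof (intro mult_right_mono)
      have "0 \<le> \<bar>D n z\<bar> * (cmod (sw_fun z))\<^sup>2" by simp
      then show "\<bar>rho n z powr (- 1 / 2) - \<bar>D n z\<bar> * (cmod (sw_fun z))\<^sup>2\<bar> \<le> 1 / cmod (sw_fun z)"
        using Dle[of n z] rle[OF f, of n] powr_ge_zero[of "rho n z" "- 1 / 2"] by (simp only: abs_le_iff) linarith
    qed simp
    also have "\<dots> = cmod (sw_logderiv z)" using f by (simp add: fL)
    finally show "cmod (a n z) \<le> cmod (sw_logderiv z)" .
  qed
  \<comment> \<open>Off the zeros these limits are the classical Wirtinger derivatives of f / |f|:
    half of g f' / f and minus half of g times the conjugate of f' / f.\<close>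
  have lims: "(\<lambda>n. u n z) \<longlonglongrightarrow> sw_dir z" "(\<lambda>n. a n z) \<longlonglongrightarrow> sw_dir z * sw_logderiv z / 2"
    "(\<lambda>n. b n z) \<longlonglongrightarrow> - (sw_dir z * cnj (sw_logderiv z) / 2)" if z: "z \<in> sw_dom" for z
  proof -
    have f: "sw_fun z \<noteq> 0" and sl: "z \<in> slit" using z by (auto simp: sw_dom_def)
    define r where "r = cmod (sw_fun z)"
    have r: "r > 0" using f by (simp add: r_def)
    define R where "R = complex_of_real r"
    have R: "R \<noteq> 0" using r by (simp add: R_def)
    define G where "G = sw_dir z"
    have fz: "sw_fun z = R * G" "cnj G * G = 1" using sgn_sw_fun_decomp[OF f] by (simp_all add: r_def R_def G_def)
    have cR: "cnj R = R" by (simp add: R_def)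
    have rt: "(\<lambda>n. rho n z powr t) \<longlonglongrightarrow> r powr (2 * t)" for t
    proof -
      have "(\<lambda>n. rho n z powr t) \<longlonglongrightarrow> (r\<^sup>2) powr t"
        unfolding rho_def e_def r_def[symmetric] using r
        by (intro tendsto_powr tendsto_shift_inverse tendsto_const) auto
      then show ?thesis using powr_sq[OF r] by simp
    qed
    have r1: "complex_of_real (r powr (2 * (- 1 / 2))) = 1 / R" and r3: "complex_of_real (r powr (2 * (- 3 / 2))) = 1 / R ^ 3"
      using r powr_realpow[OF r, of 3] by (simp_all add: R_def powr_minus inverse_eq_divide)
    have Dt: "(\<lambda>n. complex_of_real (D n z)) \<longlonglongrightarrow> - 1 / 2 * (1 / R ^ 3)"
    proof -
      have "(\<lambda>n. complex_of_real (- 1 / 2) * complex_of_real (rho n z powr (- 3 / 2)))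
          \<longlonglongrightarrow> complex_of_real (- 1 / 2) * complex_of_real (r powr (2 * (- 3 / 2)))"
        by (intro tendsto_mult tendsto_const tendsto_of_real rt)
      then show ?thesis unfolding D_def of_real_mult r3 by simp
    qed
    have ut: "(\<lambda>n. complex_of_real (rho n z powr (- 1 / 2))) \<longlonglongrightarrow> 1 / R"
      unfolding r1[symmetric] by (rule tendsto_of_real[OF rt])
    have f': "sw_fun' z = sw_logderiv z * (R * G)" using sw_fun'_eq[OF sl f] fz by simp
    have "(\<lambda>n. u n z) \<longlonglongrightarrow> 1 / R * sw_fun z" unfolding u_def by (intro tendsto_intros ut)
    moreover have "1 / R * sw_fun z = sw_dir z" using R by (simp add: fz G_def)
    ultimately show "(\<lambda>n. u n z) \<longlonglongrightarrow> sw_dir z" by simp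
    have "(\<lambda>n. a n z) \<longlonglongrightarrow> (- 1 / 2 * (1 / R ^ 3) * cnj (sw_fun z) * sw_fun z + 1 / R) * sw_fun' z"
      unfolding a_def by (intro tendsto_intros ut Dt)
    moreover have "(- 1 / 2 * (1 / R ^ 3) * cnj (sw_fun z) * sw_fun z + 1 / R) * sw_fun' z = sw_dir z * sw_logderiv z / 2"
    proof -
      have "cnj (sw_fun z) * sw_fun z = R\<^sup>2 * (cnj G * G)" by (simp add: fz cR power2_eq_square mult_ac)
      then have ffc: "cnj (sw_fun z) * sw_fun z = R\<^sup>2" using fz(2) by simp
      have "- 1 / 2 * (1 / R ^ 3) * cnj (sw_fun z) * sw_fun z = - 1 / 2 * (1 / R ^ 3) * R\<^sup>2" using ffc by (simp only: mult.assoc)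
      also have "\<dots> + 1 / R = 1 / (2 * R)" using R by (simp add: field_simps power2_eq_square power3_eq_cube)
      finally show ?thesis using R by (simp add: f' G_def)
    qed
    ultimately show "(\<lambda>n. a n z) \<longlonglongrightarrow> sw_dir z * sw_logderiv z / 2" by (simp only:)
    have "(\<lambda>n. b n z) \<longlonglongrightarrow> - 1 / 2 * (1 / R ^ 3) * sw_fun z * sw_fun z * cnj (sw_fun' z)"
      unfolding b_def by (intro tendsto_intros Dt)
    moreover have "- 1 / 2 * (1 / R ^ 3) * sw_fun z * sw_fun z * cnj (sw_fun' z) = - (sw_dir z * cnj (sw_logderiv z) / 2)"
    proof -
      have "sw_fun z * sw_fun z * cnj (sw_fun' z) = R ^ 3 * (G * (cnj G * G)) * cnj (sw_logderiv z)"
        by (simp add: fz f' cR power3_eq_cube mult_ac)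
      then have "sw_fun z * sw_fun z * cnj (sw_fun' z) = R ^ 3 * G * cnj (sw_logderiv z)" using fz(2) by simp
      then have "- 1 / 2 * (1 / R ^ 3) * (sw_fun z * sw_fun z * cnj (sw_fun' z)) = - (G * cnj (sw_logderiv z) / 2)" using R by simp
      then show ?thesis by (simp only: mult.assoc G_def)
    qed
    ultimately show "(\<lambda>n. b n z) \<longlonglongrightarrow> - (sw_dir z * cnj (sw_logderiv z) / 2)" by (simp only:)
  qed
  have ubound: "cmod (u n z) \<le> 1" if "z \<in> sw_dom" for n z
  proof -
    have f: "sw_fun z \<noteq> 0" using that by (auto simp: sw_dom_def)
    have "cmod (u n z) = rho n z powr (- 1 / 2) * cmod (sw_fun z)" by (simp add: u_def norm_mult)
    also have "\<dots> \<le> (1 / cmod (sw_fun z)) * cmod (sw_fun z)" by (intro mult_right_mono rle f) simp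
    finally show ?thesis using f by simp
  qed
  have mre: "(\<lambda>z. sw_dir z * (\<i> * of_real (Im (sw_logderiv z)))) \<in> borel_measurable (lebesgue_on disc)"
    "(\<lambda>z. sw_dir z * (\<i> * of_real (Re (sw_logderiv z)))) \<in> borel_measurable (lebesgue_on disc)"
    using sw_dir_measurable sw_logderiv_measurable by measurable
  have c1: "locally_integrable_on disc (\<lambda>z. 1 :: real)"
    by (intro continuous_on_imp_locally_integrable continuous_intros)
  have "weak_partial disc 1 sw_dir (\<lambda>z. sw_dir z * (\<i> * of_real (Im (sw_logderiv z))))"
  proof (rule weak_partial_limit[OF open_ball _ _ sw_dir_measurable mre(1) _ _ _ _ c1 sw_logderiv_norm_locally_integrable])
    show "weak_partial disc 1 (u n) (\<lambda>z. a n z + b n z)" for n using wg by (simp add: weak_gradient_def)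
    show "AE z in lebesgue. z \<in> disc \<longrightarrow> (\<lambda>n. u n z) \<longlonglongrightarrow> sw_dir z"
      by (rule eventually_mono[OF AE_disc_sw_dom]) (use lims in auto)
    show "AE z in lebesgue. z \<in> disc \<longrightarrow> (\<lambda>n. a n z + b n z) \<longlonglongrightarrow> sw_dir z * (\<i> * of_real (Im (sw_logderiv z)))"
    proof (rule eventually_mono[OF AE_disc_sw_dom], intro impI)
      fix z assume "z \<in> disc \<longrightarrow> z \<in> sw_dom" "z \<in> disc"
      then have "(\<lambda>n. a n z + b n z) \<longlonglongrightarrow> sw_dir z * sw_logderiv z / 2 + - (sw_dir z * cnj (sw_logderiv z) / 2)"
        by (intro tendsto_add lims) auto
      moreover have "sw_dir z * sw_logderiv z / 2 + - (sw_dir z * cnj (sw_logderiv z) / 2) = sw_dir z * ((sw_logderiv z - cnj (sw_logderiv z)) / 2)"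
        by (simp add: algebra_simps diff_divide_distrib)
      moreover have "(sw_logderiv z - cnj (sw_logderiv z)) / 2 = \<i> * of_real (Im (sw_logderiv z))" by (simp add: complex_eq_iff)
      ultimately show "(\<lambda>n. a n z + b n z) \<longlonglongrightarrow> sw_dir z * (\<i> * of_real (Im (sw_logderiv z)))" by (simp only:)
    qed
    show "AE z in lebesgue. z \<in> disc \<longrightarrow> cmod (u n z) \<le> 1" for n
      by (rule eventually_mono[OF AE_disc_sw_dom]) (use ubound in auto)
    show "AE z in lebesgue. z \<in> disc \<longrightarrow> cmod (a n z + b n z) \<le> 2 * cmod (sw_logderiv z)" for n
    proof (rule eventually_mono[OF AE_disc_sw_dom], intro impI)
      fix z assume "z \<in> disc \<longrightarrow> z \<in> sw_dom" "z \<in> disc"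
      then show "cmod (a n z + b n z) \<le> 2 * cmod (sw_logderiv z)"
        using ale[of z n] ble[of z n] norm_triangle_ineq[of "a n z" "b n z"] by auto
    qed
  qed (simp add: Basis_complex_def)
  moreover have "weak_partial disc \<i> sw_dir (\<lambda>z. sw_dir z * (\<i> * of_real (Re (sw_logderiv z))))"
  proof (rule weak_partial_limit[OF open_ball _ _ sw_dir_measurable mre(2) _ _ _ _ c1 sw_logderiv_norm_locally_integrable])
    show "weak_partial disc \<i> (u n) (\<lambda>z. \<i> * (a n z - b n z))" for n using wg by (simp add: weak_gradient_def)
    show "AE z in lebesgue. z \<in> disc \<longrightarrow> (\<lambda>n. u n z) \<longlonglongrightarrow> sw_dir z"
      by (rule eventually_mono[OF AE_disc_sw_dom]) (use lims in auto)
    show "AE z in lebesgue. z \<in> disc \<longrightarrow> (\<lambda>n. \<i> * (a n z - b n z)) \<longlonglongrightarrow> sw_dir z * (\<i> * of_real (Re (sw_logderiv z)))"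
    proof (rule eventually_mono[OF AE_disc_sw_dom], intro impI)
      fix z assume "z \<in> disc \<longrightarrow> z \<in> sw_dom" "z \<in> disc"
      then have "(\<lambda>n. \<i> * (a n z - b n z)) \<longlonglongrightarrow> \<i> * (sw_dir z * sw_logderiv z / 2 - - (sw_dir z * cnj (sw_logderiv z) / 2))"
        by (intro tendsto_mult tendsto_const tendsto_diff lims) auto
      moreover have "\<i> * (sw_dir z * sw_logderiv z / 2 - - (sw_dir z * cnj (sw_logderiv z) / 2)) = sw_dir z * (\<i> * ((sw_logderiv z + cnj (sw_logderiv z)) / 2))"
        by (simp add: algebra_simps add_divide_distrib)
      moreover have "(sw_logderiv z + cnj (sw_logderiv z)) / 2 = of_real (Re (sw_logderiv z))" by (simp add: complex_eq_iff)
      ultimately show "(\<lambda>n. \<i> * (a n z - b n z)) \<longlonglongrightarrow> sw_dir z * (\<i> * of_real (Re (sw_logderiv z)))" by (simp only:)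
    qed
    show "AE z in lebesgue. z \<in> disc \<longrightarrow> cmod (u n z) \<le> 1" for n
      by (rule eventually_mono[OF AE_disc_sw_dom]) (use ubound in auto)
    show "AE z in lebesgue. z \<in> disc \<longrightarrow> cmod (\<i> * (a n z - b n z)) \<le> 2 * cmod (sw_logderiv z)" for n
    proof (rule eventually_mono[OF AE_disc_sw_dom], intro impI)
      fix z assume "z \<in> disc \<longrightarrow> z \<in> sw_dom" "z \<in> disc"
      then show "cmod (\<i> * (a n z - b n z)) \<le> 2 * cmod (sw_logderiv z)"
        using ale[of z n] ble[of z n] norm_triangle_ineq4[of "a n z" "b n z"] by (auto simp: norm_mult)
    qed
  qed (simp add: Basis_complex_def)
  ultimately show ?thesis by (simp add: weak_gradient_def)
qed

lemma locally_integrable_on_add: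
  assumes "locally_integrable_on S f" "locally_integrable_on S g"
  shows "locally_integrable_on S (\<lambda>z. f z + g z)"
  using assms by (auto simp: locally_integrable_on_def intro!: set_integral_add)

text \<open>A crude majorant for the regularised logarithm of |f|. The inverse 1 / f is the
  continuous function exp (zeta^2) times the integrable \<open>sw_quot\<close>.\<close>

lemma inverse_sw_fun_locally_integrable:
  "locally_integrable_on disc (\<lambda>z. ((cmod (sw_fun z))\<^sup>2 + 1) + 1 / cmod (sw_fun z))"
proof (rule locally_integrable_on_add)
  show "locally_integrable_on disc (\<lambda>z. (cmod (sw_fun z))\<^sup>2 + 1)"
    by (intro continuous_on_imp_locally_integrable continuous_intros sw_fun_continuous_disc)
  have QQl: "locally_integrable_on disc sw_quot"
    by (rule Lp_imp_locally_integrable[OF sw_logderiv_Lp(2)]) auto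
  have cz: "continuous_on disc zeta"
    using zeta_deriv disc_subset_slit
    by (meson DERIV_isCont continuous_at_imp_continuous_on subset_iff)
  show "locally_integrable_on disc (\<lambda>z. 1 / cmod (sw_fun z))"
  proof (rule locally_integrable_on_bound[where U="\<lambda>z. exp ((zeta z)\<^sup>2) * sw_quot z"])
    show "(\<lambda>z. 1 / cmod (sw_fun z)) \<in> borel_measurable (lebesgue_on disc)"
      using sw_fun_measurable by measurable
    show "locally_integrable_on disc (\<lambda>z. exp ((zeta z)\<^sup>2) * sw_quot z)"
      by (intro locally_integrable_on_mult_continuous QQl continuous_intros cz)
    have "exp ((zeta z)\<^sup>2) * sw_quot z = 1 / sw_fun z" for z
      by (simp add: sw_quot_def sw_fun_eq exp_minus field_simps)
    then show "AE z in lebesgue. z \<in> disc \<longrightarrow> norm (1 / cmod (sw_fun z)) \<le> norm (exp ((zeta z)\<^sup>2) * sw_quot z)"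
      by (simp add: norm_divide)
  qed simp
qed

text \<open>The approximations ln (|f|^2 + \<epsilon>) / 2 are C^1 on the whole disc. Their
  z-derivative is f' / (2 f) times |f|^2 / (|f|^2 + \<epsilon>) \<le> 1. The values are bounded
  above through ln x \<le> x and below by ln |f| \<ge> - 1 / |f|.\<close>

lemma ln_sw_fun_weak_gradient:
  "weak_gradient disc (\<lambda>z. ln (cmod (sw_fun z))) (\<lambda>z. Re (sw_logderiv z)) (\<lambda>z. - Im (sw_logderiv z))"
proof -
  define e where "e n = 1 / real (Suc n)" for n
  have e: "e n > 0" "e n \<le> 1" for n by (simp_all add: e_def)
  define rho where "rho n z = (cmod (sw_fun z))\<^sup>2 + e n" for n z
  have rho: "rho n z > 0" for n z using e[of n] by (simp add: rho_def add_nonneg_pos)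
  define a where "a n z = of_real (1 / (2 * rho n z)) * cnj (sw_fun z) * sw_fun' z" for n z
  have w: "has_wirtinger (\<lambda>z. complex_of_real (ln (rho n z) / 2)) (a n z) (cnj (a n z)) z" if z: "z \<in> disc" for n z
  proof -
    have "((\<lambda>x. ln (x + e n)) has_field_derivative 1 / rho n z) (at ((cmod (sw_fun z))\<^sup>2))"
      using rho[of n z] unfolding rho_def by (auto intro!: derivative_eq_intros)
    from DERIV_cdivide[OF this, of 2]
    have "((\<lambda>x. ln (x + e n) / 2) has_field_derivative 1 / (2 * rho n z)) (at ((cmod (sw_fun z))\<^sup>2))"
      by (simp add: mult.commute)
    from has_wirtinger_compose[OF has_wirtinger_norm_sq[OF this] has_wirtinger_holomorphic[OF sw_fun_alg.f_deriv[OF z]]]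
    show ?thesis by (simp add: rho_def a_def)
  qed
  have crho: "continuous_on disc (rho n)" for n
    unfolding rho_def by (intro continuous_intros sw_fun_continuous_disc)
  have ca: "continuous_on disc (a n)" for n
    unfolding a_def using rho[of n]
    by (intro continuous_intros sw_fun_continuous_disc crho) (auto simp: less_imp_neq[THEN not_sym])
  have wg: "weak_gradient disc (\<lambda>z. Re (complex_of_real (ln (rho n z) / 2))) (\<lambda>z. Re (a n z + cnj (a n z))) (\<lambda>z. Re (\<i> * (a n z - cnj (a n z))))" for n
    by (rule weak_gradient_linear[OF bounded_linear_Re weak_gradient_wirtinger[OF open_ball w ca continuous_on_cnj[OF ca]]])
  have "Re (a n z + cnj (a n z)) = 2 * Re (a n z)" "Re (\<i> * (a n z - cnj (a n z))) = - (2 * Im (a n z))" for n z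
    by simp_all
  then have wg: "weak_gradient disc (\<lambda>z. ln (rho n z) / 2) (\<lambda>z. 2 * Re (a n z)) (\<lambda>z. - (2 * Im (a n z)))" for n
    using wg[of n] by (simp only: Re_complex_of_real)
  have ale: "cmod (a n z) \<le> cmod (sw_logderiv z) / 2" and alim: "(\<lambda>n. a n z) \<longlonglongrightarrow> sw_logderiv z / 2"
    and ulim: "(\<lambda>n. ln (rho n z) / 2) \<longlonglongrightarrow> ln (cmod (sw_fun z))"
    and ubd: "\<bar>ln (rho n z) / 2\<bar> \<le> ((cmod (sw_fun z))\<^sup>2 + 1) + 1 / cmod (sw_fun z)" if z: "z \<in> sw_dom" for n z
  proof -
    have f: "sw_fun z \<noteq> 0" and sl: "z \<in> slit" using z by (auto simp: sw_dom_def)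
    have az: "a n z = of_real ((cmod (sw_fun z))\<^sup>2 / rho n z) * (sw_logderiv z / 2)" for n
      using sw_fun'_eq[OF sl f] complex_norm_square[of "sw_fun z"] by (simp add: a_def mult_ac)
    have r: "(cmod (sw_fun z))\<^sup>2 > 0" using f by simp
    have "\<bar>(cmod (sw_fun z))\<^sup>2 / rho n z\<bar> \<le> 1" using rho[of n z] e[of n] by (simp add: rho_def)
    then have "\<bar>(cmod (sw_fun z))\<^sup>2 / rho n z\<bar> * (cmod (sw_logderiv z) / 2) \<le> 1 * (cmod (sw_logderiv z) / 2)" by (intro mult_right_mono) auto
    then show "cmod (a n z) \<le> cmod (sw_logderiv z) / 2" unfolding az norm_mult norm_of_real by (simp add: norm_divide)
    have rl: "(\<lambda>n. rho n z) \<longlonglongrightarrow> (cmod (sw_fun z))\<^sup>2"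
      unfolding rho_def e_def by (rule tendsto_shift_inverse)
    have "(\<lambda>n. a n z) \<longlonglongrightarrow> of_real ((cmod (sw_fun z))\<^sup>2 / (cmod (sw_fun z))\<^sup>2) * (sw_logderiv z / 2)"
      unfolding az using r by (intro tendsto_intros rl) auto
    then show "(\<lambda>n. a n z) \<longlonglongrightarrow> sw_logderiv z / 2" using r by simp
    have "(\<lambda>n. ln (rho n z) / 2) \<longlonglongrightarrow> ln ((cmod (sw_fun z))\<^sup>2) / 2"
      using r by (intro tendsto_intros rl) auto
    then show "(\<lambda>n. ln (rho n z) / 2) \<longlonglongrightarrow> ln (cmod (sw_fun z))" using f by (simp add: ln_realpow)
    have "ln (rho n z) \<le> rho n z" by (rule ln_bound[OF rho])
    also have "\<dots> \<le> (cmod (sw_fun z))\<^sup>2 + 1" using e by (simp add: rho_def)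
    finally have u1: "ln (rho n z) \<le> (cmod (sw_fun z))\<^sup>2 + 1" .
    have "ln ((cmod (sw_fun z))\<^sup>2) \<le> ln (rho n z)"
      using r rho[of n z] e[of n] by (subst ln_le_cancel_iff) (auto simp: rho_def)
    moreover have "ln ((cmod (sw_fun z))\<^sup>2) = 2 * ln (cmod (sw_fun z))" using f by (simp add: ln_realpow)
    moreover have "ln (1 / cmod (sw_fun z)) \<le> 1 / cmod (sw_fun z)" using f by (intro ln_bound) simp
    moreover have "ln (1 / cmod (sw_fun z)) = - ln (cmod (sw_fun z))" using f by (simp add: ln_div)
    ultimately have u2: "- (2 * (1 / cmod (sw_fun z))) \<le> ln (rho n z)" by linarith
    have "0 \<le> 1 / cmod (sw_fun z)" "0 \<le> (cmod (sw_fun z))\<^sup>2" by simp_all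
    with u1 u2 show "\<bar>ln (rho n z) / 2\<bar> \<le> ((cmod (sw_fun z))\<^sup>2 + 1) + 1 / cmod (sw_fun z)"
      unfolding abs_le_iff by linarith
  qed
  have m: "(\<lambda>z. ln (cmod (sw_fun z))) \<in> borel_measurable (lebesgue_on disc)"
    "(\<lambda>z. Re (sw_logderiv z)) \<in> borel_measurable (lebesgue_on disc)" "(\<lambda>z. - Im (sw_logderiv z)) \<in> borel_measurable (lebesgue_on disc)"
    using sw_fun_measurable sw_logderiv_measurable by measurable
  have lim1: "AE z in lebesgue. z \<in> disc \<longrightarrow> (\<lambda>n. ln (rho n z) / 2) \<longlonglongrightarrow> ln (cmod (sw_fun z))"
    by (rule eventually_mono[OF AE_disc_sw_dom]) (use ulim in auto)
  have bd1: "AE z in lebesgue. z \<in> disc \<longrightarrow> norm (ln (rho n z) / 2) \<le> ((cmod (sw_fun z))\<^sup>2 + 1) + 1 / cmod (sw_fun z)" for n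
    by (rule eventually_mono[OF AE_disc_sw_dom]) (use ubd in auto)
  have "weak_partial disc 1 (\<lambda>z. ln (cmod (sw_fun z))) (\<lambda>z. Re (sw_logderiv z))"
  proof (rule weak_partial_limit[OF open_ball _ _ m(1,2) lim1 _ bd1 _ inverse_sw_fun_locally_integrable sw_logderiv_norm_locally_integrable[of 1]])
    show "weak_partial disc 1 (\<lambda>z. ln (rho n z) / 2) (\<lambda>z. 2 * Re (a n z))" for n using wg by (simp add: weak_gradient_def)
    show "AE z in lebesgue. z \<in> disc \<longrightarrow> (\<lambda>n. 2 * Re (a n z)) \<longlonglongrightarrow> Re (sw_logderiv z)"
    proof (rule eventually_mono[OF AE_disc_sw_dom], intro impI)
      fix z assume "z \<in> disc \<longrightarrow> z \<in> sw_dom" "z \<in> disc"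
      then have "(\<lambda>n. 2 * Re (a n z)) \<longlonglongrightarrow> 2 * Re (sw_logderiv z / 2)" by (intro tendsto_intros alim) auto
      then show "(\<lambda>n. 2 * Re (a n z)) \<longlonglongrightarrow> Re (sw_logderiv z)" by simp
    qed
    show "AE z in lebesgue. z \<in> disc \<longrightarrow> norm (2 * Re (a n z)) \<le> 1 * cmod (sw_logderiv z)" for n
    proof (rule eventually_mono[OF AE_disc_sw_dom], intro impI)
      fix z assume "z \<in> disc \<longrightarrow> z \<in> sw_dom" "z \<in> disc"
      then show "norm (2 * Re (a n z)) \<le> 1 * cmod (sw_logderiv z)"
        using ale[of z n] abs_Re_le_cmod[of "a n z"] by simp
    qed
  qed (simp add: Basis_complex_def)
  moreover have "weak_partial disc \<i> (\<lambda>z. ln (cmod (sw_fun z))) (\<lambda>z. - Im (sw_logderiv z))"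
  proof (rule weak_partial_limit[OF open_ball _ _ m(1,3) lim1 _ bd1 _ inverse_sw_fun_locally_integrable sw_logderiv_norm_locally_integrable[of 1]])
    show "weak_partial disc \<i> (\<lambda>z. ln (rho n z) / 2) (\<lambda>z. - (2 * Im (a n z)))" for n using wg by (simp add: weak_gradient_def)
    show "AE z in lebesgue. z \<in> disc \<longrightarrow> (\<lambda>n. - (2 * Im (a n z))) \<longlonglongrightarrow> - Im (sw_logderiv z)"
    proof (rule eventually_mono[OF AE_disc_sw_dom], intro impI)
      fix z assume "z \<in> disc \<longrightarrow> z \<in> sw_dom" "z \<in> disc"
      then have "(\<lambda>n. - (2 * Im (a n z))) \<longlonglongrightarrow> - (2 * Im (sw_logderiv z / 2))" by (intro tendsto_intros alim) auto
      then show "(\<lambda>n. - (2 * Im (a n z))) \<longlonglongrightarrow> - Im (sw_logderiv z)" by simp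
    qed
    show "AE z in lebesgue. z \<in> disc \<longrightarrow> norm (- (2 * Im (a n z))) \<le> 1 * cmod (sw_logderiv z)" for n
    proof (rule eventually_mono[OF AE_disc_sw_dom], intro impI)
      fix z assume "z \<in> disc \<longrightarrow> z \<in> sw_dom" "z \<in> disc"
      then show "norm (- (2 * Im (a n z))) \<le> 1 * cmod (sw_logderiv z)"
        using ale[of z n] abs_Im_le_cmod[of "a n z"] by simp
    qed
  qed (simp add: Basis_complex_def)
  ultimately show ?thesis by (simp add: weak_gradient_def)
qed

section \<open>Divergence of complex vector fields\<close>

text \<open>A complex function \<open>V\<close> is identified with the vector field \<open>(Re V, - Im V)\<close>: a holomorphic
  function is then divergence free, and \<open>f'/f\<close> is the gradient of \<open>ln \<bar>f\<bar>\<close>.\<close>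

definition cdiv :: "complex set \<Rightarrow> (complex \<Rightarrow> complex) \<Rightarrow> (complex \<Rightarrow> real) \<Rightarrow> complex" where
  "cdiv S V \<phi> = distr_div S (\<lambda>z. of_real (Re (V z))) (\<lambda>z. of_real (- Im (V z))) \<phi>"

abbreviation "cRe V \<equiv> complex_of_real (Re V)"
abbreviation "cIm V \<equiv> complex_of_real (- Im V)"

lemma bounded_linear_cRe: "bounded_linear (\<lambda>z. cRe z)"
  by (rule bounded_linear_compose[OF bounded_linear_of_real bounded_linear_Re])

lemma bounded_linear_cIm: "bounded_linear (\<lambda>z. cIm z)"
  by (rule bounded_linear_compose[OF bounded_linear_of_real bounded_linear_minus[OF bounded_linear_Im]])

lemma cdiv_split:
  assumes V: "locally_integrable_on S V" and \<phi>: "test_function S \<phi>"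
  shows "cdiv S V \<phi> = - (LINT z:S|lebesgue. partial_deriv 1 \<phi> z *\<^sub>R cRe (V z))
    - (LINT z:S|lebesgue. partial_deriv \<i> \<phi> z *\<^sub>R cIm (V z))"
proof -
  from \<phi> obtain K where K: "compact K" "K \<subseteq> S" "\<And>z v. z \<notin> K \<Longrightarrow> partial_deriv v \<phi> z = 0"
    "\<And>v. v \<in> Basis \<Longrightarrow> continuous_on UNIV (partial_deriv v \<phi>)"
    by (elim test_functionE) metis
  have "set_integrable lebesgue S (\<lambda>z. partial_deriv 1 \<phi> z *\<^sub>R cRe (V z))"
    by (rule test_integrable[OF locally_integrable_on_linear[OF bounded_linear_cRe V] K(1,2) K(4) K(3)])
      (simp add: Basis_complex_def)
  moreover have "set_integrable lebesgue S (\<lambda>z. partial_deriv \<i> \<phi> z *\<^sub>R cIm (V z))"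
    by (rule test_integrable[OF locally_integrable_on_linear[OF bounded_linear_cIm V] K(1,2) K(4) K(3)])
      (simp add: Basis_complex_def)
  ultimately show ?thesis
    unfolding cdiv_def distr_div_def by (subst set_integral_add) auto
qed

lemma cdiv_weak_gradient:
  assumes w: "weak_gradient S V Vx Vy" and \<phi>: "test_function S \<phi>"
  shows "cdiv S V \<phi> = (LINT z:S|lebesgue. \<phi> z *\<^sub>R complex_of_real (Re (Vx z) - Im (Vy z)))"
proof -
  have b: "(1::complex) \<in> Basis" "\<i> \<in> Basis" by (simp_all add: Basis_complex_def)
  have wx: "weak_partial S 1 V Vx" and wy: "weak_partial S \<i> V Vy" using w by (auto simp: weak_gradient_def)
  note p = weak_partial_linear[OF bounded_linear_cRe wx b(1)] weak_partial_linear[OF bounded_linear_cIm wy b(2)]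
  from \<phi> obtain K where K: "compact K" "K \<subseteq> S" "\<And>z. z \<notin> K \<Longrightarrow> \<phi> z = 0" "continuous_on UNIV \<phi>"
    by (elim test_functionE) metis
  have l: "locally_integrable_on S (\<lambda>z. cRe (Vx z))" "locally_integrable_on S (\<lambda>z. cIm (Vy z))"
    using p by (auto simp: weak_partial_def)
  have "cdiv S V \<phi> = (LINT z:S|lebesgue. \<phi> z *\<^sub>R cRe (Vx z)) + (LINT z:S|lebesgue. \<phi> z *\<^sub>R cIm (Vy z))"
    using p \<phi> wx by (subst cdiv_split) (auto simp: weak_partial_def)
  also have "\<dots> = (LINT z:S|lebesgue. \<phi> z *\<^sub>R cRe (Vx z) + \<phi> z *\<^sub>R cIm (Vy z))"
    by (rule set_integral_add(2)[symmetric]; rule test_integrable[OF _ K(1,2) K(4) K(3)]) (use l in auto)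
  also have "\<dots> = (LINT z:S|lebesgue. \<phi> z *\<^sub>R complex_of_real (Re (Vx z) - Im (Vy z)))"
  proof -
    have "\<phi> z *\<^sub>R cRe (Vx z) + \<phi> z *\<^sub>R cIm (Vy z) = \<phi> z *\<^sub>R complex_of_real (Re (Vx z) - Im (Vy z))" for z
      by (simp add: scaleR_conv_of_real algebra_simps)
    then show ?thesis by simp
  qed
  finally show ?thesis .
qed

lemma cdiv_tendsto:
  assumes S: "open S" and \<phi>: "test_function S \<phi>"
    and u: "\<And>n. locally_integrable_on S (V n)" and f: "locally_integrable_on S W"
    and lim: "AE z in lebesgue. z \<in> S \<longrightarrow> (\<lambda>n. V n z) \<longlonglongrightarrow> W z"
    and bound: "\<And>n. AE z in lebesgue. z \<in> S \<longrightarrow> cmod (V n z) \<le> U z"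
    and U: "locally_integrable_on S (U :: complex \<Rightarrow> real)"
  shows "(\<lambda>n. cdiv S (V n) \<phi>) \<longlonglongrightarrow> cdiv S W \<phi>"
proof -
  from \<phi> obtain K where K: "compact K" "K \<subseteq> S" "\<And>z v. z \<notin> K \<Longrightarrow> partial_deriv v \<phi> z = 0"
    "\<And>v. v \<in> Basis \<Longrightarrow> continuous_on UNIV (partial_deriv v \<phi>)"
    by (elim test_functionE) metis
  have b: "(1::complex) \<in> Basis" "\<i> \<in> Basis" by (simp_all add: Basis_complex_def)
  have T: "(\<lambda>n. LINT z:S|lebesgue. partial_deriv v \<phi> z *\<^sub>R L (V n z)) \<longlonglongrightarrow> (LINT z:S|lebesgue. partial_deriv v \<phi> z *\<^sub>R L (W z))"
    if L: "bounded_linear L" "\<And>x. cmod (L x) \<le> cmod x" and v: "v \<in> Basis" for L :: "complex \<Rightarrow> complex" and v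
  proof (rule test_integral_tendsto[OF S K(1,2) K(4)[OF v] K(3) _ _ _ _ U])
    show "locally_integrable_on S (\<lambda>z. L (V n z))" for n by (rule locally_integrable_on_linear[OF L(1) u])
    show "locally_integrable_on S (\<lambda>z. L (W z))" by (rule locally_integrable_on_linear[OF L(1) f])
    show "AE z in lebesgue. z \<in> S \<longrightarrow> (\<lambda>n. L (V n z)) \<longlonglongrightarrow> L (W z)"
      by (rule eventually_mono[OF lim]) (auto intro: bounded_linear.tendsto[OF L(1)])
    show "AE z in lebesgue. z \<in> S \<longrightarrow> norm (L (V n z)) \<le> U z" for n
      by (rule eventually_mono[OF bound[of n]]) (auto intro: order_trans[OF L(2)])
  qed
  have l1: "cmod (cRe x) \<le> cmod x" and l2: "cmod (cIm x) \<le> cmod x" for x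
    by (simp_all add: abs_Re_le_cmod abs_Im_le_cmod)
  show ?thesis
    unfolding cdiv_split[OF u \<phi>] cdiv_split[OF f \<phi>]
    by (intro tendsto_intros T bounded_linear_cRe bounded_linear_cIm l1 l2 b)
qed

lemma cdiv_add:
  assumes V: "locally_integrable_on S V" and W: "locally_integrable_on S W" and \<phi>: "test_function S \<phi>"
  shows "cdiv S (\<lambda>z. V z + W z) \<phi> = cdiv S V \<phi> + cdiv S W \<phi>"
proof -
  from \<phi> obtain K where K: "compact K" "K \<subseteq> S" "\<And>z v. z \<notin> K \<Longrightarrow> partial_deriv v \<phi> z = 0"
    "\<And>v. v \<in> Basis \<Longrightarrow> continuous_on UNIV (partial_deriv v \<phi>)"
    by (elim test_functionE) metis
  have b: "(1::complex) \<in> Basis" "\<i> \<in> Basis" by (simp_all add: Basis_complex_def)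
  have A: "(LINT z:S|lebesgue. partial_deriv v \<phi> z *\<^sub>R L (V z + W z))
      = (LINT z:S|lebesgue. partial_deriv v \<phi> z *\<^sub>R L (V z)) + (LINT z:S|lebesgue. partial_deriv v \<phi> z *\<^sub>R L (W z))"
    if L: "bounded_linear L" and v: "v \<in> Basis" for L :: "complex \<Rightarrow> complex" and v
    unfolding linear_simps(1)[OF L] scaleR_add_right
    by (rule set_integral_add(2); rule test_integrable[OF locally_integrable_on_linear[OF L] K(1,2) K(4)[OF v] K(3)])
      (use V W in auto)
  show ?thesis
    unfolding cdiv_split[OF V \<phi>] cdiv_split[OF W \<phi>] cdiv_split[OF locally_integrable_on_add[OF V W] \<phi>]
      A[OF bounded_linear_cRe b(1)] A[OF bounded_linear_cIm b(2)]
    by simp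
qed

lemma locally_integrable_on_norm:
  fixes V :: "complex \<Rightarrow> complex"
  assumes "locally_integrable_on S V"
  shows "locally_integrable_on S (\<lambda>z. norm (V z))"
  using assms unfolding locally_integrable_on_def by (blast intro: set_integrable_norm)

text \<open>\<open>cdiv_tendsto\<close> for the constant sequence V, which converges almost
  everywhere to W.\<close>

lemma cdiv_cong_AE:
  assumes S: "open S" and "AE z in lebesgue. z \<in> S \<longrightarrow> V z = W z"
    and V: "locally_integrable_on S V" and W: "locally_integrable_on S W" and \<phi>: "test_function S \<phi>"
  shows "cdiv S V \<phi> = cdiv S W \<phi>"
proof -
  have "(\<lambda>n::nat. cdiv S V \<phi>) \<longlonglongrightarrow> cdiv S W \<phi>"
  proof (rule cdiv_tendsto[OF S \<phi> V W])
    show "AE z in lebesgue. z \<in> S \<longrightarrow> (\<lambda>n::nat. V z) \<longlonglongrightarrow> W z"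
      by (rule eventually_mono[OF assms(2)]) auto
    show "locally_integrable_on S (\<lambda>z. cmod (V z))"
      by (rule locally_integrable_on_norm[OF V])
  qed auto
  then show ?thesis by (simp add: LIMSEQ_const_iff)
qed

text \<open>The Cauchy-Riemann equations: the partial derivatives are V' and i V', and Re V' = Im (i
  V').\<close>

lemma cdiv_holomorphic:
  assumes S: "open S" and V: "V holomorphic_on S" and \<phi>: "test_function S \<phi>"
  shows "cdiv S V \<phi> = 0"
proof -
  have "weak_gradient S V (\<lambda>z. deriv V z + 0) (\<lambda>z. \<i> * (deriv V z - 0))"
  proof (rule weak_gradient_wirtinger[OF S])
    show "has_wirtinger V (deriv V z) 0 z" if "z \<in> S" for z
      using holomorphic_derivI[OF V S that] by (rule has_wirtinger_holomorphic)
    show "continuous_on S (deriv V)"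
      by (intro holomorphic_on_imp_continuous_on holomorphic_deriv V S)
  qed simp
  from cdiv_weak_gradient[OF this \<phi>] show ?thesis by (simp add: set_lebesgue_integral_def)
qed

text \<open>The kernel bound for p = 1 with a single kernel, encoded as the sequence of weights 1,
  0, 0, ...\<close>

lemma inverse_locally_integrable: "locally_integrable_on (ball q r) (\<lambda>z::complex. 1 / (z - q))"
proof (rule Lp_imp_locally_integrable)
  have m: "(\<lambda>z::complex. 1 / (z - q)) \<in> borel_measurable (lebesgue_on (ball q r))"
  proof -
    have [measurable]: "(\<lambda>z. z) \<in> borel_measurable (lebesgue_on (ball q r))"
      by (rule continuous_imp_measurable_on_sets_lebesgue) auto
    show ?thesis by measurable
  qed
  show "(\<lambda>z. 1 / (z - q)) \<in> Lp_space 1 (ball q r)"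
  proof (rule Lp_space_kernel_bound[OF _ m _ _ countable_empty, where a="\<lambda>_. q" and r="\<lambda>_. \<bar>r\<bar>" and c="\<lambda>n. if n = 0 then 1 else 0"])
    show "summable (\<lambda>n::nat. (if n = 0 then 1 else 0) powr 1 * \<bar>r\<bar> powr (2 - 1))"
      by (rule summable_finite[of "{0}"]) auto
    show "\<exists>n::nat. cmod (z - q) \<le> \<bar>r\<bar> \<and> cmod (1 / (z - q)) \<le> (if n = 0 then 1 else 0) / cmod (z - q)"
      if "z \<in> ball q r - {}" for z
      using that by (intro exI[of _ 0]) (auto simp: norm_divide dist_norm norm_minus_commute)
  qed auto
qed simp

text \<open>The vector field of \<open>pole_reg e\<close> has divergence \<open>2 / e\<^sup>2\<close> on the disc of radius \<open>e\<close> and 0 outside, which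
  tends to \<open>2\<pi>\<delta>\<^sub>0\<close>.\<close>

definition pole_reg :: "real \<Rightarrow> complex \<Rightarrow> complex" where
  "pole_reg e w = (if cmod w \<le> e then cnj w / of_real (e\<^sup>2) else 1 / w)"

lemma pole_reg_bound: "e > 0 \<Longrightarrow> cmod (pole_reg e w) \<le> 1 / cmod w" "e > 0 \<Longrightarrow> cmod (pole_reg e w) \<le> 1 / e"
proof -
  assume e: "e > 0"
  show "cmod (pole_reg e w) \<le> 1 / cmod w"
  proof (cases "cmod w \<le> e \<and> w \<noteq> 0")
    case True
    then have "cmod w * cmod w \<le> e * e" using e by (intro mult_mono) auto
    then have "cmod w / e\<^sup>2 \<le> 1 / cmod w" using True e by (simp add: field_simps power2_eq_square)
    moreover have "cmod (pole_reg e w) = cmod w / e\<^sup>2" using True by (simp add: pole_reg_def norm_divide norm_power)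
    ultimately show ?thesis by linarith
  qed (auto simp: pole_reg_def norm_divide)
  show "cmod (pole_reg e w) \<le> 1 / e"
  proof (cases "cmod w \<le> e")
    case True
    then have "cmod w * e \<le> e * e" using e by (intro mult_right_mono) auto
    then have "cmod w / e\<^sup>2 \<le> 1 / e" using e by (simp add: field_simps power2_eq_square)
    moreover have "cmod (pole_reg e w) = cmod w / e\<^sup>2" using True by (simp add: pole_reg_def norm_divide norm_power)
    ultimately show ?thesis by linarith
  next
    case False
    then show ?thesis using e by (auto simp: pole_reg_def norm_divide intro!: frac_le)
  qed
qed

text \<open>The two formulas agree on |w| = e. In the mixed case the numerator cnj w w' - e^2 is
  split at cnj w w = |w|^2; with e - |w| \<le> |w - w'| the pieces contribute e and 2 e times |w -
  w'|, whence the factor 3.\<close>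

lemma pole_reg_lipschitz:
  assumes e: "e > 0"
  shows "cmod (pole_reg e w - pole_reg e w') \<le> 3 / e\<^sup>2 * cmod (w - w')"
proof -
  have e2: "e\<^sup>2 > 0" using e by simp
  have mixed: "cmod (pole_reg e w - pole_reg e w') \<le> 3 / e\<^sup>2 * cmod (w - w')"
    if le: "cmod w \<le> e" and gt: "\<not> cmod w' \<le> e" for w w'
  proof -
    have w': "w' \<noteq> 0" using gt e by auto
    have d: "e - cmod w \<le> cmod (w - w')" using norm_triangle_ineq2[of w' w] gt by (simp add: norm_minus_commute)
    have eq: "pole_reg e w - pole_reg e w' = (cnj w * w' - of_real (e\<^sup>2)) / (of_real (e\<^sup>2) * w')"
      using le gt w' e by (simp add: pole_reg_def field_simps)
    have "cnj w * w = of_real ((cmod w)\<^sup>2)" using complex_norm_square[of w] by (simp add: mult.commute)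
    then have "cnj w * w' - of_real (e\<^sup>2) = cnj w * (w' - w) + of_real ((cmod w)\<^sup>2 - e\<^sup>2)"
      by (simp add: algebra_simps)
    then have "cmod (cnj w * w' - of_real (e\<^sup>2)) \<le> cmod w * cmod (w - w') + \<bar>(cmod w)\<^sup>2 - e\<^sup>2\<bar>"
      using norm_triangle_ineq[of "cnj w * (w' - w)" "of_real ((cmod w)\<^sup>2 - e\<^sup>2)"]
      by (simp only: norm_mult complex_mod_cnj norm_of_real norm_minus_commute)
    also have "\<bar>(cmod w)\<^sup>2 - e\<^sup>2\<bar> = (e - cmod w) * (e + cmod w)"
      using power_mono[OF le, of 2] by (simp add: power2_eq_square algebra_simps)
    also have "cmod w * cmod (w - w') + (e - cmod w) * (e + cmod w) \<le> e * cmod (w - w') + cmod (w - w') * (e + e)"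
      using le d e by (intro add_mono mult_mono) auto
    finally have n: "cmod (cnj w * w' - of_real (e\<^sup>2)) \<le> 3 * e * cmod (w - w')" by (simp add: algebra_simps)
    have "cmod (pole_reg e w - pole_reg e w') \<le> 3 * e * cmod (w - w') / (e\<^sup>2 * e)"
      unfolding eq norm_divide norm_mult norm_of_real using n gt e by (intro frac_le) auto
    also have "\<dots> = 3 / e\<^sup>2 * cmod (w - w')" using e by simp
    finally show ?thesis .
  qed
  consider "cmod w \<le> e" "cmod w' \<le> e" | "cmod w \<le> e" "\<not> cmod w' \<le> e" | "\<not> cmod w \<le> e" "cmod w' \<le> e"
    | "\<not> cmod w \<le> e" "\<not> cmod w' \<le> e" by blast
  then show ?thesis
  proof cases
    case 1
    then have "pole_reg e w - pole_reg e w' = cnj (w - w') / of_real (e\<^sup>2)" by (simp add: pole_reg_def diff_divide_distrib)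
    then have "cmod (pole_reg e w - pole_reg e w') = cmod (w - w') / e\<^sup>2"
      by (simp only: norm_divide complex_mod_cnj norm_of_real) simp
    also have "\<dots> \<le> 3 * cmod (w - w') / e\<^sup>2" by (intro divide_right_mono) auto
    finally show ?thesis by simp
  next
    case 2
    then show ?thesis by (rule mixed)
  next
    case 3
    then show ?thesis using mixed[of w' w] by (simp add: norm_minus_commute)
  next
    case 4
    then have w: "w \<noteq> 0" "w' \<noteq> 0" using e by auto
    have "pole_reg e w - pole_reg e w' = (w' - w) / (w * w')" using 4 w by (simp add: pole_reg_def field_simps)
    then have "cmod (pole_reg e w - pole_reg e w') = cmod (w - w') / (cmod w * cmod w')"
      by (simp only: norm_divide norm_mult norm_minus_commute)
    also have "\<dots> \<le> 3 * cmod (w - w') / (e * e)" using 4 e by (intro frac_le mult_mono) auto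
    finally show ?thesis by (simp add: power2_eq_square)
  qed
qed

lemma pole_reg_has_derivative:
  assumes e: "e > 0" and w: "cmod w \<noteq> e"
  shows "(pole_reg e has_derivative (\<lambda>h. if cmod w < e then cnj h / of_real (e\<^sup>2) else - (h / w\<^sup>2))) (at w)"
proof (cases "cmod w < e")
  case True
  have "((\<lambda>w. cnj w / of_real (e\<^sup>2)) has_derivative (\<lambda>h. cnj h / of_real (e\<^sup>2))) (at w)"
    by (intro bounded_linear.has_derivative[OF bounded_linear_divide]
        bounded_linear.has_derivative[OF bounded_linear_cnj] has_derivative_ident)
  then have "(pole_reg e has_derivative (\<lambda>h. cnj h / of_real (e\<^sup>2))) (at w)"
    by (rule has_derivative_transform_within_open[of _ _ _ _ "ball 0 e"]) (use True in \<open>auto simp: pole_reg_def\<close>)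
  then show ?thesis using True by simp
next
  case False
  then have w0: "w \<noteq> 0" "w \<in> - cball 0 e" using e w by auto
  have "((\<lambda>w. 1 / w) has_field_derivative - (1 / w\<^sup>2)) (at w)"
    using w0 by (auto intro!: derivative_eq_intros simp: power2_eq_square)
  then have "((\<lambda>w. 1 / w) has_derivative (\<lambda>h. - (h / w\<^sup>2))) (at w)"
    unfolding has_field_derivative_def by (rule has_derivative_eq_rhs) (simp add: fun_eq_iff)
  then have "(pole_reg e has_derivative (\<lambda>h. - (h / w\<^sup>2))) (at w)"
    by (rule has_derivative_transform_within_open[of _ _ _ _ "- cball 0 e"]) (use w0 in \<open>auto simp: pole_reg_def\<close>)
  then show ?thesis using False by simp
qed

text \<open>The field has a kink on the circle of radius e, but it is Lipschitz and differentiable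
  off this null set. The forms \<open>cnj 1\<close> and \<open>cnj \<i>\<close> keep both components
  instances of one formula in the direction v.\<close>

lemma pole_reg_weak_gradient:
  assumes e: "e > 0" and S: "open S"
  shows "weak_gradient S (\<lambda>z. pole_reg e (z - q))
    (\<lambda>z. if cmod (z - q) < e then cnj 1 / of_real (e\<^sup>2) else - (1 / (z - q)\<^sup>2))
    (\<lambda>z. if cmod (z - q) < e then cnj \<i> / of_real (e\<^sup>2) else - (\<i> / (z - q)\<^sup>2))"
proof -
  define P where "P v z = (if cmod (z - q) < e then cnj v / of_real (e\<^sup>2) else - (v / (z - q)\<^sup>2))" for v z
  have cont: "continuous_on UNIV (\<lambda>z. pole_reg e (z - q))"
    unfolding continuous_on_iff
  proof (intro ballI allI impI)
    fix x \<delta> :: "complex" and d :: real assume d: "d > 0"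
    have "dist (pole_reg e (y - q)) (pole_reg e (x - q)) < d" if "dist y x < d * e\<^sup>2 / 3" for y
    proof -
      have "dist (pole_reg e (y - q)) (pole_reg e (x - q)) \<le> 3 / e\<^sup>2 * dist y x"
        using pole_reg_lipschitz[OF e, of "y - q" "x - q"] by (simp add: dist_norm)
      also have "\<dots> < d" using that e by (simp add: field_simps)
      finally show ?thesis .
    qed
    then show "\<exists>\<delta>>0. \<forall>y\<in>UNIV. dist y x < \<delta> \<longrightarrow> dist (pole_reg e (y - q)) (pole_reg e (x - q)) < d"
      using d e by (intro exI[of _ "d * e\<^sup>2 / 3"]) auto
  qed
  have Vl: "locally_integrable_on S (\<lambda>z. pole_reg e (z - q))"
    by (rule continuous_on_imp_locally_integrable[OF continuous_on_subset[OF cont]]) simp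
  have Pl: "locally_integrable_on S (P v)" for v
  proof (rule locally_integrable_on_bound[OF S])
    have [measurable]: "(\<lambda>z. z) \<in> borel_measurable (lebesgue_on S)"
      by (rule continuous_imp_measurable_on_sets_lebesgue) (use S in \<open>auto intro: borel_open\<close>)
    show "P v \<in> borel_measurable (lebesgue_on S)" unfolding P_def by measurable
    show "locally_integrable_on S (\<lambda>z. cmod v / e\<^sup>2)"
      by (intro continuous_on_imp_locally_integrable continuous_intros)
    have "cmod (P v z) \<le> cmod v / e\<^sup>2" for z
      using e by (auto simp: P_def norm_divide norm_power intro!: divide_left_mono power_mono mult_pos_pos zero_less_power)
    then show "AE z in lebesgue. z \<in> S \<longrightarrow> cmod (P v z) \<le> norm (cmod v / e\<^sup>2)" by simp
  qed
  have "weak_partial S v (\<lambda>z. pole_reg e (z - q)) (P v)" if v: "v \<in> Basis" for v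
    unfolding weak_partial_def
  proof (intro conjI Vl Pl allI impI)
    fix \<phi> assume \<phi>: "test_function S \<phi>"
    from \<phi> obtain K where K: "compact K" "K \<subseteq> S" "\<And>z. z \<notin> K \<Longrightarrow> \<phi> z = 0"
      "\<And>z. (\<phi> has_derivative frechet_derivative \<phi> (at z)) (at z)"
      "continuous_on UNIV \<phi>" "\<And>v. v \<in> Basis \<Longrightarrow> continuous_on UNIV (partial_deriv v \<phi>)"
      by (elim test_functionE) metis
    obtain C where C: "\<And>x y. norm (\<phi> x - \<phi> y) \<le> C * norm (x - y)"
      by (rule C1_compact_support_lipschitz[OF K(4) _ K(1) K(3)])
        (use K(6) in \<open>auto simp: partial_deriv_def\<close>)
    have "bounded (\<phi> ` K)" by (intro compact_imp_bounded compact_continuous_image continuous_on_subset[OF K(5)] K) auto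
    then obtain B where "\<forall>x\<in>\<phi> ` K. norm x \<le> B" unfolding bounded_iff by blast
    then have B: "\<bar>\<phi> x\<bar> \<le> \<bar>B\<bar>" for x using K(3)[of x] by (cases "x \<in> K") force+
    show "(LINT z:S|lebesgue. partial_deriv v \<phi> z *\<^sub>R pole_reg e (z - q)) = - (LINT z:S|lebesgue. \<phi> z *\<^sub>R P v z)"
    proof (rule weak_partial_lipschitz[OF S \<phi> v _ Vl Pl])
      fix x y
      have "\<phi> x *\<^sub>R pole_reg e (x - q) - \<phi> y *\<^sub>R pole_reg e (y - q)
          = (\<phi> x - \<phi> y) *\<^sub>R pole_reg e (x - q) + \<phi> y *\<^sub>R (pole_reg e (x - q) - pole_reg e (y - q))"
        by (simp add: algebra_simps)
      also have "cmod \<dots> \<le> \<bar>\<phi> x - \<phi> y\<bar> * cmod (pole_reg e (x - q)) + \<bar>\<phi> y\<bar> * cmod (pole_reg e (x - q) - pole_reg e (y - q))"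
        by (intro order_trans[OF norm_triangle_ineq]) simp
      also have "\<dots> \<le> (C * cmod (x - y)) * (1 / e) + \<bar>B\<bar> * (3 / e\<^sup>2 * cmod (x - y))"
      proof (intro add_mono mult_mono)
        show "\<bar>\<phi> x - \<phi> y\<bar> \<le> C * cmod (x - y)" using C[of x y] by simp
        show "0 \<le> C * cmod (x - y)" using C[of x y] by (rule order_trans[OF norm_ge_zero])
        show "cmod (pole_reg e (x - q) - pole_reg e (y - q)) \<le> 3 / e\<^sup>2 * cmod (x - y)"
          using pole_reg_lipschitz[OF e, of "x - q" "y - q"] by simp
      qed (use pole_reg_bound(2)[OF e] B in auto)
      finally show "cmod (\<phi> x *\<^sub>R pole_reg e (x - q) - \<phi> y *\<^sub>R pole_reg e (y - q)) \<le> (C / e + 3 * \<bar>B\<bar> / e\<^sup>2) * cmod (x - y)"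
        by (simp add: algebra_simps)
    next
      have "AE z in lebesgue. z \<notin> sphere q e"
        using negligible_sphere[of q e] by (intro AE_not_in) (simp add: negligible_iff_null_sets)
      then show "AE z in lebesgue. z \<in> S \<longrightarrow> (\<exists>D. ((\<lambda>z. pole_reg e (z - q)) has_derivative D) (at z) \<and> D v = P v z)"
      proof eventually_elim
        case (elim z)
        then have "cmod (z - q) \<noteq> e" by (auto simp: dist_norm norm_minus_commute)
        note pd = pole_reg_has_derivative[OF e this]
        have "((\<lambda>z. z - q) has_derivative (\<lambda>h. h)) (at z)" by (auto intro!: derivative_eq_intros)
        from has_derivative_compose[OF this pd]
        have "((\<lambda>z. pole_reg e (z - q)) has_derivative
            (\<lambda>h. if cmod (z - q) < e then cnj h / of_real (e\<^sup>2) else - (h / (z - q)\<^sup>2))) (at z)" .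
        then show ?case by (intro impI exI conjI, assumption) (simp add: P_def)
      qed
    qed
  qed
  from this[of 1] this[of \<i>] show ?thesis
    by (simp add: weak_gradient_def Basis_complex_def P_def[abs_def])
qed

lemma cdiv_pole:
  assumes r: "r > 0" and \<phi>: "test_function (ball q r) \<phi>"
  shows "cdiv (ball q r) (\<lambda>z. 1 / (z - q)) \<phi> = of_real (2 * pi * \<phi> q)"
proof -
  let ?S = "ball q r"
  define e where "e n = 1 / real (Suc n)" for n
  have e: "e n > 0" for n by (simp add: e_def)
  have e0: "e \<longlonglongrightarrow> 0" unfolding e_def[abs_def] using tendsto_shift_inverse[of 0] by simp
  have K: "continuous_on UNIV \<phi>"
    using \<phi> by (auto simp: test_function_def intro: smooth_on_imp_continuous_on)
  have wg: "weak_gradient ?S (\<lambda>z. pole_reg (e n) (z - q))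
    (\<lambda>z. if cmod (z - q) < e n then cnj 1 / of_real ((e n)\<^sup>2) else - (1 / (z - q)\<^sup>2))
    (\<lambda>z. if cmod (z - q) < e n then cnj \<i> / of_real ((e n)\<^sup>2) else - (\<i> / (z - q)\<^sup>2))" for n
    by (rule pole_reg_weak_gradient[OF e]) simp
  have "(\<lambda>n. cdiv ?S (\<lambda>z. pole_reg (e n) (z - q)) \<phi>) \<longlonglongrightarrow> cdiv ?S (\<lambda>z. 1 / (z - q)) \<phi>"
  proof (rule cdiv_tendsto[OF open_ball \<phi> _ inverse_locally_integrable])
    show "locally_integrable_on ?S (\<lambda>z. pole_reg (e n) (z - q))" for n
      using wg[of n] by (auto simp: weak_gradient_def weak_partial_def)
    show "AE z in lebesgue. z \<in> ?S \<longrightarrow> (\<lambda>n. pole_reg (e n) (z - q)) \<longlonglongrightarrow> 1 / (z - q)"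
    proof (rule eventually_mono[OF AE_not_in_countable[of "{q}"]])
      fix z assume "z \<notin> {q}"
      then have "cmod (z - q) > 0" by simp
      from order_tendstoD(2)[OF e0 this] have "\<forall>\<^sub>F n in sequentially. pole_reg (e n) (z - q) = 1 / (z - q)"
        by (rule eventually_mono) (auto simp: pole_reg_def)
      then show "z \<in> ?S \<longrightarrow> (\<lambda>n. pole_reg (e n) (z - q)) \<longlonglongrightarrow> 1 / (z - q)"
        by (intro impI tendsto_eventually)
    qed simp
    show "AE z in lebesgue. z \<in> ?S \<longrightarrow> cmod (pole_reg (e n) (z - q)) \<le> cmod (1 / (z - q))" for n
      using pole_reg_bound(1)[OF e] by (simp add: norm_divide)
    show "locally_integrable_on ?S (\<lambda>z. cmod (1 / (z - q)))"
      by (rule locally_integrable_on_norm[OF inverse_locally_integrable])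
  qed
  moreover have "(\<lambda>n. cdiv ?S (\<lambda>z. pole_reg (e n) (z - q)) \<phi>) \<longlonglongrightarrow> of_real (2 * pi * \<phi> q)"
  proof -
    define m where "m n = (LINT z:ball q (e n)|lebesgue. \<phi> z)" for n
    have int: "set_integrable lebesgue (ball q s) h" if "continuous_on UNIV h" for s and h :: "complex \<Rightarrow> real"
    proof -
      have "set_integrable lebesgue (cball q s) h"
        using continuous_on_imp_locally_integrable[OF that] by (auto simp: locally_integrable_on_def)
      then show ?thesis by (rule set_integrable_subset) auto
    qed
    have "\<forall>\<^sub>F n in sequentially. cdiv ?S (\<lambda>z. pole_reg (e n) (z - q)) \<phi> = of_real (2 / (e n)\<^sup>2 * m n)"
      using order_tendstoD(2)[OF e0 r]
    proof eventually_elim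
      case (elim n)
      have "cdiv ?S (\<lambda>z. pole_reg (e n) (z - q)) \<phi>
        = (LINT z:?S|lebesgue. \<phi> z *\<^sub>R complex_of_real (Re (if cmod (z - q) < e n then cnj 1 / of_real ((e n)\<^sup>2) else - (1 / (z - q)\<^sup>2))
           - Im (if cmod (z - q) < e n then cnj \<i> / of_real ((e n)\<^sup>2) else - (\<i> / (z - q)\<^sup>2))))"
        by (rule cdiv_weak_gradient[OF wg \<phi>])
      also have "\<dots> = (LINT z|lebesgue. complex_of_real (2 / (e n)\<^sup>2 * (indicator (ball q (e n)) z *\<^sub>R \<phi> z)))"
        unfolding set_lebesgue_integral_def
      proof (rule Bochner_Integration.integral_cong[OF refl])
        fix z :: complex
        have "Im (\<i> / (z - q)\<^sup>2) = Re (1 / (z - q)\<^sup>2)"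
        proof -
          have "\<i> / (z - q)\<^sup>2 = \<i> * (1 / (z - q)\<^sup>2)" by simp
          then show ?thesis by (simp only: Im_i_times)
        qed
        then show "indicator ?S z *\<^sub>R \<phi> z *\<^sub>R complex_of_real (Re (if cmod (z - q) < e n then cnj 1 / of_real ((e n)\<^sup>2) else - (1 / (z - q)\<^sup>2))
           - Im (if cmod (z - q) < e n then cnj \<i> / of_real ((e n)\<^sup>2) else - (\<i> / (z - q)\<^sup>2)))
          = complex_of_real (2 / (e n)\<^sup>2 * (indicator (ball q (e n)) z *\<^sub>R \<phi> z))"
          using elim by (auto simp: indicator_def dist_norm norm_minus_commute scaleR_conv_of_real)
      qed
      also have "\<dots> = complex_of_real (LINT z|lebesgue. 2 / (e n)\<^sup>2 * (indicator (ball q (e n)) z *\<^sub>R \<phi> z))"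
        by (rule integral_complex_of_real)
      also have "\<dots> = of_real (2 / (e n)\<^sup>2 * m n)"
        unfolding m_def set_lebesgue_integral_def by (subst integral_mult_right_zero) simp
      finally show ?case .
    qed
    moreover have "(\<lambda>n. 2 / (e n)\<^sup>2 * m n) \<longlonglongrightarrow> 2 * pi * \<phi> q"
    proof (rule LIMSEQ_I)
      fix d :: real assume d: "d > 0"
      \<comment> \<open>The weight 2 / e^2 against the area pi e^2 turns an oscillation d' of the
        test function into 2 pi d' = d / 2.\<close>
      define d' where "d' = d / (4 * pi)"
      have d': "d' > 0" using d by (simp add: d'_def)
      from K have "isCont \<phi> q" by (simp add: continuous_on_eq_continuous_at)
      then obtain s where s: "s > 0" "\<And>z. dist z q < s \<Longrightarrow> dist (\<phi> z) (\<phi> q) < d'"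
        using d' unfolding continuous_at_eps_delta by blast
      have "\<forall>\<^sub>F n in sequentially. e n < s" by (rule order_tendstoD(2)[OF e0 s(1)])
      then obtain N where N: "\<And>n. n \<ge> N \<Longrightarrow> e n < s" by (auto simp: eventually_sequentially)
      have "norm (2 / (e n)\<^sup>2 * m n - 2 * pi * \<phi> q) < d" if n: "n \<ge> N" for n
      proof -
        have meas: "measure lebesgue (ball q (e n)) = pi * (e n)\<^sup>2"
          using e[of n] by (simp add: content_ball unit_ball_vol_2)
        have const: "(LINT z:ball q (e n)|lebesgue. k) = k * (pi * (e n)\<^sup>2)" for k :: real
          using meas by (simp add: set_lebesgue_integral_def mult.commute)
        have ci: "set_integrable lebesgue (ball q (e n)) (\<lambda>z. k)" for k :: real
          by (rule int) simp
        have near: "\<phi> q - d' \<le> \<phi> z \<and> \<phi> z \<le> \<phi> q + d'" if "z \<in> ball q (e n)" for z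
        proof -
          have "dist z q < s" using that N[OF n] by (simp add: dist_commute)
          from s(2)[OF this] show ?thesis by (simp add: dist_real_def abs_less_iff)
        qed
        have "(\<phi> q - d') * (pi * (e n)\<^sup>2) \<le> m n"
          unfolding const[symmetric] m_def using near by (intro set_integral_mono ci int K) auto
        moreover have "m n \<le> (\<phi> q + d') * (pi * (e n)\<^sup>2)"
          unfolding const[symmetric] m_def using near by (intro set_integral_mono ci int K) auto
        ultimately have "\<bar>m n - \<phi> q * (pi * (e n)\<^sup>2)\<bar> \<le> d' * (pi * (e n)\<^sup>2)"
          by (simp add: abs_le_iff algebra_simps)
        then have "2 / (e n)\<^sup>2 * \<bar>m n - \<phi> q * (pi * (e n)\<^sup>2)\<bar> \<le> 2 / (e n)\<^sup>2 * (d' * (pi * (e n)\<^sup>2))"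
          by (intro mult_left_mono) auto
        also have "2 / (e n)\<^sup>2 * (d' * (pi * (e n)\<^sup>2)) = d / 2" using e[of n] by (simp add: d'_def)
        also have "2 / (e n)\<^sup>2 * \<bar>m n - \<phi> q * (pi * (e n)\<^sup>2)\<bar> = \<bar>2 / (e n)\<^sup>2 * m n - 2 * pi * \<phi> q\<bar>"
        proof -
          have "2 / (e n)\<^sup>2 * (m n - \<phi> q * (pi * (e n)\<^sup>2)) = 2 / (e n)\<^sup>2 * m n - 2 * pi * \<phi> q"
            using e[of n] by (simp add: field_simps)
          then show ?thesis by (metis abs_mult abs_of_nonneg zero_le_divide_iff zero_le_numeral zero_le_power2)
        qed
        finally show ?thesis using d by simp
      qed
      then show "\<exists>N. \<forall>n\<ge>N. norm (2 / (e n)\<^sup>2 * m n - 2 * pi * \<phi> q) < d" by blast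
    qed
    then have "(\<lambda>n. complex_of_real (2 / (e n)\<^sup>2 * m n)) \<longlonglongrightarrow> of_real (2 * pi * \<phi> q)" by (rule tendsto_of_real)
    ultimately show ?thesis
      by (rule tendsto_cong[THEN iffD2])
  qed
  ultimately show ?thesis by (rule LIMSEQ_unique)
qed

section \<open>Zeros and bump functions\<close>

text \<open>Where exp (i zeta) = 1 the two terms with a factor zeta cancel, and -i exp (- zeta -
  zeta^2) remains.\<close>

lemma sw_fun'_zero:
  assumes "sw_fun z = 0"
  shows "sw_fun' z \<noteq> 0"
proof -
  have E: "exp (\<i> * zeta z) = 1" using assms by (simp add: sw_fun_eq_0_iff)
  have "(\<i> - 1) * zeta z - (zeta z)\<^sup>2 = \<i> * zeta z + (- 1 * zeta z - (zeta z)\<^sup>2)" by (simp add: algebra_simps)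
  then have "exp ((\<i> - 1) * zeta z - (zeta z)\<^sup>2) = exp (- 1 * zeta z - (zeta z)\<^sup>2)"
    by (simp only: exp_add E mult_1_left)
  then have "sw_fun' z = - \<i> * exp (- 1 * zeta z - (zeta z)\<^sup>2)"
    unfolding sw_fun'_def flat_gen_def by (simp only:) simp
  then show ?thesis by simp
qed

lemma sw_fun_holomorphic: "sw_fun holomorphic_on disc"
  unfolding holomorphic_on_open[OF open_ball] using sw_fun_alg.f_deriv by blast

lemma deriv_sw_fun: "z \<in> disc \<Longrightarrow> deriv sw_fun z = sw_fun' z"
  using sw_fun_alg.f_deriv DERIV_imp_deriv by blast

text \<open>The zeros of \<open>sw_fun\<close> are simple, so \<open>sw_logderiv = sw_fun'/sw_fun\<close> has residue 1 there.\<close>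

lemma sw_logderiv_pole:
  assumes q: "q \<in> disc" "sw_fun q = 0"
  obtains r k where "r > 0" "ball q r \<subseteq> disc" "k holomorphic_on ball q r"
    "\<And>z. z \<in> ball q r \<Longrightarrow> z \<noteq> q \<Longrightarrow> sw_fun z \<noteq> 0 \<and> sw_logderiv z = 1 / (z - q) + k z"
proof -
  \<comment> \<open>The quotient f / (z - q) with its singularity removed. Its value at q is f' q,
    which is not 0, so h has no zero near q and f' / f = 1 / (z - q) + h' / h.\<close>
  define h where "h z = (if z = q then deriv sw_fun q else (sw_fun z - sw_fun q) / (z - q))" for z
  have "q \<in> interior disc" using q(1) by (simp add: interior_open)
  from pole_lemma[OF sw_fun_holomorphic this] have h: "h holomorphic_on disc" by (simp add: h_def[abs_def])
  have hq: "h q \<noteq> 0" using sw_fun'_zero[OF q(2)] deriv_sw_fun[OF q(1)] by (simp add: h_def)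
  have fh: "sw_fun z = (z - q) * h z" for z using q(2) by (simp add: h_def)
  have "open (disc \<inter> h -` (- {0}))"
    using continuous_open_preimage[OF holomorphic_on_imp_continuous_on[OF h] open_ball, of "- {0}"] by (simp add: open_Compl)
  moreover have "q \<in> disc \<inter> h -` (- {0})" using q(1) hq by simp
  ultimately obtain r where r: "r > 0" "ball q r \<subseteq> disc \<inter> h -` (- {0})" by (meson open_contains_ball)
  define k where "k z = deriv h z / h z" for z
  have sub: "ball q r \<subseteq> disc" using r(2) by blast
  have hr: "h holomorphic_on ball q r" using h sub by (rule holomorphic_on_subset)
  have hol: "k holomorphic_on ball q r"
    unfolding k_def by (intro holomorphic_intros hr open_ball) (use r(2) in auto)
  have LLk: "sw_fun z \<noteq> 0 \<and> sw_logderiv z = 1 / (z - q) + k z" if z: "z \<in> ball q r" "z \<noteq> q" for z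
  proof -
    have zd: "z \<in> disc" using z(1) sub by blast
    have hz: "h z \<noteq> 0" using r(2) z(1) by auto
    have f0: "sw_fun z \<noteq> 0" using fh[of z] hz z(2) by simp
    have "(h has_field_derivative deriv h z) (at z)" using holomorphic_derivI[OF h open_ball zd] .
    then have "((\<lambda>z. (z - q) * h z) has_field_derivative h z + (z - q) * deriv h z) (at z)"
      by (auto intro!: derivative_eq_intros)
    moreover have "(\<lambda>z. (z - q) * h z) = sw_fun" using fh by (simp add: fun_eq_iff)
    ultimately have "(sw_fun has_field_derivative h z + (z - q) * deriv h z) (at z)" by simp
    with sw_fun_alg.f_deriv[OF zd] have "sw_fun' z = h z + (z - q) * deriv h z" by (rule DERIV_unique)
    moreover have "sw_fun' z = sw_logderiv z * sw_fun z" using sw_fun'_eq f0 zd disc_subset_slit by blast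
    ultimately have "sw_logderiv z * ((z - q) * h z) = h z + (z - q) * deriv h z" by (simp only: fh)
    then have "sw_logderiv z = (h z + (z - q) * deriv h z) / ((z - q) * h z)" using hz z(2) by (simp add: field_simps)
    also have "\<dots> = 1 / (z - q) + k z" using hz z(2) by (simp add: k_def field_simps)
    finally show ?thesis using f0 by simp
  qed
  show ?thesis by (rule that[OF r(1) sub hol LLk])
qed

lemma cnj_sw_dir_mult: "cnj (sw_dir z) * (sw_dir z * w) = w"
proof -
  have "cnj (sw_dir z) * sw_dir z = 1" using complex_norm_square[of "sw_dir z"] norm_sw_dir[of z] by (simp add: mult.commute)
  then show ?thesis by (simp add: mult.assoc[symmetric])
qed

text \<open>For g = f / |f| the field in the degree condition is the gradient of ln |f|, which is
  encoded by f' / f.\<close>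

lemma sw_dir_div_perp:
  "distr_div S (\<lambda>z. \<i> * cnj (sw_dir z) * (- (sw_dir z * (\<i> * of_real (Re (sw_logderiv z))))))
      (\<lambda>z. \<i> * cnj (sw_dir z) * (sw_dir z * (\<i> * of_real (Im (sw_logderiv z))))) \<phi> = cdiv S sw_logderiv \<phi>"
  by (simp add: cdiv_def cnj_sw_dir_mult mult.assoc)

text \<open>Near the zero, f' / f is a simple pole of residue 1 plus a holomorphic function. The
  pole contributes the Dirac mass and the holomorphic part is divergence free.\<close>

lemma sw_dir_degree_one:
  assumes q: "q \<in> disc" "sw_fun q = 0"
  shows "degree_one_singularity sw_dir q"
proof -
  obtain r k where r: "r > 0" "ball q r \<subseteq> disc" "k holomorphic_on ball q r"
    "\<And>z. z \<in> ball q r \<Longrightarrow> z \<noteq> q \<Longrightarrow> sw_fun z \<noteq> 0 \<and> sw_logderiv z = 1 / (z - q) + k z"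
    by (rule sw_logderiv_pole[OF q]) blast
  have kl: "locally_integrable_on (ball q r) k"
    by (intro continuous_on_imp_locally_integrable holomorphic_on_imp_continuous_on r(3))
  have "cdiv (ball q r) sw_logderiv \<phi> = of_real (2 * pi * \<phi> q)" if \<phi>: "test_function (ball q r) \<phi>" for \<phi>
  proof -
    have "cdiv (ball q r) sw_logderiv \<phi> = cdiv (ball q r) (\<lambda>z. 1 / (z - q) + k z) \<phi>"
    proof (rule cdiv_cong_AE[OF open_ball _ _ _ \<phi>])
      show "AE z in lebesgue. z \<in> ball q r \<longrightarrow> sw_logderiv z = 1 / (z - q) + k z"
        by (rule eventually_mono[OF AE_not_in_countable[of "{q}"]]) (use r(4) in auto)
      show "locally_integrable_on (ball q r) sw_logderiv"
        by (rule locally_integrable_on_subset[OF sw_logderiv_locally_integrable r(2)])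
      show "locally_integrable_on (ball q r) (\<lambda>z. 1 / (z - q) + k z)"
        by (rule locally_integrable_on_add[OF inverse_locally_integrable kl])
    qed
    also have "\<dots> = cdiv (ball q r) (\<lambda>z. 1 / (z - q)) \<phi> + cdiv (ball q r) k \<phi>"
      by (rule cdiv_add[OF inverse_locally_integrable kl \<phi>])
    finally show ?thesis
      by (simp add: cdiv_pole[OF r(1) \<phi>] cdiv_holomorphic[OF open_ball r(3) \<phi>])
  qed
  then show ?thesis
    unfolding degree_one_singularity_def using r(1,2) weak_gradient_subset[OF sw_dir_weak_gradient r(2)]
    by (intro exI[of _ r] exI[of _ "\<lambda>z. sw_dir z * (\<i> * of_real (Im (sw_logderiv z)))"]
        exI[of _ "\<lambda>z. sw_dir z * (\<i> * of_real (Re (sw_logderiv z)))"] conjI allI impI)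
      (simp_all only: sw_dir_div_perp)
qed

text \<open>The standard flat function exp (-1/x) divided by powers of x, which makes the family
  closed under differentiation.\<close>

definition flat_exp :: "nat \<Rightarrow> real \<Rightarrow> real" where
  "flat_exp k x = (if x > 0 then exp (- 1 / x) / x ^ k else 0)"

lemma flat_exp_deriv: "(flat_exp k has_field_derivative flat_exp (k + 2) x - real k * flat_exp (k + 1) x) (at x)"
proof -
  consider "x > 0" | "x < 0" | "x = 0" by linarith
  then show ?thesis
  proof cases
    case 1
    have "((\<lambda>x. exp (- 1 / x) / x ^ k) has_field_derivative
        (exp (- 1 / x) * (1 / x\<^sup>2) * x ^ k - exp (- 1 / x) * (real k * x ^ (k - 1))) / (x ^ k * x ^ k)) (at x)"
      using 1 by (auto intro!: derivative_eq_intros simp: power2_eq_square)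
    moreover have "(exp (- 1 / x) * (1 / x\<^sup>2) * x ^ k - exp (- 1 / x) * (real k * x ^ (k - 1))) / (x ^ k * x ^ k)
        = flat_exp (k + 2) x - real k * flat_exp (k + 1) x"
      using 1 by (cases k) (simp_all add: flat_exp_def field_simps power2_eq_square)
    ultimately have "((\<lambda>x. exp (- 1 / x) / x ^ k) has_field_derivative flat_exp (k + 2) x - real k * flat_exp (k + 1) x) (at x)"
      by simp
    then show ?thesis
      by (rule has_field_derivative_transform_within_open[where S="{0<..}"]) (use 1 in \<open>auto simp: flat_exp_def\<close>)
  next
    case 2
    have "((\<lambda>x. 0) has_field_derivative 0) (at x)" by simp
    then have "(flat_exp k has_field_derivative 0) (at x)"
      by (rule has_field_derivative_transform_within_open[where S="{..<0}"]) (use 2 in \<open>auto simp: flat_exp_def\<close>)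
    then show ?thesis using 2 by (simp add: flat_exp_def)
  next
    case 3
    \<comment> \<open>The constant of \<open>power_le_exp\<close> for exponent k + 2 at 1 / h,
      giving flat_exp k h \<le> C h^2; one power of h is left after division by h.\<close>
    define C where "C = real (k + 2) ^ (k + 2)"
    have bound: "\<bar>flat_exp k h / h\<bar> \<le> C * \<bar>h\<bar>" for h :: real
    proof (cases "h > 0")
      case True
      have "(1 / h) ^ (k + 2) \<le> C * exp (1 / h)" unfolding C_def using True by (intro power_le_exp) simp
      then have "(1 / h) ^ (k + 2) * exp (- 1 / h) \<le> C * exp (1 / h) * exp (- 1 / h)"
        by (intro mult_right_mono) auto
      also have "\<dots> = C" by (simp flip: exp_add)
      finally have "(1 / h) ^ (k + 2) * exp (- 1 / h) * h \<le> C * h" using True by (intro mult_right_mono) auto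
      moreover have "(1 / h) ^ (k + 2) * exp (- 1 / h) * h = flat_exp k h / h"
        using True by (simp add: flat_exp_def field_simps power_divide)
      ultimately show ?thesis using True by (simp add: flat_exp_def)
    next
      case False
      have "0 \<le> C * \<bar>h\<bar>" by (simp add: C_def del: abs_of_nonpos)
      with False show ?thesis by (simp add: flat_exp_def)
    qed
    have "((\<lambda>h. C * \<bar>h\<bar>) \<longlongrightarrow> C * \<bar>0\<bar>) (at 0)" by (intro tendsto_intros)
    then have lim: "((\<lambda>h. C * \<bar>h\<bar>) \<longlongrightarrow> 0) (at 0)" by simp
    have "((\<lambda>h. flat_exp k h / h) \<longlongrightarrow> 0) (at 0)"
      by (rule tendsto_0_le[OF lim, where K=1]) (use bound in \<open>auto simp: C_def abs_mult\<close>)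
    moreover have "flat_exp k 0 = 0" for k by (simp add: flat_exp_def)
    ultimately show ?thesis using 3 by (simp add: DERIV_def)
  qed
qed

inductive_set bump_alg :: "complex \<Rightarrow> real \<Rightarrow> (complex \<Rightarrow> real) set" for q r where
  bump_const: "(\<lambda>_. c) \<in> bump_alg q r"
| bump_Re: "(\<lambda>z. Re (z - q)) \<in> bump_alg q r"
| bump_Im: "(\<lambda>z. Im (z - q)) \<in> bump_alg q r"
| bump_flat_exp: "(\<lambda>z. flat_exp k (r\<^sup>2 - (cmod (z - q))\<^sup>2)) \<in> bump_alg q r"
| bump_add: "u \<in> bump_alg q r \<Longrightarrow> v \<in> bump_alg q r \<Longrightarrow> (\<lambda>z. u z + v z) \<in> bump_alg q r"
| bump_mult: "u \<in> bump_alg q r \<Longrightarrow> v \<in> bump_alg q r \<Longrightarrow> (\<lambda>z. u z * v z) \<in> bump_alg q r"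

lemma bump_alg_deriv:
  assumes u: "u \<in> bump_alg q r"
  shows "\<exists>u'. u' \<in> bump_alg q r \<and> (\<forall>z. \<exists>D. (u has_derivative D) (at z) \<and> D v = u' z)"
  using u
proof (induction rule: bump_alg.induct)
  case (bump_const c)
  show ?case by (intro exI[of _ "\<lambda>_. 0"] conjI bump_alg.bump_const allI) (auto intro!: exI[of _ "\<lambda>_. 0"])
next
  case bump_Re
  have "((\<lambda>z. Re (z - q)) has_derivative Re) (at z)" for z by (auto intro!: derivative_eq_intros)
  then have "\<forall>z. \<exists>D. ((\<lambda>z. Re (z - q)) has_derivative D) (at z) \<and> D v = Re v" by blast
  then show ?case by (intro exI[of _ "\<lambda>_. Re v"] conjI bump_alg.bump_const)
next
  case bump_Im
  have "((\<lambda>z. Im (z - q)) has_derivative Im) (at z)" for z by (auto intro!: derivative_eq_intros)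
  then have "\<forall>z. \<exists>D. ((\<lambda>z. Im (z - q)) has_derivative D) (at z) \<and> D v = Im v" by blast
  then show ?case by (intro exI[of _ "\<lambda>_. Im v"] conjI bump_alg.bump_const)
next
  case (bump_flat_exp k)
  define B where "B k z = flat_exp k (r\<^sup>2 - (cmod (z - q))\<^sup>2)" for k z
  let ?u = "\<lambda>z. (B (k + 2) z + (- real k) * B (k + 1) z) * (((- 2) * Re v) * Re (z - q) + ((- 2) * Im v) * Im (z - q))"
  have "?u \<in> bump_alg q r"
    unfolding B_def
    by (intro bump_alg.bump_add bump_alg.bump_mult bump_alg.bump_const bump_alg.bump_Re bump_alg.bump_Im bump_alg.bump_flat_exp)
  moreover have "\<exists>D. (B k has_derivative D) (at z) \<and> D v = ?u z" for z
  proof -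
    have "((\<lambda>z. r\<^sup>2 - (cmod (z - q))\<^sup>2) has_derivative (\<lambda>h. - 2 * ((z - q) \<bullet> h))) (at z)"
      unfolding power2_norm_eq_inner by (auto intro!: derivative_eq_intros simp: inner_commute)
    from DERIV_compose_FDERIV[OF flat_exp_deriv this]
    have "(B k has_derivative (\<lambda>h. (- 2 * ((z - q) \<bullet> h)) * (B (k + 2) z - real k * B (k + 1) z))) (at z)"
      by (simp add: B_def[abs_def])
    moreover have "(- 2 * ((z - q) \<bullet> v)) * (B (k + 2) z - real k * B (k + 1) z) = ?u z"
      by (simp add: inner_complex_def algebra_simps)
    ultimately show ?thesis by blast
  qed
  ultimately show ?case by (auto simp: B_def[abs_def])
next
  case (bump_add u w)
  then obtain u' w' where uw: "u' \<in> bump_alg q r" "w' \<in> bump_alg q r"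
    "\<And>z. \<exists>D. (u has_derivative D) (at z) \<and> D v = u' z" "\<And>z. \<exists>D. (w has_derivative D) (at z) \<and> D v = w' z" by blast
  have "\<exists>D. ((\<lambda>z. u z + w z) has_derivative D) (at z) \<and> D v = u' z + w' z" for z
  proof -
    obtain D E where "(u has_derivative D) (at z)" "D v = u' z" "(w has_derivative E) (at z)" "E v = w' z"
      using uw(3,4)[of z] by blast
    then show ?thesis by (intro exI[of _ "\<lambda>h. D h + E h"]) (auto intro: has_derivative_add)
  qed
  note D = this
  show ?case
    by (rule exI[of _ "\<lambda>z. u' z + w' z"], intro conjI allI bump_alg.bump_add uw(1,2) D)
next
  case (bump_mult u w)
  then obtain u' w' where uw: "u' \<in> bump_alg q r" "w' \<in> bump_alg q r"
    "\<And>z. \<exists>D. (u has_derivative D) (at z) \<and> D v = u' z" "\<And>z. \<exists>D. (w has_derivative D) (at z) \<and> D v = w' z" by blast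
  have "\<exists>D. ((\<lambda>z. u z * w z) has_derivative D) (at z) \<and> D v = u z * w' z + u' z * w z" for z
  proof -
    obtain D E where "(u has_derivative D) (at z)" "D v = u' z" "(w has_derivative E) (at z)" "E v = w' z"
      using uw(3,4)[of z] by blast
    then show ?thesis by (intro exI[of _ "\<lambda>h. u z * E h + D h * w z"]) (auto intro: has_derivative_mult)
  qed
  note D = this
  show ?case
    by (rule exI[of _ "\<lambda>z. u z * w' z + u' z * w z"], intro conjI allI D
        bump_alg.bump_add bump_alg.bump_mult uw(1,2) bump_mult.hyps)
qed

text \<open>A test function positive at q is what tells a Dirac mass at q from the zero
  distribution.\<close>

lemma bump_exists:
  fixes q :: complex
  assumes S: "open S" "q \<in> S"
  obtains \<phi> where "test_function S \<phi>" "\<phi> q > 0"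
proof -
  obtain r where r: "r > 0" "cball q r \<subseteq> S" using S open_contains_cball by blast
  define \<phi> where "\<phi> z = flat_exp 0 (r\<^sup>2 - (cmod (z - q))\<^sup>2)" for z
  have "\<phi> \<in> bump_alg q r" unfolding \<phi>_def by (rule bump_flat_exp)
  then have sm: "smooth_on UNIV \<phi>"
    by (intro smooth_on_class[where P="\<lambda>u. u \<in> bump_alg q r"]) (use bump_alg_deriv in auto)
  have "z \<in> cball q r" if "\<phi> z \<noteq> 0" for z
  proof -
    have "(cmod (z - q))\<^sup>2 < r\<^sup>2" using that by (auto simp: \<phi>_def flat_exp_def split: if_splits)
    then show ?thesis using r(1) power2_less_imp_less[of "cmod (z - q)" r] by (simp add: dist_norm norm_minus_commute)
  qed
  then have "{z. \<phi> z \<noteq> 0} \<subseteq> cball q r" by blast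
  then have cl: "closure {z. \<phi> z \<noteq> 0} \<subseteq> cball q r" by (simp add: closure_minimal)
  then have "compact (closure {z. \<phi> z \<noteq> 0})"
    by (metis bounded_cball bounded_subset closed_closure compact_eq_bounded_closed)
  with sm cl r(2) have "test_function S \<phi>" by (auto simp: test_function_def)
  moreover have "\<phi> q > 0" using r(1) by (simp add: \<phi>_def flat_exp_def)
  ultimately show ?thesis by (rule that)
qed

lemma test_function_partial_deriv:
  fixes \<phi> :: "'a::euclidean_space \<Rightarrow> real"
  assumes \<phi>: "test_function S \<phi>" and v: "v \<in> Basis"
  shows "test_function S (partial_deriv v \<phi>)"
proof -
  define K where "K = closure {z. \<phi> z \<noteq> 0}"
  have K: "compact K" "K \<subseteq> S" and sm: "smooth_on UNIV \<phi>" using \<phi> by (auto simp: test_function_def K_def)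
  have "z \<in> K" if "partial_deriv v \<phi> z \<noteq> 0" for z
  proof (rule ccontr)
    assume z: "z \<notin> K"
    have "\<phi> x = 0" if "x \<in> - K" for x using that closure_subset[of "{z. \<phi> z \<noteq> 0}"] by (auto simp: K_def)
    note zero = this
    have "(\<phi> has_derivative (\<lambda>_. 0)) (at z)"
      by (rule has_derivative_transform_within_open[of "\<lambda>_. 0" _ z UNIV "- K"])
        (use z K(1) compact_imp_closed zero in auto)
    then have "partial_deriv v \<phi> z = 0" by (simp add: partial_deriv_def frechet_derivative_at[symmetric])
    with that show False by simp
  qed
  then have "closure {z. partial_deriv v \<phi> z \<noteq> 0} \<subseteq> K"
    using K(1) compact_imp_closed by (intro closure_minimal) auto
  moreover from this have "compact (closure {z. partial_deriv v \<phi> z \<noteq> 0})"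
    using K(1) by (metis closed_closure closed_subset compact_Int_closed inf.absorb_iff2 inf.absorb2)
  ultimately show ?thesis
    using K(2) smooth_on_partial_deriv[OF sm v] by (auto simp: test_function_def)
qed

lemma smooth_on_zero: "open S \<Longrightarrow> smooth_on S (\<lambda>_. 0)"
  by (rule smooth_on_class[where P="\<lambda>u. u = (\<lambda>_. 0)"]) (auto intro!: exI[of _ "\<lambda>_. 0"])

text \<open>The factor c is smooth only on S, but the product vanishes on the complement of the
  support of \<phi>; this complement and S are open and cover the space.\<close>

lemma test_function_mult:
  fixes \<phi> c :: "'a::euclidean_space \<Rightarrow> real"
  assumes \<phi>: "test_function S \<phi>" and S: "open S" and c: "smooth_on S c"
  shows "test_function S (\<lambda>z. \<phi> z * c z)"
proof -
  define K where "K = closure {z. \<phi> z \<noteq> 0}"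
  have K: "compact K" "K \<subseteq> S" and sm: "smooth_on UNIV \<phi>" using \<phi> by (auto simp: test_function_def K_def)
  have cK: "closed K" using K(1) compact_imp_closed by blast
  have 0: "\<phi> x = 0" if "x \<in> - K" for x using that closure_subset[of "{z. \<phi> z \<noteq> 0}"] by (auto simp: K_def)
  have "smooth_on S (\<lambda>z. \<phi> z * c z)"
    by (intro smooth_on_mult S c smooth_on_subset[OF sm]) simp
  moreover have "smooth_on (- K) (\<lambda>z. \<phi> z * c z)"
    using smooth_on_cong[of "- K" "\<lambda>z. \<phi> z * c z" "\<lambda>_. 0"] smooth_on_zero[of "- K"] 0 cK by (simp add: open_Compl)
  ultimately have "smooth_on (S \<union> - K) (\<lambda>z. \<phi> z * c z)"
    using S cK by (intro smooth_on_Un) auto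
  moreover have "S \<union> - K = UNIV" using K(2) by blast
  moreover have cl: "closure {z. \<phi> z * c z \<noteq> 0} \<subseteq> K"
    unfolding K_def by (intro closure_mono) auto
  moreover have "compact (closure {z. \<phi> z * c z \<noteq> 0})"
    by (rule compact_Int_closed[OF K(1) closed_closure, of "{z. \<phi> z * c z \<noteq> 0}", unfolded inf.absorb2[OF cl]])
  ultimately show ?thesis using K(2) by (simp add: test_function_def)
qed

section \<open>Singularities of the map\<close>

text \<open>Uniqueness of weak derivatives in tested form: both integrals equal minus the integral
  of f against the derivative of the test function.\<close>

lemma weak_partial_test_eq:
  assumes "weak_partial S v f f1" "weak_partial S v f f2" "test_function S \<psi>"
  shows "(LINT z:S|lebesgue. \<psi> z *\<^sub>R f1 z) = (LINT z:S|lebesgue. \<psi> z *\<^sub>R f2 z)"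
  using assms unfolding weak_partial_def by (metis minus_equation_iff)

text \<open>Test functions are real valued, so a complex smooth factor h enters them through its
  real and imaginary parts.\<close>

lemma test_integral_real_imag:
  fixes h f :: "complex \<Rightarrow> complex"
  assumes f: "locally_integrable_on S f" and r: "test_function S (\<lambda>z. \<phi> z * Re (h z))" and i: "test_function S (\<lambda>z. \<phi> z * Im (h z))"
  shows "(LINT z:S|lebesgue. \<phi> z *\<^sub>R (h z * f z))
    = (LINT z:S|lebesgue. (\<phi> z * Re (h z)) *\<^sub>R f z) + \<i> * (LINT z:S|lebesgue. (\<phi> z * Im (h z)) *\<^sub>R f z)"
    "set_integrable lebesgue S (\<lambda>z. \<phi> z *\<^sub>R (h z * f z))"
proof -
  have int: "set_integrable lebesgue S (\<lambda>z. \<psi> z *\<^sub>R f z)" if "test_function S \<psi>" for \<psi>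
    using that by (elim test_functionE) (auto intro: test_integrable[OF f])
  have eq: "\<phi> z *\<^sub>R (h z * f z) = (\<phi> z * Re (h z)) *\<^sub>R f z + \<i> * ((\<phi> z * Im (h z)) *\<^sub>R f z)" for z
    by (simp add: scaleR_conv_of_real complex_eq_iff algebra_simps)
  have I: "set_integrable lebesgue S (\<lambda>z. \<i> * ((\<phi> z * Im (h z)) *\<^sub>R f z))"
    by (rule set_integrable_mult_right) (rule int[OF i])
  show "(LINT z:S|lebesgue. \<phi> z *\<^sub>R (h z * f z))
    = (LINT z:S|lebesgue. (\<phi> z * Re (h z)) *\<^sub>R f z) + \<i> * (LINT z:S|lebesgue. (\<phi> z * Im (h z)) *\<^sub>R f z)"
    unfolding eq by (simp only: set_integral_add(2)[OF int[OF r] I] set_integral_mult_right)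
  show "set_integrable lebesgue S (\<lambda>z. \<phi> z *\<^sub>R (h z * f z))"
    unfolding eq by (rule set_integral_add(1)[OF int[OF r] I])
qed

text \<open>The trailing factor 1 is the coefficient in the form expected by
  \<open>smooth_on_epw_sw_fun\<close>.\<close>

lemma sw_dir_eq_epw: "sw_fun z \<noteq> 0 \<Longrightarrow> cnj (sw_dir z) = epw 0 (- 1) (sw_fun z) * 1"
proof -
  assume f: "sw_fun z \<noteq> 0"
  have "epw 0 (- 1) (sw_fun z) = cnj (epw 0 1 (sw_fun z))" by (simp add: cnj_epw)
  then show ?thesis using f by (simp add: epw_def sw_dir_def)
qed

lemma smooth_on_cnj_sw_dir: "smooth_on sw_dom (\<lambda>z. cnj (sw_dir z))"
proof -
  have "smooth_on sw_dom (\<lambda>z. epw 0 (- 1) (sw_fun z) * 1)" by (rule smooth_on_epw_sw_fun[OF star_alg_const])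
  then show ?thesis
    by (subst smooth_on_cong[OF open_sw_dom]) (auto simp: sw_dom_def sw_dir_eq_epw)
qed

lemma sw_logderiv_holomorphic: "sw_logderiv holomorphic_on sw_dom"
proof -
  have z: "zeta holomorphic_on sw_dom" "sw_quot holomorphic_on sw_dom"
    unfolding holomorphic_on_open[OF open_sw_dom] using zeta_deriv sw_quot_deriv by (auto simp: sw_dom_def)
  show ?thesis
    unfolding sw_logderiv_def[abs_def] by (intro holomorphic_intros z) (auto simp: sw_dom_def slit_def)
qed

text \<open>Near a point with \<open>sw_fun q \<noteq> 0\<close> the weak gradient of \<open>sw_dir\<close> may be tested against a test function
  times the smooth function \<open>cnj sw_dir\<close>, so any weak gradient gives the same distribution as \<open>sw_logderiv\<close>.\<close>

lemma sw_dir_not_degree_one: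
  assumes q: "q \<in> disc" and f: "sw_fun q \<noteq> 0"
  shows "\<not> degree_one_singularity sw_dir q"
proof
  assume "degree_one_singularity sw_dir q"
  then obtain r gx gy where r: "r > 0" "ball q r \<subseteq> disc" and wg: "weak_gradient (ball q r) sw_dir gx gy"
    and deg: "\<And>\<phi>. test_function (ball q r) \<phi> \<Longrightarrow>
      distr_div (ball q r) (\<lambda>z. \<i> * cnj (sw_dir z) * (- gy z)) (\<lambda>z. \<i> * cnj (sw_dir z) * gx z) \<phi> = complex_of_real (2 * pi * \<phi> q)"
    unfolding degree_one_singularity_def by blast
  define S where "S = ball q r \<inter> sw_dom"
  have S: "open S" "q \<in> S" "S \<subseteq> ball q r" "S \<subseteq> sw_dom" "S \<subseteq> disc"
    using r q f open_sw_dom disc_subset_slit by (auto simp: S_def sw_dom_def)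
  obtain \<phi> where \<phi>: "test_function S \<phi>" "\<phi> q > 0" by (rule bump_exists[OF S(1,2)])
  have wgS: "weak_gradient S sw_dir gx gy" by (rule weak_gradient_subset[OF wg S(3)])
  define gx0 where "gx0 z = sw_dir z * (\<i> * of_real (Im (sw_logderiv z)))" for z
  define gy0 where "gy0 z = sw_dir z * (\<i> * of_real (Re (sw_logderiv z)))" for z
  have wg0: "weak_gradient S sw_dir gx0 gy0"
    using weak_gradient_subset[OF sw_dir_weak_gradient S(5)] by (simp add: gx0_def[abs_def] gy0_def[abs_def])
  have b: "(1::complex) \<in> Basis" "\<i> \<in> Basis" by (simp_all add: Basis_complex_def)
  have sm: "smooth_on S (\<lambda>z. Re (cnj (sw_dir z)))" "smooth_on S (\<lambda>z. Im (cnj (sw_dir z)))"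
    by (rule smooth_on_subset[OF smooth_on_linear[OF open_sw_dom smooth_on_cnj_sw_dir bounded_linear_Re] S(4)],
        rule smooth_on_subset[OF smooth_on_linear[OF open_sw_dom smooth_on_cnj_sw_dir bounded_linear_Im] S(4)])
  have test: "test_function S (\<lambda>z. partial_deriv v \<phi> z * Re (cnj (sw_dir z)))"
    "test_function S (\<lambda>z. partial_deriv v \<phi> z * Im (cnj (sw_dir z)))" if "v \<in> Basis" for v
    by (intro test_function_mult[OF test_function_partial_deriv[OF \<phi>(1) that] S(1)] sm)+
  have split: "distr_div S (\<lambda>z. \<i> * cnj (sw_dir z) * (- ky z)) (\<lambda>z. \<i> * cnj (sw_dir z) * kx z) \<phi>
      = \<i> * (LINT z:S|lebesgue. partial_deriv 1 \<phi> z *\<^sub>R (cnj (sw_dir z) * ky z))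
        - \<i> * (LINT z:S|lebesgue. partial_deriv \<i> \<phi> z *\<^sub>R (cnj (sw_dir z) * kx z))"
    if "weak_gradient S sw_dir kx ky" for kx ky
  proof -
    have l: "locally_integrable_on S kx" "locally_integrable_on S ky"
      using that by (auto simp: weak_gradient_def weak_partial_def)
    have "partial_deriv 1 \<phi> z *\<^sub>R (\<i> * cnj (sw_dir z) * (- ky z)) + partial_deriv \<i> \<phi> z *\<^sub>R (\<i> * cnj (sw_dir z) * kx z)
        = (- \<i>) * (partial_deriv 1 \<phi> z *\<^sub>R (cnj (sw_dir z) * ky z)) + \<i> * (partial_deriv \<i> \<phi> z *\<^sub>R (cnj (sw_dir z) * kx z))" for z
      by (simp add: scaleR_conv_of_real algebra_simps)
    note eq = this
    have I1: "set_integrable lebesgue S (\<lambda>z. (- \<i>) * (partial_deriv 1 \<phi> z *\<^sub>R (cnj (sw_dir z) * ky z)))"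
      by (rule set_integrable_mult_right) (rule test_integral_real_imag(2)[OF l(2) test[OF b(1)]])
    have I2: "set_integrable lebesgue S (\<lambda>z. \<i> * (partial_deriv \<i> \<phi> z *\<^sub>R (cnj (sw_dir z) * kx z)))"
      by (rule set_integrable_mult_right) (rule test_integral_real_imag(2)[OF l(1) test[OF b(2)]])
    have "distr_div S (\<lambda>z. \<i> * cnj (sw_dir z) * (- ky z)) (\<lambda>z. \<i> * cnj (sw_dir z) * kx z) \<phi>
        = - ((- \<i>) * (LINT z:S|lebesgue. partial_deriv 1 \<phi> z *\<^sub>R (cnj (sw_dir z) * ky z))
          + \<i> * (LINT z:S|lebesgue. partial_deriv \<i> \<phi> z *\<^sub>R (cnj (sw_dir z) * kx z)))"
      unfolding distr_div_def eq by (simp only: set_integral_add(2)[OF I1 I2] set_integral_mult_right)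
    then show ?thesis by simp
  qed
  have same: "(LINT z:S|lebesgue. partial_deriv w \<phi> z *\<^sub>R (cnj (sw_dir z) * k1 z)) = (LINT z:S|lebesgue. partial_deriv w \<phi> z *\<^sub>R (cnj (sw_dir z) * k2 z))"
    if k: "weak_partial S v sw_dir k1" "weak_partial S v sw_dir k2" and w: "w \<in> Basis" for v w k1 k2
  proof -
    have l: "locally_integrable_on S k1" "locally_integrable_on S k2" using k by (auto simp: weak_partial_def)
    show ?thesis
      unfolding test_integral_real_imag(1)[OF l(1) test[OF w]] test_integral_real_imag(1)[OF l(2) test[OF w]]
      using weak_partial_test_eq[OF k test(1)[OF w]] weak_partial_test_eq[OF k test(2)[OF w]] by simp
  qed
  have "complex_of_real (2 * pi * \<phi> q)
      = distr_div (ball q r) (\<lambda>z. \<i> * cnj (sw_dir z) * (- gy z)) (\<lambda>z. \<i> * cnj (sw_dir z) * gx z) \<phi>"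
    using deg test_function_subset[OF \<phi>(1) S(3)] by simp
  also have "\<dots> = distr_div S (\<lambda>z. \<i> * cnj (sw_dir z) * (- gy z)) (\<lambda>z. \<i> * cnj (sw_dir z) * gx z) \<phi>"
  proof -
    from \<phi>(1) obtain K where K: "K \<subseteq> S" "\<And>z v. z \<notin> K \<Longrightarrow> partial_deriv v \<phi> z = 0"
      by (elim test_functionE) metis
    have "z \<notin> S \<Longrightarrow> partial_deriv v \<phi> z = 0" for z v using K by blast
    then show ?thesis
      unfolding distr_div_def by (subst test_set_integral_subset[OF _ S(3)]) auto
  qed
  also have "\<dots> = distr_div S (\<lambda>z. \<i> * cnj (sw_dir z) * (- gy0 z)) (\<lambda>z. \<i> * cnj (sw_dir z) * gx0 z) \<phi>"
    unfolding split[OF wgS] split[OF wg0]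
    using same[of \<i> gy gy0 1] same[of 1 gx gx0 \<i>] wgS wg0 b by (simp add: weak_gradient_def)
  also have "\<dots> = cdiv S sw_logderiv \<phi>"
    unfolding gx0_def gy0_def by (rule sw_dir_div_perp)
  also have "\<dots> = 0"
    by (rule cdiv_holomorphic[OF S(1) holomorphic_on_subset[OF sw_logderiv_holomorphic S(4)] \<phi>(1)])
  finally show False using \<phi>(2) by simp
qed

text \<open>The rotated gradient of ln |f| is divergence free across the zeros too: rotating the
  radial field of a pole leaves no mass. For the regularisation i f' cnj f / (|f|^2 + \<epsilon>)
  the divergence is twice the real part of the conjugate derivative b, and b is i times a real
  number. The limit is dominated by |f' / f|.\<close>

lemma cdiv_i_sw_logderiv:
  assumes \<phi>: "test_function disc \<phi>"
  shows "cdiv disc (\<lambda>z. \<i> * sw_logderiv z) \<phi> = 0"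
proof -
  define e where "e n = 1 / real (Suc n)" for n
  have e: "e n > 0" for n by (simp add: e_def)
  define rho where "rho n z = (cmod (sw_fun z))\<^sup>2 + e n" for n z
  have rho: "rho n z > 0" for n z using e[of n] by (simp add: rho_def add_nonneg_pos)
  define V where "V n z = \<i> * (sw_fun' z * cnj (sw_fun z) * of_real (1 / rho n z))" for n z
  define D where "D n z = - (1 / (rho n z)\<^sup>2)" for n z
  define a where "a n z = \<i> * ((deriv sw_fun' z * cnj (sw_fun z)) * of_real (1 / rho n z) + (sw_fun' z * cnj (sw_fun z)) * (of_real (D n z) * cnj (sw_fun z) * sw_fun' z))" for n z
  define b where "b n z = \<i> * ((sw_fun' z * cnj (sw_fun' z)) * of_real (1 / rho n z) + (sw_fun' z * cnj (sw_fun z)) * (of_real (D n z) * sw_fun z * cnj (sw_fun' z)))" for n z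
  have w: "has_wirtinger (V n) (a n z) (b n z) z" if z: "z \<in> disc" for n z
  proof -
    have F: "((\<lambda>x. 1 / (x + e n)) has_field_derivative D n z) (at ((cmod (sw_fun z))\<^sup>2))"
      using rho[of n z] unfolding D_def rho_def by (auto intro!: derivative_eq_intros simp: power2_eq_square)
    have f: "has_wirtinger sw_fun (sw_fun' z) 0 z" by (rule has_wirtinger_holomorphic[OF sw_fun_alg.f_deriv[OF z]])
    have f': "has_wirtinger sw_fun' (deriv sw_fun' z) 0 z"
      by (rule has_wirtinger_holomorphic[OF holomorphic_derivI[OF sw_fun'_holomorphic open_ball z]])
    have r: "has_wirtinger (\<lambda>z. of_real (1 / rho n z)) (of_real (D n z) * cnj (sw_fun z) * sw_fun' z) (of_real (D n z) * sw_fun z * cnj (sw_fun' z)) z"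
      unfolding rho_def by (rule has_wirtinger_cong[OF has_wirtinger_compose[OF has_wirtinger_norm_sq[OF F] f]]) simp_all
    show ?thesis
      unfolding V_def a_def b_def
      by (rule has_wirtinger_cong[OF has_wirtinger_mult[OF has_wirtinger_const
            has_wirtinger_mult[OF has_wirtinger_mult[OF f' has_wirtinger_cnj[OF f]] r]]]) simp_all
  qed
  have crho: "continuous_on disc (rho n)" for n
    unfolding rho_def by (intro continuous_intros sw_fun_continuous_disc)
  have r0: "rho n z \<noteq> 0" for n z using rho[of n z] by simp
  have c: "continuous_on disc (a n)" "continuous_on disc (b n)" "continuous_on disc (V n)" for n
    unfolding a_def b_def D_def V_def using r0
    by (intro continuous_intros sw_fun_continuous_disc crho; simp)+
  have "cdiv disc (V n) \<phi> = 0" for n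
  proof -
    have "Re (b n z) = 0" for z
    proof -
      have sq: "cnj (sw_fun z) * sw_fun z = of_real ((cmod (sw_fun z))\<^sup>2)" "sw_fun' z * cnj (sw_fun' z) = of_real ((cmod (sw_fun' z))\<^sup>2)"
        using complex_norm_square[of "sw_fun z"] complex_norm_square[of "sw_fun' z"] by (simp_all add: mult.commute)
      have "b n z = \<i> * ((sw_fun' z * cnj (sw_fun' z)) * of_real (1 / rho n z) + (sw_fun' z * cnj (sw_fun' z)) * (of_real (D n z) * (cnj (sw_fun z) * sw_fun z)))"
        unfolding b_def by (simp add: mult_ac)
      also have "\<dots> = \<i> * of_real ((cmod (sw_fun' z))\<^sup>2 * (1 / rho n z) + (cmod (sw_fun' z))\<^sup>2 * (D n z * (cmod (sw_fun z))\<^sup>2))"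
        unfolding sq by simp
      finally show ?thesis by (simp only:) (simp only: Re_i_times Im_complex_of_real minus_zero)
    qed
    then have "Re (a n z + b n z) - Im (\<i> * (a n z - b n z)) = 0" for z by simp
    then show ?thesis
      using cdiv_weak_gradient[OF weak_gradient_wirtinger[OF open_ball w c(1,2)] \<phi>]
      by (simp only: of_real_0 scaleR_zero_right) (simp add: set_lebesgue_integral_def)
  qed
  moreover have "(\<lambda>n. cdiv disc (V n) \<phi>) \<longlonglongrightarrow> cdiv disc (\<lambda>z. \<i> * sw_logderiv z) \<phi>"
  proof (rule cdiv_tendsto[OF open_ball \<phi> _ _ _ _ sw_logderiv_norm_locally_integrable[of 1]])
    show "locally_integrable_on disc (V n)" for n by (rule continuous_on_imp_locally_integrable[OF c(3)])
    show "locally_integrable_on disc (\<lambda>z. \<i> * sw_logderiv z)"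
      by (rule locally_integrable_on_linear[OF bounded_linear_mult_right sw_logderiv_locally_integrable])
    have Vz: "V n z = of_real ((cmod (sw_fun z))\<^sup>2 / rho n z) * (\<i> * sw_logderiv z)" if "z \<in> sw_dom" for n z
      using sw_fun'_eq[of z] complex_norm_square[of "sw_fun z"] that by (simp add: V_def sw_dom_def mult_ac)
    show "AE z in lebesgue. z \<in> disc \<longrightarrow> (\<lambda>n. V n z) \<longlonglongrightarrow> \<i> * sw_logderiv z"
    proof (rule eventually_mono[OF AE_disc_sw_dom], intro impI)
      fix z assume "z \<in> disc \<longrightarrow> z \<in> sw_dom" "z \<in> disc"
      then have z: "z \<in> sw_dom" by blast
      then have r: "(cmod (sw_fun z))\<^sup>2 > 0" by (simp add: sw_dom_def)
      have rl: "(\<lambda>n. rho n z) \<longlonglongrightarrow> (cmod (sw_fun z))\<^sup>2"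
        unfolding rho_def e_def by (rule tendsto_shift_inverse)
      have "(\<lambda>n. V n z) \<longlonglongrightarrow> of_real ((cmod (sw_fun z))\<^sup>2 / (cmod (sw_fun z))\<^sup>2) * (\<i> * sw_logderiv z)"
        unfolding Vz[OF z] using r by (intro tendsto_intros rl) auto
      then show "(\<lambda>n. V n z) \<longlonglongrightarrow> \<i> * sw_logderiv z" using r by simp
    qed
    show "AE z in lebesgue. z \<in> disc \<longrightarrow> cmod (V n z) \<le> 1 * cmod (sw_logderiv z)" for n
    proof (rule eventually_mono[OF AE_disc_sw_dom], intro impI)
      fix z assume "z \<in> disc \<longrightarrow> z \<in> sw_dom" "z \<in> disc"
      then have z: "z \<in> sw_dom" by blast
      have "\<bar>(cmod (sw_fun z))\<^sup>2 / rho n z\<bar> \<le> 1" using rho[of n z] e[of n] by (simp add: rho_def)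
      then have "\<bar>(cmod (sw_fun z))\<^sup>2 / rho n z\<bar> * cmod (\<i> * sw_logderiv z) \<le> 1 * cmod (\<i> * sw_logderiv z)" by (intro mult_right_mono) auto
      then show "cmod (V n z) \<le> 1 * cmod (sw_logderiv z)" unfolding Vz[OF z] norm_mult norm_of_real by simp
    qed
  qed
  ultimately show ?thesis by (simp add: LIMSEQ_const_iff)
qed

lemma sw_map_hamiltonian_stationary:
  assumes "j \<ge> 1"
  shows "hamiltonian_stationary (sw_map j) sw_dir"
proof -
  \<comment> \<open>With L = f' / f, the field i cnj g grad g is (- Im L, - Re L), which is the
    field encoded by i L.\<close>
  have "distr_div disc (\<lambda>z. \<i> * cnj (sw_dir z) * (sw_dir z * (\<i> * of_real (Im (sw_logderiv z)))))
      (\<lambda>z. \<i> * cnj (sw_dir z) * (sw_dir z * (\<i> * of_real (Re (sw_logderiv z))))) \<phi> = cdiv disc (\<lambda>z. \<i> * sw_logderiv z) \<phi>" for \<phi>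
    by (simp add: cdiv_def cnj_sw_dir_mult mult.assoc)
  then show ?thesis
    unfolding hamiltonian_stationary_def
    using sw_map_lagrangian_angle[OF assms] sw_dir_weak_gradient cdiv_i_sw_logderiv
    by (intro conjI exI[of _ "\<lambda>z. sw_dir z * (\<i> * of_real (Im (sw_logderiv z)))"] exI[of _ "\<lambda>z. sw_dir z * (\<i> * of_real (Re (sw_logderiv z)))"]) auto
qed

section \<open>Integrability of the gradient of the angle\<close>

lemma Lp_space_mono:
  fixes f :: "complex \<Rightarrow> 'b::euclidean_space" and h :: "complex \<Rightarrow> 'c::euclidean_space"
  assumes h: "h \<in> Lp_space p S" and f: "f \<in> borel_measurable (lebesgue_on S)"
    and le: "\<And>z. norm (f z) \<le> norm (h z)" and p: "p \<ge> 0"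
  shows "f \<in> Lp_space p S"
proof -
  have "integrable (lebesgue_on S) (\<lambda>z. norm (f z) powr p)"
  proof (rule Bochner_Integration.integrable_bound)
    show "integrable (lebesgue_on S) (\<lambda>z. norm (h z) powr p)" using h by (simp add: Lp_space_def)
    show "(\<lambda>z. norm (f z) powr p) \<in> borel_measurable (lebesgue_on S)" using f by measurable
  qed (use le p in \<open>auto intro!: powr_mono2\<close>)
  with f show ?thesis by (simp add: Lp_space_def)
qed

lemma weak_L2_loc_mono:
  fixes f :: "complex \<Rightarrow> 'b::euclidean_space" and h :: "complex \<Rightarrow> 'c::euclidean_space"
  assumes h: "h \<in> weak_L2_loc S" and f: "f \<in> borel_measurable (lebesgue_on S)"
    and le: "\<And>z. norm (f z) \<le> norm (h z)" and S: "S \<in> sets lebesgue"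
  shows "f \<in> weak_L2_loc S"
proof -
  have m: "{z\<in>K. norm (g z) > t} \<in> lmeasurable"
    if g: "g \<in> borel_measurable (lebesgue_on S)" and K: "compact K" "K \<subseteq> S" for g :: "complex \<Rightarrow> 'd::euclidean_space" and K t
  proof -
    have "{z\<in>space (lebesgue_on S). norm (g z) > t} \<in> sets (lebesgue_on S)" using g by measurable
    then have "{z\<in>space (lebesgue_on S). norm (g z) > t} \<in> sets lebesgue" using S by (auto simp: sets_restrict_space_iff)
    moreover have "{z\<in>K. norm (g z) > t} = K \<inter> {z\<in>space (lebesgue_on S). norm (g z) > t}"
      using K by (auto simp: space_restrict_space)
    ultimately show ?thesis
      using lmeasurable_compact[OF K(1)] by (simp add: fmeasurable_Int_fmeasurable)
  qed
  have hm: "h \<in> borel_measurable (lebesgue_on S)" using h by (simp add: weak_L2_loc_def)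
  have "\<exists>C. \<forall>t>0. t\<^sup>2 * measure lebesgue {z\<in>K. norm (f z) > t} \<le> C" if K: "compact K" "K \<subseteq> S" for K
  proof -
    from h K obtain C where C: "\<And>t. t > 0 \<Longrightarrow> t\<^sup>2 * measure lebesgue {z\<in>K. norm (h z) > t} \<le> C"
      unfolding weak_L2_loc_def by blast
    have "t\<^sup>2 * measure lebesgue {z\<in>K. norm (f z) > t} \<le> C" if t: "t > 0" for t
    proof -
      have "{z\<in>K. norm (f z) > t} \<subseteq> {z\<in>K. norm (h z) > t}" using le less_le_trans by blast
      then have "measure lebesgue {z\<in>K. norm (f z) > t} \<le> measure lebesgue {z\<in>K. norm (h z) > t}"
        using m[OF f K] m[OF hm K] by (intro measure_mono_fmeasurable) auto
      then have "t\<^sup>2 * measure lebesgue {z\<in>K. norm (f z) > t} \<le> t\<^sup>2 * measure lebesgue {z\<in>K. norm (h z) > t}"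
        by (intro mult_left_mono) auto
      then show ?thesis using C[OF t] by linarith
    qed
    then show ?thesis by blast
  qed
  then show ?thesis using f by (auto simp: weak_L2_loc_def)
qed

lemma sw_dir_gradient_bounds:
  "(\<lambda>z. sw_dir z * (\<i> * of_real (Im (sw_logderiv z)))) \<in> borel_measurable (lebesgue_on disc)"
  "(\<lambda>z. sw_dir z * (\<i> * of_real (Re (sw_logderiv z)))) \<in> borel_measurable (lebesgue_on disc)"
  "cmod (sw_dir z * (\<i> * of_real (Im (sw_logderiv z)))) \<le> cmod (sw_logderiv z)"
  "cmod (sw_dir z * (\<i> * of_real (Re (sw_logderiv z)))) \<le> cmod (sw_logderiv z)"
proof -
  show "(\<lambda>z. sw_dir z * (\<i> * of_real (Im (sw_logderiv z)))) \<in> borel_measurable (lebesgue_on disc)"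
    using sw_dir_measurable sw_logderiv_measurable by measurable
  show "(\<lambda>z. sw_dir z * (\<i> * of_real (Re (sw_logderiv z)))) \<in> borel_measurable (lebesgue_on disc)"
    using sw_dir_measurable sw_logderiv_measurable by measurable
qed (simp_all add: norm_mult norm_sw_dir abs_Im_le_cmod abs_Re_le_cmod)

lemma sw_dir_W1_weak_L2: "sw_dir \<in> W1_weak_L2_loc disc"
  unfolding W1_weak_L2_loc_def mem_Collect_eq
  by (rule exI, rule exI, intro conjI, rule sw_dir_weak_gradient)
    (rule weak_L2_loc_mono[OF sw_logderiv_weak_L2 sw_dir_gradient_bounds(1)], simp_all add: sw_dir_gradient_bounds(3) del: norm_mult,
     rule weak_L2_loc_mono[OF sw_logderiv_weak_L2 sw_dir_gradient_bounds(2)], simp_all add: sw_dir_gradient_bounds(4) del: norm_mult)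

lemma cnj_measurable:
  "h \<in> borel_measurable M \<Longrightarrow> (\<lambda>z. cnj (h z)) \<in> borel_measurable M"
  by (rule measurable_compose[OF _ borel_measurable_continuous_onI[OF continuous_on_cnj[OF continuous_on_id]]])

lemma cnj_sw_dir_sobolev:
  assumes p: "1 \<le> p" "p < 2"
  shows "(\<lambda>z. cnj (sw_dir z)) \<in> W1p_space p disc \<inter> W1_weak_L2_loc disc"
proof
  note w = weak_gradient_linear[OF bounded_linear_cnj sw_dir_weak_gradient]
  have p0: "0 < p" using p by simp
  have "(\<lambda>z. 1 :: complex) \<in> Lp_space p disc"
    by (rule bounded_continuous_in_Lp_space[where C=1]) (use p0 in auto)
  then have 1: "(\<lambda>z. cnj (sw_dir z)) \<in> Lp_space p disc"
    by (rule Lp_space_mono) (use cnj_measurable[OF sw_dir_measurable] p0 in \<open>auto simp: norm_sw_dir\<close>)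
  have 2: "(\<lambda>z. cnj (sw_dir z * (\<i> * of_real (Im (sw_logderiv z))))) \<in> Lp_space p disc"
    by (rule Lp_space_mono[OF sw_logderiv_Lp(1)[OF p0 p(2)] cnj_measurable[OF sw_dir_gradient_bounds(1)]])
      (use sw_dir_gradient_bounds(3) p0 in \<open>simp_all only: complex_mod_cnj less_imp_le\<close>)
  have 3: "(\<lambda>z. cnj (sw_dir z * (\<i> * of_real (Re (sw_logderiv z))))) \<in> Lp_space p disc"
    by (rule Lp_space_mono[OF sw_logderiv_Lp(1)[OF p0 p(2)] cnj_measurable[OF sw_dir_gradient_bounds(2)]])
      (use sw_dir_gradient_bounds(4) p0 in \<open>simp_all only: complex_mod_cnj less_imp_le\<close>)
  show "(\<lambda>z. cnj (sw_dir z)) \<in> W1p_space p disc"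
    using w 1 2 3 unfolding W1p_space_def sobolev_gradient_def by blast
  have 4: "(\<lambda>z. cnj (sw_dir z * (\<i> * of_real (Im (sw_logderiv z))))) \<in> weak_L2_loc disc"
    by (rule weak_L2_loc_mono[OF sw_logderiv_weak_L2 cnj_measurable[OF sw_dir_gradient_bounds(1)]])
      (use sw_dir_gradient_bounds(3) in \<open>simp_all only: complex_mod_cnj\<close>, simp)
  have 5: "(\<lambda>z. cnj (sw_dir z * (\<i> * of_real (Re (sw_logderiv z))))) \<in> weak_L2_loc disc"
    by (rule weak_L2_loc_mono[OF sw_logderiv_weak_L2 cnj_measurable[OF sw_dir_gradient_bounds(2)]])
      (use sw_dir_gradient_bounds(4) in \<open>simp_all only: complex_mod_cnj\<close>, simp)
  show "(\<lambda>z. cnj (sw_dir z)) \<in> W1_weak_L2_loc disc"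
    using w 4 5 unfolding W1_weak_L2_loc_def by blast
qed

section \<open>The local expansion at the zeros\<close>

lemma sw_dir_perp_potential:
  assumes "S \<subseteq> disc"
  shows "perp_potential S sw_dir (\<lambda>z. ln (cmod (sw_fun z)))"
  unfolding perp_potential_def
  by (rule exI[of _ "\<lambda>z. sw_dir z * (\<i> * of_real (Im (sw_logderiv z)))"], rule exI[of _ "\<lambda>z. sw_dir z * (\<i> * of_real (Re (sw_logderiv z)))"],
      rule exI[of _ "\<lambda>z. Re (sw_logderiv z)"], rule exI[of _ "\<lambda>z. - Im (sw_logderiv z)"],
      intro conjI weak_gradient_subset[OF sw_dir_weak_gradient assms] weak_gradient_subset[OF ln_sw_fun_weak_gradient assms] AE_I2)
    (simp_all add: mult.assoc cnj_sw_dir_mult)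

lemma sw_map_eq_sw_mode:
  assumes "sw_fun z \<noteq> 0"
  shows "sw_map j z = sw_mode j (ln (cmod (sw_fun z))) (sw_dir z)"
proof -
  have e: "cmod (sw_fun z) powr sw_alpha j = exp (sqrt (real (j * (j + 1))) * ln (cmod (sw_fun z)))"
    using assms by (simp add: powr_def sw_alpha_def power2_eq_square algebra_simps)
  have g: "sgn (sw_fun z) = sw_dir z" using assms by (simp add: sw_dir_def)
  show ?thesis
    unfolding sw_map_def vec2_def sw_mode_def epw_def e g
    by (simp add: mult_ac add.commute)
qed

lemma unitary_mat_1: "unitary (mat 1)"
proof -
  have "(\<chi> k l. cnj ((mat 1 :: complex^2^2) $ l $ k)) = mat 1"
    by (simp add: vec_eq_iff mat_def)
  then show ?thesis by (simp add: unitary_def)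
qed

lemma sw_map_schoen_wolfson_type:
  assumes j: "j \<ge> 1" and q: "q \<in> disc" "sw_fun q = 0"
  shows "schoen_wolfson_type j (sw_map j) sw_dir q"
proof -
  obtain r where r: "r > 0" "ball q r \<subseteq> disc" by (rule openE[OF open_ball q(1)])
  define a where "a k = (if k = j then 1 else 0 :: complex)" for k
  have "(\<lambda>n. a (Suc n) *s sw_mode (Suc n) G g) sums sw_mode j G g" for G g
  proof -
    \<comment> \<open>Coefficients start at index 1, so mode j is the term with summation index j -
      1.\<close>
    have "(\<lambda>n. if n = j - 1 then sw_mode (Suc n) G g else 0) sums sw_mode (Suc (j - 1)) G g"
      by (rule sums_single)
    moreover have "(\<lambda>n. if n = j - 1 then sw_mode (Suc n) G g else 0) = (\<lambda>n. a (Suc n) *s sw_mode (Suc n) G g)"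
      using j by (auto simp: a_def fun_eq_iff vec_eq_iff)
    ultimately show ?thesis using j by simp
  qed
  then have "AE z in lebesgue_on (ball q r).
      \<exists>s. (\<lambda>n. a (Suc n) *s sw_mode (Suc n) (ln (cmod (sw_fun z))) (sw_dir z)) sums s \<and> sw_map j z = mat 1 *v s + 0"
  proof -
    have "AE z in lebesgue. z \<in> ball q r \<longrightarrow> z \<in> sw_dom"
      by (rule eventually_mono[OF AE_disc_sw_dom]) (use r(2) in blast)
    then have "AE z in lebesgue_on (ball q r). z \<in> sw_dom"
      by (subst AE_restrict_space_iff) auto
    then show ?thesis
      by (rule eventually_mono)
        (use \<open>\<And>G g. (\<lambda>n. a (Suc n) *s sw_mode (Suc n) G g) sums sw_mode j G g\<close> sw_map_eq_sw_mode in \<open>auto simp: sw_dom_def\<close>)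
  qed
  moreover have "summable (\<lambda>n. (cmod (a (Suc n)))\<^sup>2)"
    by (rule summable_finite[of "{j - 1}"]) (use j in \<open>auto simp: a_def\<close>)
  ultimately have "\<exists>r>0. ball q r \<subseteq> disc \<and>
       (\<exists>G U \<Phi>\<^sub>0 a. perp_potential (ball q r) sw_dir G \<and> unitary U \<and>
          summable (\<lambda>n. (cmod (a (Suc n)))\<^sup>2) \<and>
          (AE z in lebesgue_on (ball q r).
             \<exists>s. (\<lambda>n. a (Suc n) *s sw_mode (Suc n) (G z) (sw_dir z)) sums s \<and> sw_map j z = U *v s + \<Phi>\<^sub>0) \<and>
          a j \<noteq> 0 \<and> (\<forall>k. 1 \<le> k \<and> k < j \<longrightarrow> a k = 0))"
    using r sw_dir_perp_potential[OF r(2)] unitary_mat_1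
    by (intro exI[of _ r] conjI exI[of _ "\<lambda>z. ln (cmod (sw_fun z))"] exI[of _ "mat 1"] exI[of _ 0] exI[of _ a])
      (auto simp: a_def)
  then show ?thesis
    unfolding schoen_wolfson_type_def
    using q sw_map_hamiltonian_stationary[OF j] sw_dir_W1_weak_L2 sw_dir_degree_one[OF q] by blast
qed

text \<open>The degree condition alone gives the inclusion in the set of zeros: it fails wherever
  \<open>sw_fun\<close> does not vanish.\<close>

lemma sw_map_singularities:
  assumes j: "j \<ge> 1"
  shows "schoen_wolfson_singularities (sw_map j) sw_dir = range zero_pt"
proof
  show "range zero_pt \<subseteq> schoen_wolfson_singularities (sw_map j) sw_dir"
    using sw_map_schoen_wolfson_type[OF j zero_pt_in_disc sw_fun_zero_pt] j by (auto simp: schoen_wolfson_singularities_def)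
  show "schoen_wolfson_singularities (sw_map j) sw_dir \<subseteq> range zero_pt"
  proof
    fix q assume "q \<in> schoen_wolfson_singularities (sw_map j) sw_dir"
    then obtain m where "schoen_wolfson_type m (sw_map j) sw_dir q"
      by (auto simp only: schoen_wolfson_singularities_def mem_Collect_eq)
    then have q: "q \<in> disc" "degree_one_singularity sw_dir q"
      unfolding schoen_wolfson_type_def by - ((elim conjE, assumption)+)
    have "sw_fun q = 0" using sw_dir_not_degree_one[OF q(1)] q(2) by blast
    with q(1) show "q \<in> range zero_pt" by (rule disc_sw_fun_eq_0)
  qed
qed

section \<open>Isolated zeros, branch points and boundary values\<close>

lemma zeros_isolated:
  assumes h: "h holomorphic_on disc" and w: "w \<in> disc" "h w \<noteq> 0"
  shows "isolated_in_disc {z\<in>disc. h z = 0}"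
  unfolding isolated_in_disc_def
proof (intro conjI ballI notI)
  fix z assume z: "z \<in> disc" "z islimpt {z\<in>disc. h z = 0}"
  have "h w = 0"
    by (rule analytic_continuation[OF h open_ball convex_connected[OF convex_ball] _ z _ w(1)]) auto
  with w show False by simp
qed auto

lemma isolated_in_disc_Un:
  "isolated_in_disc A \<Longrightarrow> isolated_in_disc B \<Longrightarrow> isolated_in_disc (A \<union> B)"
  by (auto simp: isolated_in_disc_def islimpt_Un)

lemma isolated_in_disc_subset:
  "isolated_in_disc A \<Longrightarrow> B \<subseteq> A \<Longrightarrow> isolated_in_disc B"
  unfolding isolated_in_disc_def using islimpt_subset by blast

lemma isolated_sw_fun_zeros: "isolated_in_disc {z\<in>disc. sw_fun z = 0}"
proof -
  \<comment> \<open>If f vanished identically, so would f', but the zeros of f are simple.\<close>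
  have "\<exists>w\<in>disc. sw_fun w \<noteq> 0"
  proof (rule ccontr)
    assume "\<not> (\<exists>w\<in>disc. sw_fun w \<noteq> 0)"
    then have 0: "sw_fun w = 0" if "w \<in> disc" for w using that by blast
    have "(sw_fun has_field_derivative 0) (at (zero_pt 0))"
      by (rule has_field_derivative_transform_within_open[where f="\<lambda>_. 0" and S=disc]) (use zero_pt_in_disc 0 in auto)
    with sw_fun_alg.f_deriv[OF zero_pt_in_disc] have "sw_fun' (zero_pt 0) = 0" by (rule DERIV_unique)
    then show False using sw_fun'_zero[OF sw_fun_zero_pt] by simp
  qed
  then show ?thesis using zeros_isolated[OF sw_fun_holomorphic] by blast
qed

lemma isolated_sw_fun'_zeros: "isolated_in_disc {z\<in>disc. sw_fun' z = 0}"
  using zeros_isolated[OF sw_fun'_holomorphic zero_pt_in_disc] sw_fun'_zero[OF sw_fun_zero_pt] by blast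

lemma sw_fun_zeros_disc: "{z\<in>disc. sw_fun z = 0} = range zero_pt"
  using disc_sw_fun_eq_0 zero_pt_in_disc sw_fun_zero_pt by auto

lemma sw_map_smooth_on: "smooth_on (disc - range zero_pt) (sw_map j)"
proof -
  have "smooth_on sw_dom (sw_map j)"
    unfolding sw_map_def[abs_def]
    by (intro smooth_on_linear_pair[OF open_sw_dom _ _ bounded_linear_vec2] smooth_on_epw_sw_fun star_alg_const)
  then show ?thesis
    by (rule smooth_on_subset) (use sw_dom_disc in auto)
qed

lemma Ck_on_mono:
  assumes "Ck_on k S f" "l \<le> k"
  shows "Ck_on l S f"
  unfolding Ck_on_def
proof (intro ballI conjI impI)
  fix vs :: "'a list" assume vs: "vs \<in> lists Basis"
  show "iter_partial vs f differentiable_on S" if "length vs < l"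
    using bspec[OF assms(1)[unfolded Ck_on_def] vs] assms(2) that by simp
  show "continuous_on S (iter_partial vs f)" if "length vs \<le> l"
    using bspec[OF assms(1)[unfolded Ck_on_def] vs] assms(2) that by simp
qed

text \<open>Off the zeros of f the differential degenerates only where f' = 0. There the angle is
  smooth, so these points are branch points, and as zeros of a holomorphic function they are
  isolated.\<close>

lemma sw_map_branched_immersion:
  assumes j: "j \<ge> 1"
  shows "branched_immersion_on (disc - range zero_pt) (sw_map j)"
  unfolding branched_immersion_on_def
proof (intro conjI)
  show "open (disc - range zero_pt)" unfolding sw_dom_disc_iff by (intro open_Int open_sw_dom) simp
  show "Ck_on 1 disc (sw_map j)" by (rule Ck_on_mono[OF sw_map_Ck_on[OF j] j])
  show "isolated_in_disc {z\<in>disc. (sw_map j has_derivative (\<lambda>_. 0)) (at z)}"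
    by (rule isolated_in_disc_subset[OF isolated_in_disc_Un[OF isolated_sw_fun_zeros isolated_sw_fun'_zeros]])
      (use sw_map_critical_iff[OF j] in auto)
  let ?B = "{z\<in>disc. sw_fun z \<noteq> 0 \<and> sw_fun' z = 0}"
  have "branch_point (sw_map j) q" if q: "q \<in> ?B" for q
    unfolding branch_point_def
  proof (intro conjI exI)
    show "q \<in> disc" using q by simp
    show "(sw_map j has_derivative (\<lambda>_. 0)) (at q)" using q sw_map_critical_iff[OF j] by simp
    show "lagrangian_angle (sw_map j) (\<lambda>z. cnj (sw_dir z))" by (rule sw_map_lagrangian_angle[OF j])
    have qO: "q \<in> sw_dom" using q disc_subset_slit by (auto simp: sw_dom_def)
    from smooth_on_imp_continuous_on[OF smooth_on_cnj_sw_dir] show "isCont (\<lambda>z. cnj (sw_dir z)) q"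
      using qO by (simp only: continuous_on_eq_continuous_at[OF open_sw_dom])
  qed
  moreover have "isolated_in_disc ?B"
    by (rule isolated_in_disc_subset[OF isolated_sw_fun'_zeros]) auto
  moreover have "immersed_at (sw_map j) q" if "q \<in> (disc - range zero_pt) - ?B" for q
    using that disc_sw_fun_eq_0 by (intro sw_map_immersed_at[OF j]) auto
  ultimately show "\<exists>B. isolated_in_disc B \<and> (\<forall>q\<in>B. branch_point (sw_map j) q) \<and> (\<forall>q\<in>disc - range zero_pt - B. immersed_at (sw_map j) q)"
    by (intro exI[of _ ?B]) auto
qed (use sw_map_weakly_conformal[OF j] sw_map_lagrangian[OF j] in auto)

lemma sw_map_trace:
  assumes j: "j \<ge> 1"
  shows "continuous_extension_with_smooth_trace (sw_map j)"
  unfolding continuous_extension_with_smooth_trace_def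
proof (intro exI conjI ballI)
  \<comment> \<open>The extension of f to the closed disc by its limit 0 at the point 1. Near every
    other boundary point f is already holomorphic, so only the decay at 1 is used.\<close>
  define f1 where "f1 z = (if z = 1 then 0 else sw_fun z)" for z
  define u1 where "u1 z = epw (sw_alpha j) (int j) (f1 z) * complex_of_real (sqrt (real j + 1))" for z
  define u2 where "u2 z = epw (sw_alpha j) (- int j - 1) (f1 z) * (\<i> * complex_of_real (sqrt (real j)))" for z
  have a0: "sw_alpha j > 0" using alpha_bounds(3)[OF j] by simp
  have f1: "continuous_on (cball 0 1) f1"
    unfolding continuous_on_eq_continuous_within
  proof
    fix z :: complex assume z: "z \<in> cball 0 1"
    show "continuous (at z within cball 0 1) f1"
    proof (cases "z = 1")
      case True
      obtain C where C: "\<And>z. z \<noteq> 1 \<Longrightarrow> cmod (sw_fun z) \<le> C * cmod (1 - z) powr 1" by (rule sw_fun_decay[of 1]) blast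
      have b: "cmod (f1 x) \<le> \<bar>C\<bar> * cmod (1 - x)" for x
      proof (cases "x = 1")
        case False
        then have "cmod (f1 x) \<le> C * cmod (1 - x)" using C[OF False] by (simp add: f1_def)
        also have "\<dots> \<le> \<bar>C\<bar> * cmod (1 - x)" by (intro mult_right_mono) auto
        finally show ?thesis .
      qed (simp add: f1_def)
      have "((\<lambda>x. \<bar>C\<bar> * cmod (1 - x)) \<longlongrightarrow> \<bar>C\<bar> * cmod (1 - 1)) (at 1 within cball 0 1)" by (intro tendsto_intros)
      then have "((\<lambda>x. \<bar>C\<bar> * cmod (1 - x)) \<longlongrightarrow> 0) (at 1 within cball 0 1)" by simp
      then have "(f1 \<longlongrightarrow> 0) (at 1 within cball 0 1)"
        by (rule tendsto_0_le[where K=1]) (use b in \<open>auto simp: abs_mult\<close>)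
      then show ?thesis using True by (simp add: continuous_within f1_def)
    next
      case False
      then have "z \<in> slit" using z cball_in_slit by simp
      then have "isCont sw_fun z" using sw_fun_deriv DERIV_isCont by blast
      moreover have "\<forall>\<^sub>F x in nhds z. sw_fun x = f1 x"
        by (rule eventually_mono[OF eventually_nhds_in_open[of "- {1}" z]]) (use False in \<open>auto simp: f1_def open_Compl\<close>)
      ultimately have "isCont f1 z" using isCont_cong by fast
      then show ?thesis by (rule continuous_at_imp_continuous_at_within)
    qed
  qed
  show "continuous_on (cball 0 1) (\<lambda>z. vec2 (u1 z, u2 z))"
    unfolding u1_def u2_def
    by (intro bounded_linear.continuous_on[OF bounded_linear_vec2] continuous_on_Pair continuous_on_mult
        continuous_on_const continuous_on_compose2[OF continuous_on_epw[OF a0] f1]) auto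
  show "vec2 (u1 z, u2 z) = sw_map j z" if "z \<in> disc" for z
    using that by (auto simp: sw_map_def u1_def u2_def f1_def)
  have "smooth_on UNIV (\<lambda>t. if cis t = 1 then 0 else epw (sw_alpha j) n (sw_fun (cis t)) * k)" for n k
    by (rule smooth_trace[OF a0 star_alg_const])
  moreover have "(if cis t = 1 then 0 else epw (sw_alpha j) n (sw_fun (cis t)) * k) = epw (sw_alpha j) n (f1 (cis t)) * k" for n k t
    by (simp add: f1_def)
  ultimately have s: "smooth_on UNIV (\<lambda>t. epw (sw_alpha j) n (f1 (cis t)) * k)" for n k by simp
  show "smooth_on UNIV (\<lambda>t. vec2 (u1 (cis t), u2 (cis t)))"
    unfolding u1_def u2_def by (intro smooth_on_linear_pair[OF _ _ _ bounded_linear_vec2] s) simp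
qed

theorem theorem1p1:
  fixes p :: real and j :: nat
  assumes "1 \<le> p" and "p < 2" and "j \<ge> 1"
  shows "\<exists>(\<Phi> :: complex \<Rightarrow> complex^2) (g :: complex \<Rightarrow> complex).
     \<Phi> \<in> holder_space (sqrt (real (j\<^sup>2 + j))) disc \<and>
     weakly_conformal \<Phi> \<and> lagrangian \<Phi> \<and> hamiltonian_stationary \<Phi> g \<and>
     infinite (schoen_wolfson_singularities \<Phi> g) \<and>
     isolated_in_disc (schoen_wolfson_singularities \<Phi> g) \<and>
     continuous_extension_with_smooth_trace \<Phi> \<and>
     (\<lambda>z. cnj (g z)) \<in> W1p_space p disc \<inter> W1_weak_L2_loc disc \<and>
     smooth_on (disc - schoen_wolfson_singularities \<Phi> g) \<Phi> \<and>
     branched_immersion_on (disc - schoen_wolfson_singularities \<Phi> g) \<Phi>"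
proof (intro exI conjI)
  note sing = sw_map_singularities[OF assms(3)]
  show "sw_map j \<in> holder_space (sqrt (real (j\<^sup>2 + j))) disc" by (rule sw_map_holder_space[OF assms(3)])
  show "weakly_conformal (sw_map j)" by (rule sw_map_weakly_conformal[OF assms(3)])
  show "lagrangian (sw_map j)" by (rule sw_map_lagrangian[OF assms(3)])
  show "hamiltonian_stationary (sw_map j) sw_dir" by (rule sw_map_hamiltonian_stationary[OF assms(3)])
  show "infinite (schoen_wolfson_singularities (sw_map j) sw_dir)"
    unfolding sing using inj_zero_pt by (simp add: finite_image_iff)
  show "isolated_in_disc (schoen_wolfson_singularities (sw_map j) sw_dir)"
    unfolding sing sw_fun_zeros_disc[symmetric] by (rule isolated_sw_fun_zeros)
  show "continuous_extension_with_smooth_trace (sw_map j)" by (rule sw_map_trace[OF assms(3)])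
  show "(\<lambda>z. cnj (sw_dir z)) \<in> W1p_space p disc \<inter> W1_weak_L2_loc disc" by (rule cnj_sw_dir_sobolev[OF assms(1,2)])
  show "smooth_on (disc - schoen_wolfson_singularities (sw_map j) sw_dir) (sw_map j)"
    unfolding sing by (rule sw_map_smooth_on)
  show "branched_immersion_on (disc - schoen_wolfson_singularities (sw_map j) sw_dir) (sw_map j)"
    unfolding sing by (rule sw_map_branched_immersion[OF assms(3)])
qed

end
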